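(* Let $d\ge1$ and $n\ge d$. The mapping $$[v_1,\dots,v_d]\otimes[w_1,\dots,w_d]\otimes\prod_{j=1}^d\frac{w_j^{n_j-1}}{(n_j-1)!}\ \longmapsto\ \frac{\mathrm{sgn}\det(v_1,\dots,v_d)}{\det(w_1,\dots,w_d)}\sum_{\substack{\nu\in C\cap\mathbb Z^d\\\langle w^j,\nu\rangle\ne0\ \forall j}}\frac{e^{2\pi i\langle\nu,x\rangle}}{\prod_{j=1}^d\langle w^j,\nu\rangle^{n_j}},$$ where $n_1+\dots+n_d=n$, $n_j\ge1$, $v_1,\dots,v_d$ and $w_1,\dots,w_d$ are bases of $\mathbb Q^d$, $C=C(v_1,\dots,v_d)=\mathbb R_{\ge0}v_1+\dots+\mathbb R_{\ge0}v_d$, and $w^1,\dots,w^d$ is the basis dual to $w_1,\dots,w_d$, gives a well-defined isomorphism $$\mathrm{St}_d(\mathbb Q)\otimes\mathrm{St}_d(\mathbb Q)\otimes\mathbb S^{n-d}(\mathbb Q^d)\ \longrightarrow\ \mathrm{gr}^{\mathcal F}_d\,\mathcal S'_{\mathrm L,n}(\mathbb T^d).$$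
   Context: **Steinberg module.** $\mathrm{St}_d(\mathbb Q)$ is the $\mathbb Q$-vector space generated by apartments $[v_1,\dots,v_d]$, $v_i\in\mathbb Q^d\setminus\{0\}$, vanishing for linearly dependent $v_i$, skew-symmetric, invariant under scaling each $v_i$ by $\mathbb Q^\times$, with $\sum_{i=0}^d(-1)^i[v_0,\dots,\widehat{v_i},\dots,v_d]=0$ for nonzero $v_0,\dots,v_d$ (equivalently the top reduced rational homology of the Tits building of $\mathbb Q^d$). $\mathbb S^m$ is the $m$-th symmetric power; tensor products are over $\mathbb Q$. **Distributions.** $\mathbb T^d=\mathbb R^d/\mathbb Z^d$. A distribution $F$ on $\mathbb T^d$ is given by a Fourier series $F(x)=\sum_{\nu\in\mathbb Z^d}\widehat F(\nu)e^{2\pi i\langle\nu,x\rangle}$ with coefficients of at most polynomial growth. $\mathcal S'_n(\mathbb T^d)$ is the space of distributions with $\widehat F$ homogeneous of degree $-n$, i.e. $\widehat F(N\nu)=N^{-n}\widehat F(\nu)$ for $N\in\mathbb Z_{>0}$. For a rational convex polyhedral cone $C\subseteq\mathbb R^d$, a basis $u=(u_1,\dots,u_d)$ of (the dual of) $\mathbb Q^d$ and $n_1,\dots,n_d\ge1$ with sum $n$, let $F_{C,u,n_1,\dots,n_d}\in\mathcal S'_n(\mathbb T^d)$ be the distribution with $\widehat F(\nu)=\prod_{j=1}^d\langle u_j,\nu\rangle^{-n_j}$ if $\nu\in C\cap\mathbb Z^d$ and all $\langle u_j,\nu\rangle\ne0$, and $\widehat F(\nu)=0$ otherwise. $\mathcal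 S'_{\mathrm L,n}(\mathbb T^d)$ is the quotient of the $\mathbb Q$-span of all $F_{C,u,n_1,\dots,n_d}$ ($n_1+\dots+n_d=n$) by the $\mathbb Q$-span of those with $\dim C<d$. **Filtration.** $\mathcal F_k\mathcal S'_{\mathrm L,n}(\mathbb T^d)$ is the $\mathbb Q$-span of (classes of) all $F_{C,u,n_1,\dots,n_d}$ for which $C$ contains a $(d-k)$-dimensional linear subspace; $\mathrm{gr}^{\mathcal F}_d=\mathcal F_d/\mathcal F_{d-1}$. *)

theory Defs
  imports
    Complex_Main
    "HOL-Algebra.AbelCoset"
    "HOL-Library.Multiset"
    "HOL-Library.Poly_Mapping"
    "Jordan_Normal_Form.VS_Connect"
begin

text \<open>Vectors of dimension \<open>d\<close> are elements of \<^term>\<open>carrier_vec d\<close>, and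
  rational vector spaces are modules over the ring record \<^term>\<open>class_ring\<close> on type \<open>rat\<close>.\<close>

abbreviation rat_span :: "(rat, 'a) module \<Rightarrow> 'a set \<Rightarrow> 'a set" where
  "rat_span M S \<equiv> LinearCombinations.module.span class_ring M S"

text \<open>Elements of the quotient are the cosets of \<open>N\<close>. The scalar multiple of a coset \<open>X\<close> is
  \<open>N + c X\<close> rather than the pointwise multiple, which is not a coset for \<open>c = 0\<close>.\<close>

definition quot_mod :: "('r, 'a) module \<Rightarrow> 'a set \<Rightarrow> ('r, 'a set) module" where
  "quot_mod M N =
    \<lparr> carrier = A_RCOSETS M N,
      mult = undefined,
      one = undefined,
      zero = N,
      add = set_add M,
      smult = (\<lambda>c X. \<Union>x\<in>X. a_r_coset M N (smult M c x)) \<rparr>"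

definition free_mod :: "'g set \<Rightarrow> (rat, 'g \<Rightarrow>\<^sub>0 rat) module" where
  "free_mod G =
    \<lparr> carrier = {f. Poly_Mapping.keys f \<subseteq> G},
      mult = undefined,
      one = undefined,
      zero = 0,
      add = (+),
      smult = (\<lambda>c. Poly_Mapping.map ((*) c)) \<rparr>"

definition presented_mod :: "'g set \<Rightarrow> ('g \<Rightarrow>\<^sub>0 rat) set \<Rightarrow> (rat, ('g \<Rightarrow>\<^sub>0 rat) set) module" where
  "presented_mod G R = quot_mod (free_mod G) (rat_span (free_mod G) R)"

definition presented_gen :: "'g set \<Rightarrow> ('g \<Rightarrow>\<^sub>0 rat) set \<Rightarrow> 'g \<Rightarrow> ('g \<Rightarrow>\<^sub>0 rat) set" where
  "presented_gen G R x =
    a_r_coset (free_mod G) (rat_span (free_mod G) R) (Poly_Mapping.single x 1)"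

definition tensor_rels :: "(rat, 'a) module \<Rightarrow> (rat, 'b) module \<Rightarrow> (('a \<times> 'b) \<Rightarrow>\<^sub>0 rat) set" where
  "tensor_rels U V =
     {Poly_Mapping.single (x \<oplus>\<^bsub>U\<^esub> x', y) 1 - Poly_Mapping.single (x, y) 1
        - Poly_Mapping.single (x', y) 1 |
      x x' y. x \<in> carrier U \<and> x' \<in> carrier U \<and> y \<in> carrier V}
   \<union> {Poly_Mapping.single (x, y \<oplus>\<^bsub>V\<^esub> y') 1 - Poly_Mapping.single (x, y) 1
        - Poly_Mapping.single (x, y') 1 |
      x y y'. x \<in> carrier U \<and> y \<in> carrier V \<and> y' \<in> carrier V}
   \<union> {Poly_Mapping.single (c \<odot>\<^bsub>U\<^esub> x, y) 1 - Poly_Mapping.single (x, y) c |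
      c x y. x \<in> carrier U \<and> y \<in> carrier V}
   \<union> {Poly_Mapping.single (x, c \<odot>\<^bsub>V\<^esub> y) 1 - Poly_Mapping.single (x, y) c |
      c x y. x \<in> carrier U \<and> y \<in> carrier V}"

definition tensor_mod ::
    "(rat, 'a) module \<Rightarrow> (rat, 'b) module \<Rightarrow> (rat, (('a \<times> 'b) \<Rightarrow>\<^sub>0 rat) set) module" where
  "tensor_mod U V = presented_mod (carrier U \<times> carrier V) (tensor_rels U V)"

definition tensor_elt ::
    "(rat, 'a) module \<Rightarrow> (rat, 'b) module \<Rightarrow> 'a \<Rightarrow> 'b \<Rightarrow> (('a \<times> 'b) \<Rightarrow>\<^sub>0 rat) set" where
  "tensor_elt U V x y = presented_gen (carrier U \<times> carrier V) (tensor_rels U V) (x, y)"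

text \<open>The symmetric power is generated by the commutative products \<open>x\<^sub>1 \<cdots> x\<^sub>m\<close>, represented by the
  multiset of their factors, subject to multilinearity.\<close>

definition sym_gens :: "nat \<Rightarrow> (rat, 'a) module \<Rightarrow> 'a multiset set" where
  "sym_gens m V = {X. size X = m \<and> set_mset X \<subseteq> carrier V}"

definition sym_rels :: "nat \<Rightarrow> (rat, 'a) module \<Rightarrow> ('a multiset \<Rightarrow>\<^sub>0 rat) set" where
  "sym_rels m V =
     {Poly_Mapping.single (add_mset (x \<oplus>\<^bsub>V\<^esub> y) X) 1 - Poly_Mapping.single (add_mset x X) 1
        - Poly_Mapping.single (add_mset y X) 1 |
      x y X. x \<in> carrier V \<and> y \<in> carrier V \<and> set_mset X \<subseteq> carrier V \<and> Suc (size X) = m}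
   \<union> {Poly_Mapping.single (add_mset (c \<odot>\<^bsub>V\<^esub> x) X) 1 - Poly_Mapping.single (add_mset x X) c |
      c x X. x \<in> carrier V \<and> set_mset X \<subseteq> carrier V \<and> Suc (size X) = m}"

definition sym_mod :: "nat \<Rightarrow> (rat, 'a) module \<Rightarrow> (rat, ('a multiset \<Rightarrow>\<^sub>0 rat) set) module" where
  "sym_mod m V = presented_mod (sym_gens m V) (sym_rels m V)"

definition sym_prod :: "nat \<Rightarrow> (rat, 'a) module \<Rightarrow> 'a multiset \<Rightarrow> ('a multiset \<Rightarrow>\<^sub>0 rat) set" where
  "sym_prod m V X = presented_gen (sym_gens m V) (sym_rels m V) X"

abbreviation Qvec :: "nat \<Rightarrow> (rat, rat vec) module" where
  "Qvec d \<equiv> module_vec TYPE(rat) d"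

abbreviation Rvec :: "nat \<Rightarrow> (real, real vec) module" where
  "Rvec d \<equiv> module_vec TYPE(real) d"

definition lin_dep_list :: "nat \<Rightarrow> rat vec list \<Rightarrow> bool" where
  "lin_dep_list d vs \<longleftrightarrow>
    \<not> distinct vs \<or> LinearCombinations.module.lin_dep class_ring (Qvec d) (set vs)"

definition ordered_basis :: "nat \<Rightarrow> rat vec list \<Rightarrow> bool" where
  "ordered_basis d vs \<longleftrightarrow>
    distinct vs \<and> vectorspace.basis class_ring (Qvec d) (set vs)"

text \<open>The dual space of \<open>\<rat>\<^sup>d\<close> is identified with \<open>\<rat>\<^sup>d\<close> by the standard scalar product.\<close>

definition dual_bases :: "nat \<Rightarrow> rat vec list \<Rightarrow> rat vec list \<Rightarrow> bool" where
  "dual_bases d us ws \<longleftrightarrow>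
    ordered_basis d us \<and> ordered_basis d ws \<and>
    (\<forall>i<d. \<forall>j<d. us ! i \<bullet> ws ! j = (if i = j then 1 else 0))"

definition steinberg_gens :: "nat \<Rightarrow> rat vec list set" where
  "steinberg_gens d = {vs. length vs = d \<and> set vs \<subseteq> carrier_vec d - {0\<^sub>v d}}"

definition steinberg_rels :: "nat \<Rightarrow> (rat vec list \<Rightarrow>\<^sub>0 rat) set" where
  "steinberg_rels d =
     {Poly_Mapping.single vs 1 | vs. vs \<in> steinberg_gens d \<and> lin_dep_list d vs}
   \<union> {Poly_Mapping.single (vs[i := vs ! j, j := vs ! i]) 1 + Poly_Mapping.single vs 1 |
      vs i j. vs \<in> steinberg_gens d \<and> i < d \<and> j < d \<and> i \<noteq> j}
   \<union> {Poly_Mapping.single (vs[i := c \<cdot>\<^sub>v vs ! i]) 1 - Poly_Mapping.single vs 1 |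
      vs i c. vs \<in> steinberg_gens d \<and> i < d \<and> c \<noteq> 0}
   \<union> {(\<Sum>i\<le>d. Poly_Mapping.single (take i vs @ drop (Suc i) vs) ((-1) ^ i)) |
      vs. length vs = Suc d \<and> set vs \<subseteq> carrier_vec d - {0\<^sub>v d}}"

definition steinberg :: "nat \<Rightarrow> (rat, (rat vec list \<Rightarrow>\<^sub>0 rat) set) module" where
  "steinberg d = presented_mod (steinberg_gens d) (steinberg_rels d)"

definition apartment :: "nat \<Rightarrow> rat vec list \<Rightarrow> (rat vec list \<Rightarrow>\<^sub>0 rat) set" where
  "apartment d vs = presented_gen (steinberg_gens d) (steinberg_rels d) vs"

text \<open>The closed convex cone in \<open>\<real>\<^sup>d\<close> generated by finitely many rational vectors.\<close>

definition cone_gen :: "nat \<Rightarrow> rat vec list \<Rightarrow> real vec set" where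
  "cone_gen d gs =
    {mat_of_cols d (map (map_vec real_of_rat) gs) *\<^sub>v c |
      c. c \<in> carrier_vec (length gs) \<and> (\<forall>i<length gs. 0 \<le> c $ i)}"

definition rational_cone :: "nat \<Rightarrow> real vec set \<Rightarrow> bool" where
  "rational_cone d C \<longleftrightarrow> (\<exists>gs. set gs \<subseteq> carrier_vec d \<and> C = cone_gen d gs)"

definition subspace_dim :: "nat \<Rightarrow> real vec set \<Rightarrow> nat" where
  "subspace_dim d W = vectorspace.dim class_ring ((Rvec d)\<lparr>carrier := W\<rparr>)"

definition cone_dim :: "nat \<Rightarrow> real vec set \<Rightarrow> nat" where
  "cone_dim d C = subspace_dim d (LinearCombinations.module.span class_ring (Rvec d) C)"

definition contains_subspace :: "nat \<Rightarrow> nat \<Rightarrow> real vec set \<Rightarrow> bool" where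
  "contains_subspace d k C \<longleftrightarrow>
    (\<exists>W. VectorSpace.subspace class_ring W (Rvec d) \<and> W \<subseteq> C \<and> subspace_dim d W = k)"

text \<open>A distribution on the torus \<open>\<real>\<^sup>d / \<int>\<^sup>d\<close> is given by its family of Fourier coefficients,
  indexed by \<open>\<int>\<^sup>d\<close> and of at most polynomial growth; outside \<^term>\<open>carrier_vec d\<close> the
  coefficient function is \<open>0\<close> by convention.\<close>

definition torus_distr :: "nat \<Rightarrow> (int vec \<Rightarrow> complex) set" where
  "torus_distr d =
    {F. (\<forall>\<nu>. \<nu> \<notin> carrier_vec d \<longrightarrow> F \<nu> = 0) \<and>
        (\<exists>K m. \<forall>\<nu>\<in>carrier_vec d. cmod (F \<nu>) \<le> K * (1 + real_of_int (\<Sum>i<d. \<bar>\<nu> $ i\<bar>)) ^ m)}"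

definition hom_distr_mod :: "nat \<Rightarrow> nat \<Rightarrow> (rat, int vec \<Rightarrow> complex) module" where
  "hom_distr_mod d n =
    \<lparr> carrier = {F \<in> torus_distr d.
        \<forall>N>0. \<forall>\<nu>\<in>carrier_vec d. F (int N \<cdot>\<^sub>v \<nu>) = F \<nu> / of_nat N ^ n},
      mult = undefined,
      one = undefined,
      zero = (\<lambda>\<nu>. 0),
      add = (\<lambda>F G \<nu>. F \<nu> + G \<nu>),
      smult = (\<lambda>c F \<nu>. of_rat c * F \<nu>) \<rparr>"

definition cone_distr ::
    "nat \<Rightarrow> real vec set \<Rightarrow> rat vec list \<Rightarrow> nat list \<Rightarrow> int vec \<Rightarrow> complex" where
  "cone_distr d C us ns \<nu> =
    (if \<nu> \<in> carrier_vec d \<and> map_vec real_of_int \<nu> \<in> C \<and>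
        (\<forall>j<d. us ! j \<bullet> map_vec rat_of_int \<nu> \<noteq> 0)
     then of_rat (\<Prod>j<d. 1 / (us ! j \<bullet> map_vec rat_of_int \<nu>) ^ (ns ! j))
     else 0)"

definition exponents :: "nat \<Rightarrow> nat \<Rightarrow> nat list \<Rightarrow> bool" where
  "exponents d n ns \<longleftrightarrow> length ns = d \<and> (\<forall>j<d. 1 \<le> ns ! j) \<and> sum_list ns = n"

definition cone_distrs :: "nat \<Rightarrow> nat \<Rightarrow> (real vec set \<Rightarrow> bool) \<Rightarrow> (int vec \<Rightarrow> complex) set" where
  "cone_distrs d n P =
    {cone_distr d C us ns | C us ns.
      rational_cone d C \<and> P C \<and> ordered_basis d us \<and> exponents d n ns}"

definition low_dim_span :: "nat \<Rightarrow> nat \<Rightarrow> (int vec \<Rightarrow> complex) set" where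
  "low_dim_span d n = rat_span (hom_distr_mod d n) (cone_distrs d n (\<lambda>C. cone_dim d C < d))"

definition SL_span :: "nat \<Rightarrow> nat \<Rightarrow> (rat, int vec \<Rightarrow> complex) module" where
  "SL_span d n =
    (hom_distr_mod d n)
      \<lparr>carrier := rat_span (hom_distr_mod d n) (cone_distrs d n (\<lambda>C. True))\<rparr>"

definition SL_mod :: "nat \<Rightarrow> nat \<Rightarrow> (rat, (int vec \<Rightarrow> complex) set) module" where
  "SL_mod d n = quot_mod (SL_span d n) (low_dim_span d n)"

definition SL_class :: "nat \<Rightarrow> nat \<Rightarrow> (int vec \<Rightarrow> complex) \<Rightarrow> (int vec \<Rightarrow> complex) set" where
  "SL_class d n F = a_r_coset (SL_span d n) (low_dim_span d n) F"

definition SL_filt :: "nat \<Rightarrow> nat \<Rightarrow> nat \<Rightarrow> (int vec \<Rightarrow> complex) set set" where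
  "SL_filt d n k =
    rat_span (SL_mod d n) (SL_class d n ` cone_distrs d n (contains_subspace d (d - k)))"

text \<open>The top graded piece \<open>\<F>\<^sub>d / \<F>\<^sub>d\<^sub>-\<^sub>1\<close>, for \<open>d \<ge> 1\<close>.\<close>

definition gr_top :: "nat \<Rightarrow> nat \<Rightarrow> (rat, (int vec \<Rightarrow> complex) set set) module" where
  "gr_top d n = quot_mod ((SL_mod d n)\<lparr>carrier := SL_filt d n d\<rparr>) (SL_filt d n (d - 1))"

definition gr_top_class ::
    "nat \<Rightarrow> nat \<Rightarrow> (int vec \<Rightarrow> complex) \<Rightarrow> (int vec \<Rightarrow> complex) set set" where
  "gr_top_class d n F =
    a_r_coset ((SL_mod d n)\<lparr>carrier := SL_filt d n d\<rparr>) (SL_filt d n (d - 1)) (SL_class d n F)"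

abbreviation StSt :: "nat \<Rightarrow> _" where
  "StSt d \<equiv> tensor_mod (steinberg d) (steinberg d)"

abbreviation StStSym :: "nat \<Rightarrow> nat \<Rightarrow> _" where
  "StStSym d n \<equiv> tensor_mod (StSt d) (sym_mod (n - d) (Qvec d))"

text \<open>The element \<open>[v] \<otimes> [w] \<otimes> (\<Prod>j. w\<^sub>j ^ (n\<^sub>j - 1) / (n\<^sub>j - 1)!)\<close>.\<close>

definition StStSym_elt where
  "StStSym_elt d n vs ws ns =
    tensor_elt (StSt d) (sym_mod (n - d) (Qvec d))
      (tensor_elt (steinberg d) (steinberg d) (apartment d vs) (apartment d ws))
      ((1 / (\<Prod>j<d. fact (ns ! j - 1))) \<odot>\<^bsub>sym_mod (n - d) (Qvec d)\<^esub>
        sym_prod (n - d) (Qvec d) (\<Sum>j<d. replicate_mset (ns ! j - 1) (ws ! j)))"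

end

theory Submission
  imports
    Defs
    "HOL-Computational_Algebra.Polynomial"
    "Jordan_Normal_Form.DL_Rank"
begin

text \<open>Well-definedness. Everything is tested at generic points, that is, off finitely many
  rational hyperplanes through the origin (\<open>gen_all\<close>). A combination of cone
  distributions that vanishes at all generic lattice points is a combination of distributions on
  lower-dimensional cones (\<open>generic_zero_low\<close>), hence zero in the quotient. At generic
  points the image of a triple factors (\<open>tri_fun_generic\<close>) into a signed indicator of
  the cone of the v's and a rational function that depends on the w's and on the symmetric factor.
  Signed indicators satisfy the Steinberg relations up to a multiple of the indicator of a cone
  containing a line (\<open>steinberg_rel_chamber\<close>), and the distributions on such cones span
  the filtration step d - 1. The functions 1 / (det w * prod_j <w^j, x>) satisfy the Steinberg
  relations identically at generic points (\<open>steinberg_rel_pole\<close>); this is the vanishing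
  of a divided difference of a constant. A vector of the symmetric factor acts as the derivative in
  the opposite direction; this raises exponents and produces the factorials, and differentiating the
  identities for exponents one settles all exponents (\<open>steinberg_rel_pole_deriv\<close>).

  Surjectivity. Linear programming with generic heights triangulates every rational cone at generic
  points (\<open>cone_triangulation\<close>), so simplicial cones suffice modulo lower-dimensional
  ones (\<open>simplicial_span\<close>). The distribution of a simplicial cone represents, up to a
  nonzero scalar, a value prescribed for the map (\<open>tri_fun_value\<close>).

  Injectivity. Gaussian elimination by means of the Steinberg relations shows that the apartments of
  unitriangular bases span the Steinberg module (\<open>steinberg_sub_eq\<close>). Hence the
  elements with unitriangular v and w and arbitrary exponents span the source, and their images have
  to be shown independent (\<open>unitri_distr_independent\<close>). For a basis b consider the
  curves x + sum_i \<plusminus> t^(d-i) b_i. Every rational cone contains such a curve for all large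
  t or avoids it for all large t. The alternating sum of these truth values over all sign choices
  (\<open>germ_sum\<close>) kills lower-dimensional cones and cones with a line, and for
  unitriangular b and v its value on the cone of v is the Kronecker delta of b and v
  (\<open>germ_sum_unitri\<close>). Along the curve the coefficients are rational functions of t, so
  they may be evaluated at t = 0, where the curve passes through x. The result is a linear relation
  between the rational functions of x with poles given by w (\<open>germ_relation\<close>), and
  these are linearly independent by partial fractions (\<open>rat_fun_independent\<close>).\<close>

abbreviation "single \<equiv> Poly_Mapping.single"
abbreviation "lookup \<equiv> Poly_Mapping.lookup"
abbreviation "keys \<equiv> Poly_Mapping.keys"

section \<open>Rational vector spaces, subspaces and linear maps in record form\<close>

abbreviation qvs :: "(rat, 'a) module \<Rightarrow> bool" where
  "qvs V \<equiv> vectorspace class_ring V"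

abbreviation qlin :: "(rat, 'a) module \<Rightarrow> (rat, 'b) module \<Rightarrow> ('a \<Rightarrow> 'b) \<Rightarrow> bool" where
  "qlin V W f \<equiv> linear_map class_ring V W f"

abbreviation qsub :: "'a set \<Rightarrow> (rat, 'a) module \<Rightarrow> bool" where
  "qsub N V \<equiv> submodule class_ring N V"

lemma qvs_module: "qvs V \<Longrightarrow> Module.module class_ring V"
  by (simp add: vectorspace_def)

lemma qvs_abelian_group: "qvs V \<Longrightarrow> abelian_group V"
  by (simp add: vectorspace_def Module.module_def)

text \<open>Additive inverses are no separate datum: the multiple by -1 provides them.\<close>

lemma qvsI:
  assumes "\<zero>\<^bsub>V\<^esub> \<in> carrier V"
    and "\<And>x y. x \<in> carrier V \<Longrightarrow> y \<in> carrier V \<Longrightarrow> x \<oplus>\<^bsub>V\<^esub> y \<in> carrier V"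
    and "\<And>c x. x \<in> carrier V \<Longrightarrow> c \<odot>\<^bsub>V\<^esub> x \<in> carrier V"
    and "\<And>x y. x \<in> carrier V \<Longrightarrow> y \<in> carrier V \<Longrightarrow> x \<oplus>\<^bsub>V\<^esub> y = y \<oplus>\<^bsub>V\<^esub> x"
    and "\<And>x y z. x \<in> carrier V \<Longrightarrow> y \<in> carrier V \<Longrightarrow> z \<in> carrier V \<Longrightarrow>
      x \<oplus>\<^bsub>V\<^esub> y \<oplus>\<^bsub>V\<^esub> z = x \<oplus>\<^bsub>V\<^esub> (y \<oplus>\<^bsub>V\<^esub> z)"
    and "\<And>x. x \<in> carrier V \<Longrightarrow> x \<oplus>\<^bsub>V\<^esub> \<zero>\<^bsub>V\<^esub> = x"
    and neg: "\<And>x. x \<in> carrier V \<Longrightarrow> x \<oplus>\<^bsub>V\<^esub> (-1) \<odot>\<^bsub>V\<^esub> x = \<zero>\<^bsub>V\<^esub>"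
    and "\<And>a b x. x \<in> carrier V \<Longrightarrow> (a * b) \<odot>\<^bsub>V\<^esub> x = a \<odot>\<^bsub>V\<^esub> (b \<odot>\<^bsub>V\<^esub> x)"
    and "\<And>x. x \<in> carrier V \<Longrightarrow> 1 \<odot>\<^bsub>V\<^esub> x = x"
    and "\<And>a b x. x \<in> carrier V \<Longrightarrow> (a + b) \<odot>\<^bsub>V\<^esub> x = a \<odot>\<^bsub>V\<^esub> x \<oplus>\<^bsub>V\<^esub> b \<odot>\<^bsub>V\<^esub> x"
    and "\<And>a x y. x \<in> carrier V \<Longrightarrow> y \<in> carrier V \<Longrightarrow> a \<odot>\<^bsub>V\<^esub> (x \<oplus>\<^bsub>V\<^esub> y) = a \<odot>\<^bsub>V\<^esub> x \<oplus>\<^bsub>V\<^esub> a \<odot>\<^bsub>V\<^esub> y"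
  shows "qvs V"
proof (rule vs_criteria[OF class_field])
  show "\<forall>v\<in>carrier V. \<exists>neg_v\<in>carrier V. v \<oplus>\<^bsub>V\<^esub> neg_v = \<zero>\<^bsub>V\<^esub>"
    using assms(3) neg by blast
qed (use assms in auto)

context
  fixes V :: "(rat, 'a) module"
  assumes V: "qvs V"
begin

interpretation vectorspace class_ring V by (fact V)

lemma qvs_zero: "\<zero>\<^bsub>V\<^esub> \<in> carrier V"
  and qvs_add: "x \<in> carrier V \<Longrightarrow> y \<in> carrier V \<Longrightarrow> x \<oplus>\<^bsub>V\<^esub> y \<in> carrier V"
  and qvs_smult: "x \<in> carrier V \<Longrightarrow> c \<odot>\<^bsub>V\<^esub> x \<in> carrier V"
  and qvs_comm: "x \<in> carrier V \<Longrightarrow> y \<in> carrier V \<Longrightarrow> x \<oplus>\<^bsub>V\<^esub> y = y \<oplus>\<^bsub>V\<^esub> x"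
  and qvs_assoc: "x \<in> carrier V \<Longrightarrow> y \<in> carrier V \<Longrightarrow> z \<in> carrier V \<Longrightarrow>
    x \<oplus>\<^bsub>V\<^esub> y \<oplus>\<^bsub>V\<^esub> z = x \<oplus>\<^bsub>V\<^esub> (y \<oplus>\<^bsub>V\<^esub> z)"
  and qvs_add_zero: "x \<in> carrier V \<Longrightarrow> x \<oplus>\<^bsub>V\<^esub> \<zero>\<^bsub>V\<^esub> = x"
  and qvs_zero_add: "x \<in> carrier V \<Longrightarrow> \<zero>\<^bsub>V\<^esub> \<oplus>\<^bsub>V\<^esub> x = x"
  and qvs_one: "x \<in> carrier V \<Longrightarrow> 1 \<odot>\<^bsub>V\<^esub> x = x"
  and qvs_smult_smult: "x \<in> carrier V \<Longrightarrow> a \<odot>\<^bsub>V\<^esub> (b \<odot>\<^bsub>V\<^esub> x) = (a * b) \<odot>\<^bsub>V\<^esub> x"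
  and qvs_smult_l: "x \<in> carrier V \<Longrightarrow> (a + b) \<odot>\<^bsub>V\<^esub> x = a \<odot>\<^bsub>V\<^esub> x \<oplus>\<^bsub>V\<^esub> b \<odot>\<^bsub>V\<^esub> x"
  and qvs_smult_r: "x \<in> carrier V \<Longrightarrow> y \<in> carrier V \<Longrightarrow>
    a \<odot>\<^bsub>V\<^esub> (x \<oplus>\<^bsub>V\<^esub> y) = a \<odot>\<^bsub>V\<^esub> x \<oplus>\<^bsub>V\<^esub> a \<odot>\<^bsub>V\<^esub> y"
  using smult_closed[of c x] smult_l_distr[of a b x] smult_r_distr[of a x y]
    smult_assoc1[of a b x] smult_one[of x]
  by (simp_all add: M.a_ac)

lemma qvs_zero_smult: "x \<in> carrier V \<Longrightarrow> 0 \<odot>\<^bsub>V\<^esub> x = \<zero>\<^bsub>V\<^esub>"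
  using smult_l_null by simp

lemma qvs_smult_zero: "c \<odot>\<^bsub>V\<^esub> \<zero>\<^bsub>V\<^esub> = \<zero>\<^bsub>V\<^esub>"
  using smult_r_null by simp

lemma qvs_neg: "x \<in> carrier V \<Longrightarrow> x \<oplus>\<^bsub>V\<^esub> (-1) \<odot>\<^bsub>V\<^esub> x = \<zero>\<^bsub>V\<^esub>"
  using qvs_smult_l[of x 1 "-1"] by (simp add: qvs_one qvs_zero_smult)

lemma qvs_neg_eq: "x \<in> carrier V \<Longrightarrow> \<ominus>\<^bsub>V\<^esub> x = (-1) \<odot>\<^bsub>V\<^esub> x"
  using M.minus_equality[of "(-1) \<odot>\<^bsub>V\<^esub> x" x] qvs_neg[of x] qvs_smult[of x "-1"]
    qvs_comm[of x "(-1) \<odot>\<^bsub>V\<^esub> x"] by simp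

lemma qvs_eq_iff_diff:
  assumes x: "x \<in> carrier V" and y: "y \<in> carrier V"
  shows "x \<oplus>\<^bsub>V\<^esub> (-1) \<odot>\<^bsub>V\<^esub> y = \<zero>\<^bsub>V\<^esub> \<longleftrightarrow> x = y"
proof
  have n: "(-1) \<odot>\<^bsub>V\<^esub> y \<in> carrier V" using y by (rule qvs_smult)
  assume "x \<oplus>\<^bsub>V\<^esub> (-1) \<odot>\<^bsub>V\<^esub> y = \<zero>\<^bsub>V\<^esub>"
  then have "x \<oplus>\<^bsub>V\<^esub> (-1) \<odot>\<^bsub>V\<^esub> y = y \<oplus>\<^bsub>V\<^esub> (-1) \<odot>\<^bsub>V\<^esub> y" using y by (simp add: qvs_neg)
  then show "x = y" using x y n by simp
qed (use y in \<open>simp add: qvs_neg\<close>)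

lemma qsubI:
  assumes "N \<subseteq> carrier V" "\<zero>\<^bsub>V\<^esub> \<in> N"
    and "\<And>x y. x \<in> N \<Longrightarrow> y \<in> N \<Longrightarrow> x \<oplus>\<^bsub>V\<^esub> y \<in> N"
    and "\<And>c x. x \<in> N \<Longrightarrow> c \<odot>\<^bsub>V\<^esub> x \<in> N"
  shows "qsub N V"
  by (rule submodule.intro) (use assms V in \<open>auto simp: vectorspace_def\<close>)

lemma qspan_sub: "S \<subseteq> carrier V \<Longrightarrow> qsub (rat_span V S) V"
  by (rule span_is_submodule)

lemma qspan_superset: "S \<subseteq> carrier V \<Longrightarrow> S \<subseteq> rat_span V S"
  by (rule in_own_span)

lemma qspan_least: "S \<subseteq> N \<Longrightarrow> qsub N V \<Longrightarrow> rat_span V S \<subseteq> N"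
  by (rule span_is_subset)

lemma qspan_carrier: "S \<subseteq> carrier V \<Longrightarrow> rat_span V S \<subseteq> carrier V"
  by (rule span_is_subset2)

lemma qspan_induct [consumes 2, case_names zero base add smult]:
  assumes x: "x \<in> rat_span V S" and S: "S \<subseteq> carrier V"
    and "P \<zero>\<^bsub>V\<^esub>" "\<And>s. s \<in> S \<Longrightarrow> P s"
    and "\<And>x y. x \<in> carrier V \<Longrightarrow> y \<in> carrier V \<Longrightarrow> P x \<Longrightarrow> P y \<Longrightarrow> P (x \<oplus>\<^bsub>V\<^esub> y)"
    and "\<And>c x. x \<in> carrier V \<Longrightarrow> P x \<Longrightarrow> P (c \<odot>\<^bsub>V\<^esub> x)"
  shows "P x"
proof -
  have "qsub {x \<in> carrier V. P x} V"
    by (rule qsubI) (use assms qvs_zero qvs_add qvs_smult in auto)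
  then have "rat_span V S \<subseteq> {x \<in> carrier V. P x}"
    using S assms(4) by (intro qspan_least) auto
  then show ?thesis using x by auto
qed

lemma qsub_qvs: "qsub N V \<Longrightarrow> qvs (V\<lparr>carrier := N\<rparr>)"
  using submodule_is_module[of N] V by (auto simp: vectorspace_def)

lemma qsub_abelian_subgroup: "qsub N V \<Longrightarrow> abelian_subgroup N V"
proof (rule abelian_subgroupI3)
  assume N: "qsub N V"
  show "additive_subgroup N V"
  proof (rule additive_subgroup.intro, rule subgroup.intro)
    show "inv\<^bsub>add_monoid V\<^esub> x \<in> N" if x: "x \<in> N" for x
    proof -
      have "(-1) \<odot>\<^bsub>V\<^esub> x \<in> N" using N x by (simp add: submodule.smult_closed)
      moreover have "x \<in> carrier V" using N x by (auto simp: submodule_def)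
      ultimately show ?thesis using qvs_neg_eq[of x] by (simp add: a_inv_def)
    qed
  qed (use N in \<open>auto simp: submodule_def\<close>)
qed (rule qvs_abelian_group[OF V])

end

lemma qsub_subset: "qsub N V \<Longrightarrow> N \<subseteq> carrier V"
  and qsub_zero: "qsub N V \<Longrightarrow> \<zero>\<^bsub>V\<^esub> \<in> N"
  and qsub_add: "qsub N V \<Longrightarrow> x \<in> N \<Longrightarrow> y \<in> N \<Longrightarrow> x \<oplus>\<^bsub>V\<^esub> y \<in> N"
  and qsub_smult: "qsub N V \<Longrightarrow> x \<in> N \<Longrightarrow> c \<odot>\<^bsub>V\<^esub> x \<in> N"
  by (auto simp: submodule_def)

lemma qlinI:
  assumes "qvs V" "qvs W" "\<And>x. x \<in> carrier V \<Longrightarrow> f x \<in> carrier W"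
    and "\<And>x y. x \<in> carrier V \<Longrightarrow> y \<in> carrier V \<Longrightarrow> f (x \<oplus>\<^bsub>V\<^esub> y) = f x \<oplus>\<^bsub>W\<^esub> f y"
    and "\<And>c x. x \<in> carrier V \<Longrightarrow> f (c \<odot>\<^bsub>V\<^esub> x) = c \<odot>\<^bsub>W\<^esub> f x"
  shows "qlin V W f"
  using assms unfolding linear_map_def mod_hom_def mod_hom_axioms_def LinearCombinations.module_hom_def
  by (simp add: qvs_module)

lemma
  assumes "qlin V W f"
  shows qlin_dom: "qvs V" and qlin_cod: "qvs W"
    and qlin_closed: "x \<in> carrier V \<Longrightarrow> f x \<in> carrier W"
    and qlin_add: "x \<in> carrier V \<Longrightarrow> y \<in> carrier V \<Longrightarrow> f (x \<oplus>\<^bsub>V\<^esub> y) = f x \<oplus>\<^bsub>W\<^esub> f y"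
    and qlin_smult: "x \<in> carrier V \<Longrightarrow> f (c \<odot>\<^bsub>V\<^esub> x) = c \<odot>\<^bsub>W\<^esub> f x"
  using assms unfolding linear_map_def mod_hom_def mod_hom_axioms_def LinearCombinations.module_hom_def
  by (simp_all add: Pi_iff)

lemma qlin_zero: "qlin V W f \<Longrightarrow> f \<zero>\<^bsub>V\<^esub> = \<zero>\<^bsub>W\<^esub>"
  using qlin_smult[of V W f "\<zero>\<^bsub>V\<^esub>" 0] qlin_closed[of V W f "\<zero>\<^bsub>V\<^esub>"] qlin_dom[of V W f] qlin_cod[of V W f]
  by (simp add: qvs_zero qvs_zero_smult qvs_smult_zero)

lemma qlin_comp: "qlin U V f \<Longrightarrow> qlin V W g \<Longrightarrow> qlin U W (\<lambda>x. g (f x))"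
  by (rule qlinI) (auto simp: qlin_closed qlin_dom qlin_cod qlin_add qlin_smult)

lemma qlin_const_zero: "qvs V \<Longrightarrow> qvs W \<Longrightarrow> qlin V W (\<lambda>x. \<zero>\<^bsub>W\<^esub>)"
  by (rule qlinI) (auto simp: qvs_zero qvs_add_zero qvs_smult_zero)

lemma qlin_sum:
  assumes f: "qlin V W f" and g: "qlin V W g"
  shows "qlin V W (\<lambda>x. f x \<oplus>\<^bsub>W\<^esub> g x)"
proof (rule qlinI)
  note W = qlin_cod[OF f]
  fix x y assume xy: "x \<in> carrier V" "y \<in> carrier V"
  interpret vectorspace class_ring W by fact
  show "f (x \<oplus>\<^bsub>V\<^esub> y) \<oplus>\<^bsub>W\<^esub> g (x \<oplus>\<^bsub>V\<^esub> y) = f x \<oplus>\<^bsub>W\<^esub> g x \<oplus>\<^bsub>W\<^esub> (f y \<oplus>\<^bsub>W\<^esub> g y)"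
    using xy f g by (simp add: qlin_add qlin_closed[OF f] qlin_closed[OF g] M.a_ac)
qed (use f g in \<open>auto simp: qlin_dom[OF f] qlin_cod[OF f] qlin_closed[OF f] qlin_closed[OF g]
       qlin_smult[OF f] qlin_smult[OF g] qvs_add qvs_smult qvs_smult_r[OF qlin_cod[OF f]]\<close>)

lemma qlin_scale:
  assumes f: "qlin V W f"
  shows "qlin V W (\<lambda>x. c \<odot>\<^bsub>W\<^esub> f x)"
  by (rule qlinI)
    (auto simp: qlin_dom[OF f] qlin_cod[OF f] qlin_closed[OF f] qlin_add[OF f]
       qlin_smult[OF f] qvs_add qvs_smult qvs_smult_r[OF qlin_cod[OF f]]
       qvs_smult_smult[OF qlin_cod[OF f]] mult.commute)

lemma qlin_ker_sub: "qlin V W f \<Longrightarrow> qsub {x \<in> carrier V. f x = \<zero>\<^bsub>W\<^esub>} V"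
  by (rule qsubI)
    (auto simp: qlin_dom qlin_zero qlin_add qlin_smult qvs_zero qvs_add qvs_smult qlin_cod
      qvs_add_zero qvs_smult_zero)

lemma qlin_vimage_sub: "qlin V W f \<Longrightarrow> qsub N W \<Longrightarrow> qsub {x \<in> carrier V. f x \<in> N} V"
  by (rule qsubI)
    (auto simp: qlin_dom qlin_zero qlin_add qlin_smult qvs_zero qvs_add qvs_smult
      qsub_zero qsub_add qsub_smult)

lemma qlin_image_sub:
  assumes f: "qlin V W f"
  shows "qsub (f ` carrier V) W"
proof (rule qsubI[OF qlin_cod[OF f]])
  show "f ` carrier V \<subseteq> carrier W" using qlin_closed[OF f] by auto
  show "\<zero>\<^bsub>W\<^esub> \<in> f ` carrier V" using imageI[OF qvs_zero[OF qlin_dom[OF f]], of f] by (simp add: qlin_zero[OF f])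
next
  fix x y assume "x \<in> f ` carrier V" "y \<in> f ` carrier V"
  then obtain a b where *: "a \<in> carrier V" "b \<in> carrier V" "x = f a" "y = f b" by blast
  show "x \<oplus>\<^bsub>W\<^esub> y \<in> f ` carrier V"
    using imageI[OF qvs_add[OF qlin_dom[OF f] *(1,2)], of f] by (simp add: qlin_add[OF f] *)
next
  fix c x assume "x \<in> f ` carrier V"
  then obtain a where *: "a \<in> carrier V" "x = f a" by blast
  show "c \<odot>\<^bsub>W\<^esub> x \<in> f ` carrier V"
    using imageI[OF qvs_smult[OF qlin_dom[OF f] *(1)], of f] by (simp add: qlin_smult[OF f] *)
qed

lemma qlin_inj_onI:
  assumes f: "qlin V W f" and "\<And>x. x \<in> carrier V \<Longrightarrow> f x = \<zero>\<^bsub>W\<^esub> \<Longrightarrow> x = \<zero>\<^bsub>V\<^esub>"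
  shows "inj_on f (carrier V)"
proof (rule inj_onI)
  note V = qlin_dom[OF f] and W = qlin_cod[OF f]
  fix x y assume x: "x \<in> carrier V" and y: "y \<in> carrier V" and "f x = f y"
  then have "f (x \<oplus>\<^bsub>V\<^esub> (-1) \<odot>\<^bsub>V\<^esub> y) = \<zero>\<^bsub>W\<^esub>"
    by (simp add: qlin_add[OF f] qlin_smult[OF f] qvs_smult[OF V] qvs_neg[OF W] qlin_closed[OF f])
  then show "x = y" using assms(2)[of "x \<oplus>\<^bsub>V\<^esub> (-1) \<odot>\<^bsub>V\<^esub> y"] x y
    by (simp add: qvs_eq_iff_diff[OF V] qvs_add[OF V] qvs_smult[OF V])
qed

lemma qlin_finsum:
  assumes f: "qlin V W f" and "finite A" "x \<in> A \<rightarrow> carrier V"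
  shows "f (finsum V x A) = finsum W (\<lambda>a. f (x a)) A"
  using assms(2,3)
proof (induction A rule: finite_induct)
  case empty
  interpret V: vectorspace class_ring V by (rule qlin_dom[OF f])
  interpret W: vectorspace class_ring W by (rule qlin_cod[OF f])
  show ?case by (simp add: qlin_zero[OF f])
next
  case (insert a A)
  interpret V: vectorspace class_ring V by (rule qlin_dom[OF f])
  interpret W: vectorspace class_ring W by (rule qlin_cod[OF f])
  have *: "(\<lambda>a. f (x a)) \<in> A \<rightarrow> carrier W" "f (x a) \<in> carrier W" 
    using insert.prems qlin_closed[OF f] by auto
  show ?case using insert * by (simp add: qlin_add[OF f] Pi_def)
qed

section \<open>Quotients\<close>

context
  fixes V :: "(rat, 'a) module" and N
  assumes V: "qvs V" and N: "qsub N V"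
begin

interpretation vectorspace class_ring V by (fact V)
interpretation abelian_subgroup N V by (rule qsub_abelian_subgroup[OF V N])

lemma coset_eq_iff:
  assumes x: "x \<in> carrier V" and y: "y \<in> carrier V"
  shows "N +>\<^bsub>V\<^esub> x = N +>\<^bsub>V\<^esub> y \<longleftrightarrow> x \<oplus>\<^bsub>V\<^esub> (-1) \<odot>\<^bsub>V\<^esub> y \<in> N"
proof
  assume "N +>\<^bsub>V\<^esub> x = N +>\<^bsub>V\<^esub> y"
  then have "x \<in> N +>\<^bsub>V\<^esub> y" using a_rcos_self[OF x] by simp
  then obtain h where h: "h \<in> N" "x = h \<oplus>\<^bsub>V\<^esub> y" by (auto simp: a_r_coset_def')
  then have "h \<in> carrier V" using qsub_subset[OF N] by auto
  then have "x \<oplus>\<^bsub>V\<^esub> (-1) \<odot>\<^bsub>V\<^esub> y = h"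
    using y h(2) qvs_assoc[OF V, of h y "(-1) \<odot>\<^bsub>V\<^esub> y"] qvs_smult[OF V, of y "-1"] 
    by (simp add: qvs_neg[OF V] qvs_add_zero[OF V])
  then show "x \<oplus>\<^bsub>V\<^esub> (-1) \<odot>\<^bsub>V\<^esub> y \<in> N" using h by simp
next
  assume h: "x \<oplus>\<^bsub>V\<^esub> (-1) \<odot>\<^bsub>V\<^esub> y \<in> N"
  have "(x \<oplus>\<^bsub>V\<^esub> (-1) \<odot>\<^bsub>V\<^esub> y) \<oplus>\<^bsub>V\<^esub> y = x"
    using x y qvs_smult[OF V, of y "-1"] qvs_neg[OF V, of y] qvs_comm[OF V, of "(-1) \<odot>\<^bsub>V\<^esub> y" y]
    by (simp add: M.a_assoc)
  then have "x \<in> N +>\<^bsub>V\<^esub> y" using h by (force simp: a_r_coset_def')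
  then show "N +>\<^bsub>V\<^esub> x = N +>\<^bsub>V\<^esub> y"
    using a_repr_independence[OF _ y a_subgroup, of x] by simp
qed

lemma coset_zero_iff: "x \<in> carrier V \<Longrightarrow> N +>\<^bsub>V\<^esub> x = N \<longleftrightarrow> x \<in> N"
  using coset_eq_iff[of x "\<zero>\<^bsub>V\<^esub>"] qsub_subset[OF N]
  by (simp add: qvs_smult_zero[OF V])

lemma quot_carrier: "carrier (quot_mod V N) = (\<lambda>x. N +>\<^bsub>V\<^esub> x) ` carrier V"
  by (auto simp: quot_mod_def A_RCOSETS_def')

lemma quot_zero: "\<zero>\<^bsub>quot_mod V N\<^esub> = N"
  by (simp add: quot_mod_def)

lemma quot_add: "x \<in> carrier V \<Longrightarrow> y \<in> carrier V \<Longrightarrow>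
    (N +>\<^bsub>V\<^esub> x) \<oplus>\<^bsub>quot_mod V N\<^esub> (N +>\<^bsub>V\<^esub> y) = N +>\<^bsub>V\<^esub> (x \<oplus>\<^bsub>V\<^esub> y)"
  by (simp add: quot_mod_def a_rcos_sum)

text \<open>The union in \<open>quot_mod\<close> runs over representatives whose multiples all lie
  in one and the same coset, so it collapses to that coset.\<close>

lemma quot_smult:
  assumes x: "x \<in> carrier V"
  shows "c \<odot>\<^bsub>quot_mod V N\<^esub> (N +>\<^bsub>V\<^esub> x) = N +>\<^bsub>V\<^esub> (c \<odot>\<^bsub>V\<^esub> x)"
proof -
  have "N +>\<^bsub>V\<^esub> (c \<odot>\<^bsub>V\<^esub> y) = N +>\<^bsub>V\<^esub> (c \<odot>\<^bsub>V\<^esub> x)" if "y \<in> N +>\<^bsub>V\<^esub> x" for y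
  proof -
    obtain h where h: "h \<in> N" "y = h \<oplus>\<^bsub>V\<^esub> x" using \<open>y \<in> N +>\<^bsub>V\<^esub> x\<close> by (auto simp: a_r_coset_def')
    have hc: "h \<in> carrier V" using h qsub_subset[OF N] by auto
    have "c \<odot>\<^bsub>V\<^esub> y = c \<odot>\<^bsub>V\<^esub> h \<oplus>\<^bsub>V\<^esub> c \<odot>\<^bsub>V\<^esub> x"
      using h hc x by (simp add: qvs_smult_r[OF V])
    moreover have "c \<odot>\<^bsub>V\<^esub> h \<in> N" using h(1) by (rule qsub_smult[OF N])
    ultimately have "c \<odot>\<^bsub>V\<^esub> y \<in> N +>\<^bsub>V\<^esub> (c \<odot>\<^bsub>V\<^esub> x)" by (auto simp: a_r_coset_def')
    then show ?thesis
      using a_repr_independence[OF _ qvs_smult[OF V x] a_subgroup, of "c \<odot>\<^bsub>V\<^esub> y"] by simp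
  qed
  moreover have "N +>\<^bsub>V\<^esub> x \<noteq> {}" using a_rcos_self[OF x] by blast
  ultimately show ?thesis unfolding quot_mod_def module.simps by (intro SUP_eq_const)
qed

lemma quot_qvs: "qvs (quot_mod V N)"
proof -
  have z: "\<zero>\<^bsub>quot_mod V N\<^esub> = N +>\<^bsub>V\<^esub> \<zero>\<^bsub>V\<^esub>"
    using coset_zero_iff[OF qvs_zero[OF V]] qsub_zero[OF N] by (simp add: quot_zero)
  show ?thesis
    by (rule qvsI; clarsimp simp: quot_carrier z quot_add quot_smult qvs_zero[OF V] qvs_add[OF V]
        qvs_smult[OF V] qvs_add_zero[OF V] qvs_neg[OF V] qvs_one[OF V] qvs_smult_smult[OF V]
        qvs_smult_l[OF V] qvs_smult_r[OF V]; simp add: M.a_ac)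
qed

lemma quot_qlin: "qlin V (quot_mod V N) (\<lambda>x. N +>\<^bsub>V\<^esub> x)"
  by (rule qlinI) (auto simp: V quot_qvs quot_carrier quot_add quot_smult)

end

text \<open>Universal property of the quotient. The factored map evaluates \<open>f\<close> at a
  chosen representative, and vanishing on \<open>N\<close> makes the choice irrelevant.\<close>

lemma quot_factor:
  assumes N: "qsub N V" and f: "qlin V W f" and k: "\<And>x. x \<in> N \<Longrightarrow> f x = \<zero>\<^bsub>W\<^esub>"
  obtains g where "qlin (quot_mod V N) W g" "\<And>x. x \<in> carrier V \<Longrightarrow> g (N +>\<^bsub>V\<^esub> x) = f x"
proof -
  note V = qlin_dom[OF f] and W = qlin_cod[OF f]
  define g where "g X = f (SOME x. x \<in> carrier V \<and> N +>\<^bsub>V\<^esub> x = X)" for X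
  have g: "g (N +>\<^bsub>V\<^esub> x) = f x" if x: "x \<in> carrier V" for x
  proof -
    define y where "y = (SOME y. y \<in> carrier V \<and> N +>\<^bsub>V\<^esub> y = N +>\<^bsub>V\<^esub> x)"
    have "y \<in> carrier V \<and> N +>\<^bsub>V\<^esub> y = N +>\<^bsub>V\<^esub> x"
      unfolding y_def by (rule someI[of _ x]) (use x in auto)
    then have y: "y \<in> carrier V" "y \<oplus>\<^bsub>V\<^esub> (-1) \<odot>\<^bsub>V\<^esub> x \<in> N"
      using coset_eq_iff[OF V N _ x] by auto
    then have "f y \<oplus>\<^bsub>W\<^esub> (-1) \<odot>\<^bsub>W\<^esub> f x = \<zero>\<^bsub>W\<^esub>"
      using k[OF y(2)] x by (simp add: qlin_add[OF f] qlin_smult[OF f] qvs_smult[OF V])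
    then have "f y = f x" using qvs_eq_iff_diff[OF W] qlin_closed[OF f] x y by blast
    then show ?thesis by (simp add: g_def y_def)
  qed
  have "qlin (quot_mod V N) W g"
    by (rule qlinI)
      (auto simp: quot_qvs[OF V N] W quot_carrier[OF V N] g quot_add[OF V N] quot_smult[OF V N]
        qlin_closed[OF f] qlin_add[OF f] qlin_smult[OF f] qvs_add[OF V] qvs_smult[OF V])
  then show thesis using g that by blast
qed

section \<open>Presented spaces and tensor products\<close>

lemma lookup_map_mult [simp]: "lookup (Poly_Mapping.map ((*) c) p) k = (c::rat) * lookup p k"
  by (simp add: Poly_Mapping.map.rep_eq when_def)

lemma free_carrier: "carrier (free_mod G) = {p. keys p \<subseteq> G}"
  and free_zero: "\<zero>\<^bsub>free_mod G\<^esub> = 0"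
  and free_add: "p \<oplus>\<^bsub>free_mod G\<^esub> q = p + q"
  and free_smult: "c \<odot>\<^bsub>free_mod G\<^esub> p = Poly_Mapping.map ((*) c) p"
  by (simp_all add: free_mod_def)

lemma keys_map_mult: "keys (Poly_Mapping.map ((*) (c::rat)) p) \<subseteq> keys p"
  by (auto simp: in_keys_iff)

lemma map_mult_single: "Poly_Mapping.map ((*) (c::rat)) (single g d) = single g (c * d)"
  by (intro poly_mapping_eqI) (simp add: lookup_single when_def)

lemma free_qvs: "qvs (free_mod G)"
proof (rule qvsI)
  fix p q :: "'a \<Rightarrow>\<^sub>0 rat"
  assume "p \<in> carrier (free_mod G)" "q \<in> carrier (free_mod G)"
  then show "p \<oplus>\<^bsub>free_mod G\<^esub> q \<in> carrier (free_mod G)"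
    using keys_add[of p q] by (auto simp: free_carrier free_add)
next
  fix p :: "'a \<Rightarrow>\<^sub>0 rat" and c
  assume "p \<in> carrier (free_mod G)"
  then show "c \<odot>\<^bsub>free_mod G\<^esub> p \<in> carrier (free_mod G)"
    using keys_map_mult[of c p] by (auto simp: free_carrier free_smult)
qed (auto simp: free_carrier free_zero free_add free_smult lookup_add algebra_simps intro!: poly_mapping_eqI)

lemma free_minus: "p - q = p \<oplus>\<^bsub>free_mod G\<^esub> (-1) \<odot>\<^bsub>free_mod G\<^esub> q"
  by (intro poly_mapping_eqI) (simp add: free_add free_smult lookup_add lookup_minus)

lemma free_single: "g \<in> G \<Longrightarrow> single g c \<in> carrier (free_mod G)"
  by (simp add: free_carrier)

lemma free_single_smult: "single g c = c \<odot>\<^bsub>free_mod G\<^esub> single g 1"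
  by (simp add: free_smult map_mult_single)

text \<open>Induction over a finite set containing the support, splitting off the term at one key.
  This is how linear statements on a free space are reduced to its generators.\<close>

lemma free_sub_eq:
  assumes N: "qsub N (free_mod G)" and g: "\<And>g. g \<in> G \<Longrightarrow> single g 1 \<in> N"
    and p: "p \<in> carrier (free_mod G)"
  shows "p \<in> N"
proof -
  have "p \<in> N" if "finite A" "keys p \<subseteq> A" "A \<subseteq> G" for A p
    using that
  proof (induction A arbitrary: p rule: finite_induct)
    case empty
    then have "p = 0" by simp
    then show ?case using qsub_zero[OF N] by (simp add: free_zero)
  next
    case (insert a A)
    let ?q = "p - single a (lookup p a)"
    have "keys ?q \<subseteq> A" using insert.prems
      by (auto simp: in_keys_iff lookup_minus lookup_single when_def split: if_splits)
    then have q: "?q \<in> N" using insert by auto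
    have "single a (lookup p a) \<in> N"
      using qsub_smult[OF N g[of a], of "lookup p a"] insert.prems
      by (simp flip: free_single_smult)
    from qsub_add[OF N q this] show ?case by (simp add: free_add)
  qed
  from this[of "keys p" p] show ?thesis using p by (simp add: free_carrier)
qed

definition free_ext :: "(rat, 'b) module \<Rightarrow> ('g \<Rightarrow> 'b) \<Rightarrow> ('g \<Rightarrow>\<^sub>0 rat) \<Rightarrow> 'b" where
  "free_ext W f p = finsum W (\<lambda>g. lookup p g \<odot>\<^bsub>W\<^esub> f g) (keys p)"

lemma free_ext_superset:
  assumes W: "qvs W" and "finite A" "keys p \<subseteq> A" "f \<in> A \<rightarrow> carrier W"
  shows "free_ext W f p = finsum W (\<lambda>g. lookup p g \<odot>\<^bsub>W\<^esub> f g) A"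
proof -
  interpret vectorspace class_ring W by fact
  show ?thesis unfolding free_ext_def
    by (rule M.add.finprod_mono_neutral_cong_left)
      (use assms in \<open>auto simp: in_keys_iff qvs_zero_smult[OF W] Pi_iff\<close>)
qed

lemma free_ext_qlin:
  assumes W: "qvs W" and f: "f \<in> G \<rightarrow> carrier W"
  shows "qlin (free_mod G) W (free_ext W f)"
proof -
  interpret vectorspace class_ring W by fact
  show ?thesis
  proof (rule qlinI[OF free_qvs W])
    fix p assume p: "p \<in> carrier (free_mod G)"
    then have k: "keys p \<subseteq> G" by (simp add: free_carrier)
    show "free_ext W f p \<in> carrier W"
      unfolding free_ext_def by (rule M.finsum_closed) (use f k in \<open>auto intro: qvs_smult[OF W]\<close>)
    fix c
    have "free_ext W f (c \<odot>\<^bsub>free_mod G\<^esub> p) = finsum W (\<lambda>g. c \<odot>\<^bsub>W\<^esub> (lookup p g \<odot>\<^bsub>W\<^esub> f g)) (keys p)"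
      using f k keys_map_mult[of c p]
      by (subst free_ext_superset[OF W, of "keys p"])
        (auto simp: free_smult qvs_smult_smult[OF W] Pi_iff intro!: M.add.finprod_cong' qvs_smult[OF W])
    also have "\<dots> = c \<odot>\<^bsub>W\<^esub> free_ext W f p"
      unfolding free_ext_def
      by (rule qlin_finsum[symmetric, OF qlin_scale[of W W "\<lambda>x. x"]])
        (use f k in \<open>auto intro!: qvs_smult[OF W] qlinI[OF W W]\<close>)
    finally show "free_ext W f (c \<odot>\<^bsub>free_mod G\<^esub> p) = c \<odot>\<^bsub>W\<^esub> free_ext W f p" .
  next
    fix p q assume "p \<in> carrier (free_mod G)" "q \<in> carrier (free_mod G)"
    then have k: "keys p \<union> keys q \<subseteq> G" by (simp add: free_carrier)
    let ?A = "keys p \<union> keys q"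
    have fA: "f \<in> ?A \<rightarrow> carrier W" using f k by auto
    have "free_ext W f (p \<oplus>\<^bsub>free_mod G\<^esub> q) =
        finsum W (\<lambda>g. lookup p g \<odot>\<^bsub>W\<^esub> f g \<oplus>\<^bsub>W\<^esub> lookup q g \<odot>\<^bsub>W\<^esub> f g) ?A"
      using fA keys_add[of p q]
      apply (subst free_ext_superset[OF W, of ?A])
         apply (simp_all add: free_add lookup_add)
      apply (rule M.add.finprod_cong')
        apply (auto simp: Pi_iff qvs_smult_l[OF W] intro!: qvs_smult[OF W] qvs_add[OF W])
      done
    also have "\<dots> = finsum W (\<lambda>g. lookup p g \<odot>\<^bsub>W\<^esub> f g) ?A \<oplus>\<^bsub>W\<^esub> finsum W (\<lambda>g. lookup q g \<odot>\<^bsub>W\<^esub> f g) ?A"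
      by (rule M.finsum_addf) (use fA in \<open>auto intro!: qvs_smult[OF W]\<close>)
    also have "\<dots> = free_ext W f p \<oplus>\<^bsub>W\<^esub> free_ext W f q"
      using fA by (subst (1 2) free_ext_superset[OF W, of ?A]) auto
    finally show "free_ext W f (p \<oplus>\<^bsub>free_mod G\<^esub> q) = free_ext W f p \<oplus>\<^bsub>W\<^esub> free_ext W f q" .
  qed
qed

lemma free_ext_single:
  assumes W: "qvs W" and f: "f g \<in> carrier W"
  shows "free_ext W f (single g c) = c \<odot>\<^bsub>W\<^esub> f g"
proof -
  interpret vectorspace class_ring W by fact
  show ?thesis using f qvs_smult[OF W f]
    by (subst free_ext_superset[OF W, of "{g}"]) (auto simp: lookup_single)
qed

lemma free_ext_cong:
  assumes W: "qvs W" and "r \<in> carrier (free_mod G)" "g \<in> G \<rightarrow> carrier W" "\<And>a. a \<in> G \<Longrightarrow> f a = g a"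
  shows "free_ext W f r = free_ext W g r"
proof -
  interpret vectorspace class_ring W by fact
  show ?thesis unfolding free_ext_def
    by (rule M.add.finprod_cong') (use assms in \<open>auto simp: free_carrier intro!: qvs_smult[OF W]\<close>)
qed

text \<open>For fixed \<open>r\<close> this is a finite linear combination of the linear maps
  \<open>f g\<close>. It permits checking a relation in one variable on generators of the other
  variables.\<close>

lemma free_ext_param_qlin:
  assumes W: "qvs W" and V: "qvs V" and f: "\<And>g. g \<in> G \<Longrightarrow> qlin V W (f g)"
    and r: "r \<in> carrier (free_mod G)"
  shows "qlin V W (\<lambda>x. free_ext W (\<lambda>g. f g x) r)"
proof -
  interpret vectorspace class_ring W by fact
  have "qlin V W (\<lambda>x. finsum W (\<lambda>g. lookup r g \<odot>\<^bsub>W\<^esub> f g x) A)" if "finite A" "A \<subseteq> G" for A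
    using that
  proof (induction A rule: finite_induct)
    case empty
    then show ?case using qlin_const_zero[OF V W] by simp
  next
    case (insert a A)
    have l: "qlin V W (\<lambda>x. lookup r a \<odot>\<^bsub>W\<^esub> f a x \<oplus>\<^bsub>W\<^esub> finsum W (\<lambda>g. lookup r g \<odot>\<^bsub>W\<^esub> f g x) A)"
      using insert by (intro qlin_sum qlin_scale f) auto
    have e: "finsum W (\<lambda>g. lookup r g \<odot>\<^bsub>W\<^esub> f g x) (insert a A) =
       lookup r a \<odot>\<^bsub>W\<^esub> f a x \<oplus>\<^bsub>W\<^esub> finsum W (\<lambda>g. lookup r g \<odot>\<^bsub>W\<^esub> f g x) A" if "x \<in> carrier V" for x
      using insert qlin_closed[OF f, OF _ that] by (intro M.finsum_insert) (auto intro!: qvs_smult[OF W])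
    show ?case
      by (rule qlinI[OF V W])
        (simp_all add: e qlin_closed[OF l] qlin_add[OF l] qlin_smult[OF l] qvs_add[OF V] qvs_smult[OF V])
  qed
  from this[of "keys r"] show ?thesis using r by (simp add: free_ext_def free_carrier)
qed

lemma free_ext_comp:
  assumes h: "qlin V W h" and f: "f \<in> G \<rightarrow> carrier V" and p: "p \<in> carrier (free_mod G)"
  shows "h (free_ext V f p) = free_ext W (\<lambda>g. h (f g)) p"
proof -
  interpret W: vectorspace class_ring W by (rule qlin_cod[OF h])
  have k: "keys p \<subseteq> G" using p by (simp add: free_carrier)
  have "h (free_ext V f p) = finsum W (\<lambda>g. h (lookup p g \<odot>\<^bsub>V\<^esub> f g)) (keys p)"
    unfolding free_ext_def
    by (rule qlin_finsum[OF h]) (use f k in \<open>auto intro!: qvs_smult[OF qlin_dom[OF h]]\<close>)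
  also have "\<dots> = free_ext W (\<lambda>g. h (f g)) p"
    unfolding free_ext_def
    by (rule W.M.add.finprod_cong')
      (use f k in \<open>auto simp: qlin_smult[OF h] Pi_iff intro!: qvs_smult[OF qlin_cod[OF h]] qlin_closed[OF h]\<close>)
  finally show ?thesis .
qed

section \<open>Universal property of generators and relations\<close>

locale presentation =
  fixes G :: "'g set" and R :: "('g \<Rightarrow>\<^sub>0 rat) set"
  assumes R: "R \<subseteq> carrier (free_mod G)"
begin

abbreviation "PM \<equiv> presented_mod G R"
abbreviation "gen \<equiv> presented_gen G R"
abbreviation "N \<equiv> rat_span (free_mod G) R"

lemma N_sub: "qsub N (free_mod G)"
  by (rule qspan_sub[OF free_qvs R])

lemma PM_qvs: "qvs PM"
  unfolding presented_mod_def by (rule quot_qvs[OF free_qvs N_sub])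

lemma cls_qlin: "qlin (free_mod G) PM (\<lambda>p. N +>\<^bsub>free_mod G\<^esub> p)"
  unfolding presented_mod_def by (rule quot_qlin[OF free_qvs N_sub])

lemma PM_carrier: "carrier PM = (\<lambda>p. N +>\<^bsub>free_mod G\<^esub> p) ` carrier (free_mod G)"
  unfolding presented_mod_def by (rule quot_carrier[OF free_qvs N_sub])

lemma gen_carrier: "g \<in> G \<Longrightarrow> gen g \<in> carrier PM"
  using qlin_closed[OF cls_qlin free_single[of g G 1]] by (simp add: presented_gen_def)

text \<open>Both sides are linear in \<open>p\<close> and agree on the generators. Thus a relation
  becomes the vanishing of an explicit combination of the classes \<open>gen g\<close>.\<close>

lemma cls_ext:
  assumes p: "p \<in> carrier (free_mod G)"
  shows "N +>\<^bsub>free_mod G\<^esub> p = free_ext PM gen p"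
proof -
  have e: "qlin (free_mod G) PM (free_ext PM gen)"
    by (rule free_ext_qlin[OF PM_qvs]) (auto intro: gen_carrier)
  let ?h = "\<lambda>p. (N +>\<^bsub>free_mod G\<^esub> p) \<oplus>\<^bsub>PM\<^esub> (-1) \<odot>\<^bsub>PM\<^esub> free_ext PM gen p"
  have h: "qlin (free_mod G) PM ?h"
    by (intro qlin_sum cls_qlin qlin_scale e)
  have "p \<in> {p \<in> carrier (free_mod G). ?h p = \<zero>\<^bsub>PM\<^esub>}"
  proof (rule free_sub_eq[OF qlin_ker_sub[OF h] _ p])
    fix g assume g: "g \<in> G"
    then have "free_ext PM gen (single g 1) = gen g"
      using free_ext_single[OF PM_qvs, of gen g 1] gen_carrier[OF g] by (simp add: qvs_one[OF PM_qvs])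
    then show "single g 1 \<in> {p \<in> carrier (free_mod G). ?h p = \<zero>\<^bsub>PM\<^esub>}"
      using g gen_carrier[OF g] by (simp add: free_single presented_gen_def qvs_neg[OF PM_qvs])
  qed
  then show ?thesis
    using qvs_eq_iff_diff[OF PM_qvs qlin_closed[OF cls_qlin p] qlin_closed[OF e p]] by simp
qed

lemma rel_zero: "r \<in> R \<Longrightarrow> free_ext PM gen r = \<zero>\<^bsub>PM\<^esub>"
  using qspan_superset[OF free_qvs R] R coset_zero_iff[OF free_qvs N_sub, of r]
  by (subst cls_ext[symmetric]) (auto simp: presented_mod_def quot_zero[OF free_qvs N_sub])

lemma sub_eq:
  assumes S: "qsub S PM" and g: "\<And>g. g \<in> G \<Longrightarrow> gen g \<in> S" and x: "x \<in> carrier PM"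
  shows "x \<in> S"
proof -
  obtain p where p: "p \<in> carrier (free_mod G)" "x = N +>\<^bsub>free_mod G\<^esub> p" using x by (auto simp: PM_carrier)
  have "p \<in> {p \<in> carrier (free_mod G). N +>\<^bsub>free_mod G\<^esub> p \<in> S}"
    by (rule free_sub_eq[OF qlin_vimage_sub[OF cls_qlin S] _ p(1)])
      (use g in \<open>auto simp: free_single presented_gen_def\<close>)
  then show ?thesis using p by simp
qed

lemma qlin_eq:
  assumes f: "qlin PM W f" and h: "qlin PM W h" and g: "\<And>g. g \<in> G \<Longrightarrow> f (gen g) = h (gen g)"
    and x: "x \<in> carrier PM"
  shows "f x = h x"
proof -
  note W = qlin_cod[OF f]
  have l: "qlin PM W (\<lambda>x. f x \<oplus>\<^bsub>W\<^esub> (-1) \<odot>\<^bsub>W\<^esub> h x)" by (intro qlin_sum qlin_scale f h)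
  have "x \<in> {x \<in> carrier PM. f x \<oplus>\<^bsub>W\<^esub> (-1) \<odot>\<^bsub>W\<^esub> h x = \<zero>\<^bsub>W\<^esub>}"
    by (rule sub_eq[OF qlin_ker_sub[OF l] _ x])
      (auto simp: g gen_carrier qvs_neg[OF W] qlin_closed[OF h])
  then show ?thesis using qvs_eq_iff_diff[OF W qlin_closed[OF f x] qlin_closed[OF h x]] by simp
qed

lemma lift:
  assumes W: "qvs W" and f: "f \<in> G \<rightarrow> carrier W" and r: "\<And>r. r \<in> R \<Longrightarrow> free_ext W f r = \<zero>\<^bsub>W\<^esub>"
  obtains h where "qlin PM W h" "\<And>g. g \<in> G \<Longrightarrow> h (gen g) = f g"
proof -
  have F: "qlin (free_mod G) W (free_ext W f)" by (rule free_ext_qlin[OF W f])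
  have "N \<subseteq> {p \<in> carrier (free_mod G). free_ext W f p = \<zero>\<^bsub>W\<^esub>}"
    by (rule qspan_least[OF free_qvs _ qlin_ker_sub[OF F]]) (use r R in auto)
  then have "\<And>p. p \<in> N \<Longrightarrow> free_ext W f p = \<zero>\<^bsub>W\<^esub>" by auto
  from quot_factor[OF N_sub F this] obtain h where
    h: "qlin PM W h" "\<And>p. p \<in> carrier (free_mod G) \<Longrightarrow> h (N +>\<^bsub>free_mod G\<^esub> p) = free_ext W f p"
    unfolding presented_mod_def by blast
  have "h (gen g) = f g" if "g \<in> G" for g
    using h(2)[OF free_single[OF that, of 1]] free_ext_single[OF W, of f g 1] f that
    by (auto simp: presented_gen_def qvs_one[OF W])
  then show thesis using that h(1) by blast
qed

end

definition qbilin :: "(rat, 'a) module \<Rightarrow> (rat, 'b) module \<Rightarrow> (rat, 'c) module \<Rightarrow> ('a \<Rightarrow> 'b \<Rightarrow> 'c) \<Rightarrow> bool" where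
  "qbilin U V W \<beta> \<longleftrightarrow> (\<forall>y\<in>carrier V. qlin U W (\<lambda>x. \<beta> x y)) \<and> (\<forall>x\<in>carrier U. qlin V W (\<beta> x))"

text \<open>\<open>lift\<close> is applied for each fixed \<open>v\<close>; linearity in
  \<open>v\<close> follows because two linear maps that agree on the generators are equal.\<close>

lemma (in presentation) lift_bilin:
  assumes V: "qvs V" and W: "qvs W" and f: "\<And>g. g \<in> G \<Longrightarrow> qlin V W (f g)"
    and r: "\<And>r v. r \<in> R \<Longrightarrow> v \<in> carrier V \<Longrightarrow> free_ext W (\<lambda>g. f g v) r = \<zero>\<^bsub>W\<^esub>"
  obtains \<beta> where "qbilin PM V W \<beta>" "\<And>g v. g \<in> G \<Longrightarrow> v \<in> carrier V \<Longrightarrow> \<beta> (gen g) v = f g v"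
proof -
  have "\<exists>h. qlin PM W h \<and> (\<forall>g\<in>G. h (gen g) = f g v)" if v: "v \<in> carrier V" for v
    by (rule lift[OF W, of "\<lambda>g. f g v"]) (use r v qlin_closed[OF f] in auto)
  then obtain h where h: "\<And>v. v \<in> carrier V \<Longrightarrow> qlin PM W (h v)"
      "\<And>v g. v \<in> carrier V \<Longrightarrow> g \<in> G \<Longrightarrow> h v (gen g) = f g v"
    by metis
  have "qlin V W (\<lambda>v. h v x)" if x: "x \<in> carrier PM" for x
  proof (rule qlinI[OF V W])
    fix v w assume vw: "v \<in> carrier V" "w \<in> carrier V"
    show "h (v \<oplus>\<^bsub>V\<^esub> w) x = h v x \<oplus>\<^bsub>W\<^esub> h w x"
      by (rule qlin_eq[OF h(1) qlin_sum[OF h(1) h(1)] _ x])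
        (use vw in \<open>auto simp: qvs_add[OF V] h(2) qlin_add[OF f]\<close>)
  next
    fix c v assume v: "v \<in> carrier V"
    show "h (c \<odot>\<^bsub>V\<^esub> v) x = c \<odot>\<^bsub>W\<^esub> h v x"
      by (rule qlin_eq[OF h(1) qlin_scale[OF h(1)] _ x])
        (use v in \<open>auto simp: qvs_smult[OF V] h(2) qlin_smult[OF f]\<close>)
  qed (rule qlin_closed[OF h(1) x])
  then have "qbilin PM V W (\<lambda>x v. h v x)" unfolding qbilin_def using h(1) by blast
  then show thesis using that h(2) by blast
qed

lemma qbilin_closed: "qbilin U V W \<beta> \<Longrightarrow> x \<in> carrier U \<Longrightarrow> y \<in> carrier V \<Longrightarrow> \<beta> x y \<in> carrier W"
  by (auto simp: qbilin_def qlin_closed)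

section \<open>Tensor products and trilinear maps\<close>

lemma tensor_presentation:
  assumes U: "qvs U" and V: "qvs V"
  shows "presentation (carrier U \<times> carrier V) (tensor_rels U V)"
proof -
  let ?F = "free_mod (carrier U \<times> carrier V)"
  note [simp] = qvs_add[OF free_qvs] qvs_smult[OF free_qvs] qvs_add[OF U] qvs_add[OF V]
    qvs_smult[OF U] qvs_smult[OF V] free_single
  show ?thesis
  proof (rule presentation.intro)
    show "tensor_rels U V \<subseteq> carrier ?F"
      unfolding tensor_rels_def by (auto simp: free_minus[of _ _ "carrier U \<times> carrier V"])
  qed
qed

context
  fixes U :: "(rat, 'a) module" and V :: "(rat, 'b) module"
  assumes U: "qvs U" and V: "qvs V"
begin

interpretation presentation "carrier U \<times> carrier V" "tensor_rels U V"
  by (rule tensor_presentation[OF U V])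

lemma tensor_qvs: "qvs (tensor_mod U V)"
  using PM_qvs by (simp add: tensor_mod_def)

lemma tensor_sub_eq:
  assumes "qsub S (tensor_mod U V)"
    and "\<And>x y. x \<in> carrier U \<Longrightarrow> y \<in> carrier V \<Longrightarrow> tensor_elt U V x y \<in> S"
    and "z \<in> carrier (tensor_mod U V)"
  shows "z \<in> S"
  by (rule sub_eq[of S z]) (use assms in \<open>auto simp: tensor_mod_def tensor_elt_def\<close>)

lemma tensor_qlin_eq:
  assumes "qlin (tensor_mod U V) W f" "qlin (tensor_mod U V) W h"
    and "\<And>x y. x \<in> carrier U \<Longrightarrow> y \<in> carrier V \<Longrightarrow> f (tensor_elt U V x y) = h (tensor_elt U V x y)"
    and "z \<in> carrier (tensor_mod U V)"
  shows "f z = h z"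
  by (rule qlin_eq[of W f h z]) (use assms in \<open>auto simp: tensor_mod_def tensor_elt_def\<close>)

text \<open>Each of the four families of relations expresses exactly one of the four bilinearity
  laws. Read from right to left this yields \<open>tensor_lift\<close>, from left to right
  \<open>tensor_elt_bilin\<close>.\<close>

lemma free_ext_tensor_rel:
  assumes W: "qvs W" and f: "f \<in> carrier U \<times> carrier V \<rightarrow> carrier W" 
  shows "(\<forall>r\<in>tensor_rels U V. free_ext W f r = \<zero>\<^bsub>W\<^esub>) \<longleftrightarrow> qbilin U V W (\<lambda>x y. f (x, y))"
proof -
  let ?G = "carrier U \<times> carrier V"
  let ?e = "free_ext W f"
  note F = free_ext_qlin[OF W f]
  note [simp] = qvs_add[OF free_qvs] qvs_smult[OF free_qvs] qvs_add[OF U] qvs_add[OF V]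
    qvs_smult[OF U] qvs_smult[OF V] free_single qlin_add[OF F] qlin_smult[OF F] 
  have s: "?e (single (x, y) c) = c \<odot>\<^bsub>W\<^esub> f (x, y)" if "x \<in> carrier U" "y \<in> carrier V" for x y c
    using free_ext_single[OF W, of f "(x,y)" c] f that by auto
  have fc: "f (x, y) \<in> carrier W" if "x \<in> carrier U" "y \<in> carrier V" for x y using f that by auto
  interpret W: vectorspace class_ring W by fact
  have add_iff: "1 \<odot>\<^bsub>W\<^esub> a \<oplus>\<^bsub>W\<^esub> (-1) \<odot>\<^bsub>W\<^esub> (1 \<odot>\<^bsub>W\<^esub> b) \<oplus>\<^bsub>W\<^esub> (-1) \<odot>\<^bsub>W\<^esub> (1 \<odot>\<^bsub>W\<^esub> c) = \<zero>\<^bsub>W\<^esub> \<longleftrightarrow> a = b \<oplus>\<^bsub>W\<^esub> c"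
    if "a \<in> carrier W" "b \<in> carrier W" "c \<in> carrier W" for a b c
  proof -
    have "1 \<odot>\<^bsub>W\<^esub> a \<oplus>\<^bsub>W\<^esub> (-1) \<odot>\<^bsub>W\<^esub> (1 \<odot>\<^bsub>W\<^esub> b) \<oplus>\<^bsub>W\<^esub> (-1) \<odot>\<^bsub>W\<^esub> (1 \<odot>\<^bsub>W\<^esub> c) = a \<oplus>\<^bsub>W\<^esub> (-1) \<odot>\<^bsub>W\<^esub> (b \<oplus>\<^bsub>W\<^esub> c)"
      using that by (simp add: qvs_one[OF W] qvs_smult_r[OF W] qvs_assoc[OF W] qvs_smult[OF W])
    then show ?thesis using qvs_eq_iff_diff[OF W] that by (simp add: qvs_add[OF W])
  qed
  have sm_iff: "1 \<odot>\<^bsub>W\<^esub> a \<oplus>\<^bsub>W\<^esub> (-1) \<odot>\<^bsub>W\<^esub> (c \<odot>\<^bsub>W\<^esub> b) = \<zero>\<^bsub>W\<^esub> \<longleftrightarrow> a = c \<odot>\<^bsub>W\<^esub> b"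
    if "a \<in> carrier W" "b \<in> carrier W" for a b c
    using that qvs_eq_iff_diff[OF W, of a "c \<odot>\<^bsub>W\<^esub> b"] by (simp add: qvs_one[OF W] qvs_smult[OF W])
  have 1: "?e (single (x \<oplus>\<^bsub>U\<^esub> x', y) 1 - single (x, y) 1 - single (x', y) 1)
      = \<zero>\<^bsub>W\<^esub> \<longleftrightarrow> f (x \<oplus>\<^bsub>U\<^esub> x', y) = f (x, y) \<oplus>\<^bsub>W\<^esub> f (x', y)"
    if "x \<in> carrier U" "x' \<in> carrier U" "y \<in> carrier V" for x x' y
    using that by (simp add: free_minus[of _ _ ?G] s add_iff fc)
  have 2: "?e (single (x, y \<oplus>\<^bsub>V\<^esub> y') 1 - single (x, y) 1 - single (x, y') 1)
      = \<zero>\<^bsub>W\<^esub> \<longleftrightarrow> f (x, y \<oplus>\<^bsub>V\<^esub> y') = f (x, y) \<oplus>\<^bsub>W\<^esub> f (x, y')"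
    if "x \<in> carrier U" "y' \<in> carrier V" "y \<in> carrier V" for x y y'
    using that by (simp add: free_minus[of _ _ ?G] s add_iff fc)
  have 3: "?e (single (c \<odot>\<^bsub>U\<^esub> x, y) 1 - single (x, y) c)
      = \<zero>\<^bsub>W\<^esub> \<longleftrightarrow> f (c \<odot>\<^bsub>U\<^esub> x, y) = c \<odot>\<^bsub>W\<^esub> f (x, y)"
    if "x \<in> carrier U" "y \<in> carrier V" for x y c
    using that by (simp add: free_minus[of _ _ ?G] s sm_iff fc)
  have 4: "?e (single (x, c \<odot>\<^bsub>V\<^esub> y) 1 - single (x, y) c)
      = \<zero>\<^bsub>W\<^esub> \<longleftrightarrow> f (x, c \<odot>\<^bsub>V\<^esub> y) = c \<odot>\<^bsub>W\<^esub> f (x, y)"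
    if "x \<in> carrier U" "y \<in> carrier V" for x y c
    using that by (simp add: free_minus[of _ _ ?G] s sm_iff fc)
  show ?thesis
  proof
    assume z: "\<forall>r\<in>tensor_rels U V. ?e r = \<zero>\<^bsub>W\<^esub>"
    show "qbilin U V W (\<lambda>x y. f (x, y))"
      unfolding qbilin_def
    proof (intro conjI ballI qlinI U V W)
      fix x x' y assume a: "x \<in> carrier U" "x' \<in> carrier U" "y \<in> carrier V"
      show "f (x \<oplus>\<^bsub>U\<^esub> x', y) = f (x, y) \<oplus>\<^bsub>W\<^esub> f (x', y)"
        by (rule 1[THEN iffD1], (rule a)+, rule z[rule_format]) (use a in \<open>auto simp: tensor_rels_def\<close>)
    next
      fix x y y' assume a: "x \<in> carrier U" "y \<in> carrier V" "y' \<in> carrier V"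
      show "f (x, y \<oplus>\<^bsub>V\<^esub> y') = f (x, y) \<oplus>\<^bsub>W\<^esub> f (x, y')"
        by (rule 2[THEN iffD1], rule a(1), rule a(3), rule a(2), rule z[rule_format]) (use a in \<open>auto simp: tensor_rels_def\<close>)
    next
      fix x y c assume a: "x \<in> carrier U" "y \<in> carrier V"
      show "f (c \<odot>\<^bsub>U\<^esub> x, y) = c \<odot>\<^bsub>W\<^esub> f (x, y)"
        by (rule 3[THEN iffD1], (rule a)+, rule z[rule_format]) (use a in \<open>auto simp: tensor_rels_def\<close>)
      show "f (x, c \<odot>\<^bsub>V\<^esub> y) = c \<odot>\<^bsub>W\<^esub> f (x, y)"
        by (rule 4[THEN iffD1], (rule a)+, rule z[rule_format]) (use a in \<open>auto simp: tensor_rels_def\<close>)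
    qed (use fc in auto)
  next
    assume b: "qbilin U V W (\<lambda>x y. f (x, y))"
    then have "\<And>y. y \<in> carrier V \<Longrightarrow> qlin U W (\<lambda>x. f (x, y))" "\<And>x. x \<in> carrier U \<Longrightarrow> qlin V W (\<lambda>y. f (x, y))"
      by (auto simp: qbilin_def)
    note l = qlin_add[OF this(1)] qlin_add[OF this(2)] qlin_smult[OF this(1)] qlin_smult[OF this(2)]
    show "\<forall>r\<in>tensor_rels U V. ?e r = \<zero>\<^bsub>W\<^esub>"
    proof
      fix r assume "r \<in> tensor_rels U V"
      then show "?e r = \<zero>\<^bsub>W\<^esub>"
        unfolding tensor_rels_def
        apply (elim UnE CollectE exE conjE)
        subgoal using l(1) by (simp only: 1)
        subgoal using l(2) by (simp only: 2)
        subgoal using l(3) by (simp only: 3)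
        subgoal using l(4) by (simp only: 4)
        done
    qed
  qed
qed

lemma tensor_lift:
  assumes W: "qvs W" and b: "qbilin U V W \<beta>"
  obtains h where "qlin (tensor_mod U V) W h"
    "\<And>x y. x \<in> carrier U \<Longrightarrow> y \<in> carrier V \<Longrightarrow> h (tensor_elt U V x y) = \<beta> x y"
proof -
  have f: "(\<lambda>(x, y). \<beta> x y) \<in> carrier U \<times> carrier V \<rightarrow> carrier W"
    using qbilin_closed[OF b] by auto
  show thesis
    by (rule lift[OF W f]) (use free_ext_tensor_rel[OF W f] b that in \<open>auto simp: tensor_mod_def tensor_elt_def\<close>)
qed

lemma tensor_elt_bilin: "qbilin U V (tensor_mod U V) (tensor_elt U V)"
proof -
  have "presented_gen (carrier U \<times> carrier V) (tensor_rels U V) \<in> carrier U \<times> carrier V \<rightarrow> carrier (tensor_mod U V)"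
    using gen_carrier by (auto simp: tensor_mod_def)
  from free_ext_tensor_rel[OF tensor_qvs this] rel_zero show ?thesis
    by (simp add: tensor_mod_def tensor_elt_def[abs_def])
qed

end

lemma qbilin_qlin1: "qbilin U V W \<beta> \<Longrightarrow> y \<in> carrier V \<Longrightarrow> qlin U W (\<lambda>x. \<beta> x y)"
  and qbilin_qlin2: "qbilin U V W \<beta> \<Longrightarrow> x \<in> carrier U \<Longrightarrow> qlin V W (\<beta> x)"
  by (auto simp: qbilin_def)

text \<open>The variables are linearised one at a time, starting with the last:
  \<open>\<chi>\<close> on C, \<open>\<beta>\<close> on pairs from B and C, \<open>\<beta>'\<close>
  on the tensor product of B and C, \<open>\<gamma>\<close> with the variable of A added, and
  finally a change of bracketing. Relations in one variable need checking for generators in the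
  other two, since a linear map is determined by generators.\<close>

lemma trilinear_lift:
  assumes A: "presentation GA RA" and B: "presentation GB RB" and C: "presentation GC RC"
    and W: "qvs W"
    and t: "\<And>a b c. a \<in> GA \<Longrightarrow> b \<in> GB \<Longrightarrow> c \<in> GC \<Longrightarrow> t a b c \<in> carrier W"
    and tA: "\<And>r b c. r \<in> RA \<Longrightarrow> b \<in> GB \<Longrightarrow> c \<in> GC \<Longrightarrow> free_ext W (\<lambda>a. t a b c) r = \<zero>\<^bsub>W\<^esub>"
    and tB: "\<And>a r c. a \<in> GA \<Longrightarrow> r \<in> RB \<Longrightarrow> c \<in> GC \<Longrightarrow> free_ext W (\<lambda>b. t a b c) r = \<zero>\<^bsub>W\<^esub>"
    and tC: "\<And>a b r. a \<in> GA \<Longrightarrow> b \<in> GB \<Longrightarrow> r \<in> RC \<Longrightarrow> free_ext W (t a b) r = \<zero>\<^bsub>W\<^esub>"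
  obtains \<Phi> where
    "qlin (tensor_mod (tensor_mod (presented_mod GA RA) (presented_mod GB RB)) (presented_mod GC RC)) W \<Phi>"
    "\<And>a b c. a \<in> GA \<Longrightarrow> b \<in> GB \<Longrightarrow> c \<in> GC \<Longrightarrow>
      \<Phi> (tensor_elt (tensor_mod (presented_mod GA RA) (presented_mod GB RB)) (presented_mod GC RC)
          (tensor_elt (presented_mod GA RA) (presented_mod GB RB)
             (presented_gen GA RA a) (presented_gen GB RB b)) (presented_gen GC RC c)) = t a b c"
proof -
  interpret A: presentation GA RA by fact
  interpret B: presentation GB RB by fact
  interpret C: presentation GC RC by fact
  note qA = A.PM_qvs and qB = B.PM_qvs and qC = C.PM_qvs
  let ?BC = "tensor_mod B.PM C.PM" and ?AB = "tensor_mod A.PM B.PM"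
  have "\<exists>h. qlin C.PM W h \<and> (\<forall>c\<in>GC. h (C.gen c) = t a b c)" if ab: "a \<in> GA" "b \<in> GB" for a b
    by (rule C.lift[OF W, of "t a b"]) (use t tC ab in auto)
  then obtain \<chi> where \<chi>: "\<And>a b. a \<in> GA \<Longrightarrow> b \<in> GB \<Longrightarrow> qlin C.PM W (\<chi> a b)"
      "\<And>a b c. a \<in> GA \<Longrightarrow> b \<in> GB \<Longrightarrow> c \<in> GC \<Longrightarrow> \<chi> a b (C.gen c) = t a b c"
    by metis
  have "\<exists>\<beta>. qbilin B.PM C.PM W \<beta> \<and> (\<forall>b\<in>GB. \<forall>z\<in>carrier C.PM. \<beta> (B.gen b) z = \<chi> a b z)" if a: "a \<in> GA" for a
  proof (rule B.lift_bilin[OF qC W, of "\<chi> a"])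
    fix r z assume r: "r \<in> RB" and z: "z \<in> carrier C.PM"
    have rc: "r \<in> carrier (free_mod GB)" using r B.R by auto
    show "free_ext W (\<lambda>b. \<chi> a b z) r = \<zero>\<^bsub>W\<^esub>"
    proof (rule C.qlin_eq[OF free_ext_param_qlin[OF W qC _ rc] qlin_const_zero[OF qC W] _ z])
      fix c assume c: "c \<in> GC"
      have "free_ext W (\<lambda>b. \<chi> a b (C.gen c)) r = free_ext W (\<lambda>b. t a b c) r"
        by (rule free_ext_cong[OF W rc]) (use a c \<chi> t in auto)
      then show "free_ext W (\<lambda>b. \<chi> a b (C.gen c)) r = \<zero>\<^bsub>W\<^esub>" using tB a r c by simp
    qed (use a \<chi> in auto)
  qed (use a \<chi> in auto)
  then obtain \<beta> where \<beta>: "\<And>a. a \<in> GA \<Longrightarrow> qbilin B.PM C.PM W (\<beta> a)"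
      "\<And>a b z. a \<in> GA \<Longrightarrow> b \<in> GB \<Longrightarrow> z \<in> carrier C.PM \<Longrightarrow> \<beta> a (B.gen b) z = \<chi> a b z"
    by metis
  have "\<exists>h. qlin ?BC W h \<and> (\<forall>y\<in>carrier B.PM. \<forall>z\<in>carrier C.PM. h (tensor_elt B.PM C.PM y z) = \<beta> a y z)"
    if a: "a \<in> GA" for a
    by (rule tensor_lift[OF qB qC W \<beta>(1)[OF a]]) auto
  then obtain \<beta>' where \<beta>': "\<And>a. a \<in> GA \<Longrightarrow> qlin ?BC W (\<beta>' a)"
      "\<And>a y z. a \<in> GA \<Longrightarrow> y \<in> carrier B.PM \<Longrightarrow> z \<in> carrier C.PM \<Longrightarrow> \<beta>' a (tensor_elt B.PM C.PM y z) = \<beta> a y z"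
    by metis
  \<comment> \<open>A relation in \<open>RA\<close> yields a linear map on the tensor product of B
    and C. It is zero because it is zero on pure tensors, where first \<open>y\<close> and then
    \<open>z\<close> may be taken to be generators.\<close>
  obtain \<gamma> where \<gamma>: "qbilin A.PM ?BC W \<gamma>" "\<And>a p. a \<in> GA \<Longrightarrow> p \<in> carrier ?BC \<Longrightarrow> \<gamma> (A.gen a) p = \<beta>' a p"
  proof (rule A.lift_bilin[OF tensor_qvs[OF qB qC] W, of \<beta>'])
    fix r p assume r: "r \<in> RA" and p: "p \<in> carrier ?BC"
    have rc: "r \<in> carrier (free_mod GA)" using r A.R by auto
    show "free_ext W (\<lambda>a. \<beta>' a p) r = \<zero>\<^bsub>W\<^esub>"
    proof (rule tensor_qlin_eq[OF qB qC free_ext_param_qlin[OF W tensor_qvs[OF qB qC] _ rc]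
          qlin_const_zero[OF tensor_qvs[OF qB qC] W] _ p])
      fix y z assume y: "y \<in> carrier B.PM" and z: "z \<in> carrier C.PM"
      have "free_ext W (\<lambda>a. \<beta> a y z) r = \<zero>\<^bsub>W\<^esub>"
      proof (rule B.qlin_eq[OF free_ext_param_qlin[OF W qB _ rc] qlin_const_zero[OF qB W] _ y])
        fix b assume b: "b \<in> GB"
        have "free_ext W (\<lambda>a. \<chi> a b z) r = \<zero>\<^bsub>W\<^esub>"
        proof (rule C.qlin_eq[OF free_ext_param_qlin[OF W qC _ rc] qlin_const_zero[OF qC W] _ z])
          fix c assume c: "c \<in> GC"
          have "free_ext W (\<lambda>a. \<chi> a b (C.gen c)) r = free_ext W (\<lambda>a. t a b c) r"
            by (rule free_ext_cong[OF W rc]) (use b c \<chi> t in auto)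
          then show "free_ext W (\<lambda>a. \<chi> a b (C.gen c)) r = \<zero>\<^bsub>W\<^esub>" using tA b r c by simp
        qed (use b \<chi> in auto)
        moreover have "free_ext W (\<lambda>a. \<beta> a (B.gen b) z) r = free_ext W (\<lambda>a. \<chi> a b z) r"
          by (rule free_ext_cong[OF W rc])
            (use b z in \<open>auto simp: \<beta>(2) intro!: qlin_closed[OF \<chi>(1)]\<close>)
        ultimately show "free_ext W (\<lambda>a. \<beta> a (B.gen b) z) r = \<zero>\<^bsub>W\<^esub>" by simp
      qed (use z \<beta>(1) in \<open>auto intro: qbilin_qlin1\<close>)
      moreover have "free_ext W (\<lambda>a. \<beta>' a (tensor_elt B.PM C.PM y z)) r = free_ext W (\<lambda>a. \<beta> a y z) r"
        by (rule free_ext_cong[OF W rc])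
          (use y z in \<open>auto simp: \<beta>'(2) intro!: qbilin_closed[OF \<beta>(1)]\<close>)
      ultimately show "free_ext W (\<lambda>a. \<beta>' a (tensor_elt B.PM C.PM y z)) r = \<zero>\<^bsub>W\<^esub>" by simp
    qed (use \<beta>' in auto)
  qed (use \<beta>' in auto)
  note te = tensor_elt_bilin[OF qB qC]
  \<comment> \<open>Change of bracketing: for fixed \<open>z\<close> the map sending
    \<open>x\<close>, \<open>y\<close> to \<open>\<gamma>\<close> of \<open>x\<close> and of the
    tensor of \<open>y\<close> and \<open>z\<close> is bilinear, so it lives on the tensor product
    of A and B.\<close>
  have "\<exists>h. qlin ?AB W h \<and> (\<forall>x\<in>carrier A.PM. \<forall>y\<in>carrier B.PM.
      h (tensor_elt A.PM B.PM x y) = \<gamma> x (tensor_elt B.PM C.PM y z))" if z: "z \<in> carrier C.PM" for z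
  proof (rule tensor_lift[OF qA qB W, of "\<lambda>x y. \<gamma> x (tensor_elt B.PM C.PM y z)"])
    show "qbilin A.PM B.PM W (\<lambda>x y. \<gamma> x (tensor_elt B.PM C.PM y z))"
      unfolding qbilin_def[of A.PM B.PM]
      using qbilin_qlin1[OF \<gamma>(1) qbilin_closed[OF te _ z]]
        qlin_comp[OF qbilin_qlin1[OF te z] qbilin_qlin2[OF \<gamma>(1)]] by blast
  qed auto
  then obtain \<delta> where \<delta>: "\<And>z. z \<in> carrier C.PM \<Longrightarrow> qlin ?AB W (\<delta> z)"
      "\<And>x y z. x \<in> carrier A.PM \<Longrightarrow> y \<in> carrier B.PM \<Longrightarrow> z \<in> carrier C.PM \<Longrightarrow>
        \<delta> z (tensor_elt A.PM B.PM x y) = \<gamma> x (tensor_elt B.PM C.PM y z)"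
    by metis
  have "qlin C.PM W (\<lambda>z. \<delta> z p)" if p: "p \<in> carrier ?AB" for p
  proof (rule qlinI[OF qC W])
    fix z z' assume z: "z \<in> carrier C.PM" "z' \<in> carrier C.PM"
    show "\<delta> (z \<oplus>\<^bsub>C.PM\<^esub> z') p = \<delta> z p \<oplus>\<^bsub>W\<^esub> \<delta> z' p"
    proof (rule tensor_qlin_eq[OF qA qB \<delta>(1) qlin_sum[OF \<delta>(1) \<delta>(1)] _ p])
      fix x y assume xy: "x \<in> carrier A.PM" "y \<in> carrier B.PM"
      then show "\<delta> (z \<oplus>\<^bsub>C.PM\<^esub> z') (tensor_elt A.PM B.PM x y) =
          \<delta> z (tensor_elt A.PM B.PM x y) \<oplus>\<^bsub>W\<^esub> \<delta> z' (tensor_elt A.PM B.PM x y)"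
        using z by (simp add: \<delta>(2) qvs_add[OF qC] qlin_add[OF qbilin_qlin2[OF te]]
            qlin_add[OF qbilin_qlin2[OF \<gamma>(1)]] qbilin_closed[OF te])
    qed (use z qvs_add[OF qC] in auto)
  next
    fix z c assume z: "z \<in> carrier C.PM"
    show "\<delta> (c \<odot>\<^bsub>C.PM\<^esub> z) p = c \<odot>\<^bsub>W\<^esub> \<delta> z p"
    proof (rule tensor_qlin_eq[OF qA qB \<delta>(1) qlin_scale[OF \<delta>(1)] _ p])
      fix x y assume xy: "x \<in> carrier A.PM" "y \<in> carrier B.PM"
      then show "\<delta> (c \<odot>\<^bsub>C.PM\<^esub> z) (tensor_elt A.PM B.PM x y) = c \<odot>\<^bsub>W\<^esub> \<delta> z (tensor_elt A.PM B.PM x y)"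
        using z by (simp add: \<delta>(2) qvs_smult[OF qC] qlin_smult[OF qbilin_qlin2[OF te]]
            qlin_smult[OF qbilin_qlin2[OF \<gamma>(1)]] qbilin_closed[OF te])
    qed (use z qvs_smult[OF qC] in auto)
  qed (rule qlin_closed[OF \<delta>(1) p])
  then have "qbilin ?AB C.PM W (\<lambda>p z. \<delta> z p)"
    using \<delta>(1) by (auto simp: qbilin_def)
  then obtain \<Phi> where "qlin (tensor_mod ?AB C.PM) W \<Phi>"
    "\<And>p z. p \<in> carrier ?AB \<Longrightarrow> z \<in> carrier C.PM \<Longrightarrow> \<Phi> (tensor_elt ?AB C.PM p z) = \<delta> z p"
    by (rule tensor_lift[OF tensor_qvs[OF qA qB] qC W]) auto
  then show thesis
    by (intro that[of \<Phi>]) (auto simp: A.gen_carrier B.gen_carrier C.gen_carrier \<delta>(2) \<gamma>(2) \<beta>'(2) \<beta>(2) \<chi>(2)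
        qbilin_closed[OF te] qbilin_closed[OF tensor_elt_bilin[OF qA qB]])
qed

section \<open>Lists of vectors and determinants\<close>

abbreviation Det :: "nat \<Rightarrow> 'a :: comm_ring_1 vec list \<Rightarrow> 'a" where
  "Det d vs \<equiv> det (mat_of_cols d vs)"

definition vlist :: "nat \<Rightarrow> 'a vec list \<Rightarrow> bool" where
  "vlist d vs \<longleftrightarrow> length vs = d \<and> set vs \<subseteq> carrier_vec d"

lemma vlist_carrier: "vlist d vs \<Longrightarrow> mat_of_cols d vs \<in> carrier_mat d d"
  by (auto simp: vlist_def)

lemma vlist_nth: "vlist d vs \<Longrightarrow> i < d \<Longrightarrow> vs ! i \<in> carrier_vec d"
  by (auto simp: vlist_def)

lemma vlist_update: "vlist d vs \<Longrightarrow> x \<in> carrier_vec d \<Longrightarrow> vlist d (vs[i := x])"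
  by (auto simp: vlist_def dest!: set_update_subset_insert[THEN subsetD])

lemma sprod: "x \<in> carrier_vec d \<Longrightarrow> y \<in> carrier_vec d \<Longrightarrow> x \<bullet> y = (\<Sum>k<d. x $ k * y $ k)"
  by (auto simp: scalar_prod_def intro!: sum.cong)

lemma Det_zero_iff:
  fixes vs :: "'a :: field vec list"
  assumes vs: "vlist d vs"
  shows "Det d vs = 0 \<longleftrightarrow> (\<exists>c. (\<exists>i<d. c i \<noteq> 0) \<and> (\<forall>k<d. (\<Sum>i<d. c i * vs ! i $ k) = 0))"
proof -
  let ?A = "mat_of_cols d vs"
  have A: "?A \<in> carrier_mat d d" using vlist_carrier[OF vs] .
  have mv: "(?A *\<^sub>v v) $ k = (\<Sum>i<d. v $ i * vs ! i $ k)" if "v \<in> carrier_vec d" "k < d" for v k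
    using that vs by (auto simp: scalar_prod_def vlist_def mat_of_cols_index mult.commute lessThan_atLeast0
        intro!: sum.cong)
  show ?thesis
  proof
    assume "Det d vs = 0"
    then obtain v where v: "v \<in> carrier_vec d" "v \<noteq> 0\<^sub>v d" "?A *\<^sub>v v = 0\<^sub>v d"
      using det_0_iff_vec_prod_zero_field[OF A] by auto
    then have "\<exists>i<d. v $ i \<noteq> 0" by (metis carrier_vecD eq_vecI index_zero_vec)
    moreover have "\<forall>k<d. (\<Sum>i<d. v $ i * vs ! i $ k) = 0"
      using mv[OF v(1)] v(3) by (metis index_zero_vec(1))
    ultimately show "\<exists>c. (\<exists>i<d. c i \<noteq> 0) \<and> (\<forall>k<d. (\<Sum>i<d. c i * vs ! i $ k) = 0)" by blast
  next
    assume "\<exists>c. (\<exists>i<d. c i \<noteq> 0) \<and> (\<forall>k<d. (\<Sum>i<d. c i * vs ! i $ k) = 0)"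
    then obtain c i where c: "i < d" "c i \<noteq> 0" "\<forall>k<d. (\<Sum>i<d. c i * vs ! i $ k) = 0" by blast
    have "vec d c \<noteq> 0\<^sub>v d" using c(1,2) by (metis index_vec index_zero_vec(1))
    moreover have "?A *\<^sub>v vec d c = 0\<^sub>v d"
      by (rule eq_vecI) (use mv[of "vec d c"] c(3) in auto)
    ultimately show "Det d vs = 0"
      using det_0_iff_vec_prod_zero_field[OF A] by (metis vec_carrier)
  qed
qed

text \<open>The vectors are the rows of a square matrix, filled up with zero rows; its determinant
  vanishes, so it has a nonzero kernel vector.\<close>

lemma orth_exists:
  fixes hs :: "'a :: field vec list"
  assumes "set hs \<subseteq> carrier_vec d" and "length hs < d \<or> length hs = d \<and> Det d hs = 0"
  shows "\<exists>h\<in>carrier_vec d. h \<noteq> 0\<^sub>v d \<and> (\<forall>g\<in>set hs. h \<bullet> g = 0)"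
proof -
  define A where "A = mat d d (\<lambda>(i, j). if i < length hs then hs ! i $ j else 0)"
  have A: "A \<in> carrier_mat d d" by (simp add: A_def)
  have "det A = 0"
  proof (cases "length hs < d")
    case True
    then show ?thesis
      by (subst laplace_expansion_row[OF A True]) (auto simp: A_def)
  next
    case False
    then have *: "length hs = d" "Det d hs = 0" using assms by auto
    have "A = transpose_mat (mat_of_cols d hs)"
      using * by (intro eq_matI) (auto simp: A_def mat_of_cols_index)
    then show ?thesis using det_transpose[of "mat_of_cols d hs" d] * by auto
  qed
  then obtain h where h: "h \<in> carrier_vec d" "h \<noteq> 0\<^sub>v d" "A *\<^sub>v h = 0\<^sub>v d"
    using det_0_iff_vec_prod_zero_field[OF A] by auto
  have "h \<bullet> g = 0" if "g \<in> set hs" for g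
  proof -
    obtain i where i: "i < length hs" "g = hs ! i" using \<open>g \<in> set hs\<close> by (metis in_set_conv_nth)
    then have id: "i < d" using assms(2) by auto
    have "hs ! i \<in> carrier_vec d" using i(1) assms(1) nth_mem by blast
    then have "row A i = g" using i id by (intro eq_vecI) (auto simp: A_def)
    then have "g \<bullet> h = 0" using h(3) id by (metis A carrier_matD(1) index_mult_mat_vec index_zero_vec(1))
    then show ?thesis using h(1) that assms(1) by (metis comm_scalar_prod subsetD)
  qed
  then show ?thesis using h by blast
qed

text \<open>The coefficients of a dependence form a vector orthogonal to the \<open>d\<close>
  coordinate rows, in a space of dimension \<open>length vs > d\<close>.\<close>

lemma long_list_dependent:
  fixes vs :: "'a :: field vec list"
  assumes vs: "set vs \<subseteq> carrier_vec d" and l: "d < length vs"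
  shows "\<exists>c. (\<exists>i<length vs. c i \<noteq> 0) \<and> (\<forall>k<d. (\<Sum>i<length vs. c i * vs ! i $ k) = 0)"
proof -
  let ?m = "length vs"
  let ?hs = "map (\<lambda>k. vec ?m (\<lambda>i. vs ! i $ k)) [0..<d]"
  have "\<exists>h\<in>carrier_vec ?m. h \<noteq> 0\<^sub>v ?m \<and> (\<forall>g\<in>set ?hs. h \<bullet> g = 0)"
    by (rule orth_exists) (use l in auto)
  then obtain h where h: "h \<in> carrier_vec ?m" "h \<noteq> 0\<^sub>v ?m" "\<forall>g\<in>set ?hs. h \<bullet> g = 0" by blast
  have "\<exists>i<?m. h $ i \<noteq> 0" using h by (metis carrier_vecD eq_vecI index_zero_vec)
  moreover have "(\<Sum>i<?m. h $ i * vs ! i $ k) = 0" if "k < d" for k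
  proof -
    have "h \<bullet> vec ?m (\<lambda>i. vs ! i $ k) = 0" using h(3) that by auto
    then show ?thesis using sprod[OF h(1), of "vec ?m (\<lambda>i. vs ! i $ k)"] by simp
  qed
  ultimately show ?thesis by blast
qed

text \<open>Duality under the standard scalar product. That both lists are bases is a consequence
  (\<open>dual_lists_Det\<close>) and therefore not part of the definition.\<close>

definition dual_lists :: "nat \<Rightarrow> 'a :: field vec list \<Rightarrow> 'a vec list \<Rightarrow> bool" where
  "dual_lists d us vs \<longleftrightarrow> vlist d us \<and> vlist d vs \<and>
    (\<forall>i<d. \<forall>j<d. us ! i \<bullet> vs ! j = (if i = j then 1 else 0))"

lemma dual_lists_mult:
  assumes "vlist d us" "vlist d vs"
  shows "dual_lists d us vs \<longleftrightarrow> mat_of_rows d us * mat_of_cols d vs = 1\<^sub>m d"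
proof -
  have e: "(mat_of_rows d us * mat_of_cols d vs) $$ (i, j) = us ! i \<bullet> vs ! j" if "i < d" "j < d" for i j
    using that assms by (simp add: vlist_def subset_iff)
  show ?thesis
  proof
    assume "dual_lists d us vs"
    then show "mat_of_rows d us * mat_of_cols d vs = 1\<^sub>m d"
      using e assms by (intro eq_matI) (auto simp: dual_lists_def vlist_def)
  next
    assume "mat_of_rows d us * mat_of_cols d vs = 1\<^sub>m d"
    then show "dual_lists d us vs" using e assms unfolding dual_lists_def by (metis index_one_mat(1))
  qed
qed

lemma dual_lists_exists:
  fixes vs :: "'a :: field vec list"
  assumes vs: "vlist d vs" and "Det d vs \<noteq> 0"
  shows "\<exists>us. dual_lists d us vs"
proof -
  let ?A = "mat_of_cols d vs"
  have A: "?A \<in> carrier_mat d d" using vlist_carrier[OF vs] .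
  obtain B where B: "B \<in> carrier_mat d d" "B * ?A = 1\<^sub>m d"
    using det_non_zero_imp_unit[OF A assms(2)] by (auto simp: Units_def ring_mat_def)
  have us: "vlist d (rows B)" using B by (auto simp: vlist_def rows_def)
  have "mat_of_rows d (rows B) = B" using B by (metis carrier_matD(2) mat_of_rows_rows)
  then show ?thesis using dual_lists_mult[OF us vs] B by auto
qed

lemma dual_lists_Det:
  assumes "dual_lists d us vs"
  shows "Det d us * Det d vs = 1"
proof -
  have *: "vlist d us" "vlist d vs" using assms by (auto simp: dual_lists_def)
  have r: "mat_of_rows d us \<in> carrier_mat d d" using *(1) by (auto simp: vlist_def)
  have "det (mat_of_rows d us * mat_of_cols d vs) = 1"
    using dual_lists_mult[OF *] assms by simp
  then have "det (mat_of_rows d us) * Det d vs = 1" using det_mult[OF r vlist_carrier[OF *(2)]] by simp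
  moreover have "det (mat_of_rows d us) = Det d us"
    using det_transpose[OF r] by (simp add: transpose_mat_of_rows)
  ultimately show ?thesis by simp
qed

text \<open>A left inverse of a square matrix is also a right inverse.\<close>

lemma dual_lists_expand:
  assumes d: "dual_lists d us vs" and x: "x \<in> carrier_vec d" and k: "k < d"
  shows "x $ k = (\<Sum>i<d. (us ! i \<bullet> x) * vs ! i $ k)"
proof -
  have *: "vlist d us" "vlist d vs" using d by (auto simp: dual_lists_def)
  let ?U = "mat_of_rows d us" and ?V = "mat_of_cols d vs"
  have U: "?U \<in> carrier_mat d d" and V: "?V \<in> carrier_mat d d" using * by (auto simp: vlist_def)
  have "?U * ?V = 1\<^sub>m d" using dual_lists_mult[OF *] d by simp
  then have "?V * ?U = 1\<^sub>m d" by (rule mat_mult_left_right_inverse[OF U V])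
  then have "x = ?V *\<^sub>v (?U *\<^sub>v x)" using assoc_mult_mat_vec[OF V U x] x by simp
  also have "\<dots> $ k = (\<Sum>i<d. (us ! i \<bullet> x) * vs ! i $ k)"
    using * k x by (auto simp: scalar_prod_def[of "row ?V k"] vlist_def mat_of_cols_index subset_iff mult.commute lessThan_atLeast0
        intro!: sum.cong)
  finally show ?thesis .
qed

lemma dual_lists_coord:
  assumes d: "dual_lists d us vs" and x: "x \<in> carrier_vec d" and i: "i < d"
    and e: "\<And>k. k < d \<Longrightarrow> x $ k = (\<Sum>i<d. e i * vs ! i $ k)"
  shows "us ! i \<bullet> x = e i"
proof -
  have *: "us ! i \<in> carrier_vec d" "\<And>j. j < d \<Longrightarrow> vs ! j \<in> carrier_vec d"
    using d i by (auto simp: dual_lists_def vlist_nth)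
  have "us ! i \<bullet> x = (\<Sum>k<d. us ! i $ k * (\<Sum>j<d. e j * vs ! j $ k))"
    using e by (simp add: sprod[OF *(1) x])
  also have "\<dots> = (\<Sum>j<d. e j * (us ! i \<bullet> vs ! j))"
    unfolding sum_distrib_left by (subst sum.swap)
      (auto simp: sprod[OF *(1) *(2)] sum_distrib_left mult.left_commute intro!: sum.cong)
  also have "\<dots> = (\<Sum>j<d. if i = j then e j else 0)"
    using d i by (intro sum.cong) (auto simp: dual_lists_def)
  finally show ?thesis using i by simp
qed

lemma dual_lists_unique:
  assumes "dual_lists d us vs" "dual_lists d us' vs" shows "us = us'"
proof (rule nth_equalityI)
  show "length us = length us'" using assms by (auto simp: dual_lists_def vlist_def)
  fix i assume "i < length us"
  then have i: "i < d" using assms by (auto simp: dual_lists_def vlist_def)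
  show "us ! i = us' ! i"
  proof (rule eq_vecI)
    have c: "us ! i \<in> carrier_vec d" "us' ! i \<in> carrier_vec d"
      using assms i by (auto simp: dual_lists_def vlist_nth)
    then show "dim_vec (us ! i) = dim_vec (us' ! i)" by auto
    fix k assume "k < dim_vec (us' ! i)"
    then have k: "k < d" using c by auto
    have "us ! i \<bullet> unit_vec d k = us' ! i \<bullet> unit_vec d k"
      by (rule dual_lists_coord[OF assms(1) _ i dual_lists_expand[OF assms(2)]]) auto
    then show "us ! i $ k = us' ! i $ k" using c k by simp
  qed
qed

lemma dual_lists_zero:
  assumes d: "dual_lists d us vs" and x: "x \<in> carrier_vec d" and "\<And>i. i < d \<Longrightarrow> us ! i \<bullet> x = 0"
  shows "x = 0\<^sub>v d"
  by (rule eq_vecI) (use x dual_lists_expand[OF d x] assms(3) in auto)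

lemma Det_swap:
  assumes vs: "vlist d vs" and ij: "i < d" "j < d" "i \<noteq> j"
  shows "Det d (vs[i := vs ! j, j := vs ! i]) = - Det d vs"
proof -
  have "mat_of_cols d (vs[i := vs ! j, j := vs ! i]) = swapcols i j (mat_of_cols d vs)"
    using vs ij by (intro eq_matI) (auto simp: vlist_def mat_of_cols_index nth_list_update)
  then show ?thesis using det_swapcols[OF ij vlist_carrier[OF vs]] by simp
qed

lemma Det_scale:
  assumes vs: "vlist d vs" and i: "i < d"
  shows "Det d (vs[i := c \<cdot>\<^sub>v vs ! i]) = c * Det d vs"
proof -
  have *: "vs ! i \<in> carrier_vec d" using vlist_nth[OF vs i] .
  let ?B = "transpose_mat (mat_of_cols d vs)"
  have B: "?B \<in> carrier_mat d d" using vlist_carrier[OF vs] by simp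
  have "mat_of_cols d (vs[i := c \<cdot>\<^sub>v vs ! i]) = transpose_mat (multrow i c ?B)"
    using vs i * by (intro eq_matI) (auto simp: vlist_def mat_of_cols_index nth_list_update)
  then show ?thesis
    using det_multrow[OF i B, of c] det_transpose[OF vlist_carrier[OF vs]] det_transpose[of "multrow i c ?B" d] B
    by simp
qed

section \<open>Deleting one of \<open>d + 1\<close> vectors, and the relation given by the maximal
  minors\<close>

definition omit :: "nat \<Rightarrow> 'a list \<Rightarrow> 'a list" where
  "omit i vs = take i vs @ drop (Suc i) vs"

lemma length_omit: "i < length vs \<Longrightarrow> length (omit i vs) = length vs - 1"
  by (auto simp: omit_def)

lemma nth_omit: "i < length vs \<Longrightarrow> j < length vs - 1 \<Longrightarrow> omit i vs ! j = vs ! (if j < i then j else Suc j)"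
  by (auto simp: omit_def nth_append)

lemma set_omit: "set (omit i vs) \<subseteq> set vs"
  by (auto simp: omit_def dest: in_set_takeD in_set_dropD)

text \<open>Reindexing between the \<open>d\<close> positions after deletion of entry
  \<open>k\<close> and the original positions other than \<open>k\<close>; \<open>prod_omit\<close>
  and \<open>all_omit\<close> do the same for products and for quantifiers.\<close>

lemma sum_omit:
  assumes "k \<le> d"
  shows "(\<Sum>p<d. f (if p < k then p else Suc p)) = (\<Sum>j\<in>{..d} - {k}. f j)"
  by (rule sum.reindex_bij_witness[of _ "\<lambda>j. if j < k then j else j - 1" "\<lambda>p. if p < k then p else Suc p"])
    (use assms in auto)

lemma prod_omit:
  assumes "k \<le> d"
  shows "(\<Prod>p<d. f (if p < k then p else Suc p)) = (\<Prod>j\<in>{..d} - {k}. f j)"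
  by (rule prod.reindex_bij_witness[of _ "\<lambda>j. if j < k then j else j - 1" "\<lambda>p. if p < k then p else Suc p"])
    (use assms in auto)

lemma all_omit:
  assumes "k \<le> d"
  shows "(\<forall>p<d. P (if p < k then p else Suc p)) \<longleftrightarrow> (\<forall>j\<le>d. j \<noteq> k \<longrightarrow> P j)"
proof
  assume a: "\<forall>p<d. P (if p < k then p else Suc p)"
  show "\<forall>j\<le>d. j \<noteq> k \<longrightarrow> P j"
  proof (intro allI impI)
    fix j assume j: "j \<le> d" "j \<noteq> k"
    show "P j"
    proof (cases "j < k")
      case True then show ?thesis using a[rule_format, of j] assms by auto
    next
      case False
      then have "\<not> j - 1 < k" "Suc (j - 1) = j" "j - 1 < d" using j by auto
      then show ?thesis using a[rule_format, of "j - 1"] by simp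
    qed
  qed
qed (use assms in auto)

lemma vlist_omit: "length vs = Suc d \<Longrightarrow> set vs \<subseteq> carrier_vec d \<Longrightarrow> i \<le> d \<Longrightarrow> vlist d (omit i vs)"
  using length_omit[of i vs] set_omit[of i vs] by (auto simp: vlist_def)

text \<open>Expand along the last row a square matrix in which row \<open>k\<close> occurs twice.\<close>
lemma Det_omit_relation:
  fixes vs :: "'a :: comm_ring_1 vec list"
  assumes l: "length vs = Suc d" and vs: "set vs \<subseteq> carrier_vec d" and k: "k < d"
  shows "(\<Sum>i\<le>d. (-1) ^ i * Det d (omit i vs) * vs ! i $ k) = 0"
proof -
  define A where "A = mat (Suc d) (Suc d) (\<lambda>(r, i). vs ! i $ (if r = d then k else r))"
  have A: "A \<in> carrier_mat (Suc d) (Suc d)" by (simp add: A_def)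
  have "row A k = row A d" using k by (intro eq_vecI) (auto simp: A_def)
  then have "det A = 0" using k by (intro det_identical_rows[OF A, of k d]) auto
  moreover have "det A = (\<Sum>i<Suc d. A $$ (d, i) * cofactor A d i)"
    by (rule laplace_expansion_row[OF A]) simp
  moreover have "A $$ (d, i) * cofactor A d i = (-1) ^ d * ((-1) ^ i * Det d (omit i vs) * vs ! i $ k)" if "i < Suc d" for i
  proof -
    have "mat_delete A d i = mat_of_cols d (omit i vs)"
      using that l by (intro eq_matI) (auto simp: A_def mat_delete_def mat_of_cols_index length_omit nth_omit)
    then show ?thesis using that by (simp add: A_def cofactor_def power_add mult_ac)
  qed
  ultimately have "0 = (\<Sum>i<Suc d. (-1) ^ d * ((-1) ^ i * Det d (omit i vs) * vs ! i $ k))" by simp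
  also have "\<dots> = (-1) ^ d * (\<Sum>i\<le>d. (-1) ^ i * Det d (omit i vs) * vs ! i $ k)"
    by (simp add: sum_distrib_left lessThan_Suc_atMost)
  finally have "(-1) ^ d * ((-1) ^ d * (\<Sum>i\<le>d. (-1) ^ i * Det d (omit i vs) * vs ! i $ k)) = 0" by simp
  then show ?thesis by simp
qed

text \<open>A repeated vector lowers the rank; for distinct vectors dependence is a nonzero kernel
  vector of the matrix.\<close>

lemma lin_dep_list_iff:
  assumes vs: "vlist d vs"
  shows "lin_dep_list d vs \<longleftrightarrow> Det d vs = 0"
proof -
  interpret vec_space "TYPE(rat)" d .
  let ?A = "mat_of_cols d vs"
  have A: "?A \<in> carrier_mat d d" using vlist_carrier[OF vs] .
  have c: "cols ?A = vs" using vs by (simp add: vlist_def)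
  show ?thesis
  proof (cases "distinct vs")
    case False
    then show ?thesis using non_distinct_low_rank[OF A] det_rank_iff[OF A] c
      by (auto simp: lin_dep_list_def)
  next
    case True
    have "lin_dep (set vs) \<longleftrightarrow> Det d vs = 0"
      using lin_depE[OF A] lin_depI[OF A] True c det_0_iff_vec_prod_zero_field[OF A] by metis
    then show ?thesis using True by (simp add: lin_dep_list_def)
  qed
qed

lemma ordered_basis_iff: "ordered_basis d vs \<longleftrightarrow> vlist d vs \<and> Det d vs \<noteq> 0"
proof -
  interpret vec_space "TYPE(rat)" d .
  show ?thesis
  proof
    assume b: "ordered_basis d vs"
    then have *: "distinct vs" "basis (set vs)" by (auto simp: ordered_basis_def)
    then have v: "vlist d vs"
      using dim_basis[of "set vs"] dim_is_n by (auto simp: vlist_def basis_def distinct_card)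
    then show "vlist d vs \<and> Det d vs \<noteq> 0"
      using lin_dep_list_iff[OF v] * by (auto simp: lin_dep_list_def basis_def)
  next
    assume v: "vlist d vs \<and> Det d vs \<noteq> 0"
    then have *: "distinct vs" "lin_indpt (set vs)"
      using lin_dep_list_iff[of d vs] by (auto simp: lin_dep_list_def)
    have "basis (set vs)"
      by (rule dim_li_is_basis) (use v * dim_is_n in \<open>auto simp: vlist_def distinct_card\<close>)
    then show "ordered_basis d vs" using * by (simp add: ordered_basis_def)
  qed
qed

lemma dual_bases_iff: "dual_bases d us ws \<longleftrightarrow> dual_lists d us ws"
proof
  assume d: "dual_lists d us ws"
  then have "Det d us \<noteq> 0" "Det d ws \<noteq> 0" using dual_lists_Det[OF d] by auto
  then show "dual_bases d us ws" using d by (auto simp: dual_bases_def dual_lists_def ordered_basis_iff)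
qed (auto simp: dual_bases_def dual_lists_def ordered_basis_iff)

section \<open>Rational cones\<close>

abbreviation rvec :: "rat vec \<Rightarrow> real vec" where
  "rvec \<equiv> map_vec real_of_rat"

lemma cone_gen_list_iff:
  assumes gs: "set gs \<subseteq> carrier_vec d"
  shows "x \<in> cone_gen d gs \<longleftrightarrow> x \<in> carrier_vec d \<and>
    (\<exists>c. (\<forall>i<length gs. 0 \<le> c i) \<and> (\<forall>k<d. x $ k = (\<Sum>i<length gs. c i * real_of_rat (gs ! i $ k))))"
proof -
  let ?A = "mat_of_cols d (map rvec gs)"
  have mv: "(?A *\<^sub>v c) $ k = (\<Sum>i<length gs. c $ i * real_of_rat (gs ! i $ k))"
    if c: "c \<in> carrier_vec (length gs)" and k: "k < d" for c k
  proof -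
    have "dim_vec (gs ! i) = d" if "i < length gs" for i using gs that nth_mem by fastforce
    then show ?thesis using c k
      by (auto simp: scalar_prod_def mat_of_cols_index mult.commute lessThan_atLeast0 simp del: mat_of_cols_map intro!: sum.cong)
  qed
  show ?thesis
  proof
    assume "x \<in> cone_gen d gs"
    then obtain c where c: "c \<in> carrier_vec (length gs)" "\<forall>i<length gs. 0 \<le> c $ i" "x = ?A *\<^sub>v c"
      by (auto simp: cone_gen_def)
    then show "x \<in> carrier_vec d \<and> (\<exists>c. (\<forall>i<length gs. 0 \<le> c i) \<and>
        (\<forall>k<d. x $ k = (\<Sum>i<length gs. c i * real_of_rat (gs ! i $ k))))"
      using mv[OF c(1)] by (auto simp del: mat_of_cols_map intro!: exI[of _ "($) c"] carrier_vecI)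
  next
    assume "x \<in> carrier_vec d \<and> (\<exists>c. (\<forall>i<length gs. 0 \<le> c i) \<and>
        (\<forall>k<d. x $ k = (\<Sum>i<length gs. c i * real_of_rat (gs ! i $ k))))"
    then obtain c where c: "x \<in> carrier_vec d" "\<forall>i<length gs. 0 \<le> c i"
        "\<forall>k<d. x $ k = (\<Sum>i<length gs. c i * real_of_rat (gs ! i $ k))" by blast
    have "x = ?A *\<^sub>v vec (length gs) c"
      using c(1,3) mv[of "vec (length gs) c"] by (intro eq_vecI) (auto simp del: mat_of_cols_map)
    then show "x \<in> cone_gen d gs" using c(2) unfolding cone_gen_def
      by (intro CollectI exI[of _ "vec (length gs) c"]) auto
  qed
qed

text \<open>Passage from lists to sets of generators: coefficients of a repeated generator are added
  up, and conversely each coefficient is placed at one chosen position of its generator.\<close>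

lemma cone_gen_iff:
  assumes gs: "set gs \<subseteq> carrier_vec d"
  shows "x \<in> cone_gen d gs \<longleftrightarrow> x \<in> carrier_vec d \<and>
    (\<exists>c. (\<forall>g\<in>set gs. 0 \<le> c g) \<and> (\<forall>k<d. x $ k = (\<Sum>g\<in>set gs. c g * real_of_rat (g $ k))))"
proof -
  have "(\<exists>c. (\<forall>i<length gs. 0 \<le> c i) \<and> (\<forall>k<d. x $ k = (\<Sum>i<length gs. c i * real_of_rat (gs ! i $ k))))
    \<longleftrightarrow> (\<exists>c. (\<forall>g\<in>set gs. 0 \<le> c g) \<and> (\<forall>k<d. x $ k = (\<Sum>g\<in>set gs. c g * real_of_rat (g $ k))))"
    (is "?l \<longleftrightarrow> ?r")
  proof
    assume ?l
    then obtain c where c: "\<And>i. i < length gs \<Longrightarrow> 0 \<le> c i"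
        "\<And>k. k < d \<Longrightarrow> x $ k = (\<Sum>i<length gs. c i * real_of_rat (gs ! i $ k))" by blast
    define c' where "c' g = (\<Sum>i\<in>{i\<in>{..<length gs}. gs ! i = g}. c i)" for g
    have im: "set gs = (\<lambda>i. gs ! i) ` {..<length gs}" by (auto simp: set_conv_nth)
    have "x $ k = (\<Sum>g\<in>set gs. c' g * real_of_rat (g $ k))" if "k < d" for k
    proof -
      have "x $ k = (\<Sum>g\<in>set gs. \<Sum>i\<in>{i\<in>{..<length gs}. gs ! i = g}. c i * real_of_rat (gs ! i $ k))"
        unfolding c(2)[OF that] by (rule sum.group[symmetric]) auto
      also have "\<dots> = (\<Sum>g\<in>set gs. c' g * real_of_rat (g $ k))"
        by (auto simp: c'_def sum_distrib_right intro!: sum.cong)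
      finally show ?thesis .
    qed
    moreover have "0 \<le> c' g" for g using c(1) by (auto simp: c'_def intro!: sum_nonneg)
    ultimately show ?r by blast
  next
    assume ?r
    then obtain c where c: "\<And>g. g \<in> set gs \<Longrightarrow> 0 \<le> c g"
        "\<And>k. k < d \<Longrightarrow> x $ k = (\<Sum>g\<in>set gs. c g * real_of_rat (g $ k))" by blast
    define pos where "pos g = (SOME i. i < length gs \<and> gs ! i = g)" for g
    have pos: "pos g < length gs \<and> gs ! pos g = g" if "g \<in> set gs" for g
      unfolding pos_def by (rule someI_ex) (use that in \<open>auto simp: in_set_conv_nth\<close>)
    define c' where "c' i = (if pos (gs ! i) = i then c (gs ! i) else 0)" for i
    have "x $ k = (\<Sum>i<length gs. c' i * real_of_rat (gs ! i $ k))" if "k < d" for k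
    proof -
      have "(\<Sum>i<length gs. c' i * real_of_rat (gs ! i $ k)) =
          (\<Sum>i\<in>pos ` set gs. c' i * real_of_rat (gs ! i $ k))"
      proof (rule sum.mono_neutral_right)
        show "\<forall>i\<in>{..<length gs} - pos ` set gs. c' i * real_of_rat (gs ! i $ k) = 0"
          by (auto simp: c'_def) (metis imageI nth_mem)
      qed (use pos in auto)
      also have "\<dots> = (\<Sum>g\<in>set gs. c' (pos g) * real_of_rat (gs ! pos g $ k))"
        by (rule sum.reindex_cong[OF _ refl refl]) (metis inj_onI pos)
      also have "\<dots> = x $ k"
        unfolding c(2)[OF that] using pos by (auto simp: c'_def intro!: sum.cong)
      finally show ?thesis by simp
    qed
    moreover have "0 \<le> c' i" if "i < length gs" for i using c(1) that by (auto simp: c'_def)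
    ultimately show ?l by blast
  qed
  then show ?thesis using cone_gen_list_iff[OF gs] by simp
qed

lemma cone_gen_carrier: "set gs \<subseteq> carrier_vec d \<Longrightarrow> cone_gen d gs \<subseteq> carrier_vec d"
  by (auto simp: cone_gen_iff)

lemma cone_gen_cong:
  "set gs \<subseteq> carrier_vec d \<Longrightarrow> set gs = set gs' \<Longrightarrow> cone_gen d gs = cone_gen d gs'"
  by (intro equalityI subsetI) (simp_all add: cone_gen_iff)

lemma cone_gen_zero: "set gs \<subseteq> carrier_vec d \<Longrightarrow> 0\<^sub>v d \<in> cone_gen d gs"
  by (subst cone_gen_iff) (auto intro!: exI[of _ "\<lambda>_. 0"])

lemma cone_gen_add:
  assumes gs: "set gs \<subseteq> carrier_vec d" and x: "x \<in> cone_gen d gs" and y: "y \<in> cone_gen d gs"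
  shows "x + y \<in> cone_gen d gs"
proof -
  obtain a b where a: "x \<in> carrier_vec d" "\<forall>g\<in>set gs. 0 \<le> a g" "\<forall>k<d. x $ k = (\<Sum>g\<in>set gs. a g * real_of_rat (g $ k))"
    and b: "y \<in> carrier_vec d" "\<forall>g\<in>set gs. 0 \<le> b g" "\<forall>k<d. y $ k = (\<Sum>g\<in>set gs. b g * real_of_rat (g $ k))"
    using x y unfolding cone_gen_iff[OF gs] by blast
  show ?thesis unfolding cone_gen_iff[OF gs]
    by (intro conjI exI[of _ "\<lambda>g. a g + b g"]) (use a b in \<open>auto simp: sum.distrib algebra_simps\<close>)
qed

lemma cone_gen_smult:
  assumes gs: "set gs \<subseteq> carrier_vec d" and x: "x \<in> cone_gen d gs" and t: "0 \<le> t"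
  shows "t \<cdot>\<^sub>v x \<in> cone_gen d gs"
proof -
  obtain a where a: "x \<in> carrier_vec d" "\<forall>g\<in>set gs. 0 \<le> a g" "\<forall>k<d. x $ k = (\<Sum>g\<in>set gs. a g * real_of_rat (g $ k))"
    using x unfolding cone_gen_iff[OF gs] by blast
  show ?thesis unfolding cone_gen_iff[OF gs]
    by (intro conjI exI[of _ "\<lambda>g. t * a g"]) (use a t in \<open>auto simp: sum_distrib_left algebra_simps\<close>)
qed

lemma cone_gen_member:
  assumes gs: "set gs \<subseteq> carrier_vec d" and g: "g \<in> set gs"
  shows "rvec g \<in> cone_gen d gs"
proof -
  have "(\<Sum>h\<in>set gs. (if h = g then 1 else 0) * real_of_rat (h $ k)) = real_of_rat (g $ k)" for k
    using g by (subst sum.remove[of _ g]) (auto intro!: sum.neutral)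
  then show ?thesis unfolding cone_gen_iff[OF gs]
    by (intro conjI exI[of _ "\<lambda>h. if h = g then 1 else 0"]) (use g gs in auto)
qed

lemma cone_gen_sum:
  assumes gs: "set gs \<subseteq> carrier_vec d" and "finite A"
    and "\<And>a. a \<in> A \<Longrightarrow> y a \<in> cone_gen d gs" "\<And>a. a \<in> A \<Longrightarrow> 0 \<le> t a"
  shows "vec d (\<lambda>k. \<Sum>a\<in>A. t a * y a $ k) \<in> cone_gen d gs"
  using assms(2-)
proof (induction A rule: finite_induct)
  case empty
  then show ?case using cone_gen_zero[OF gs] by (simp add: zero_vec_def)
next
  case (insert a A)
  have y: "y a \<in> carrier_vec d" using insert cone_gen_carrier[OF gs] by auto
  have "vec d (\<lambda>k. \<Sum>a\<in>insert a A. t a * y a $ k) = t a \<cdot>\<^sub>v y a + vec d (\<lambda>k. \<Sum>a\<in>A. t a * y a $ k)"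
    using insert(1,2) y by (intro eq_vecI) auto
  then show ?case using insert by (auto intro!: cone_gen_add[OF gs] cone_gen_smult[OF gs])
qed

lemma cone_gen_least:
  assumes gs: "set gs \<subseteq> carrier_vec d" and hs: "set hs \<subseteq> carrier_vec d"
    and "\<And>g. g \<in> set gs \<Longrightarrow> rvec g \<in> cone_gen d hs"
  shows "cone_gen d gs \<subseteq> cone_gen d hs"
proof
  fix x assume "x \<in> cone_gen d gs"
  then obtain a where a: "x \<in> carrier_vec d" "\<forall>g\<in>set gs. 0 \<le> a g" "\<forall>k<d. x $ k = (\<Sum>g\<in>set gs. a g * real_of_rat (g $ k))"
    unfolding cone_gen_iff[OF gs] by blast
  have gk: "rvec g $ k = real_of_rat (g $ k)" if "g \<in> set gs" "k < d" for g k using gs that by auto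
  have "x = vec d (\<lambda>k. \<Sum>g\<in>set gs. a g * rvec g $ k)"
    by (rule eq_vecI) (use a gk in \<open>auto intro!: sum.cong\<close>)
  also have "\<dots> \<in> cone_gen d hs"
    by (rule cone_gen_sum[OF hs]) (use assms(3) a(2) in auto)
  finally show "x \<in> cone_gen d hs" .
qed

lemma cone_gen_mono:
  "set gs \<subseteq> set hs \<Longrightarrow> set hs \<subseteq> carrier_vec d \<Longrightarrow> cone_gen d gs \<subseteq> cone_gen d hs"
  by (rule cone_gen_least) (auto intro: cone_gen_member)

lemma cone_gen_smult_iff:
  assumes gs: "set gs \<subseteq> carrier_vec d" and t: "0 < t" and x: "x \<in> carrier_vec d"
  shows "t \<cdot>\<^sub>v x \<in> cone_gen d gs \<longleftrightarrow> x \<in> cone_gen d gs"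
proof
  assume "t \<cdot>\<^sub>v x \<in> cone_gen d gs"
  then have "(1 / t) \<cdot>\<^sub>v (t \<cdot>\<^sub>v x) \<in> cone_gen d gs" by (rule cone_gen_smult[OF gs]) (use t in auto)
  moreover have "(1 / t) \<cdot>\<^sub>v (t \<cdot>\<^sub>v x) = x" using t by (intro eq_vecI) auto
  ultimately show "x \<in> cone_gen d gs" by simp
qed (use t in \<open>auto intro: cone_gen_smult[OF gs]\<close>)

text \<open>Rational forms applied to a combination with real coefficients. Cones are real while
  their generators, the test forms and the relevant points are rational, so this identity is the
  bridge between the two.\<close>

lemma combination_sprod:
  assumes h: "h \<in> carrier_vec d" and x: "x \<in> carrier_vec d" and v: "\<And>i. i \<in> A \<Longrightarrow> v i \<in> carrier_vec d"
    and c: "\<And>k. k < d \<Longrightarrow> rvec x $ k = (\<Sum>i\<in>A. c i * real_of_rat (v i $ k))"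
  shows "real_of_rat (h \<bullet> x) = (\<Sum>i\<in>A. c i * real_of_rat (h \<bullet> v i))"
proof -
  have "real_of_rat (h \<bullet> x) = (\<Sum>k<d. real_of_rat (h $ k) * rvec x $ k)"
    using x by (simp add: sprod[OF h x] of_rat_sum of_rat_mult)
  also have "\<dots> = (\<Sum>i\<in>A. c i * (\<Sum>k<d. real_of_rat (h $ k * v i $ k)))"
    unfolding sum_distrib_left by (subst sum.swap) (auto simp: c sum_distrib_left of_rat_mult mult_ac intro!: sum.cong)
  also have "\<dots> = (\<Sum>i\<in>A. c i * real_of_rat (h \<bullet> v i))"
    using v by (intro sum.cong) (auto simp: sprod[OF h] of_rat_sum)
  finally show ?thesis .
qed

lemma simplicial_cone_coord:
  assumes d: "dual_lists d us vs" and x: "x \<in> carrier_vec d" and j: "j < d"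
    and c: "\<And>k. k < d \<Longrightarrow> rvec x $ k = (\<Sum>i<d. c i * real_of_rat (vs ! i $ k))"
  shows "real_of_rat (us ! j \<bullet> x) = c j"
proof -
  have u: "us ! j \<in> carrier_vec d" and v: "\<And>i. i < d \<Longrightarrow> vs ! i \<in> carrier_vec d"
    using d j by (auto simp: dual_lists_def vlist_nth)
  have "real_of_rat (us ! j \<bullet> x) = (\<Sum>i<d. c i * real_of_rat (us ! j \<bullet> vs ! i))"
    by (rule combination_sprod[OF u x, where v = "(!) vs"]) (use v c in auto)
  also have "\<dots> = (\<Sum>i<d. if j = i then c i else 0)"
    using d j by (intro sum.cong) (auto simp: dual_lists_def)
  finally show ?thesis using j by simp
qed

text \<open>The coefficients with respect to a basis are unique and equal to the dual coordinates;
  for a rational point they are therefore rational.\<close>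

lemma simplicial_cone_iff:
  assumes d: "dual_lists d us vs" and x: "x \<in> carrier_vec d"
  shows "rvec x \<in> cone_gen d vs \<longleftrightarrow> (\<forall>j<d. 0 \<le> us ! j \<bullet> x)"
proof -
  have vs: "set vs \<subseteq> carrier_vec d" "length vs = d" using d by (auto simp: dual_lists_def vlist_def)
  show ?thesis
  proof
    assume "rvec x \<in> cone_gen d vs"
    then obtain c where "\<forall>i<d. 0 \<le> c i" "\<forall>k<d. rvec x $ k = (\<Sum>i<d. c i * real_of_rat (vs ! i $ k))"
      unfolding cone_gen_list_iff[OF vs(1)] vs(2) by blast
    then show "\<forall>j<d. 0 \<le> us ! j \<bullet> x" using simplicial_cone_coord[OF d x] by (metis zero_le_of_rat_iff)
  next
    assume "\<forall>j<d. 0 \<le> us ! j \<bullet> x"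
    then show "rvec x \<in> cone_gen d vs"
      unfolding cone_gen_list_iff[OF vs(1)] vs(2) using x
      by (intro conjI exI[of _ "\<lambda>j. real_of_rat (us ! j \<bullet> x)"])
        (auto simp: dual_lists_expand[OF d x] of_rat_sum of_rat_mult)
  qed
qed

text \<open>The double description step: the section of a cone by a hyperplane is generated by the
  generators on the hyperplane and the crossing points of the segments joining its two sides.\<close>
lemma cone_gen_hyperplane:
  assumes gs: "set gs \<subseteq> carrier_vec d" and h: "h \<in> carrier_vec d"
  obtains hs where "set hs \<subseteq> carrier_vec d" "\<And>g. g \<in> set hs \<Longrightarrow> h \<bullet> g = 0"
    "\<And>x. x \<in> carrier_vec d \<Longrightarrow> rvec x \<in> cone_gen d hs \<longleftrightarrow> rvec x \<in> cone_gen d gs \<and> h \<bullet> x = 0"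
proof -
  let ?Z = "{g \<in> set gs. h \<bullet> g = 0}" and ?P = "{g \<in> set gs. h \<bullet> g > 0}" and ?N = "{g \<in> set gs. h \<bullet> g < 0}"
  define w where "w p q = (- (h \<bullet> q)) \<cdot>\<^sub>v p + (h \<bullet> p) \<cdot>\<^sub>v q" for p q
  obtain hs where hs: "set hs = ?Z \<union> (\<lambda>(p, q). w p q) ` (?P \<times> ?N)"
    using finite_list[of "?Z \<union> (\<lambda>(p, q). w p q) ` (?P \<times> ?N)"] by auto
  have hsc: "set hs \<subseteq> carrier_vec d" using gs by (auto simp: hs w_def intro!: add_carrier_vec)
  have h0: "h \<bullet> g = 0" if "g \<in> set hs" for g
    using that gs h unfolding hs
    by (auto simp: w_def scalar_prod_add_distrib[OF h] subset_iff)
  have wc: "rvec (w p q) \<in> cone_gen d gs" if "p \<in> ?P" "q \<in> ?N" for p q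
  proof -
    have c: "p \<in> carrier_vec d" "q \<in> carrier_vec d" using that gs by auto
    have "rvec (w p q) = real_of_rat (- (h \<bullet> q)) \<cdot>\<^sub>v rvec p + real_of_rat (h \<bullet> p) \<cdot>\<^sub>v rvec q"
      using c by (intro eq_vecI) (auto simp: w_def of_rat_add of_rat_mult of_rat_minus of_rat_diff)
    then show ?thesis
      using that by (auto intro!: cone_gen_add[OF gs] cone_gen_smult[OF gs] cone_gen_member[OF gs])
  qed
  have sub: "cone_gen d hs \<subseteq> cone_gen d gs"
    by (rule cone_gen_least[OF hsc gs]) (use wc cone_gen_member[OF gs] in \<open>auto simp: hs\<close>)
  show thesis
  proof (rule that[OF hsc h0])
    fix x :: "rat vec" assume x: "x \<in> carrier_vec d"
    show "rvec x \<in> cone_gen d hs \<longleftrightarrow> rvec x \<in> cone_gen d gs \<and> h \<bullet> x = 0"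
    proof
      assume xh: "rvec x \<in> cone_gen d hs"
      then obtain c where c: "\<And>k. k < d \<Longrightarrow> rvec x $ k = (\<Sum>g\<in>set hs. c g * real_of_rat (g $ k))"
        unfolding cone_gen_iff[OF hsc] by blast
      have "real_of_rat (h \<bullet> x) = (\<Sum>g\<in>set hs. c g * real_of_rat (h \<bullet> g))"
        by (rule combination_sprod[OF h x, where v = "\<lambda>g. g"]) (use hsc c in auto)
      also have "\<dots> = 0" using h0 by simp
      finally show "rvec x \<in> cone_gen d gs \<and> h \<bullet> x = 0" using xh sub by auto
    next
      assume "rvec x \<in> cone_gen d gs \<and> h \<bullet> x = 0"
      then have hx: "h \<bullet> x = 0" and "rvec x \<in> cone_gen d gs" by auto
      then obtain c where c: "\<And>g. g \<in> set gs \<Longrightarrow> 0 \<le> c g"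
          "\<And>k. k < d \<Longrightarrow> rvec x $ k = (\<Sum>g\<in>set gs. c g * real_of_rat (g $ k))"
        unfolding cone_gen_iff[OF gs] by blast
      let ?r = "\<lambda>g. real_of_rat (h \<bullet> g)"
      \<comment> \<open>As \<open>h \<bullet> x = 0\<close>, both sides of the hyperplane carry the
        same total weight \<open>S\<close>. If \<open>S = 0\<close>, nothing off the hyperplane
        contributes. Otherwise the weights \<open>c p * c q / S\<close> form a transport plan that
        writes the off-hyperplane part through the crossing points \<open>w p q\<close>.\<close>
      define S where "S = (\<Sum>p\<in>?P. c p * ?r p)"
      have split: "(\<Sum>g\<in>set gs. f g) = (\<Sum>g\<in>?Z. f g) + (\<Sum>p\<in>?P. f p) + (\<Sum>q\<in>?N. f q)" for f :: "rat vec \<Rightarrow> real"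
      proof -
        have "set gs = ?Z \<union> (?P \<union> ?N)" by auto
        then have "sum f (set gs) = sum f (?Z \<union> (?P \<union> ?N))" by simp
        also have "\<dots> = (\<Sum>g\<in>?Z. f g) + ((\<Sum>p\<in>?P. f p) + (\<Sum>q\<in>?N. f q))"
          by (subst sum.union_disjoint; (auto; fail)?; subst sum.union_disjoint; (auto; fail)?)
        finally show ?thesis by simp
      qed
      have "0 = real_of_rat (h \<bullet> x)" using hx by simp
      also have "\<dots> = (\<Sum>g\<in>set gs. c g * ?r g)" 
        by (rule combination_sprod[OF h x, where v = "\<lambda>g. g"]) (use gs c(2) in auto)
      also have "\<dots> = S + (\<Sum>q\<in>?N. c q * ?r q)" unfolding split S_def by simp
      finally have SN: "(\<Sum>q\<in>?N. c q * (- ?r q)) = S" by (simp add: sum_negf)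
      show "rvec x \<in> cone_gen d hs"
      proof (cases "S = 0")
        case True
        have "\<forall>p\<in>?P. c p * ?r p = 0"
          by (rule sum_nonneg_eq_0_iff[THEN iffD1]) (use True c(1) in \<open>auto simp: S_def\<close>)
        moreover have "\<forall>q\<in>?N. c q * (- ?r q) = 0"
          by (rule sum_nonneg_eq_0_iff[THEN iffD1])
            (use True SN c(1) in \<open>auto simp: mult_nonneg_nonpos\<close>)
        ultimately have cz: "\<And>p. p \<in> ?P \<Longrightarrow> c p = 0" "\<And>q. q \<in> ?N \<Longrightarrow> c q = 0" by auto
        have "rvec x = vec d (\<lambda>k. \<Sum>g\<in>?Z. c g * rvec g $ k)"
        proof (rule eq_vecI)
          fix k assume "k < dim_vec (vec d (\<lambda>k. \<Sum>g\<in>?Z. c g * rvec g $ k))"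
          then have k: "k < d" by simp
          then have "rvec x $ k = (\<Sum>g\<in>?Z. c g * real_of_rat (g $ k))"
            unfolding c(2)[OF k] split using cz by simp
          also have "\<dots> = (\<Sum>g\<in>?Z. c g * rvec g $ k)" using gs k by (intro sum.cong) (auto simp: subset_iff)
          finally show "rvec x $ k = vec d (\<lambda>k. \<Sum>g\<in>?Z. c g * rvec g $ k) $ k" using k by simp
        qed (use x in auto)
        also have "\<dots> \<in> cone_gen d hs"
          by (rule cone_gen_sum[OF hsc]) (use c(1) cone_gen_member[OF hsc] in \<open>auto simp: hs\<close>)
        finally show ?thesis .
      next
        case False
        then have S: "S > 0" using c(1) sum_nonneg[of ?P "\<lambda>p. c p * ?r p"] by (force simp: S_def less_le)
        have "rvec x = vec d (\<lambda>k. \<Sum>g\<in>?Z. c g * rvec g $ k)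
            + vec d (\<lambda>k. \<Sum>pq\<in>?P \<times> ?N. (c (fst pq) * c (snd pq) / S) * rvec (w (fst pq) (snd pq)) $ k)"
        proof (rule eq_vecI)
          fix k assume "k < dim_vec (vec d (\<lambda>k. \<Sum>g\<in>?Z. c g * rvec g $ k)
            + vec d (\<lambda>k. \<Sum>pq\<in>?P \<times> ?N. (c (fst pq) * c (snd pq) / S) * rvec (w (fst pq) (snd pq)) $ k))"
          then have k: "k < d" by simp
          have wk: "rvec (w p q) $ k = (- ?r q) * real_of_rat (p $ k) + ?r p * real_of_rat (q $ k)"
            if "p \<in> set gs" "q \<in> set gs" for p q
          proof -
            have "dim_vec p = d" "dim_vec q = d" using that gs by auto
            then show ?thesis using k by (simp add: w_def of_rat_add of_rat_mult of_rat_minus of_rat_diff)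
          qed
          have "(\<Sum>pq\<in>?P \<times> ?N. (c (fst pq) * c (snd pq) / S) * rvec (w (fst pq) (snd pq)) $ k)
            = (\<Sum>p\<in>?P. \<Sum>q\<in>?N. (c p * c q / S) * rvec (w p q) $ k)"
            by (subst sum.cartesian_product) (simp add: case_prod_beta)
          also have "\<dots> = (\<Sum>p\<in>?P. \<Sum>q\<in>?N. (c p * real_of_rat (p $ k) / S) * (c q * (- ?r q))
              + (c p * ?r p / S) * (c q * real_of_rat (q $ k)))"
            using S by (intro sum.cong refl) (auto simp: wk field_simps)
          also have "\<dots> = (\<Sum>p\<in>?P. (c p * real_of_rat (p $ k) / S) * S)
              + (\<Sum>p\<in>?P. c p * ?r p / S) * (\<Sum>q\<in>?N. c q * real_of_rat (q $ k))"
            by (simp only: sum.distrib sum_distrib_left[symmetric] sum_distrib_right[symmetric] SN)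
          also have "(\<Sum>p\<in>?P. c p * ?r p / S) = 1"
            using S by (simp add: S_def flip: sum_divide_distrib)
          finally have "(\<Sum>pq\<in>?P \<times> ?N. (c (fst pq) * c (snd pq) / S) * rvec (w (fst pq) (snd pq)) $ k)
              = (\<Sum>p\<in>?P. c p * real_of_rat (p $ k)) + (\<Sum>q\<in>?N. c q * real_of_rat (q $ k))" using S by simp
          moreover have "(\<Sum>g\<in>?Z. c g * rvec g $ k) = (\<Sum>g\<in>?Z. c g * real_of_rat (g $ k))"
            using gs k by (intro sum.cong) (auto simp: subset_iff)
          ultimately show "rvec x $ k = (vec d (\<lambda>k. \<Sum>g\<in>?Z. c g * rvec g $ k)
            + vec d (\<lambda>k. \<Sum>pq\<in>?P \<times> ?N. (c (fst pq) * c (snd pq) / S) * rvec (w (fst pq) (snd pq)) $ k)) $ k"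
            using k unfolding c(2)[OF k] split by simp
        qed (use x in auto)
        also have "\<dots> \<in> cone_gen d hs"
          by (intro cone_gen_add[OF hsc] cone_gen_sum[OF hsc])
            (use c(1) S in \<open>auto simp: hs intro!: cone_gen_member[OF hsc]\<close>)
        finally show ?thesis .
      qed
    qed
  qed
qed

section \<open>Generic points and a generic description of cones\<close>

text \<open>The working notion of genericity. The exceptional set is a finite union of linear
  hyperplanes, so generic properties are closed under finite conjunction, and what happens on the
  exceptional set is absorbed by distributions on lower-dimensional cones.\<close>

definition gen_all :: "nat \<Rightarrow> (rat vec \<Rightarrow> bool) \<Rightarrow> bool" where
  "gen_all d P \<longleftrightarrow> (\<exists>H. finite H \<and> H \<subseteq> carrier_vec d - {0\<^sub>v d} \<and>
    (\<forall>x\<in>carrier_vec d. (\<forall>h\<in>H. h \<bullet> x \<noteq> 0) \<longrightarrow> P x))"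

lemma gen_allI: "(\<And>x. x \<in> carrier_vec d \<Longrightarrow> P x) \<Longrightarrow> gen_all d P"
  unfolding gen_all_def by (intro exI[of _ "{}"]) auto

lemma gen_all_conj: "gen_all d P \<Longrightarrow> gen_all d Q \<Longrightarrow> gen_all d (\<lambda>x. P x \<and> Q x)"
  unfolding gen_all_def
proof (elim exE conjE, goal_cases)
  case (1 A B)
  then show ?case by (intro exI[of _ "A \<union> B"]) auto
qed

lemma gen_all_mono:
  "gen_all d P \<Longrightarrow> (\<And>x. x \<in> carrier_vec d \<Longrightarrow> P x \<Longrightarrow> Q x) \<Longrightarrow> gen_all d Q"
  unfolding gen_all_def by meson

lemma gen_all_ball:
  assumes "finite A" "\<And>a. a \<in> A \<Longrightarrow> gen_all d (P a)"
  shows "gen_all d (\<lambda>x. \<forall>a\<in>A. P a x)"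
  using assms by (induction A rule: finite_induct) (auto intro: gen_allI gen_all_conj)

lemma gen_all_lessThan:
  "(\<And>i. i < (n::nat) \<Longrightarrow> gen_all d (P i)) \<Longrightarrow> gen_all d (\<lambda>x. \<forall>i<n. P i x)"
  using gen_all_ball[of "{..<n}" d P] by (simp add: Ball_def)

lemma gen_all_neq: "h \<in> carrier_vec d \<Longrightarrow> h \<noteq> 0\<^sub>v d \<Longrightarrow> gen_all d (\<lambda>x. h \<bullet> x \<noteq> 0)"
  unfolding gen_all_def by (intro exI[of _ "{h}"]) auto

lemma dual_lists_nonzero: "dual_lists d us vs \<Longrightarrow> j < d \<Longrightarrow> us ! j \<noteq> 0\<^sub>v d"
  by (metis dual_lists_def scalar_prod_left_zero vlist_nth zero_neq_one)

lemma gen_all_dual: "dual_lists d us vs \<Longrightarrow> gen_all d (\<lambda>x. \<forall>j<d. us ! j \<bullet> x \<noteq> 0)"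
  by (intro gen_all_lessThan gen_all_neq) (auto simp: dual_lists_nonzero dual_lists_def vlist_nth)

text \<open>Caratheodory: a positive combination with inclusion-minimal support is supported on a basis,
  unless the point lies on one of the finitely many hyperplanes spanned by generators.\<close>
lemma cone_gen_caratheodory:
  assumes gs: "set gs \<subseteq> carrier_vec d"
  shows "gen_all d (\<lambda>x. rvec x \<in> cone_gen d gs \<longleftrightarrow>
    (\<exists>vs us. set vs \<subseteq> set gs \<and> dual_lists d us vs \<and> (\<forall>j<d. 0 < us ! j \<bullet> x)))"
proof -
  let ?D = "{S. S \<subseteq> set gs \<and> (\<exists>h\<in>carrier_vec d. h \<noteq> 0\<^sub>v d \<and> (\<forall>g\<in>S. h \<bullet> g = 0))}"
  have "\<forall>S\<in>?D. \<exists>h. h \<in> carrier_vec d \<and> h \<noteq> 0\<^sub>v d \<and> (\<forall>g\<in>S. h \<bullet> g = 0)" by blast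
  \<comment> \<open>One normal vector for every subset of generators lying in some hyperplane. These
    finitely many normals define the exceptional set.\<close>
  from bchoice[OF this] obtain nrm where nrm: "\<And>S. S \<in> ?D \<Longrightarrow> nrm S \<in> carrier_vec d \<and> nrm S \<noteq> 0\<^sub>v d \<and> (\<forall>g\<in>S. nrm S \<bullet> g = 0)"
    by blast
  have "gen_all d (\<lambda>x. \<forall>S\<in>?D. nrm S \<bullet> x \<noteq> 0)"
    by (rule gen_all_ball) (use nrm in \<open>auto intro: gen_all_neq\<close>)
  then show ?thesis
  proof (rule gen_all_mono)
    fix x assume x: "x \<in> carrier_vec d" and gx: "\<forall>S\<in>?D. nrm S \<bullet> x \<noteq> 0"
    show "rvec x \<in> cone_gen d gs \<longleftrightarrow>
      (\<exists>vs us. set vs \<subseteq> set gs \<and> dual_lists d us vs \<and> (\<forall>j<d. 0 < us ! j \<bullet> x))"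
    proof
      assume "\<exists>vs us. set vs \<subseteq> set gs \<and> dual_lists d us vs \<and> (\<forall>j<d. 0 < us ! j \<bullet> x)"
      then obtain vs us where *: "set vs \<subseteq> set gs" "dual_lists d us vs" "\<forall>j<d. 0 < us ! j \<bullet> x" by blast
      then have "rvec x \<in> cone_gen d vs" using simplicial_cone_iff[OF *(2) x] by (auto simp: less_imp_le)
      then show "rvec x \<in> cone_gen d gs" using cone_gen_mono[OF *(1) gs] by auto
    next
      assume "rvec x \<in> cone_gen d gs"
      define rep where "rep c \<longleftrightarrow> (\<forall>g\<in>set gs. (0::real) \<le> c g) \<and>
        (\<forall>k<d. rvec x $ k = (\<Sum>g\<in>set gs. c g * real_of_rat (g $ k)))" for c
      define supp where "supp c = {g\<in>set gs. (0::real) < c g}" for c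
      obtain c where c: "rep c" "\<And>c'. rep c' \<Longrightarrow> card (supp c) \<le> card (supp c')"
      proof -
        have "\<exists>c. rep c" using \<open>rvec x \<in> cone_gen d gs\<close> unfolding cone_gen_iff[OF gs] rep_def by blast
        then obtain c0 where "rep c0" by blast
        then show thesis using that arg_min_natI[of rep c0 "\<lambda>c. card (supp c)"] arg_min_nat_le[of rep _ "\<lambda>c. card (supp c)"]
          by blast
      qed
      let ?S = "supp c"
      have SD: "?S \<notin> ?D"
      proof
        assume D: "?S \<in> ?D"
        let ?h = "nrm ?S"
        have h: "?h \<in> carrier_vec d" "\<And>g. g \<in> ?S \<Longrightarrow> ?h \<bullet> g = 0" using nrm[OF D] by auto
        have "real_of_rat (?h \<bullet> x) = (\<Sum>g\<in>set gs. c g * real_of_rat (?h \<bullet> g))"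
          by (rule combination_sprod[OF h(1) x, where v = "\<lambda>g. g"]) (use gs c(1) in \<open>auto simp: rep_def\<close>)
        also have "\<dots> = 0" 
          using h(2) c(1) by (intro sum.neutral) (force simp: rep_def supp_def less_le)
        finally have "?h \<bullet> x = 0" by simp
        then show False using gx D by blast
      qed
      obtain vs where vs: "set vs = ?S" "distinct vs" using finite_distinct_list[of ?S] by (auto simp: supp_def)
      have vsc: "set vs \<subseteq> carrier_vec d" using gs vs by (auto simp: supp_def)
      have "\<not> (length vs < d \<or> length vs = d \<and> Det d vs = 0)"
        using orth_exists[OF vsc] SD vs(1) by (auto simp: supp_def)
      moreover have "\<not> d < length vs"
      proof
        assume "d < length vs"
        \<comment> \<open>A support with more than \<open>d\<close> elements is linearly dependent.
          The coefficients \<open>c\<close> are moved along the dependence until one of them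
          vanishes, which contradicts minimality of the support.\<close>
        from long_list_dependent[OF vsc this] obtain a0 i0 where
          a0: "i0 < length vs" "a0 i0 \<noteq> 0" "\<And>k. k < d \<Longrightarrow> (\<Sum>i<length vs. a0 i * vs ! i $ k) = 0" by blast
        define a where "a i = (if 0 < a0 i0 then a0 i else - a0 i)" for i
        have a: "0 < a i0" using a0(2) by (auto simp: a_def)
        have a': "(\<Sum>i<length vs. a i * vs ! i $ k) = 0" if "k < d" for k
          by (cases "0 < a0 i0") (simp_all add: a_def sum_negf a0(3)[OF that])
        let ?I = "{i. i < length vs \<and> 0 < a i}"
        let ?q = "\<lambda>i. c (vs ! i) / real_of_rat (a i)"
        \<comment> \<open>The index at which a coefficient first reaches zero; the sign of
          \<open>a\<close> was normalised so that some entry is positive and the set of candidates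
          is nonempty.\<close>
        define j where "j = arg_min_on ?q ?I"
        have j: "j \<in> ?I" "\<And>i. i \<in> ?I \<Longrightarrow> ?q j \<le> ?q i"
          using a0(1) a arg_min_if_finite(1)[of ?I ?q] arg_min_least[of ?I _ ?q] by (auto simp: j_def)
        define c' where "c' g = (if g \<in> ?S then c g - ?q j * real_of_rat (a (the_elem {i. i < length vs \<and> vs ! i = g})) else c g)" for g
        have idx: "the_elem {i'. i' < length vs \<and> vs ! i' = vs ! i} = i" if "i < length vs" for i
        proof -
          have "{i'. i' < length vs \<and> vs ! i' = vs ! i} = {i}" using vs(2) that nth_eq_iff_index_eq by auto
          then show ?thesis by simp
        qed
        have c'v: "c' (vs ! i) = c (vs ! i) - ?q j * real_of_rat (a i)" if "i < length vs" for i
          using that vs(1) nth_mem[OF that] by (simp add: c'_def idx)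
        have cp: "0 < c (vs ! i)" if "i < length vs" for i using vs(1) nth_mem[OF that] by (auto simp: supp_def)
        have c'0: "0 \<le> c' (vs ! i)" if i: "i < length vs" for i
        proof (cases "0 < a i")
          case True
          then have "?q j \<le> c (vs ! i) / real_of_rat (a i)" using j(2) i by auto
          then show ?thesis using True by (simp add: c'v[OF i] pos_le_divide_eq)
        next
          case False
          then have "?q j * real_of_rat (a i) \<le> 0" using j(1) cp by (intro mult_nonneg_nonpos) (auto simp: less_imp_le)
          then show ?thesis using cp[OF i] by (simp add: c'v[OF i])
        qed
        have c'out: "c' g = c g" if "g \<notin> set vs" for g using that vs(1) by (simp add: c'_def)
        have "rep c'" unfolding rep_def
        proof (intro conjI ballI allI impI)
          fix g assume "g \<in> set gs"
          then show "0 \<le> c' g"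
          proof (cases "g \<in> set vs")
            case True then show ?thesis using c'0 by (metis in_set_conv_nth)
          next
            case False then show ?thesis using c'out c(1) \<open>g \<in> set gs\<close> by (simp add: rep_def)
          qed
        next
          fix k assume k: "k < d"
          have sub: "set vs \<subseteq> set gs" using vs(1) by (auto simp: supp_def)
          have re: "(\<Sum>g\<in>set vs. f g) = (\<Sum>i<length vs. f (vs ! i))" for f :: "rat vec \<Rightarrow> real"
            using sum.distinct_set_conv_list[OF vs(2), of f] sum_list_sum_nth[of "map f vs"] by (simp add: lessThan_atLeast0)
          have "(\<Sum>g\<in>set gs. c' g * real_of_rat (g $ k)) - (\<Sum>g\<in>set gs. c g * real_of_rat (g $ k))
              = (\<Sum>g\<in>set gs. (c' g - c g) * real_of_rat (g $ k))"
            by (simp add: sum_subtractf left_diff_distrib)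
          also have "\<dots> = (\<Sum>g\<in>set vs. (c' g - c g) * real_of_rat (g $ k))"
            using c'out by (intro sum.mono_neutral_right) (auto simp: sub)
          also have "\<dots> = (\<Sum>i<length vs. - ?q j * real_of_rat (a i * vs ! i $ k))"
            unfolding re by (intro sum.cong) (auto simp: c'v of_rat_mult)
          also have "\<dots> = - ?q j * real_of_rat (\<Sum>i<length vs. a i * vs ! i $ k)"
            by (simp only: sum_distrib_left of_rat_sum)
          also have "\<dots> = 0" using a'[OF k] by simp
          finally show "rvec x $ k = (\<Sum>g\<in>set gs. c' g * real_of_rat (g $ k))"
            using c(1) k by (simp add: rep_def)
        qed
        moreover have "supp c' \<subset> ?S"
        proof
          show "supp c' \<subseteq> ?S"
          proof
            fix g assume "g \<in> supp c'"
            then show "g \<in> ?S" using c'out[of g] vs(1) by (cases "g \<in> set vs") (auto simp: supp_def)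
          qed
          have "vs ! j \<in> ?S" using j(1) vs(1) nth_mem by blast
          moreover have "c' (vs ! j) = 0" using j(1) by (simp add: c'v)
          then have "vs ! j \<notin> supp c'" by (simp add: supp_def)
          ultimately show "supp c' \<noteq> ?S" by blast
        qed
        then have "card (supp c') < card ?S" by (intro psubset_card_mono) (auto simp: supp_def)
        ultimately show False using c(2) by fastforce
      qed
      ultimately have l: "length vs = d" and D: "Det d vs \<noteq> 0" by auto
      then have "vlist d vs" using vsc by (simp add: vlist_def)
      then obtain us where us: "dual_lists d us vs" using dual_lists_exists D by blast
      have "real_of_rat (us ! j \<bullet> x) = c (vs ! j)" if j: "j < d" for j
      proof (rule simplicial_cone_coord[OF us x j, of "\<lambda>i. c (vs ! i)"])
        fix k assume k: "k < d"
        have "rvec x $ k = (\<Sum>g\<in>set gs. c g * real_of_rat (g $ k))" using c(1) k by (simp add: rep_def)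
        also have "\<dots> = (\<Sum>g\<in>set vs. c g * real_of_rat (g $ k))"
          using c(1) vs(1) by (intro sum.mono_neutral_right) (auto simp: supp_def rep_def less_le)
        also have "\<dots> = (\<Sum>i<d. c (vs ! i) * real_of_rat (vs ! i $ k))"
          using sum.distinct_set_conv_list[OF vs(2), of "\<lambda>g. c g * real_of_rat (g $ k)"]
            sum_list_sum_nth[of "map (\<lambda>g. c g * real_of_rat (g $ k)) vs"] l by (simp add: lessThan_atLeast0)
        finally show "rvec x $ k = (\<Sum>i<d. c (vs ! i) * real_of_rat (vs ! i $ k))" .
      qed
      moreover have "0 < c (vs ! j)" if "j < d" for j using that vs(1) l nth_mem[of j vs] by (auto simp: supp_def)
      ultimately have "\<forall>j<d. 0 < us ! j \<bullet> x" by (metis zero_less_of_rat_iff)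
      then show "\<exists>vs us. set vs \<subseteq> set gs \<and> dual_lists d us vs \<and> (\<forall>j<d. 0 < us ! j \<bullet> x)"
        using us vs(1) by (intro exI[of _ vs] exI[of _ us]) (auto simp: supp_def)
    qed
  qed
qed

text \<open>Greedy choice: an independent list shorter than \<open>d\<close> has a nonzero
  orthogonal vector \<open>h\<close>, the hypothesis supplies a generator not orthogonal to
  \<open>h\<close>, and appending it keeps independence.\<close>

lemma basis_or_orthogonal:
  assumes gs: "set gs \<subseteq> carrier_vec d"
    and no: "\<And>h. h \<in> carrier_vec d \<Longrightarrow> (\<And>g. g \<in> set gs \<Longrightarrow> h \<bullet> g = 0) \<Longrightarrow> h = 0\<^sub>v d"
  obtains vs us where "set vs \<subseteq> set gs" "dual_lists d us (vs :: 'a :: field vec list)"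
proof -
  have "k \<le> d \<Longrightarrow> \<exists>vs. length vs = k \<and> set vs \<subseteq> set gs \<and>
      (\<forall>c. (\<forall>m<d. (\<Sum>i<k. c i * vs ! i $ m) = 0) \<longrightarrow> (\<forall>i<k. c i = 0))" for k
  proof (induction k)
    case 0
    show ?case by auto
  next
    case (Suc k)
    then obtain vs where vs: "length vs = k" "set vs \<subseteq> set gs"
      "\<And>c. (\<forall>m<d. (\<Sum>i<k. c i * vs ! i $ m) = 0) \<Longrightarrow> (\<forall>i<k. c i = 0)" by auto
    have "set vs \<subseteq> carrier_vec d" using vs gs by auto
    then obtain h where h: "h \<in> carrier_vec d" "h \<noteq> 0\<^sub>v d" "\<forall>g\<in>set vs. h \<bullet> g = 0"
      using orth_exists[of vs d] vs(1) Suc.prems by auto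
    then obtain g where g: "g \<in> set gs" "h \<bullet> g \<noteq> 0" using no[of h] by blast
    have gc: "g \<in> carrier_vec d" using g gs by auto
    have *: "\<forall>i<Suc k. c i = 0" if c: "\<forall>m<d. (\<Sum>i<Suc k. c i * (vs @ [g]) ! i $ m) = 0" for c
    proof -
      have c': "(\<Sum>i<k. c i * vs ! i $ m) + c k * g $ m = 0" if "m < d" for m
      proof -
        have "(\<Sum>i<k. c i * (vs @ [g]) ! i $ m) = (\<Sum>i<k. c i * vs ! i $ m)"
          using vs(1) by (intro sum.cong) (auto simp: nth_append)
        then show ?thesis using c[rule_format, OF that] vs(1) by (simp add: nth_append)
      qed
      have "0 = (\<Sum>m<d. h $ m * ((\<Sum>i<k. c i * vs ! i $ m) + c k * g $ m))" using c' by simp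
      also have "\<dots> = (\<Sum>m<d. \<Sum>i<k. h $ m * (c i * vs ! i $ m)) + c k * (\<Sum>m<d. h $ m * g $ m)"
        by (simp add: distrib_left sum.distrib sum_distrib_left mult_ac)
      also have "(\<Sum>m<d. \<Sum>i<k. h $ m * (c i * vs ! i $ m)) = (\<Sum>i<k. c i * (\<Sum>m<d. h $ m * vs ! i $ m))"
        by (subst sum.swap) (simp add: sum_distrib_left mult_ac)
      also have "\<dots> = (\<Sum>i<k. c i * (h \<bullet> vs ! i))"
      proof (rule sum.cong[OF refl])
        fix i assume "i \<in> {..<k}"
        then have "vs ! i \<in> carrier_vec d" using vs(1) nth_mem[of i vs] subsetD[OF vs(2)] subsetD[OF gs] by auto
        then show "c i * (\<Sum>m<d. h $ m * vs ! i $ m) = c i * (h \<bullet> vs ! i)" by (simp add: sprod[OF h(1)])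
      qed
      also have "\<dots> = 0" using h(3) vs(1) nth_mem by (intro sum.neutral) auto
      finally have "c k = 0" using g(2) by (simp add: sprod[OF h(1) gc])
      moreover have "\<forall>i<k. c i = 0"
      proof (rule vs(3), intro allI impI)
        fix m assume "m < d"
        from c'[OF this] show "(\<Sum>i<k. c i * vs ! i $ m) = 0" by (simp add: \<open>c k = 0\<close>)
      qed
      ultimately show ?thesis by (auto simp: less_Suc_eq)
    qed
    have "length (vs @ [g]) = Suc k" "set (vs @ [g]) \<subseteq> set gs" using vs g by auto
    moreover have "\<forall>c. (\<forall>m<d. (\<Sum>i<Suc k. c i * (vs @ [g]) ! i $ m) = 0) \<longrightarrow> (\<forall>i<Suc k. c i = 0)"
      using * by iprover
    ultimately show ?case by iprover
  qed
  from this[of d] obtain vs where vs: "length vs = d" "set vs \<subseteq> set gs"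
      "\<And>c. (\<forall>m<d. (\<Sum>i<d. c i * vs ! i $ m) = 0) \<Longrightarrow> (\<forall>i<d. c i = 0)" by auto
  have v: "vlist d vs" using vs gs by (auto simp: vlist_def)
  then have "Det d vs \<noteq> 0" using Det_zero_iff[OF v] vs(3) by metis
  then show thesis using dual_lists_exists[OF v] vs(2) that by blast
qed

section \<open>Dimension of a cone and lines inside it\<close>

lemma mem_cone_lincomb:
  fixes U :: "real vec set"
  assumes U: "qU = LinearCombinations.module.span class_ring (Rvec d) U" and Uc: "U \<subseteq> carrier_vec d"
    and "finite A" "\<And>a. a \<in> A \<Longrightarrow> y a \<in> U"
  shows "vec d (\<lambda>k. \<Sum>a\<in>A. t a * y a $ k) \<in> qU"
  using assms(3-)
proof (induction A rule: finite_induct)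
  interpret vec_space "TYPE(real)" d .
  have sub: "submodule class_ring (span U) V" by (rule span_is_submodule[OF Uc])
  {
    case empty
    have "0\<^sub>v d \<in> span U" using sub by (auto simp: submodule_def module_vec_simps)
    then show ?case by (simp add: zero_vec_def U)
  next
    case (insert a A)
    have ya: "y a \<in> span U" using in_own_span[OF Uc] insert.prems by auto
    have yc: "y a \<in> carrier_vec d" using insert.prems Uc by auto
    have "vec d (\<lambda>k. \<Sum>a\<in>insert a A. t a * y a $ k) = t a \<cdot>\<^sub>v y a + vec d (\<lambda>k. \<Sum>a\<in>A. t a * y a $ k)"
      using insert(1,2) yc by (intro eq_vecI) auto
    also have "\<dots> \<in> span U"
      using sub ya insert by (auto simp: submodule_def module_vec_simps U)
    finally show ?case by (simp add: U)
  }
qed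

text \<open>Translates the dimension of the real span into a rational condition: rational generators
  either contain a rational basis, which spans the real space, or are all orthogonal to a nonzero
  rational vector.\<close>

lemma cone_dim_less_iff:
  assumes gs: "set gs \<subseteq> carrier_vec d"
  shows "cone_dim d (cone_gen d gs) < d \<longleftrightarrow> (\<exists>h\<in>carrier_vec d. h \<noteq> 0\<^sub>v d \<and> (\<forall>g\<in>set gs. h \<bullet> g = 0))"
proof -
  interpret vec_space "TYPE(real)" d .
  let ?C = "cone_gen d gs" and ?S = "rvec ` set gs"
  have Cc: "?C \<subseteq> carrier_vec d" by (rule cone_gen_carrier[OF gs])
  have Sc: "?S \<subseteq> carrier_vec d" using gs by auto
  have dim: "cone_dim d ?C = vectorspace.dim class_ring (vs (span ?C))"
    by (simp add: cone_dim_def subspace_dim_def)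
  show ?thesis
  proof
    assume l: "cone_dim d ?C < d"
    show "\<exists>h\<in>carrier_vec d. h \<noteq> 0\<^sub>v d \<and> (\<forall>g\<in>set gs. h \<bullet> g = 0)"
    proof (rule ccontr)
      assume "\<not> ?thesis"
      then obtain bs us where vu: "set bs \<subseteq> set gs" "dual_lists d us bs"
        using basis_or_orthogonal[OF gs] by blast
      have vl: "length bs = d" "vlist d bs" using vu(2) by (auto simp: dual_lists_def vlist_def)
      have "carrier_vec d \<subseteq> span ?C"
      proof
        fix x :: "real vec" assume x: "x \<in> carrier_vec d"
        \<comment> \<open>The coordinates of a real vector in a rational basis. Duality is available
          over the rationals, so the expansion is checked by expanding the unit vectors.\<close>
        define e where "e i = (\<Sum>l<d. real_of_rat (us ! i $ l) * x $ l)" for i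
        have "x = vec d (\<lambda>k. \<Sum>i<d. e i * rvec (bs ! i) $ k)"
        proof (rule eq_vecI)
          fix k assume "k < dim_vec (vec d (\<lambda>k. \<Sum>i<d. e i * rvec (bs ! i) $ k))"
          then have k: "k < d" by simp
          have "(\<Sum>i<d. e i * rvec (bs ! i) $ k)
              = (\<Sum>i<d. \<Sum>l<d. x $ l * real_of_rat (us ! i $ l * bs ! i $ k))"
          proof (rule sum.cong[OF refl])
            fix i assume "i \<in> {..<d}"
            then have "rvec (bs ! i) $ k = real_of_rat (bs ! i $ k)" using k vlist_nth[OF vl(2), of i] by auto
            then show "e i * rvec (bs ! i) $ k = (\<Sum>l<d. x $ l * real_of_rat (us ! i $ l * bs ! i $ k))"
              unfolding e_def sum_distrib_right by (simp add: of_rat_mult mult_ac)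
          qed
          also have "\<dots> = (\<Sum>l<d. x $ l * real_of_rat (\<Sum>i<d. us ! i $ l * bs ! i $ k))"
            by (subst sum.swap) (simp add: sum_distrib_left of_rat_sum)
          also have "\<dots> = (\<Sum>l<d. x $ l * real_of_rat (unit_vec d l $ k))"
          proof (rule sum.cong[OF refl])
            fix l assume l: "l \<in> {..<d}"
            have "us ! i \<bullet> unit_vec d l = us ! i $ l" if "i < d" for i
              using vu(2) that l by (simp add: dual_lists_def vlist_nth)
            then show "x $ l * real_of_rat (\<Sum>i<d. us ! i $ l * bs ! i $ k) = x $ l * real_of_rat (unit_vec d l $ k)"
              using dual_lists_expand[OF vu(2) _ k, of "unit_vec d l"] by simp
          qed
          also have "\<dots> = (\<Sum>l<d. if l = k then x $ l else 0)"
            using k by (intro sum.cong) (auto simp: unit_vec_def)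
          also have "\<dots> = x $ k" using k by simp
          finally show "x $ k = vec d (\<lambda>k. \<Sum>i<d. e i * rvec (bs ! i) $ k) $ k" using k by simp
        qed (use x in auto)
        also have "\<dots> \<in> span ?C"
        proof (rule mem_cone_lincomb[OF refl Cc])
          fix i assume "i \<in> {..<d}"
          then have "bs ! i \<in> set gs" using nth_mem[of i bs] vu(1) vl(1) by auto
          then show "rvec (bs ! i) \<in> ?C" by (rule cone_gen_member[OF gs])
        qed simp
        finally show "x \<in> span ?C" .
      qed
      then have "span ?C = carrier_vec d" using span_is_subset2[of ?C] Cc by auto
      moreover have V: "vs (carrier_vec d) = V" by (simp add: module_vec_def)
      ultimately have "cone_dim d ?C = d" unfolding dim by (simp only: V dim_is_n)
      then show False using l by simp
    qed
  next
    assume "\<exists>h\<in>carrier_vec d. h \<noteq> 0\<^sub>v d \<and> (\<forall>g\<in>set gs. h \<bullet> g = 0)"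
    then obtain h where h: "h \<in> carrier_vec d" "h \<noteq> 0\<^sub>v d" "\<And>g. g \<in> set gs \<Longrightarrow> h \<bullet> g = 0" by blast
    have "?C \<subseteq> span ?S"
    proof
      fix x assume "x \<in> ?C"
      then obtain c where c: "x \<in> carrier_vec d" "\<forall>k<d. x $ k = (\<Sum>g\<in>set gs. c g * real_of_rat (g $ k))"
        unfolding cone_gen_iff[OF gs] by blast
      have "x = vec d (\<lambda>k. \<Sum>g\<in>set gs. c g * rvec g $ k)"
        using c gs by (intro eq_vecI) (auto simp: subset_iff intro!: sum.cong)
      also have "\<dots> \<in> span ?S" by (rule mem_cone_lincomb[OF refl Sc]) auto
      finally show "x \<in> span ?S" .
    qed
    moreover have "?S \<subseteq> ?C" by (auto intro: cone_gen_member[OF gs])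
    ultimately have eq: "span ?C = span ?S"
      using span_is_subset[of ?C "span ?S"] span_is_submodule[of ?S] span_is_monotone[of ?S ?C] Sc by auto
    have "lin_indpt {}"
      by (metis empty_subsetI fin_dim finite_basis_exists subset_li_is_li basis_def)
    then have "\<exists>U. finite U \<and> maximal U (\<lambda>T. T \<subseteq> ?S \<and> lin_indpt T)"
      by (intro maximal_exists[of _ "card ?S" "{}"]) (auto intro: finite_subset card_mono)
    then obtain U where U: "maximal U (\<lambda>T. T \<subseteq> ?S \<and> lin_indpt T)" by blast
    then have U': "U \<subseteq> ?S" "lin_indpt U" by (auto simp: maximal_def)
    have Uf: "finite U" using U' by (auto intro: finite_subset)
    have "vectorspace.dim class_ring (vs (span ?S)) = card U"
      by (rule dim_span) (use Sc U in auto)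
    \<comment> \<open>With \<open>d\<close> elements \<open>U\<close> would be a basis of the whole
      space contained in the hyperplane orthogonal to \<open>h\<close>.\<close>
    moreover have "card U < d"
    proof (rule ccontr)
      assume "\<not> card U < d"
      then have "basis U" using dim_li_is_basis[OF fin_dim Uf] U' Sc dim_is_n by auto
      then have sp: "span U = carrier_vec d" by (simp add: basis_def)
      let ?N = "{x \<in> carrier_vec d. rvec h \<bullet> x = 0}"
      have "submodule class_ring ?N V"
        by (rule submodule.intro)
          (use h(1) in \<open>auto simp: module_vec_simps scalar_prod_add_distrib[of _ d] intro: module_axioms\<close>)
      moreover have "U \<subseteq> ?N"
      proof
        fix x assume "x \<in> U"
        then obtain g where g: "g \<in> set gs" "x = rvec g" using U' by auto
        then have gc: "g \<in> carrier_vec d" using gs by auto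
        have "rvec h \<bullet> rvec g = real_of_rat (h \<bullet> g)"
          using h(1) gc by (simp add: sprod[of _ d] of_rat_sum of_rat_mult)
        then show "x \<in> ?N" using g h(3) gc by simp
      qed
      ultimately have N: "carrier_vec d \<subseteq> ?N" using span_is_subset[of U ?N] sp by auto
      have "h = 0\<^sub>v d"
      proof (rule eq_vecI)
        fix k assume "k < dim_vec (0\<^sub>v d)"
        then have k: "k < d" by simp
        have "rvec h \<bullet> unit_vec d k = 0" using subsetD[OF N unit_vec_carrier[of d k]] by simp
        moreover have "rvec h \<bullet> unit_vec d k = real_of_rat (h $ k)"
          using k h(1) by auto
        ultimately show "h $ k = 0\<^sub>v d $ k" using k by simp
      qed (use h(1) in auto)
      then show False using h(2) by simp
    qed
    ultimately show "cone_dim d ?C < d" using dim eq by simp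
  qed
qed

text \<open>Adding nonnegative representations of \<open>x\<close> and of \<open>- x\<close> gives a
  nonnegative relation between generators in which some nonzero generator has a positive
  coefficient; solving for it shows that its negative lies in the cone. Thus a line can be found
  through a generator, and it is rational.\<close>

lemma contains_line_iff:
  assumes gs: "set gs \<subseteq> carrier_vec d"
  shows "contains_subspace d 1 (cone_gen d gs) \<longleftrightarrow> (\<exists>g\<in>set gs. g \<noteq> 0\<^sub>v d \<and> rvec (- g) \<in> cone_gen d gs)"
proof -
  interpret vec_space "TYPE(real)" d .
  let ?C = "cone_gen d gs"
  show ?thesis
  proof
    assume "contains_subspace d 1 ?C"
    then obtain W where W: "subspace class_ring W V" "W \<subseteq> ?C" "vectorspace.dim class_ring (vs W) = 1"
      by (auto simp: contains_subspace_def subspace_dim_def)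
    have Ws: "submodule class_ring W V" using W(1) by (simp add: subspace_def)
    have Wc: "W \<subseteq> carrier_vec d" using W(2) cone_gen_carrier[OF gs] by auto
    have "W \<noteq> {0\<^sub>v d}"
    proof
      assume "W = {0\<^sub>v d}"
      moreover have "span {} = {0\<^sub>v d}"
        using span_is_subset[of "{}" "{0\<^sub>v d}"] span_is_submodule[of "{}"] Ws calculation
        by (auto simp: submodule_def module_vec_simps)
      ultimately show False using W(3) dim_zero_vs by simp
    qed
    moreover have "0\<^sub>v d \<in> W" using Ws by (auto simp: submodule_def module_vec_simps)
    ultimately obtain x where x: "x \<in> W" "x \<noteq> 0\<^sub>v d" by blast
    have xc: "x \<in> carrier_vec d" using x Wc by auto
    have "(-1) \<cdot>\<^sub>v x \<in> W" using Ws x(1) by (auto simp: submodule_def module_vec_simps)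
    then have "x \<in> ?C" "(-1) \<cdot>\<^sub>v x \<in> ?C" using W(2) x(1) by auto
    then obtain a b where a: "\<forall>g\<in>set gs. 0 \<le> a g" "\<forall>k<d. x $ k = (\<Sum>g\<in>set gs. a g * real_of_rat (g $ k))"
      and b: "\<forall>g\<in>set gs. 0 \<le> b g" "\<forall>k<d. ((-1) \<cdot>\<^sub>v x) $ k = (\<Sum>g\<in>set gs. b g * real_of_rat (g $ k))"
      unfolding cone_gen_iff[OF gs] by blast
    obtain k where k: "k < d" "x $ k \<noteq> 0" using x(2) xc by (metis carrier_vecD eq_vecI index_zero_vec)
    have "\<exists>g\<in>set gs. a g * real_of_rat (g $ k) \<noteq> 0"
      using a(2) k by (metis (no_types, lifting) sum.neutral)
    then obtain g where g: "g \<in> set gs" "a g \<noteq> 0" "g $ k \<noteq> 0" by auto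
    have s: "0 < a g + b g" using a(1) b(1) g by (metis add_pos_nonneg less_le)
    have ab: "(\<Sum>g\<in>set gs. (a g + b g) * real_of_rat (g $ k)) = 0" if "k < d" for k
    proof -
      have "(\<Sum>g\<in>set gs. a g * real_of_rat (g $ k)) = x $ k" using a(2) that by simp
      moreover have "(\<Sum>g\<in>set gs. b g * real_of_rat (g $ k)) = - x $ k"
        using b(2)[rule_format, OF that] that xc by simp
      ultimately show ?thesis by (simp add: distrib_right sum.distrib)
    qed
    have "rvec (- g) \<in> ?C"
      unfolding cone_gen_iff[OF gs]
    proof (intro conjI exI[of _ "\<lambda>g'. if g' = g then 0 else (a g' + b g') / (a g + b g)"] ballI allI impI)
      fix k assume k: "k < d"
      have "(\<Sum>g'\<in>set gs. (if g' = g then 0 else (a g' + b g') / (a g + b g)) * real_of_rat (g' $ k))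
          = (\<Sum>g'\<in>set gs - {g}. (a g' + b g') * real_of_rat (g' $ k)) / (a g + b g)"
        using g(1) by (subst sum.remove[of _ g]) (auto simp: sum_divide_distrib intro!: sum.cong)
      also have "(\<Sum>g'\<in>set gs - {g}. (a g' + b g') * real_of_rat (g' $ k)) = - ((a g + b g) * real_of_rat (g $ k))"
        using ab[OF k] g(1) by (subst (asm) sum.remove[of _ g]) auto
      finally show "rvec (- g) $ k = (\<Sum>g'\<in>set gs. (if g' = g then 0 else (a g' + b g') / (a g + b g)) * real_of_rat (g' $ k))"
        using s g(1) gs k by (auto simp: of_rat_minus subset_iff)
    qed (use a(1) b(1) s g gs in auto)
    moreover have "g \<noteq> 0\<^sub>v d" using g(3) k by auto
    ultimately show "\<exists>g\<in>set gs. g \<noteq> 0\<^sub>v d \<and> rvec (- g) \<in> ?C" using g(1) by blast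
  next
    assume "\<exists>g\<in>set gs. g \<noteq> 0\<^sub>v d \<and> rvec (- g) \<in> ?C"
    then obtain g where g: "g \<in> set gs" "g \<noteq> 0\<^sub>v d" "rvec (- g) \<in> ?C" by blast
    have gc: "g \<in> carrier_vec d" using g gs by auto
    let ?r = "rvec g"
    let ?W = "span {?r}"
    have rc: "{?r} \<subseteq> carrier_vec d" using gc by auto
    have r0: "?r \<noteq> 0\<^sub>v d"
    proof
      assume r: "?r = 0\<^sub>v d"
      have "g = 0\<^sub>v d"
      proof (rule eq_vecI)
        fix k assume "k < dim_vec (0\<^sub>v d)"
        then have k: "k < d" by simp
        then have "?r $ k = real_of_rat (g $ k)" using gc by auto
        then show "g $ k = 0\<^sub>v d $ k" using r k by simp
      qed (use gc in auto)
      then show False using g(2) by simp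
    qed
    let ?L = "{t \<cdot>\<^sub>v ?r | t. True}"
    have "?W \<subseteq> ?L"
    proof (rule span_is_subset)
      show "{?r} \<subseteq> ?L" by (auto intro!: exI[of _ 1])
      show "submodule class_ring ?L V"
      proof (rule submodule.intro)
        show "\<zero>\<^bsub>V\<^esub> \<in> ?L" using gc by (auto simp: module_vec_simps intro!: exI[of _ 0])
      next
        fix v w assume "v \<in> ?L" "w \<in> ?L"
        then show "v \<oplus>\<^bsub>V\<^esub> w \<in> ?L" using add_smult_distrib_vec[of _ _ ?r, symmetric] by (auto simp: module_vec_simps)
      next
        fix c v assume "v \<in> ?L"
        then show "c \<odot>\<^bsub>V\<^esub> v \<in> ?L" using smult_smult_assoc[of c _ ?r] by (auto simp: module_vec_simps)
      qed (use gc in \<open>auto simp: module_vec_simps intro: module_axioms\<close>)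
    qed
    moreover have "t \<cdot>\<^sub>v ?r \<in> ?C" for t
    proof (cases "0 \<le> t")
      case True then show ?thesis using cone_gen_smult[OF gs cone_gen_member[OF gs g(1)]] by simp
    next
      case False
      have "t \<cdot>\<^sub>v ?r = (- t) \<cdot>\<^sub>v rvec (- g)" using gc by (intro eq_vecI) (auto simp: of_rat_minus)
      then show ?thesis using cone_gen_smult[OF gs g(3), of "- t"] False by simp
    qed
    ultimately have WC: "?W \<subseteq> ?C" by auto
    have li: "lin_indpt {?r}"
    proof
      assume "lin_dep {?r}"
      then obtain A a v where A: "finite A" "A \<subseteq> {?r}" "lincomb a A = 0\<^sub>v d" "v \<in> A" "a v \<noteq> 0"
        unfolding lin_dep_def by (auto simp: module_vec_simps)
      then have Ar: "A = {?r}" by auto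
      have "a ?r * ?r $ k = 0" if "k < d" for k
        using lincomb_index[OF that rc, of a] A(3) that by (simp add: Ar)
      moreover have "a ?r \<noteq> 0" using A Ar by auto
      ultimately have "?r = 0\<^sub>v d" using gc by (intro eq_vecI) auto
      then show False using r0 by simp
    qed
    have "vectorspace.dim class_ring (vs ?W) = card {?r}"
      by (rule dim_span) (use rc li in \<open>auto simp: maximal_def\<close>)
    moreover have "subspace class_ring ?W V" by (rule span_is_subspace) (use rc in auto)
    ultimately show "contains_subspace d 1 ?C" using WC by (auto simp: contains_subspace_def subspace_dim_def)
  qed
qed

lemma contains_zero_subspace:
  assumes gs: "set gs \<subseteq> carrier_vec d"
  shows "contains_subspace d 0 (cone_gen d gs)"
proof -
  interpret vec_space "TYPE(real)" d .
  have "submodule class_ring {0\<^sub>v d} V"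
    by (rule submodule.intro) (auto simp: module_vec_simps intro: module_axioms)
  then have "span {} \<subseteq> {0\<^sub>v d}" by (intro span_is_subset) auto
  moreover have "subspace class_ring (span {}) V" by (rule span_is_subspace) auto
  ultimately show ?thesis using dim_zero_vs cone_gen_zero[OF gs]
    unfolding contains_subspace_def subspace_dim_def by (intro exI[of _ "span {}"]) auto
qed

section \<open>Spaces of distributions\<close>

abbreviation ivec :: "int vec \<Rightarrow> rat vec" where
  "ivec \<equiv> map_vec rat_of_int"

definition rat_fun :: "nat \<Rightarrow> rat vec list \<Rightarrow> nat list \<Rightarrow> rat vec \<Rightarrow> rat" where
  "rat_fun d us ns x = (\<Prod>j<d. 1 / (us ! j \<bullet> x) ^ (ns ! j))"

text \<open>The Fourier coefficient is rational and makes sense at every rational point, not just at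
  lattice points; the proof mostly works with this extension.\<close>

definition cone_fun :: "nat \<Rightarrow> real vec set \<Rightarrow> rat vec list \<Rightarrow> nat list \<Rightarrow> rat vec \<Rightarrow> rat" where
  "cone_fun d C us ns x = (if rvec x \<in> C \<and> (\<forall>j<d. us ! j \<bullet> x \<noteq> 0) then rat_fun d us ns x else 0)"

lemma cone_distr_cone_fun:
  "cone_distr d C us ns \<nu> = (if \<nu> \<in> carrier_vec d then of_rat (cone_fun d C us ns (ivec \<nu>)) else 0)"
proof -
  have "rvec (ivec \<nu>) = map_vec real_of_int \<nu>" by (rule eq_vecI) auto
  then show ?thesis by (auto simp: cone_distr_def cone_fun_def rat_fun_def)
qed

lemma cone_fun_smult:
  assumes C: "rational_cone d C" and us: "vlist d us" and ns: "exponents d n ns" and t: "0 < t"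
    and x: "x \<in> carrier_vec d"
  shows "cone_fun d C us ns (t \<cdot>\<^sub>v x) = cone_fun d C us ns x / t ^ n"
proof -
  obtain gs where gs: "set gs \<subseteq> carrier_vec d" "C = cone_gen d gs" using C by (auto simp: rational_cone_def)
  have "rvec (t \<cdot>\<^sub>v x) = real_of_rat t \<cdot>\<^sub>v rvec x" using x by (intro eq_vecI) (auto simp: of_rat_mult)
  then have m: "rvec (t \<cdot>\<^sub>v x) \<in> C \<longleftrightarrow> rvec x \<in> C"
    using cone_gen_smult_iff[OF gs(1), of "real_of_rat t" "rvec x"] t x gs(2) by simp
  have p: "us ! j \<bullet> (t \<cdot>\<^sub>v x) = t * (us ! j \<bullet> x)" if "j < d" for j
    using vlist_nth[OF us that] x by simp
  have "n = (\<Sum>j<d. ns ! j)" using ns by (auto simp: exponents_def sum_list_sum_nth lessThan_atLeast0)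
  then have tn: "t ^ n = (\<Prod>j<d. t ^ (ns ! j))" by (simp add: power_sum)
  have "rat_fun d us ns (t \<cdot>\<^sub>v x) = (\<Prod>j<d. 1 / (us ! j \<bullet> x) ^ (ns ! j) / t ^ (ns ! j))"
    unfolding rat_fun_def using p by (intro prod.cong) (auto simp: power_mult_distrib)
  also have "\<dots> = rat_fun d us ns x / t ^ n"
    unfolding tn rat_fun_def by (rule prod_dividef)
  finally show ?thesis using m p t by (auto simp: cone_fun_def)
qed

lemma common_denominator:
  assumes "finite S"
  shows "\<exists>D::nat. 0 < D \<and> (\<forall>q\<in>S. \<exists>z. of_nat D * (q::rat) = of_int z)"
  using assms
proof (induction S rule: finite_induct)
  case empty
  show ?case by (intro exI[of _ 1]) auto
next
  case (insert q S)
  then obtain D where D: "0 < D" "\<forall>q\<in>S. \<exists>z. of_nat D * q = of_int z" by blast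
  obtain a b where q: "q = of_int a / of_int b" "0 < b"
    using quotient_of_div[of q "fst (quotient_of q)" "snd (quotient_of q)"] quotient_of_denom_pos'[of q] by auto
  have b: "of_nat (nat b) = (of_int b :: rat)" using q(2) by simp
  have "\<exists>z. of_nat (D * nat b) * q' = of_int z" if "q' \<in> insert q S" for q'
  proof (cases "q' = q")
    case True
    then show ?thesis using q b by (intro exI[of _ "int D * a"]) (simp add: field_simps)
  next
    case False
    then have "q' \<in> S" using that by simp
    then obtain z where "of_nat D * q' = of_int z" using D(2) by blast
    then show ?thesis using b by (intro exI[of _ "b * z"]) (simp add: mult_ac)
  qed
  moreover have "0 < D * nat b" using D q by simp
  ultimately show ?case by blast
qed

lemma vec_common_denominator:
  assumes x: "x \<in> carrier_vec d"
  obtains D \<nu> where "0 < (D::nat)" "\<nu> \<in> carrier_vec d" "of_nat D \<cdot>\<^sub>v x = ivec \<nu>"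
proof -
  obtain D :: nat where D: "0 < D" "\<forall>q\<in>(\<lambda>k. x $ k) ` {..<d}. \<exists>z. of_nat D * q = of_int z"
    using common_denominator[of "(\<lambda>k. x $ k) ` {..<d}"] by auto
  then have "\<forall>k. \<exists>z. k < d \<longrightarrow> of_nat D * x $ k = of_int z" by auto
  then obtain z where z: "\<And>k. k < d \<Longrightarrow> of_nat D * x $ k = of_int (z k)" by metis
  have "of_nat D \<cdot>\<^sub>v x = ivec (vec d z)" using x z by (intro eq_vecI) auto
  then show thesis using that[OF D(1), of "vec d z"] by simp
qed

text \<open>A rational linear form takes values in a fixed fraction (1/D) Z on the lattice, so its
  nonzero values stay away from zero.\<close>

lemma rat_fun_bounded:
  assumes us: "vlist d us"
  shows "\<exists>K. \<forall>\<nu>\<in>carrier_vec d. (\<forall>j<d. us ! j \<bullet> ivec \<nu> \<noteq> 0) \<longrightarrow> \<bar>rat_fun d us ns (ivec \<nu>)\<bar> \<le> K"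
proof -
  have "\<exists>K. 0 \<le> K \<and> (\<forall>\<nu>\<in>carrier_vec d. us ! j \<bullet> ivec \<nu> \<noteq> 0 \<longrightarrow> \<bar>1 / (us ! j \<bullet> ivec \<nu>) ^ (ns ! j)\<bar> \<le> K)" if j: "j < d" for j
  proof -
    have u: "us ! j \<in> carrier_vec d" using vlist_nth[OF us j] .
    obtain D u' where D: "0 < (D::nat)" "u' \<in> carrier_vec d" "of_nat D \<cdot>\<^sub>v us ! j = ivec u'"
      using vec_common_denominator[OF u] by blast
    have "\<bar>1 / (us ! j \<bullet> ivec \<nu>) ^ (ns ! j)\<bar> \<le> of_nat D ^ (ns ! j)"
      if nu: "\<nu> \<in> carrier_vec d" and nz: "us ! j \<bullet> ivec \<nu> \<noteq> 0" for \<nu>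
    proof -
      have "of_nat D * (us ! j \<bullet> ivec \<nu>) = (of_nat D \<cdot>\<^sub>v us ! j) \<bullet> ivec \<nu>" using u nu by simp
      also have "\<dots> = of_int (u' \<bullet> \<nu>)"
        unfolding D(3) using D(2) nu by (simp add: sprod[of _ d])
      finally have e: "of_nat D * (us ! j \<bullet> ivec \<nu>) = of_int (u' \<bullet> \<nu>)" .
      then have "u' \<bullet> \<nu> \<noteq> 0" using nz D(1) by auto
      then have "1 \<le> \<bar>u' \<bullet> \<nu>\<bar>" by simp
      then have "1 \<le> \<bar>of_int (u' \<bullet> \<nu>) :: rat\<bar>" by linarith
      then have "1 \<le> of_nat D * \<bar>us ! j \<bullet> ivec \<nu>\<bar>" unfolding e[symmetric] by (simp add: abs_mult)
      then have "1 / \<bar>us ! j \<bullet> ivec \<nu>\<bar> \<le> of_nat D" using nz by (simp add: divide_le_eq)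
      then have "(1 / \<bar>us ! j \<bullet> ivec \<nu>\<bar>) ^ (ns ! j) \<le> of_nat D ^ (ns ! j)" by (intro power_mono) auto
      then show ?thesis by (simp add: power_abs power_divide)
    qed
    then show ?thesis by (intro exI[of _ "of_nat D ^ (ns ! j)"]) auto
  qed
  then have "\<forall>j. \<exists>K. j < d \<longrightarrow> 0 \<le> K \<and> (\<forall>\<nu>\<in>carrier_vec d. us ! j \<bullet> ivec \<nu> \<noteq> 0 \<longrightarrow> \<bar>1 / (us ! j \<bullet> ivec \<nu>) ^ (ns ! j)\<bar> \<le> K)"
    by blast
  from choice[OF this] obtain K where K: "\<And>j. j < d \<Longrightarrow> 0 \<le> K j"
    "\<And>j \<nu>. j < d \<Longrightarrow> \<nu> \<in> carrier_vec d \<Longrightarrow> us ! j \<bullet> ivec \<nu> \<noteq> 0 \<Longrightarrow> \<bar>1 / (us ! j \<bullet> ivec \<nu>) ^ (ns ! j)\<bar> \<le> K j" by blast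
  have "\<bar>rat_fun d us ns (ivec \<nu>)\<bar> \<le> (\<Prod>j<d. K j)"
    if "\<nu> \<in> carrier_vec d" "\<forall>j<d. us ! j \<bullet> ivec \<nu> \<noteq> 0" for \<nu>
    unfolding rat_fun_def abs_prod by (rule prod_mono) (use K that in auto)
  then show ?thesis by blast
qed

lemma torus_distr_bounded:
  assumes "\<And>\<nu>. \<nu> \<notin> carrier_vec d \<Longrightarrow> F \<nu> = 0" "\<And>\<nu>. \<nu> \<in> carrier_vec d \<Longrightarrow> cmod (F \<nu>) \<le> K"
  shows "F \<in> torus_distr d"
  unfolding torus_distr_def using assms by (intro CollectI conjI exI[of _ K] exI[of _ 0]) auto

lemma torus_distr_add:
  assumes F: "F \<in> torus_distr d" and G: "G \<in> torus_distr d"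
  shows "(\<lambda>\<nu>. F \<nu> + G \<nu>) \<in> torus_distr d"
proof -
  let ?b = "\<lambda>\<nu>. 1 + real_of_int (\<Sum>i<d. \<bar>(\<nu>::int vec) $ i\<bar>)"
  obtain K m where K: "\<And>\<nu>. \<nu> \<in> carrier_vec d \<Longrightarrow> cmod (F \<nu>) \<le> K * ?b \<nu> ^ m"
    using F by (auto simp: torus_distr_def)
  obtain L l where L: "\<And>\<nu>. \<nu> \<in> carrier_vec d \<Longrightarrow> cmod (G \<nu>) \<le> L * ?b \<nu> ^ l"
    using G by (auto simp: torus_distr_def)
  have b: "1 \<le> ?b \<nu>" for \<nu> by (auto intro: sum_nonneg)
  have "cmod (F \<nu> + G \<nu>) \<le> (\<bar>K\<bar> + \<bar>L\<bar>) * ?b \<nu> ^ (m + l)" if nu: "\<nu> \<in> carrier_vec d" for \<nu>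
  proof -
    have "K * ?b \<nu> ^ m \<le> \<bar>K\<bar> * ?b \<nu> ^ (m + l)"
      using power_increasing[OF _ b, of m "m + l" \<nu>] b[of \<nu>] by (intro mult_mono) auto
    moreover have "L * ?b \<nu> ^ l \<le> \<bar>L\<bar> * ?b \<nu> ^ (m + l)"
      using power_increasing[OF _ b, of l "m + l" \<nu>] b[of \<nu>] by (intro mult_mono) auto
    ultimately show ?thesis
      using norm_triangle_ineq[of "F \<nu>" "G \<nu>"] K[OF nu] L[OF nu] by (simp add: distrib_right)
  qed
  then show ?thesis using F G unfolding torus_distr_def by auto
qed

lemma torus_distr_scale:
  assumes F: "F \<in> torus_distr d"
  shows "(\<lambda>\<nu>. c * F \<nu>) \<in> torus_distr d"
proof -
  let ?b = "\<lambda>\<nu>. 1 + real_of_int (\<Sum>i<d. \<bar>(\<nu>::int vec) $ i\<bar>)"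
  obtain K m where K: "\<And>\<nu>. \<nu> \<in> carrier_vec d \<Longrightarrow> cmod (F \<nu>) \<le> K * ?b \<nu> ^ m"
    using F by (auto simp: torus_distr_def)
  have "cmod (c * F \<nu>) \<le> (cmod c * K) * ?b \<nu> ^ m" if "\<nu> \<in> carrier_vec d" for \<nu>
    using mult_left_mono[OF K[OF that], of "cmod c"] by (simp add: norm_mult mult_ac)
  then show ?thesis using F unfolding torus_distr_def by auto
qed

lemma hom_zero: "\<zero>\<^bsub>hom_distr_mod d n\<^esub> = (\<lambda>\<nu>. 0)"
  and hom_add: "F \<oplus>\<^bsub>hom_distr_mod d n\<^esub> G = (\<lambda>\<nu>. F \<nu> + G \<nu>)"
  and hom_smult: "c \<odot>\<^bsub>hom_distr_mod d n\<^esub> F = (\<lambda>\<nu>. of_rat c * F \<nu>)"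
  and hom_carrier: "carrier (hom_distr_mod d n) = {F \<in> torus_distr d.
        \<forall>N>0. \<forall>\<nu>\<in>carrier_vec d. F (int N \<cdot>\<^sub>v \<nu>) = F \<nu> / of_nat N ^ n}"
  by (simp_all add: hom_distr_mod_def)

lemma hom_qvs: "qvs (hom_distr_mod d n)"
proof (rule qvsI)
  show "\<zero>\<^bsub>hom_distr_mod d n\<^esub> \<in> carrier (hom_distr_mod d n)"
    by (auto simp: hom_zero hom_carrier intro: torus_distr_bounded[of _ _ 0])
next
  fix F G assume "F \<in> carrier (hom_distr_mod d n)" "G \<in> carrier (hom_distr_mod d n)"
  then show "F \<oplus>\<^bsub>hom_distr_mod d n\<^esub> G \<in> carrier (hom_distr_mod d n)"
    by (auto simp: hom_add hom_carrier add_divide_distrib intro: torus_distr_add)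
next
  fix c F assume "F \<in> carrier (hom_distr_mod d n)"
  then show "c \<odot>\<^bsub>hom_distr_mod d n\<^esub> F \<in> carrier (hom_distr_mod d n)"
    by (auto simp: hom_smult hom_carrier intro: torus_distr_scale)
qed (auto simp: hom_zero hom_add hom_smult of_rat_mult of_rat_add of_rat_minus algebra_simps)

lemma cone_distrs_carrier: "cone_distrs d n P \<subseteq> carrier (hom_distr_mod d n)"
proof
  fix F assume "F \<in> cone_distrs d n P"
  then obtain C us ns where F: "F = cone_distr d C us ns" and C: "rational_cone d C"
    and us: "vlist d us" and ns: "exponents d n ns"
    by (auto simp: cone_distrs_def ordered_basis_iff)
  obtain K where K: "\<forall>\<nu>\<in>carrier_vec d. (\<forall>j<d. us ! j \<bullet> ivec \<nu> \<noteq> 0) \<longrightarrow> \<bar>rat_fun d us ns (ivec \<nu>)\<bar> \<le> K"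
    using rat_fun_bounded[OF us] by blast
  have "cmod (F \<nu>) \<le> real_of_rat (max K 0)" if "\<nu> \<in> carrier_vec d" for \<nu>
  proof -
    have "\<bar>cone_fun d C us ns (ivec \<nu>)\<bar> \<le> max K 0" using K that by (auto simp: cone_fun_def)
    then have "real_of_rat \<bar>cone_fun d C us ns (ivec \<nu>)\<bar> \<le> real_of_rat (max K 0)" by (simp only: of_rat_less_eq)
    moreover have "cmod (of_rat q) = real_of_rat \<bar>q\<bar>" for q
    proof -
      have "(of_rat q :: complex) = of_real (real_of_rat q)" by (cases q) (simp add: of_rat_rat)
      then show ?thesis by (simp only: norm_of_real) (simp add: abs_rat_def abs_if of_rat_minus)
    qed
    ultimately show ?thesis using that by (simp add: F cone_distr_cone_fun)
  qed
  then have t: "F \<in> torus_distr d" by (intro torus_distr_bounded) (auto simp: F cone_distr_cone_fun)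
  have "F (int N \<cdot>\<^sub>v \<nu>) = F \<nu> / of_nat N ^ n" if N: "0 < N" and nu: "\<nu> \<in> carrier_vec d" for N \<nu>
  proof -
    have "ivec (int N \<cdot>\<^sub>v \<nu>) = of_nat N \<cdot>\<^sub>v ivec \<nu>" by (rule eq_vecI) auto
    then show ?thesis
      using cone_fun_smult[OF C us ns, of "of_nat N" "ivec \<nu>"] N nu
      by (simp add: F cone_distr_cone_fun of_rat_divide of_rat_power)
  qed
  then show "F \<in> carrier (hom_distr_mod d n)" using t by (auto simp: hom_carrier)
qed

section \<open>The filtration and the kernel of the map to the top graded piece\<close>

lemma qspan_mono:
  "qvs V \<Longrightarrow> S \<subseteq> T \<Longrightarrow> T \<subseteq> carrier V \<Longrightarrow> rat_span V S \<subseteq> rat_span V T"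
  by (meson qspan_least qspan_sub qspan_superset subset_trans)

lemma cone_distrs_mono: "(\<And>C. P C \<Longrightarrow> Q C) \<Longrightarrow> cone_distrs d n P \<subseteq> cone_distrs d n Q"
  by (fastforce simp: cone_distrs_def)

definition SLc :: "nat \<Rightarrow> nat \<Rightarrow> (int vec \<Rightarrow> complex) set" where
  "SLc d n = rat_span (hom_distr_mod d n) (cone_distrs d n (\<lambda>C. True))"

text \<open>The functions whose class in the top graded piece is zero, by
  \<open>gr_top_class_zero_iff\<close>. It replaces reasoning with cosets of cosets.\<close>

definition low_or_line :: "nat \<Rightarrow> nat \<Rightarrow> (int vec \<Rightarrow> complex) set" where
  "low_or_line d n = rat_span (hom_distr_mod d n)
     (cone_distrs d n (\<lambda>C. cone_dim d C < d \<or> contains_subspace d 1 C))"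

lemma SLc_sub: "qsub (SLc d n) (hom_distr_mod d n)"
  unfolding SLc_def by (rule qspan_sub[OF hom_qvs cone_distrs_carrier])

lemma low_or_line_sub: "qsub (low_or_line d n) (hom_distr_mod d n)"
  unfolding low_or_line_def by (rule qspan_sub[OF hom_qvs cone_distrs_carrier])

lemma low_dim_span_sub: "qsub (low_dim_span d n) (hom_distr_mod d n)"
  unfolding low_dim_span_def by (rule qspan_sub[OF hom_qvs cone_distrs_carrier])

lemma SLc_qvs: "qvs (SL_span d n)"
  using qsub_qvs[OF hom_qvs SLc_sub] by (simp add: SL_span_def SLc_def)

lemma SL_span_simps:
  "carrier (SL_span d n) = SLc d n" "\<zero>\<^bsub>SL_span d n\<^esub> = (\<lambda>\<nu>. 0)"
  "F \<oplus>\<^bsub>SL_span d n\<^esub> G = (\<lambda>\<nu>. F \<nu> + G \<nu>)" "c \<odot>\<^bsub>SL_span d n\<^esub> F = (\<lambda>\<nu>. of_rat c * F \<nu>)"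
  by (simp_all add: SL_span_def SLc_def hom_distr_mod_def)

lemma low_subset: "low_dim_span d n \<subseteq> SLc d n" and low_or_line_subset: "low_or_line d n \<subseteq> SLc d n"
  and low_subset_low_or_line: "low_dim_span d n \<subseteq> low_or_line d n"
  unfolding low_dim_span_def SLc_def low_or_line_def
  by (intro qspan_mono hom_qvs cone_distrs_carrier cone_distrs_mono; blast)+

lemma qsub_SL: "qsub N (hom_distr_mod d n) \<Longrightarrow> N \<subseteq> SLc d n \<Longrightarrow> qsub N (SL_span d n)"
  by (rule qsubI[OF SLc_qvs])
    (auto simp: SL_span_simps submodule_def hom_zero hom_add hom_smult)

lemma SL_mod_qvs: "qvs (SL_mod d n)"
  unfolding SL_mod_def by (rule quot_qvs[OF SLc_qvs qsub_SL[OF low_dim_span_sub low_subset]])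

lemma SL_class_qlin: "qlin (SL_span d n) (SL_mod d n) (SL_class d n)"
  unfolding SL_mod_def SL_class_def[abs_def]
  by (rule quot_qlin[OF SLc_qvs qsub_SL[OF low_dim_span_sub low_subset]])

lemma SL_mod_carrier: "carrier (SL_mod d n) = SL_class d n ` SLc d n"
  unfolding SL_mod_def SL_class_def[abs_def]
  using quot_carrier[OF SLc_qvs qsub_SL[OF low_dim_span_sub low_subset]] by (simp add: SL_span_simps)

lemma SL_class_image: "S \<subseteq> SLc d n \<Longrightarrow> SL_class d n ` S \<subseteq> carrier (SL_mod d n)"
  by (auto simp: SL_mod_carrier)

lemma SL_class_zero_iff: "F \<in> SLc d n \<Longrightarrow> SL_class d n F = \<zero>\<^bsub>SL_mod d n\<^esub> \<longleftrightarrow> F \<in> low_dim_span d n"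
  unfolding SL_mod_def SL_class_def
  using coset_zero_iff[OF SLc_qvs qsub_SL[OF low_dim_span_sub low_subset]]
    quot_zero[OF SLc_qvs qsub_SL[OF low_dim_span_sub low_subset]] by (simp add: SL_span_simps)

lemma cone_distrs_SLc: "cone_distrs d n P \<subseteq> SLc d n"
  using cone_distrs_mono[of P "\<lambda>_. True" d n] qspan_superset[OF hom_qvs cone_distrs_carrier]
  unfolding SLc_def by blast

lemma qspan_image:
  assumes f: "qlin V W f" and S: "S \<subseteq> carrier V" and y: "y \<in> rat_span W (f ` S)"
  obtains x where "x \<in> rat_span V S" "y = f x"
proof -
  have fS: "f ` S \<subseteq> carrier W" using S qlin_closed[OF f] by auto
  have sub: "qsub (rat_span V S) V" by (rule qspan_sub[OF qlin_dom[OF f] S])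
  have "\<exists>x\<in>rat_span V S. y = f x"
    using y fS
  proof (induction rule: qspan_induct[OF qlin_cod[OF f], consumes 2, case_names zero base add smult])
    case zero
    then show ?case using qsub_zero[OF sub] qlin_zero[OF f] by force
  next
    case (base s)
    then show ?case using qspan_superset[OF qlin_dom[OF f] S] by auto
  next
    case (add x y)
    then obtain a b where ab: "a \<in> rat_span V S" "x = f a" "b \<in> rat_span V S" "y = f b" by blast
    then have "f (a \<oplus>\<^bsub>V\<^esub> b) = x \<oplus>\<^bsub>W\<^esub> y" using qsub_subset[OF sub] by (auto simp: qlin_add[OF f] subset_iff)
    then show ?case using qsub_add[OF sub ab(1,3)] by (intro bexI[of _ "a \<oplus>\<^bsub>V\<^esub> b"]) auto
  next
    case (smult c x)
    then obtain a where a: "a \<in> rat_span V S" "x = f a" by blast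
    then have "f (c \<odot>\<^bsub>V\<^esub> a) = c \<odot>\<^bsub>W\<^esub> x" using qsub_subset[OF sub] by (auto simp: qlin_smult[OF f] subset_iff)
    then show ?case using qsub_smult[OF sub a(1)] by (intro bexI[of _ "c \<odot>\<^bsub>V\<^esub> a"]) auto
  qed
  then show thesis using that by blast
qed

text \<open>The condition for step \<open>d\<close> asks for a subspace of dimension zero, which
  every cone contains.\<close>

lemma SL_filt_top: "SL_filt d n d = carrier (SL_mod d n)"
proof
  show "SL_filt d n d \<subseteq> carrier (SL_mod d n)"
    unfolding SL_filt_def by (rule qspan_carrier[OF SL_mod_qvs SL_class_image[OF cone_distrs_SLc]])
  let ?S = "cone_distrs d n (contains_subspace d (d - d))"
  have "cone_distrs d n (\<lambda>_. True) \<subseteq> ?S"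
  proof
    fix F assume "F \<in> cone_distrs d n (\<lambda>_. True)"
    then obtain C us ns where "F = cone_distr d C us ns" "rational_cone d C" "ordered_basis d us" "exponents d n ns"
      by (auto simp: cone_distrs_def)
    moreover have "contains_subspace d (d - d) C"
      using \<open>rational_cone d C\<close> contains_zero_subspace by (auto simp: rational_cone_def)
    ultimately show "F \<in> ?S" unfolding cone_distrs_def by blast
  qed
  have sub: "qsub (SL_filt d n d) (SL_mod d n)"
    unfolding SL_filt_def by (rule qspan_sub[OF SL_mod_qvs SL_class_image[OF cone_distrs_SLc]])
  have "SL_class d n F \<in> SL_filt d n d" if "F \<in> SLc d n" for F
  proof -
    have "qsub {F \<in> SLc d n. SL_class d n F \<in> SL_filt d n d} (SL_span d n)"
      using qlin_vimage_sub[OF SL_class_qlin sub] by (simp add: SL_span_simps)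
    then have "qsub {F \<in> SLc d n. SL_class d n F \<in> SL_filt d n d} (hom_distr_mod d n)"
      using qsub_subset[OF SLc_sub] by (intro qsubI[OF hom_qvs]) (auto simp: submodule_def SL_span_simps hom_zero hom_add hom_smult)
    then have "SLc d n \<subseteq> {F \<in> SLc d n. SL_class d n F \<in> SL_filt d n d}"
      unfolding SLc_def[of d n]
      apply (rule qspan_least[OF hom_qvs, rotated])
      using \<open>cone_distrs d n (\<lambda>_. True) \<subseteq> ?S\<close> cone_distrs_SLc[of d n "\<lambda>_. True"]
        qspan_superset[OF SL_mod_qvs SL_class_image[OF cone_distrs_SLc]]
      unfolding SL_filt_def SLc_def by blast
    then show ?thesis using that by auto
  qed
  then show "carrier (SL_mod d n) \<subseteq> SL_filt d n d" by (auto simp: SL_mod_carrier)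
qed

lemma SL_filt_sub: "qsub (SL_filt d n k) (SL_mod d n)"
  unfolding SL_filt_def by (rule qspan_sub[OF SL_mod_qvs SL_class_image[OF cone_distrs_SLc]])

lemma gr_top_eq: "gr_top d n = quot_mod (SL_mod d n) (SL_filt d n (d - 1))"
  by (simp add: gr_top_def SL_filt_top)

lemma gr_top_class_eq: "gr_top_class d n F = SL_filt d n (d - 1) +>\<^bsub>SL_mod d n\<^esub> SL_class d n F"
  by (simp add: gr_top_class_def SL_filt_top)

lemma gr_top_qvs: "qvs (gr_top d n)"
  unfolding gr_top_eq by (rule quot_qvs[OF SL_mod_qvs SL_filt_sub])

lemma gr_top_class_qlin: "qlin (SL_span d n) (gr_top d n) (gr_top_class d n)"
  unfolding gr_top_eq gr_top_class_eq[abs_def]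
  by (rule qlin_comp[OF SL_class_qlin quot_qlin[OF SL_mod_qvs SL_filt_sub]])

lemma gr_top_carrier: "carrier (gr_top d n) = gr_top_class d n ` SLc d n"
  unfolding gr_top_eq gr_top_class_eq[abs_def] quot_carrier[OF SL_mod_qvs SL_filt_sub] SL_mod_carrier by auto

text \<open>The two quotients are taken in succession: cones of lower dimension are divided out
  first, then classes of cones with a line. The preimage of zero is the span of both families
  together.\<close>

lemma gr_top_class_zero_iff:
  assumes d: "1 \<le> d" and F: "F \<in> SLc d n"
  shows "gr_top_class d n F = \<zero>\<^bsub>gr_top d n\<^esub> \<longleftrightarrow> F \<in> low_or_line d n"
proof -
  let ?L = "cone_distrs d n (contains_subspace d (d - (d - 1)))"
  \<comment> \<open>This uses \<open>1 \<le> d\<close>; with truncated subtraction the value for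
    \<open>d = 0\<close> would be 0.\<close>
  have one: "d - (d - 1) = 1" using d by simp
  have L1: "rat_span (hom_distr_mod d n) ?L \<subseteq> low_or_line d n"
    unfolding low_or_line_def one by (intro qspan_mono hom_qvs cone_distrs_carrier cone_distrs_mono) auto
  have spans: "rat_span (SL_span d n) ?L \<subseteq> low_or_line d n"
    using L1 qspan_superset[OF hom_qvs cone_distrs_carrier, of d n "contains_subspace d (d - (d - 1))"]
    by (intro qspan_least[OF SLc_qvs _ qsub_SL[OF low_or_line_sub low_or_line_subset]]) auto
  have "gr_top_class d n F = \<zero>\<^bsub>gr_top d n\<^esub> \<longleftrightarrow> SL_class d n F \<in> SL_filt d n (d - 1)"
    unfolding gr_top_class_eq gr_top_eq quot_zero[OF SL_mod_qvs SL_filt_sub]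
    by (rule coset_zero_iff[OF SL_mod_qvs SL_filt_sub]) (use F in \<open>auto simp: SL_mod_carrier\<close>)
  also have "\<dots> \<longleftrightarrow> F \<in> low_or_line d n"
  proof
    assume "SL_class d n F \<in> SL_filt d n (d - 1)"
    then obtain G where G: "G \<in> rat_span (SL_span d n) ?L" "SL_class d n F = SL_class d n G"
      unfolding SL_filt_def
      by (rule qspan_image[OF SL_class_qlin, rotated]) (auto simp: SL_span_simps cone_distrs_SLc[THEN subsetD])
    have GL: "G \<in> low_or_line d n" using G spans by auto
    have Gc: "G \<in> SLc d n" using GL low_or_line_subset by auto
    have "F \<oplus>\<^bsub>SL_span d n\<^esub> (-1) \<odot>\<^bsub>SL_span d n\<^esub> G \<in> low_dim_span d n"
      using coset_eq_iff[OF SLc_qvs qsub_SL[OF low_dim_span_sub low_subset], where x = F and y = G] F Gc G(2)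
      by (simp add: SL_span_simps(1) SL_class_def)
    then have "(\<lambda>\<nu>. F \<nu> - G \<nu>) \<in> low_or_line d n" using low_subset_low_or_line by (auto simp: SL_span_simps of_rat_minus)
    from qsub_add[OF low_or_line_sub this GL] show "F \<in> low_or_line d n" by (simp add: hom_add)
  next
    assume "F \<in> low_or_line d n"
    have "qsub {F \<in> SLc d n. SL_class d n F \<in> SL_filt d n (d - 1)} (SL_span d n)"
      using qlin_vimage_sub[OF SL_class_qlin SL_filt_sub] by (simp add: SL_span_simps)
    then have sub: "qsub {F \<in> SLc d n. SL_class d n F \<in> SL_filt d n (d - 1)} (hom_distr_mod d n)"
      using qsub_subset[OF SLc_sub] by (intro qsubI[OF hom_qvs]) (auto simp: submodule_def SL_span_simps hom_zero hom_add hom_smult)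
    have "low_or_line d n \<subseteq> {F \<in> SLc d n. SL_class d n F \<in> SL_filt d n (d - 1)}"
      unfolding low_or_line_def
    proof (rule qspan_least[OF hom_qvs _ sub], rule subsetI)
      fix G assume G: "G \<in> cone_distrs d n (\<lambda>C. cone_dim d C < d \<or> contains_subspace d 1 C)"
      then have Gc: "G \<in> SLc d n" using cone_distrs_SLc by auto
      from G consider "G \<in> cone_distrs d n (\<lambda>C. cone_dim d C < d)" | "G \<in> ?L"
        unfolding one cone_distrs_def by blast
      then have "SL_class d n G \<in> SL_filt d n (d - 1)"
      proof cases
        case 1
        then have "G \<in> low_dim_span d n"
          using qspan_superset[OF hom_qvs cone_distrs_carrier] unfolding low_dim_span_def by blast
        then show ?thesis using SL_class_zero_iff[OF Gc] qsub_zero[OF SL_filt_sub] by simp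
      next
        case 2
        then show ?thesis unfolding SL_filt_def
          using qspan_superset[OF SL_mod_qvs SL_class_image[OF cone_distrs_SLc]] by blast
      qed
      then show "G \<in> {F \<in> SLc d n. SL_class d n F \<in> SL_filt d n (d - 1)}" using Gc by simp
    qed
    then show "SL_class d n F \<in> SL_filt d n (d - 1)" using \<open>F \<in> low_or_line d n\<close> by auto
  qed
  finally show ?thesis .
qed

text \<open>Removing the lattice points on one hyperplane changes a cone distribution by a cone
  distribution supported on that hyperplane.\<close>
lemma generic_zero_low:
  assumes F: "F \<in> SLc d n" and H: "finite H" "H \<subseteq> carrier_vec d - {0\<^sub>v d}"
    and z: "\<And>\<nu>. \<nu> \<in> carrier_vec d \<Longrightarrow> (\<And>h. h \<in> H \<Longrightarrow> h \<bullet> ivec \<nu> \<noteq> 0) \<Longrightarrow> F \<nu> = 0"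
  shows "F \<in> low_dim_span d n"
proof -
  have step: "(\<lambda>\<nu>. if h \<bullet> ivec \<nu> = 0 then F \<nu> else 0) \<in> low_dim_span d n"
    if F: "F \<in> SLc d n" and h: "h \<in> carrier_vec d" "h \<noteq> 0\<^sub>v d" for F h
    using F[unfolded SLc_def] cone_distrs_carrier
  proof (induction rule: qspan_induct[OF hom_qvs, consumes 2, case_names zero base add smult])
    case zero
    show ?case using qsub_zero[OF low_dim_span_sub, of d n] unfolding hom_zero by simp
  next
    case (base F)
    then obtain C us ns where F: "F = cone_distr d C us ns" and C: "rational_cone d C"
      and us: "ordered_basis d us" and ns: "exponents d n ns" by (auto simp: cone_distrs_def)
    obtain gs where gs: "set gs \<subseteq> carrier_vec d" "C = cone_gen d gs" using C by (auto simp: rational_cone_def)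
    obtain hs where hs: "set hs \<subseteq> carrier_vec d" "\<And>g. g \<in> set hs \<Longrightarrow> h \<bullet> g = 0"
      "\<And>x. x \<in> carrier_vec d \<Longrightarrow> rvec x \<in> cone_gen d hs \<longleftrightarrow> rvec x \<in> cone_gen d gs \<and> h \<bullet> x = 0"
      using cone_gen_hyperplane[OF gs(1) h(1)] by blast
    have "(\<lambda>\<nu>. if h \<bullet> ivec \<nu> = 0 then F \<nu> else 0) = cone_distr d (cone_gen d hs) us ns"
      using hs(3) by (auto simp: F cone_distr_cone_fun cone_fun_def gs)
    moreover have "cone_dim d (cone_gen d hs) < d"
      using cone_dim_less_iff[OF hs(1)] h hs(2) by blast
    ultimately have "(\<lambda>\<nu>. if h \<bullet> ivec \<nu> = 0 then F \<nu> else 0) \<in> cone_distrs d n (\<lambda>C. cone_dim d C < d)"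
      using us ns hs(1) by (auto simp: cone_distrs_def rational_cone_def)
    then show ?case using qspan_superset[OF hom_qvs cone_distrs_carrier] unfolding low_dim_span_def by blast
  next
    case (add F G)
    have "(\<lambda>\<nu>. if h \<bullet> ivec \<nu> = 0 then (F \<oplus>\<^bsub>hom_distr_mod d n\<^esub> G) \<nu> else 0) =
      (\<lambda>\<nu>. (if h \<bullet> ivec \<nu> = 0 then F \<nu> else 0) + (if h \<bullet> ivec \<nu> = 0 then G \<nu> else 0))"
      by (auto simp: hom_add)
    then show ?case using qsub_add[OF low_dim_span_sub add(3,4)] by (simp add: hom_add)
  next
    case (smult c F)
    have "(\<lambda>\<nu>. if h \<bullet> ivec \<nu> = 0 then (c \<odot>\<^bsub>hom_distr_mod d n\<^esub> F) \<nu> else 0) =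
      (\<lambda>\<nu>. of_rat c * (if h \<bullet> ivec \<nu> = 0 then F \<nu> else 0))"
      by (auto simp: hom_smult)
    then show ?case using qsub_smult[OF low_dim_span_sub smult(2)] by (simp add: hom_smult)
  qed
  show ?thesis
    using H F z
  proof (induction H arbitrary: F rule: finite_induct)
    case empty
    have "F \<nu> = 0" for \<nu>
    proof (cases "\<nu> \<in> carrier_vec d")
      case True then show ?thesis using empty by simp
    next
      case False
      have "F \<in> carrier (hom_distr_mod d n)" using empty.prems(2) qsub_subset[OF SLc_sub] by blast
      then show ?thesis using False by (simp add: hom_carrier torus_distr_def)
    qed
    then have "F = (\<lambda>\<nu>. 0)" by (intro ext)
    then show ?case using qsub_zero[OF low_dim_span_sub, of d n] unfolding hom_zero by simp
  next
    case (insert h H)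
    let ?G = "\<lambda>\<nu>. if h \<bullet> ivec \<nu> = 0 then F \<nu> else 0"
    have G: "?G \<in> low_dim_span d n" using step insert.prems by auto
    have Gs: "?G \<in> SLc d n" using G low_subset by blast
    let ?F = "\<lambda>\<nu>. F \<nu> + of_rat (-1) * ?G \<nu>"
    have "(\<lambda>\<nu>. of_rat (-1) * ?G \<nu>) \<in> SLc d n"
      using qsub_smult[OF SLc_sub Gs, where c = "-1"] by (simp only: hom_smult)
    from qsub_add[OF SLc_sub insert.prems(2) this] have Fs: "?F \<in> SLc d n" by (simp only: hom_add)
    have "?F \<in> low_dim_span d n"
    proof (rule insert.IH[OF _ Fs])
      fix \<nu> :: "int vec" assume "\<nu> \<in> carrier_vec d" "\<And>h. h \<in> H \<Longrightarrow> h \<bullet> ivec \<nu> \<noteq> 0"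
      then show "?F \<nu> = 0"
        using insert.prems(3)[of \<nu>] by (cases "h \<bullet> ivec \<nu> = 0") (auto simp: of_rat_minus)
    qed (use insert.prems(1) in auto)
    from qsub_add[OF low_dim_span_sub this G] show ?case
      by (simp add: hom_add of_rat_minus)
  qed
qed

section \<open>Circuits\<close>

text \<open>Unique when it exists (\<open>dual_lists_unique\<close>) and unspecified when
  \<open>vs\<close> is not a basis; in the functions below the latter case is annihilated by a
  factor \<open>sgn 0\<close>, by \<open>1 / 0 = 0\<close>, or by an explicit case
  distinction.\<close>

definition dual :: "nat \<Rightarrow> rat vec list \<Rightarrow> rat vec list" where
  "dual d vs = (SOME us. dual_lists d us vs)"

lemma dual_lists_dual: "vlist d vs \<Longrightarrow> Det d vs \<noteq> 0 \<Longrightarrow> dual_lists d (dual d vs) vs"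
  unfolding dual_def using dual_lists_exists by (rule someI_ex)

lemma dual_eq: "dual_lists d us vs \<Longrightarrow> dual d vs = us"
  unfolding dual_def by (rule some_equality) (auto dest: dual_lists_unique)

lemma dual_lists_Det_nz: "dual_lists d us vs \<Longrightarrow> Det d vs \<noteq> 0"
  using dual_lists_Det by fastforce

lemma cone_gen_nonneg:
  assumes gs: "set gs \<subseteq> carrier_vec d" and h: "h \<in> carrier_vec d" and "\<And>g. g \<in> set gs \<Longrightarrow> 0 \<le> h \<bullet> g"
    and x: "x \<in> carrier_vec d" and m: "rvec x \<in> cone_gen d gs"
  shows "0 \<le> h \<bullet> x"
proof -
  obtain c where c: "\<And>g. g \<in> set gs \<Longrightarrow> 0 \<le> c g"
      "\<And>k. k < d \<Longrightarrow> rvec x $ k = (\<Sum>g\<in>set gs. c g * real_of_rat (g $ k))"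
    using m unfolding cone_gen_iff[OF gs] by blast
  have "real_of_rat (h \<bullet> x) = (\<Sum>g\<in>set gs. c g * real_of_rat (h \<bullet> g))"
    by (rule combination_sprod[OF h x, where v = "\<lambda>g. g"]) (use gs c(2) in auto)
  also have "\<dots> \<ge> 0" using c(1) assms(3) by (intro sum_nonneg mult_nonneg_nonneg) auto
  finally show ?thesis by simp
qed

section \<open>Signed cone indicators and pole functions of a basis\<close>

definition ind :: "real vec set \<Rightarrow> rat vec \<Rightarrow> rat" where
  "ind C x = of_bool (rvec x \<in> C)"

lemma ind_simplicial:
  assumes d: "dual_lists d us vs"
  shows "gen_all d (\<lambda>x. ind (cone_gen d vs) x = of_bool (\<forall>j<d. 0 < us ! j \<bullet> x))"
proof (rule gen_all_mono[OF gen_all_dual[OF d]])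
  fix x assume x: "x \<in> carrier_vec d" and g: "\<forall>j<d. us ! j \<bullet> x \<noteq> 0"
  have "rvec x \<in> cone_gen d vs \<longleftrightarrow> (\<forall>j<d. 0 < us ! j \<bullet> x)"
    unfolding simplicial_cone_iff[OF d x] using g by (metis less_le)
  then show "ind (cone_gen d vs) x = of_bool (\<forall>j<d. 0 < us ! j \<bullet> x)" unfolding ind_def by (rule arg_cong)
qed

text \<open>The contribution of the first Steinberg factor, on the open cone. Dependent lists give
  zero because of the sign factor.\<close>

definition chamber_fun :: "nat \<Rightarrow> rat vec list \<Rightarrow> rat vec \<Rightarrow> rat" where
  "chamber_fun d vs x = sgn (Det d vs) * of_bool (\<forall>j<d. 0 < dual d vs ! j \<bullet> x)"

text \<open>The contribution of the second Steinberg factor when all exponents are one. Dependent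
  lists give zero because \<open>1 / 0 = 0\<close>.\<close>

definition pole_fun :: "nat \<Rightarrow> rat vec list \<Rightarrow> rat vec \<Rightarrow> rat" where
  "pole_fun d ws x = 1 / Det d ws * (\<Prod>j<d. 1 / (dual d ws ! j \<bullet> x))"

lemma coords_eq:
  assumes v: "vlist d vs" and D: "Det d vs \<noteq> 0" and x: "x \<in> carrier_vec d"
    and e: "\<And>k. k < d \<Longrightarrow> x $ k = (\<Sum>i<d. e i * vs ! i $ k)" and j: "j < d"
  shows "dual d vs ! j \<bullet> x = e j"
  by (rule dual_lists_coord[OF dual_lists_dual[OF v D] x j e])

lemma coords_ex:
  assumes v: "vlist d vs" and D: "Det d vs \<noteq> 0" and x: "x \<in> carrier_vec d" and k: "k < d"
  shows "x $ k = (\<Sum>i<d. (dual d vs ! i \<bullet> x) * vs ! i $ k)"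
  by (rule dual_lists_expand[OF dual_lists_dual[OF v D] x k])

lemma dual_swap:
  assumes v: "vlist d vs" and D: "Det d vs \<noteq> 0" and ij: "i < d" "j < d" "i \<noteq> j"
  shows "dual d (vs[i := vs ! j, j := vs ! i]) = (dual d vs)[i := dual d vs ! j, j := dual d vs ! i]"
proof (rule dual_eq)
  note dd = dual_lists_dual[OF v D]
  have u: "vlist d (dual d vs)" using dd by (simp add: dual_lists_def)
  show "dual_lists d ((dual d vs)[i := dual d vs ! j, j := dual d vs ! i]) (vs[i := vs ! j, j := vs ! i])"
    unfolding dual_lists_def
  proof (intro conjI allI impI)
    fix a b assume ab: "a < d" "b < d"
    have uv: "dual d vs ! a \<bullet> vs ! b = (if a = b then 1 else 0)" if "a < d" "b < d" for a b
      using dd that by (simp add: dual_lists_def)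
    have l: "length vs = d" "length (dual d vs) = d" using u v by (auto simp: vlist_def)
    show "(dual d vs)[i := dual d vs ! j, j := dual d vs ! i] ! a \<bullet> vs[i := vs ! j, j := vs ! i] ! b = (if a = b then 1 else 0)"
      using ab ij l by (simp add: nth_list_update uv)
  qed (intro vlist_update u v vlist_nth[OF u] vlist_nth[OF v] ij)+
qed

lemma dual_scale:
  assumes v: "vlist d vs" and D: "Det d vs \<noteq> 0" and i: "i < d" and c: "c \<noteq> 0"
  shows "dual d (vs[i := c \<cdot>\<^sub>v vs ! i]) = (dual d vs)[i := (1 / c) \<cdot>\<^sub>v dual d vs ! i]"
proof (rule dual_eq)
  note dd = dual_lists_dual[OF v D]
  have u: "vlist d (dual d vs)" using dd by (simp add: dual_lists_def)
  have uv: "dual d vs ! a \<bullet> vs ! b = (if a = b then 1 else 0)" if "a < d" "b < d" for a b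
    using dd that by (simp add: dual_lists_def)
  have l: "length vs = d" "length (dual d vs) = d" using u v by (auto simp: vlist_def)
  show "dual_lists d ((dual d vs)[i := (1 / c) \<cdot>\<^sub>v dual d vs ! i]) (vs[i := c \<cdot>\<^sub>v vs ! i])"
    unfolding dual_lists_def
  proof (intro conjI allI impI)
    fix a b assume ab: "a < d" "b < d"
    show "(dual d vs)[i := (1 / c) \<cdot>\<^sub>v dual d vs ! i] ! a \<bullet> vs[i := c \<cdot>\<^sub>v vs ! i] ! b = (if a = b then 1 else 0)"
      using ab i c l uv vlist_nth[OF v ab(2)] vlist_nth[OF u ab(1)] vlist_nth[OF v i] vlist_nth[OF u i]
      by (auto simp: nth_list_update)
  qed (use u v i in \<open>auto intro!: vlist_update vlist_nth\<close>)
qed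

lemma pole_fun_swap:
  assumes v: "vlist d vs" and ij: "i < d" "j < d" "i \<noteq> j"
  shows "pole_fun d (vs[i := vs ! j, j := vs ! i]) x + pole_fun d vs x = 0"
proof (cases "Det d vs = 0")
  case True
  then show ?thesis using Det_swap[OF v ij] by (simp add: pole_fun_def)
next
  case False
  have l: "length (dual d vs) = d" using dual_lists_dual[OF v False] by (simp add: dual_lists_def vlist_def)
  have "(\<Prod>k<d. 1 / ((dual d vs)[i := dual d vs ! j, j := dual d vs ! i] ! k \<bullet> x)) = (\<Prod>k<d. 1 / (dual d vs ! k \<bullet> x))"
    by (rule prod.reindex_bij_witness[of _ "\<lambda>k. if k = i then j else if k = j then i else k"
          "\<lambda>k. if k = i then j else if k = j then i else k"])
      (use ij l in \<open>auto simp: nth_list_update\<close>)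
  then show ?thesis
    unfolding pole_fun_def Det_swap[OF v ij] dual_swap[OF v False ij] by simp
qed

lemma chamber_fun_swap:
  assumes v: "vlist d vs" and ij: "i < d" "j < d" "i \<noteq> j"
  shows "chamber_fun d (vs[i := vs ! j, j := vs ! i]) x + chamber_fun d vs x = 0"
proof (cases "Det d vs = 0")
  case True
  then show ?thesis using Det_swap[OF v ij] by (simp add: chamber_fun_def)
next
  case False
  have l: "length (dual d vs) = d" using dual_lists_dual[OF v False] by (simp add: dual_lists_def vlist_def)
  have "(\<forall>k<d. 0 < (dual d vs)[i := dual d vs ! j, j := dual d vs ! i] ! k \<bullet> x) \<longleftrightarrow> (\<forall>k<d. 0 < dual d vs ! k \<bullet> x)"
  proof (intro iffI allI impI)
    fix k assume a: "\<forall>k<d. 0 < (dual d vs)[i := dual d vs ! j, j := dual d vs ! i] ! k \<bullet> x" and "k < d"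
    then show "0 < dual d vs ! k \<bullet> x"
      using a[rule_format, of i] a[rule_format, of j] a[rule_format, of k] ij l
      by (auto simp: nth_list_update split: if_splits)
  next
    fix k assume "\<forall>k<d. 0 < dual d vs ! k \<bullet> x" "k < d"
    then show "0 < (dual d vs)[i := dual d vs ! j, j := dual d vs ! i] ! k \<bullet> x"
      using ij l by (auto simp: nth_list_update)
  qed
  then show ?thesis
    unfolding chamber_fun_def Det_swap[OF v ij] dual_swap[OF v False ij] by (simp add: sgn_minus)
qed

text \<open>The determinant is multiplied by \<open>c\<close> and one dual form by
  \<open>1 / c\<close>; the effects cancel.\<close>

lemma pole_fun_scale:
  assumes v: "vlist d vs" and i: "i < d" and c: "c \<noteq> 0" and x: "x \<in> carrier_vec d"
  shows "pole_fun d (vs[i := c \<cdot>\<^sub>v vs ! i]) x = pole_fun d vs x"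
proof (cases "Det d vs = 0")
  case True
  then show ?thesis using Det_scale[OF v i] by (simp add: pole_fun_def)
next
  case False
  have u: "vlist d (dual d vs)" using dual_lists_dual[OF v False] by (simp add: dual_lists_def)
  then have l: "length (dual d vs) = d" by (simp add: vlist_def)
  have ui: "dual d vs ! i \<in> carrier_vec d" by (rule vlist_nth[OF u i])
  have "(\<Prod>k<d. 1 / ((dual d vs)[i := (1 / c) \<cdot>\<^sub>v dual d vs ! i] ! k \<bullet> x)) = c * (\<Prod>k<d. 1 / (dual d vs ! k \<bullet> x))"
    using i l ui x c by (subst (1 2) prod.remove[of _ i]) (auto simp: nth_list_update intro!: prod.cong)
  then show ?thesis
    unfolding pole_fun_def Det_scale[OF v i] dual_scale[OF v False i c] using c by simp
qed

text \<open>For positive \<open>c\<close> nothing changes. For negative \<open>c\<close> the two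
  open cones are the halves of the cone generated by \<open>vs\<close> and the negative of
  \<open>vs ! i\<close>, and they carry opposite signs; their difference is, off the walls, a
  multiple of the indicator of that cone, which contains the line through
  \<open>vs ! i\<close>.\<close>

lemma chamber_fun_scale:
  assumes v: "vlist d vs" and i: "i < d" and c: "c \<noteq> 0" and nz: "set vs \<subseteq> - {0\<^sub>v d}"
  shows "\<exists>gs \<kappa>. set gs \<subseteq> carrier_vec d \<and> (\<kappa> = 0 \<or> contains_subspace d 1 (cone_gen d gs)) \<and>
    gen_all d (\<lambda>x. chamber_fun d (vs[i := c \<cdot>\<^sub>v vs ! i]) x - chamber_fun d vs x = \<kappa> * ind (cone_gen d gs) x)"
proof (cases "Det d vs = 0 \<or> 0 < c")
  case True
  have "chamber_fun d (vs[i := c \<cdot>\<^sub>v vs ! i]) x - chamber_fun d vs x = 0" if x: "x \<in> carrier_vec d" for x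
  proof (cases "Det d vs = 0")
    case True
    then show ?thesis using Det_scale[OF v i] by (simp add: chamber_fun_def)
  next
    case False
    then have c: "0 < c" using True by simp
    have u: "vlist d (dual d vs)" using dual_lists_dual[OF v False] by (simp add: dual_lists_def)
    then have l: "length (dual d vs) = d" by (simp add: vlist_def)
    have ui: "dual d vs ! i \<in> carrier_vec d" by (rule vlist_nth[OF u i])
    have "0 < (dual d vs)[i := (1 / c) \<cdot>\<^sub>v dual d vs ! i] ! k \<bullet> x \<longleftrightarrow> 0 < dual d vs ! k \<bullet> x" if "k < d" for k
      using that i l ui x c by (auto simp: nth_list_update zero_less_divide_iff)
    then have "(\<forall>k<d. 0 < (dual d vs)[i := (1 / c) \<cdot>\<^sub>v dual d vs ! i] ! k \<bullet> x) \<longleftrightarrow> (\<forall>k<d. 0 < dual d vs ! k \<bullet> x)"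
      by blast
    then show ?thesis
      unfolding chamber_fun_def Det_scale[OF v i] dual_scale[OF v False i less_imp_neq[OF c, symmetric]]
      using c by (simp add: sgn_mult)
  qed
  then show ?thesis by (intro exI[of _ "[]"] exI[of _ 0]) (auto intro: gen_allI)
next
  case False
  then have D: "Det d vs \<noteq> 0" and c0: "c < 0" using c by auto
  note dd = dual_lists_dual[OF v D]
  have u: "vlist d (dual d vs)" using dd by (simp add: dual_lists_def)
  then have l: "length (dual d vs) = d" by (simp add: vlist_def)
  have uc: "dual d vs ! j \<in> carrier_vec d" if "j < d" for j by (rule vlist_nth[OF u that])
  have uv: "dual d vs ! a \<bullet> vs ! b = (if a = b then 1 else 0)" if "a < d" "b < d" for a b
    using dd that by (simp add: dual_lists_def)
  have vi: "vs ! i \<in> carrier_vec d" by (rule vlist_nth[OF v i])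
  have lv: "length vs = d" using v by (simp add: vlist_def)
  let ?gs = "vs @ [- (vs ! i)]"
  let ?vs' = "vs[i := (-1) \<cdot>\<^sub>v vs ! i]"
  have gs: "set ?gs \<subseteq> carrier_vec d" using v vi by (auto simp: vlist_def)
  have v': "vlist d ?vs'" by (rule vlist_update[OF v]) (use vi in simp)
  have dd': "dual_lists d ((dual d vs)[i := (-1) \<cdot>\<^sub>v dual d vs ! i]) ?vs'"
    using dual_lists_dual[OF v', unfolded dual_scale[OF v D i, of "-1", simplified]] Det_scale[OF v i, of "-1"] D by simp
  have sub': "set ?vs' \<subseteq> set ?gs"
    using set_update_subset_insert[of vs i "(-1) \<cdot>\<^sub>v vs ! i"] by (auto simp: uminus_vec_def smult_vec_def)
  have mem: "rvec x \<in> cone_gen d ?gs \<longleftrightarrow> (\<forall>j<d. j \<noteq> i \<longrightarrow> 0 \<le> dual d vs ! j \<bullet> x)" if x: "x \<in> carrier_vec d" for x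
  proof
    assume m: "rvec x \<in> cone_gen d ?gs"
    show "\<forall>j<d. j \<noteq> i \<longrightarrow> 0 \<le> dual d vs ! j \<bullet> x"
    proof (intro allI impI)
      fix j assume j: "j < d" "j \<noteq> i"
      have "0 \<le> dual d vs ! j \<bullet> g" if "g \<in> set ?gs" for g
        using that uv[OF j(1)] i j(2) lv uc[OF j(1)] vi by (auto simp: in_set_conv_nth)
      then show "0 \<le> dual d vs ! j \<bullet> x" by (rule cone_gen_nonneg[OF gs uc[OF j(1)] _ x m])
    qed
  next
    assume a: "\<forall>j<d. j \<noteq> i \<longrightarrow> 0 \<le> dual d vs ! j \<bullet> x"
    show "rvec x \<in> cone_gen d ?gs"
    proof (cases "0 \<le> dual d vs ! i \<bullet> x")
      case True
      then have "rvec x \<in> cone_gen d vs" unfolding simplicial_cone_iff[OF dd x] using a by auto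
      then show ?thesis using cone_gen_mono[of vs ?gs d] gs by auto
    next
      case False
      have "0 \<le> (dual d vs)[i := (-1) \<cdot>\<^sub>v dual d vs ! i] ! j \<bullet> x" if "j < d" for j
        using a l uc[OF i] x False that i by (cases "j = i") auto
      then have "rvec x \<in> cone_gen d ?vs'" unfolding simplicial_cone_iff[OF dd' x] by blast
      then show ?thesis using cone_gen_mono[OF sub' gs] by auto
    qed
  qed
  have vm: "vs ! i \<in> set vs" using i lv by auto
  have "contains_subspace d 1 (cone_gen d ?gs)"
    unfolding contains_line_iff[OF gs]
  proof (intro bexI conjI)
    show "vs ! i \<noteq> 0\<^sub>v d" using nz vm by blast
    show "rvec (- vs ! i) \<in> cone_gen d ?gs" by (rule cone_gen_member[OF gs]) simp
    show "vs ! i \<in> set ?gs" using vm by simp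
  qed
  moreover have "gen_all d (\<lambda>x. chamber_fun d (vs[i := c \<cdot>\<^sub>v vs ! i]) x - chamber_fun d vs x
      = - sgn (Det d vs) * ind (cone_gen d ?gs) x)"
  proof (rule gen_all_mono[OF gen_all_dual[OF dd]])
    fix x assume x: "x \<in> carrier_vec d" and g: "\<forall>j<d. dual d vs ! j \<bullet> x \<noteq> 0"
    let ?r = "\<forall>j<d. j \<noteq> i \<longrightarrow> 0 < dual d vs ! j \<bullet> x" and ?e = "dual d vs ! i \<bullet> x"
    have 1: "(\<forall>k<d. 0 < (dual d vs)[i := (1 / c) \<cdot>\<^sub>v dual d vs ! i] ! k \<bullet> x) \<longleftrightarrow> ?r \<and> ?e < 0"
      using i l uc[OF i] x c0 by (auto simp: nth_list_update zero_less_divide_iff)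
    have 2: "(\<forall>k<d. 0 < dual d vs ! k \<bullet> x) \<longleftrightarrow> ?r \<and> ?e > 0" using i by auto
    have 3: "rvec x \<in> cone_gen d ?gs \<longleftrightarrow> ?r" unfolding mem[OF x] using g by (auto simp: less_le)
    have "?e \<noteq> 0" using g i by simp
    then show "chamber_fun d (vs[i := c \<cdot>\<^sub>v vs ! i]) x - chamber_fun d vs x = - sgn (Det d vs) * ind (cone_gen d ?gs) x"
      unfolding chamber_fun_def ind_def Det_scale[OF v i] dual_scale[OF v D i c] 1 2 3
      using c0 by (auto simp: sgn_mult)
  qed
  ultimately show ?thesis using gs by blast
qed

text \<open>Up to sign this is the divided difference of the constant 1 at two or more
  nodes.\<close>

lemma lagrange_sum_zero:
  assumes "finite S" "2 \<le> card S" "inj_on z S"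
  shows "(\<Sum>i\<in>S. \<Prod>j\<in>S - {i}. 1 / (z j - z i :: 'a :: field)) = 0"
  using assms
proof (induction "card S" arbitrary: S rule: less_induct)
  case less
  let ?P = "\<lambda>S i. \<Prod>j\<in>S - {i}. 1 / (z j - z i)"
  obtain p where p: "p \<in> S" using less.prems(2) by fastforce
  then have "card (S - {p}) \<ge> 1" using less.prems by simp
  then obtain q where q: "q \<in> S" "q \<noteq> p" by (metis Diff_iff card.empty equals0I insertCI not_one_le_zero)
  have pq: "z p \<noteq> z q" using less.prems(3) p q by (auto dest: inj_onD)
  have R: "?P A i = 1 / (z k - z i) * ?P (A - {k}) i" if "A \<subseteq> S" "k \<in> A" "k \<noteq> i" for A k i
  proof -
    have "?P A i = 1 / (z k - z i) * (\<Prod>j\<in>A - {i} - {k}. 1 / (z j - z i))"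
      using that less.prems(1) finite_subset by (intro prod.remove) auto
    moreover have "A - {i} - {k} = A - {k} - {i}" by auto
    ultimately show ?thesis by (simp only:)
  qed
  \<comment> \<open>The recursion of divided differences, term by term: dropping \<open>q\<close>
    minus dropping \<open>p\<close>. After summation only the case of two nodes is not covered by
    induction, and there the two terms are equal.\<close>
  have step: "(z q - z p) * ?P S i = (if i = q then 0 else ?P (S - {q}) i) - (if i = p then 0 else ?P (S - {p}) i)"
    if i: "i \<in> S" for i
  proof -
    consider "i = p" | "i = q" | "i \<noteq> p" "i \<noteq> q" by blast
    then show ?thesis
    proof cases
      case 1
      then show ?thesis using R[of S q p] q pq by simp
    next
      case 2
      then show ?thesis using R[of S p q] p q pq by (simp add: field_simps)
    next
      case 3
      let ?T = "?P (S - {p} - {q}) i"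
      have ne: "z i \<noteq> z p" "z i \<noteq> z q" using less.prems(3) i p q 3 by (auto dest: inj_onD)
      have S: "S - {q} - {p} = S - {p} - {q}" by auto
      have e: "?P S i = 1 / (z p - z i) * (1 / (z q - z i) * ?T)" "?P (S - {p}) i = 1 / (z q - z i) * ?T"
        "?P (S - {q}) i = 1 / (z p - z i) * ?T"
        using R[of S p i] R[of "S - {p}" q i] R[of "S - {q}" p i] p q 3 S by auto
      show ?thesis unfolding e using 3 ne by (simp add: field_simps)
    qed
  qed
  have "(z q - z p) * (\<Sum>i\<in>S. ?P S i) = (\<Sum>i\<in>S. if i = q then 0 else ?P (S - {q}) i) - (\<Sum>i\<in>S. if i = p then 0 else ?P (S - {p}) i)"
    unfolding sum_distrib_left sum_subtractf[symmetric] by (rule sum.cong[OF refl step])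
  also have "\<dots> = sum (?P (S - {q})) (S - {q}) - sum (?P (S - {p})) (S - {p})"
    using less.prems(1) by (intro arg_cong2[where f = minus] sum.mono_neutral_cong_right) auto
  also have "\<dots> = 0"
  proof (cases "card S = 2")
    case True
    have cq: "card (S - {q}) = 1" and cp: "card (S - {p}) = 1" using True p q less.prems by auto
    have "S - {q} = {p}" using cq p q by (metis Diff_iff card_1_singletonE singletonD)
    moreover have "S - {p} = {q}" using cp p q by (metis Diff_iff card_1_singletonE singletonD)
    ultimately show ?thesis by simp
  next
    case False
    then have "sum (?P (S - {q})) (S - {q}) = 0" "sum (?P (S - {p})) (S - {p}) = 0"
      using less.prems p q by (auto intro!: less.hyps dest: inj_on_subset simp: card_gt_0_iff)
    then show ?thesis by simp
  qed
  finally show ?case using pq by simp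
qed

text \<open>Only the minimiser of \<open>z\<close> on \<open>A\<close> can contribute.\<close>

lemma sum_least_above:
  fixes z :: "nat \<Rightarrow> 'a :: linorder"
  assumes A: "finite A" "inj_on z A"
  shows "(\<Sum>k\<in>A. of_bool ((\<forall>j\<in>A - {k}. z k < z j) \<and> (\<forall>j\<in>B. z j < z k)))
    = (of_bool (A \<noteq> {} \<and> (\<forall>j\<in>B. \<forall>k\<in>A. z j < z k)) :: rat)"
proof (cases "A = {}")
  case False
  define p where "p = arg_min_on z A"
  have p: "p \<in> A" unfolding p_def by (rule arg_min_if_finite(1)[OF A(1) False])
  have le: "z p \<le> z k" if "k \<in> A" for k using arg_min_least[OF A(1) False that] by (simp add: p_def)
  then have lt: "z p < z k" if "k \<in> A" "k \<noteq> p" for k using A(2) p that by (auto simp: less_le dest: inj_onD)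
  have "(\<Sum>k\<in>A. of_bool ((\<forall>j\<in>A - {k}. z k < z j) \<and> (\<forall>j\<in>B. z j < z k)))
    = (\<Sum>k\<in>A. if k = p then of_bool (\<forall>j\<in>B. z j < z p) else (0 :: rat))"
  proof (rule sum.cong[OF refl])
    fix k assume k: "k \<in> A"
    have "\<not> (\<forall>j\<in>A - {k}. z k < z j)" if "k \<noteq> p"
    proof
      assume "\<forall>j\<in>A - {k}. z k < z j"
      then have "z k < z p" using p that by simp
      then show False using le[OF k] by simp
    qed
    then show "of_bool ((\<forall>j\<in>A - {k}. z k < z j) \<and> (\<forall>j\<in>B. z j < z k)) = (if k = p then of_bool (\<forall>j\<in>B. z j < z p) else (0 :: rat))"
      using lt by auto
  qed
  also have "\<dots> = of_bool (\<forall>j\<in>B. z j < z p)" using A(1) p by simp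
  also have "(\<forall>j\<in>B. z j < z p) \<longleftrightarrow> (\<forall>j\<in>B. \<forall>k\<in>A. z j < z k)" using p le less_le_trans by blast
  finally show ?thesis using False by simp
qed simp

text \<open>A positive index contributes when its \<open>z\<close> is least among the positive
  indices and above all negative ones; a negative index contributes when its \<open>z\<close> is
  greatest among the negative indices and below all positive ones. If both signs occur, either both
  contributions are present and cancel, or neither is. If one sign occurs, exactly one index
  contributes.\<close>

lemma good_sum:
  fixes a z :: "nat \<Rightarrow> rat"
  assumes S: "finite S" "S \<noteq> {}" and nz: "\<And>k. k \<in> S \<Longrightarrow> a k \<noteq> 0" and z: "inj_on z S"
  shows "(\<Sum>k\<in>S. sgn (a k) * of_bool (\<forall>j\<in>S - {k}. 0 < a j * (z j - z k)))
    = (if \<forall>k\<in>S. 0 < a k then 1 else if \<forall>k\<in>S. a k < 0 then - 1 else 0)"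
proof -
  let ?g = "\<lambda>k. \<forall>j\<in>S - {k}. 0 < a j * (z j - z k)"
  let ?P = "{k \<in> S. 0 < a k}" and ?N = "{k \<in> S. a k < 0}"
  have fin: "finite ?P" "finite ?N" using S by auto
  have SPN: "S = ?P \<union> ?N" using nz by force
  have pos: "0 < a j * (z j - z k) \<longleftrightarrow> (if 0 < a j then z k < z j else z j < z k)" if "j \<in> S" for j k
    using nz[OF that] by (auto simp: zero_less_mult_iff)
  have gP: "?g k \<longleftrightarrow> (\<forall>j\<in>?P - {k}. z k < z j) \<and> (\<forall>j\<in>?N. z j < z k)" if "k \<in> ?P" for k
    using that nz by (auto simp: pos not_less le_less)
  have gN: "?g k \<longleftrightarrow> (\<forall>j\<in>?N - {k}. - z k < - z j) \<and> (\<forall>j\<in>?P. - z j < - z k)" if "k \<in> ?N" for k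
    using that nz by (auto simp: pos not_less le_less)
  have "(\<Sum>k\<in>S. sgn (a k) * of_bool (?g k)) = (\<Sum>k\<in>?P. sgn (a k) * of_bool (?g k)) + (\<Sum>k\<in>?N. sgn (a k) * of_bool (?g k))"
    using fin by (subst SPN) (intro sum.union_disjoint, auto)
  also have "(\<Sum>k\<in>?P. sgn (a k) * of_bool (?g k)) = (\<Sum>k\<in>?P. of_bool ((\<forall>j\<in>?P - {k}. z k < z j) \<and> (\<forall>j\<in>?N. z j < z k)))"
  proof (rule sum.cong[OF refl])
    fix k assume k: "k \<in> ?P"
    then have "sgn (a k) = 1" by simp
    then show "sgn (a k) * of_bool (?g k) = of_bool ((\<forall>j\<in>?P - {k}. z k < z j) \<and> (\<forall>j\<in>?N. z j < z k))"
      unfolding gP[OF k] by simp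
  qed
  also have "\<dots> = of_bool (?P \<noteq> {} \<and> (\<forall>j\<in>?N. \<forall>k\<in>?P. z j < z k))"
    using z by (intro sum_least_above fin) (rule inj_on_subset, auto)
  also have "(\<Sum>k\<in>?N. sgn (a k) * of_bool (?g k)) = - (\<Sum>k\<in>?N. of_bool ((\<forall>j\<in>?N - {k}. - z k < - z j) \<and> (\<forall>j\<in>?P. - z j < - z k)))"
    unfolding sum_negf[symmetric]
  proof (rule sum.cong[OF refl])
    fix k assume k: "k \<in> ?N"
    then have "sgn (a k) = - 1" by simp
    then show "sgn (a k) * of_bool (?g k) = - of_bool ((\<forall>j\<in>?N - {k}. - z k < - z j) \<and> (\<forall>j\<in>?P. - z j < - z k))"
      unfolding gN[OF k] by simp
  qed
  also have "(\<Sum>k\<in>?N. of_bool ((\<forall>j\<in>?N - {k}. - z k < - z j) \<and> (\<forall>j\<in>?P. - z j < - z k)))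
      = (of_bool (?N \<noteq> {} \<and> (\<forall>j\<in>?P. \<forall>k\<in>?N. - z j < - z k)) :: rat)"
    using z by (intro sum_least_above fin) (auto simp: inj_on_def)
  also have "(\<forall>j\<in>?P. \<forall>k\<in>?N. - z j < - z k) \<longleftrightarrow> (\<forall>j\<in>?N. \<forall>k\<in>?P. z j < z k)" by auto
  finally have s: "(\<Sum>k\<in>S. sgn (a k) * of_bool (?g k)) = of_bool (?P \<noteq> {} \<and> (\<forall>j\<in>?N. \<forall>k\<in>?P. z j < z k))
      + - of_bool (?N \<noteq> {} \<and> (\<forall>j\<in>?N. \<forall>k\<in>?P. z j < z k))" .
  have c: "(\<forall>k\<in>S. 0 < a k) \<longleftrightarrow> ?N = {}" "(\<forall>k\<in>S. a k < 0) \<longleftrightarrow> ?P = {}"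
    using nz by (auto simp: not_less le_less)
  have "?P \<noteq> {} \<or> ?N \<noteq> {}" using SPN S(2) by blast
  then show ?thesis unfolding s c by auto
qed

section \<open>The circuit relation among \<open>d + 1\<close> vectors, with signed maximal minors
  \<open>a\<close> as coefficients\<close>

context
  fixes d :: nat and vs :: "rat vec list" and a :: "nat \<Rightarrow> rat"
  assumes l: "length vs = Suc d" and vc: "set vs \<subseteq> carrier_vec d"
  defines "a \<equiv> \<lambda>k. (-1) ^ k * Det d (omit k vs)"
begin

lemma circuit_vlist: "k \<le> d \<Longrightarrow> vlist d (omit k vs)"
  by (rule vlist_omit[OF l vc])

lemma circuit_nth: "k \<le> d \<Longrightarrow> p < d \<Longrightarrow> omit k vs ! p = vs ! (if p < k then p else Suc p)"
  using l by (simp add: nth_omit)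

lemma circuit_relation: "m < d \<Longrightarrow> (\<Sum>j\<le>d. a j * vs ! j $ m) = 0"
  using Det_omit_relation[OF l vc] by (simp add: a_def)

text \<open>Fix coefficients \<open>c\<close> expressing \<open>x\<close> through all
  \<open>d + 1\<close> vectors, with \<open>c k0 = 0\<close>. Subtracting \<open>c k / a k\<close>
  times the relation eliminates vector \<open>k\<close> and leaves the coordinates of
  \<open>x\<close> in the basis without \<open>k\<close>.\<close>

lemma circuit_coords:
  assumes k0: "k0 \<le> d" "a k0 \<noteq> 0" and x: "x \<in> carrier_vec d"
  obtains c where
    "\<And>k p. k \<le> d \<Longrightarrow> a k \<noteq> 0 \<Longrightarrow> p < d \<Longrightarrow> dual d (omit k vs) ! p \<bullet> x =
      c (if p < k then p else Suc p) - c k * a (if p < k then p else Suc p) / a k"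
proof -
  have D: "Det d (omit k vs) \<noteq> 0" if "a k \<noteq> 0" for k using that by (auto simp: a_def)
  define c where "c j = (if j = k0 then 0 else dual d (omit k0 vs) ! (if j < k0 then j else j - 1) \<bullet> x)" for j
  have c\<sigma>: "c (if p < k0 then p else Suc p) = dual d (omit k0 vs) ! p \<bullet> x" for p
    by (auto simp: c_def)
  have xc: "x $ m = (\<Sum>j\<le>d. c j * vs ! j $ m)" if m: "m < d" for m
  proof -
    have "x $ m = (\<Sum>p<d. (dual d (omit k0 vs) ! p \<bullet> x) * omit k0 vs ! p $ m)"
      by (rule coords_ex[OF circuit_vlist[OF k0(1)] D[OF k0(2)] x m])
    also have "\<dots> = (\<Sum>p<d. (\<lambda>j. c j * vs ! j $ m) (if p < k0 then p else Suc p))"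
      by (rule sum.cong[OF refl]) (simp only: c\<sigma> circuit_nth[OF k0(1)] lessThan_iff)
    also have "\<dots> = (\<Sum>j\<in>{..d} - {k0}. c j * vs ! j $ m)" by (rule sum_omit[OF k0(1)])
    also have "\<dots> = (\<Sum>j\<le>d. c j * vs ! j $ m)"
      by (rule sum.mono_neutral_left) (auto simp: c_def)
    finally show ?thesis .
  qed
  show thesis
  proof (rule that)
    fix k p assume k: "k \<le> d" "a k \<noteq> 0" and p: "p < d"
    let ?e = "\<lambda>j. c j - c k * a j / a k"
    have "x $ m = (\<Sum>i<d. ?e (if i < k then i else Suc i) * omit k vs ! i $ m)" if m: "m < d" for m
    proof -
      have "x $ m = (\<Sum>j\<le>d. c j * vs ! j $ m) - c k / a k * (\<Sum>j\<le>d. a j * vs ! j $ m)"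
        using xc[OF m] circuit_relation[OF m] by simp
      also have "\<dots> = (\<Sum>j\<le>d. ?e j * vs ! j $ m)"
        by (simp add: sum_distrib_left sum_subtractf[symmetric] left_diff_distrib mult.assoc)
      also have "\<dots> = (\<Sum>j\<in>{..d} - {k}. ?e j * vs ! j $ m)"
        using k by (intro sum.mono_neutral_right) auto
      also have "\<dots> = (\<Sum>i<d. (\<lambda>j. ?e j * vs ! j $ m) (if i < k then i else Suc i))"
        by (rule sum_omit[OF k(1), symmetric])
      also have "\<dots> = (\<Sum>i<d. ?e (if i < k then i else Suc i) * omit k vs ! i $ m)"
        by (rule sum.cong[OF refl]) (simp only: circuit_nth[OF k(1)] lessThan_iff)
      finally show ?thesis .
    qed
    then show "dual d (omit k vs) ! p \<bullet> x = ?e (if p < k then p else Suc p)"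
      by (rule coords_eq[OF circuit_vlist[OF k(1)] D[OF k(2)] x _ p])
  qed
qed

lemma gen_all_circuit: "gen_all d (\<lambda>x. \<forall>k\<in>{k. k \<le> d \<and> a k \<noteq> 0}. \<forall>p<d. dual d (omit k vs) ! p \<bullet> x \<noteq> 0)"
  by (rule gen_all_ball) (auto simp: a_def intro!: gen_all_dual dual_lists_dual circuit_vlist)

text \<open>If two ratios \<open>c j / a j\<close> and \<open>c k / a k\<close> agreed, the
  coordinate at \<open>j\<close> in the basis without \<open>k\<close> would vanish, which
  genericity of \<open>x\<close> excludes.\<close>

lemma circuit_inj:
  assumes "\<forall>k\<in>{k. k \<le> d \<and> a k \<noteq> 0}. \<forall>p<d. dual d (omit k vs) ! p \<bullet> x \<noteq> 0"
    and c: "\<And>k p. k \<le> d \<Longrightarrow> a k \<noteq> 0 \<Longrightarrow> p < d \<Longrightarrow> dual d (omit k vs) ! p \<bullet> x =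
      c (if p < k then p else Suc p) - c k * a (if p < k then p else Suc p) / a k"
  shows "inj_on (\<lambda>k. c k / a k) {k. k \<le> d \<and> a k \<noteq> 0}"
proof (rule inj_onI, rule ccontr)
  fix j k assume *: "j \<in> {k. k \<le> d \<and> a k \<noteq> 0}" "k \<in> {k. k \<le> d \<and> a k \<noteq> 0}" "c j / a j = c k / a k" "j \<noteq> k"
  have "\<forall>p<d. c (if p < k then p else Suc p) - c k * a (if p < k then p else Suc p) / a k \<noteq> 0"
    using assms(1) c *(2) by fastforce
  then have "\<forall>j\<le>d. j \<noteq> k \<longrightarrow> c j - c k * a j / a k \<noteq> 0"
    using *(2) by (subst (asm) all_omit[of k d "\<lambda>j. c j - c k * a j / a k \<noteq> 0"]) auto
  then show False using * by (auto simp: field_simps)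
qed

text \<open>A relation with a single nonzero coefficient would make one of the vectors zero.\<close>

lemma circuit_card:
  assumes nz: "set vs \<subseteq> - {0\<^sub>v d}" and k0: "k0 \<le> d" "a k0 \<noteq> 0"
  shows "2 \<le> card {k. k \<le> d \<and> a k \<noteq> 0}"
proof (rule ccontr)
  let ?S = "{k. k \<le> d \<and> a k \<noteq> 0}"
  assume "\<not> ?thesis"
  moreover have "k0 \<in> ?S" "finite ?S" using k0 by auto
  ultimately have S: "?S = {k0}" using card_le_Suc0_iff_eq[of ?S] by auto
  have "vs ! k0 \<in> set vs" using k0 l by simp
  moreover have "vs ! k0 = 0\<^sub>v d"
  proof (rule eq_vecI)
    fix m assume "m < dim_vec (0\<^sub>v d)"
    then have m: "m < d" by simp
    have "(\<Sum>j\<le>d. a j * vs ! j $ m) = (\<Sum>j\<in>{k0}. a j * vs ! j $ m)"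
      using S k0 by (intro sum.mono_neutral_right) auto
    then show "vs ! k0 $ m = 0\<^sub>v d $ m" using circuit_relation[OF m] k0 m by simp
  qed (use \<open>vs ! k0 \<in> set vs\<close> vc in auto)
  ultimately show False using nz by auto
qed

text \<open>With \<open>z j = c j / a j\<close>, the coordinate at \<open>j\<close> in the basis
  without \<open>k\<close> is \<open>a j * (z j - z k)\<close>, or \<open>c j\<close> when
  \<open>a j = 0\<close>. All terms share the constant \<open>K\<close>, and what remains is the sum
  in \<open>lagrange_sum_zero\<close>.\<close>

lemma pole_fun_circuit:
  assumes nz: "set vs \<subseteq> - {0\<^sub>v d}"
  shows "gen_all d (\<lambda>x. (\<Sum>k\<le>d. (-1) ^ k * pole_fun d (omit k vs) x) = 0)"
proof (rule gen_all_mono[OF gen_all_circuit])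
  let ?S = "{k. k \<le> d \<and> a k \<noteq> 0}"
  fix x assume x: "x \<in> carrier_vec d" and g: "\<forall>k\<in>?S. \<forall>p<d. dual d (omit k vs) ! p \<bullet> x \<noteq> 0"
  have t: "(-1) ^ k * pole_fun d (omit k vs) x = 1 / a k * (\<Prod>p<d. 1 / (dual d (omit k vs) ! p \<bullet> x))" for k
    unfolding pole_fun_def a_def by (cases "even k") auto
  show "(\<Sum>k\<le>d. (-1) ^ k * pole_fun d (omit k vs) x) = 0"
  proof (cases "?S = {}")
    case True
    then show ?thesis unfolding t by (intro sum.neutral) auto
  next
    case False
    then obtain k0 where k0: "k0 \<le> d" "a k0 \<noteq> 0" by blast
    obtain c where c: "\<And>k p. k \<le> d \<Longrightarrow> a k \<noteq> 0 \<Longrightarrow> p < d \<Longrightarrow> dual d (omit k vs) ! p \<bullet> x =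
      c (if p < k then p else Suc p) - c k * a (if p < k then p else Suc p) / a k"
      using circuit_coords[OF k0 x] by blast
    define z where "z = (\<lambda>k. c k / a k)"
    have inj: "inj_on z ?S" unfolding z_def by (rule circuit_inj[OF g c])
    define K where "K = (\<Prod>j\<in>{..d} - ?S. 1 / c j) * (\<Prod>j\<in>?S. 1 / a j)"
    have "1 / a k * (\<Prod>p<d. 1 / (dual d (omit k vs) ! p \<bullet> x)) = K * (\<Prod>j\<in>?S - {k}. 1 / (z j - z k))" if k: "k \<in> ?S" for k
    proof -
      have kk: "k \<le> d" "a k \<noteq> 0" using k by auto
      have "(\<Prod>p<d. 1 / (dual d (omit k vs) ! p \<bullet> x)) =
          (\<Prod>p<d. (\<lambda>j. 1 / (c j - c k * a j / a k)) (if p < k then p else Suc p))"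
        by (rule prod.cong[OF refl]) (simp only: c[OF kk] lessThan_iff)
      also have "\<dots> = (\<Prod>j\<in>{..d} - {k}. 1 / (c j - c k * a j / a k))" by (rule prod_omit[OF kk(1)])
      also have "{..d} - {k} = ({..d} - ?S) \<union> (?S - {k})" using kk by auto
      also have "(\<Prod>j\<in>({..d} - ?S) \<union> (?S - {k}). 1 / (c j - c k * a j / a k)) =
          (\<Prod>j\<in>{..d} - ?S. 1 / (c j - c k * a j / a k)) * (\<Prod>j\<in>?S - {k}. 1 / (c j - c k * a j / a k))"
        by (rule prod.union_disjoint) auto
      also have "(\<Prod>j\<in>{..d} - ?S. 1 / (c j - c k * a j / a k)) = (\<Prod>j\<in>{..d} - ?S. 1 / c j)"
        by (rule prod.cong) auto
      also have "(\<Prod>j\<in>?S - {k}. 1 / (c j - c k * a j / a k)) = (\<Prod>j\<in>?S - {k}. 1 / a j * (1 / (z j - z k)))"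
        by (rule prod.cong) (use kk in \<open>auto simp: z_def field_simps\<close>)
      also have "\<dots> = (\<Prod>j\<in>?S - {k}. 1 / a j) * (\<Prod>j\<in>?S - {k}. 1 / (z j - z k))" by (rule prod.distrib)
      finally have e: "(\<Prod>p<d. 1 / (dual d (omit k vs) ! p \<bullet> x)) =
        (\<Prod>j\<in>{..d} - ?S. 1 / c j) * ((\<Prod>j\<in>?S - {k}. 1 / a j) * (\<Prod>j\<in>?S - {k}. 1 / (z j - z k)))" .
      have "(\<Prod>j\<in>?S. 1 / a j) = 1 / a k * (\<Prod>j\<in>?S - {k}. 1 / a j)" by (rule prod.remove) (use k in auto)
      then show ?thesis unfolding e K_def by (simp only: mult_ac)
    qed
    then have "(\<Sum>k\<in>?S. 1 / a k * (\<Prod>p<d. 1 / (dual d (omit k vs) ! p \<bullet> x))) = K * (\<Sum>k\<in>?S. \<Prod>j\<in>?S - {k}. 1 / (z j - z k))"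
      by (simp add: sum_distrib_left)
    also have "\<dots> = 0" using lagrange_sum_zero[OF _ circuit_card[OF nz k0] inj] by simp
    finally show ?thesis unfolding t
      by (subst sum.mono_neutral_right[of _ ?S]) auto
  qed
qed

text \<open>When no two coefficients of the relation have opposite signs, it writes the negative of
  \<open>vs ! k0\<close> as a nonnegative combination of the other vectors.\<close>

lemma circuit_line:
  assumes nz: "set vs \<subseteq> - {0\<^sub>v d}" and k0: "k0 \<le> d" "a k0 \<noteq> 0"
    and sg: "\<And>k. k \<le> d \<Longrightarrow> 0 \<le> a k / a k0"
  shows "contains_subspace d 1 (cone_gen d vs)"
proof -
  have m: "vs ! k0 \<in> set vs" using k0 l by simp
  have "rvec (- (vs ! k0)) \<in> cone_gen d vs"
    unfolding cone_gen_list_iff[OF vc]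
  proof (intro conjI exI[of _ "\<lambda>i. if i = k0 then 0 else real_of_rat (a i / a k0)"] allI impI)
    show "rvec (- (vs ! k0)) \<in> carrier_vec d" using m vc by auto
    show "0 \<le> (if i = k0 then 0 else real_of_rat (a i / a k0))" if "i < length vs" for i
      using sg[of i] that l by auto
    fix k assume k: "k < d"
    have "(\<Sum>i\<in>{..d} - {k0}. a i / a k0 * vs ! i $ k) = (\<Sum>i\<le>d. a i * vs ! i $ k) / a k0 - vs ! k0 $ k"
      using k0 by (subst (2) sum.remove[of _ k0]) (auto simp: sum_divide_distrib add_divide_distrib)
    then have e: "(\<Sum>i\<in>{..d} - {k0}. a i / a k0 * vs ! i $ k) = - vs ! k0 $ k"
      using circuit_relation[OF k] by simp
    have "(\<Sum>i<length vs. (if i = k0 then 0 else real_of_rat (a i / a k0)) * real_of_rat (vs ! i $ k))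
        = (\<Sum>i\<in>{..d} - {k0}. real_of_rat (a i / a k0 * vs ! i $ k))"
      unfolding l lessThan_Suc_atMost using k0
      by (subst sum.remove[of _ k0]) (auto simp flip: of_rat_mult intro!: sum.cong)
    also have "\<dots> = real_of_rat (- vs ! k0 $ k)" unfolding e[symmetric] of_rat_sum ..
    also have "\<dots> = rvec (- (vs ! k0)) $ k" using m vc k by (auto simp: subset_iff)
    finally show "rvec (- (vs ! k0)) $ k =
      (\<Sum>i<length vs. (if i = k0 then 0 else real_of_rat (a i / a k0)) * real_of_rat (vs ! i $ k))" by simp
  qed
  then show ?thesis unfolding contains_line_iff[OF vc] using m nz by blast
qed

text \<open>At a generic point the alternating sum counts, with signs, the simplicial cones
  containing it, and \<open>good_sum\<close> evaluates this count. It is zero when the relation has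
  coefficients of both signs; otherwise it is a constant sign on the cone of all
  \<open>d + 1\<close> vectors, which contains a line by \<open>circuit_line\<close>.\<close>

lemma chamber_fun_circuit:
  assumes nz: "set vs \<subseteq> - {0\<^sub>v d}"
  shows "\<exists>gs \<kappa>. set gs \<subseteq> carrier_vec d \<and> (\<kappa> = 0 \<or> contains_subspace d 1 (cone_gen d gs)) \<and>
    gen_all d (\<lambda>x. (\<Sum>k\<le>d. (-1) ^ k * chamber_fun d (omit k vs) x) = \<kappa> * ind (cone_gen d gs) x)"
proof -
  let ?S = "{k. k \<le> d \<and> a k \<noteq> 0}"
  have t: "(-1) ^ k * chamber_fun d (omit k vs) x = sgn (a k) * of_bool (\<forall>p<d. 0 < dual d (omit k vs) ! p \<bullet> x)" for k x
    unfolding chamber_fun_def a_def by (cases "even k") (auto simp: sgn_minus)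
  show ?thesis
  proof (cases "?S = {}")
    case True
    then have "(\<Sum>k\<le>d. (-1) ^ k * chamber_fun d (omit k vs) x) = 0" for x unfolding t by (intro sum.neutral) auto
    then show ?thesis by (intro exI[of _ "[]"] exI[of _ 0]) (auto intro: gen_allI)
  next
    case False
    then obtain k0 where k0: "k0 \<le> d" "a k0 \<noteq> 0" by blast
    define \<kappa> where "\<kappa> = (if \<forall>k\<in>?S. 0 < a k then 1 else if \<forall>k\<in>?S. a k < 0 then - 1 else (0 :: rat))"
    have "\<kappa> = 0 \<or> contains_subspace d 1 (cone_gen d vs)"
    proof (rule disjCI)
      assume "\<not> contains_subspace d 1 (cone_gen d vs)"
      then obtain k where k: "k \<le> d" "a k / a k0 < 0" using circuit_line[OF nz k0] by force
      then have "k \<in> ?S" "k0 \<in> ?S" using k0 by auto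
      then show "\<kappa> = 0" using k(2) unfolding \<kappa>_def
        by (auto simp: divide_less_0_iff dest: less_asym)
    qed
    moreover have "gen_all d (\<lambda>x. (\<Sum>k\<le>d. (-1) ^ k * chamber_fun d (omit k vs) x) = \<kappa> * ind (cone_gen d vs) x)"
    proof (rule gen_all_mono[OF gen_all_circuit])
      fix x assume x: "x \<in> carrier_vec d" and g: "\<forall>k\<in>?S. \<forall>p<d. dual d (omit k vs) ! p \<bullet> x \<noteq> 0"
      obtain c where c: "\<And>k p. k \<le> d \<Longrightarrow> a k \<noteq> 0 \<Longrightarrow> p < d \<Longrightarrow> dual d (omit k vs) ! p \<bullet> x =
        c (if p < k then p else Suc p) - c k * a (if p < k then p else Suc p) / a k"
        using circuit_coords[OF k0 x] by blast
      define z where "z = (\<lambda>k. c k / a k)"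
      have inj: "inj_on z ?S" unfolding z_def by (rule circuit_inj[OF g c])
      \<comment> \<open>The conditions coming from vectors outside the circuit, where
        \<open>a j = 0\<close>; they do not depend on \<open>k\<close> and factor out of the
        sum.\<close>
      let ?Z = "\<forall>j\<le>d. a j = 0 \<longrightarrow> 0 < c j"
      let ?G = "\<lambda>k. \<forall>j\<in>?S - {k}. 0 < a j * (z j - z k)"
      have eq: "(\<forall>p<d. 0 < dual d (omit k vs) ! p \<bullet> x) \<longleftrightarrow> ?Z \<and> ?G k" if k: "k \<in> ?S" for k
      proof -
        have kk: "k \<le> d" "a k \<noteq> 0" using k by auto
        have "(\<forall>p<d. 0 < dual d (omit k vs) ! p \<bullet> x) \<longleftrightarrow>
           (\<forall>p<d. (\<lambda>j. 0 < c j - c k * a j / a k) (if p < k then p else Suc p))"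
          using c[OF kk] by simp
        also have "\<dots> \<longleftrightarrow> (\<forall>j\<le>d. j \<noteq> k \<longrightarrow> 0 < c j - c k * a j / a k)" by (rule all_omit[OF kk(1)])
        also have "\<dots> \<longleftrightarrow> ?Z \<and> ?G k"
        proof -
          have 1: "0 < c j - c k * a j / a k \<longleftrightarrow> 0 < c j" if "a j = 0" for j using that by simp
          have 2: "c j - c k * a j / a k = a j * (z j - z k)" if "a j \<noteq> 0" for j
            using that kk by (simp add: z_def field_simps)
          show ?thesis
          proof (intro iffI conjI)
            assume h: "\<forall>j\<le>d. j \<noteq> k \<longrightarrow> 0 < c j - c k * a j / a k"
            show ?Z using h 1 kk(2) by metis
            show "?G k"
            proof
              fix j assume "j \<in> ?S - {k}"
              then have j: "j \<le> d" "j \<noteq> k" "a j \<noteq> 0" by auto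
              then have "0 < c j - c k * a j / a k" using h by blast
              then show "0 < a j * (z j - z k)" unfolding 2[OF j(3)] .
            qed
          next
            assume h: "?Z \<and> ?G k"
            show "\<forall>j\<le>d. j \<noteq> k \<longrightarrow> 0 < c j - c k * a j / a k"
            proof (intro allI impI)
              fix j assume j: "j \<le> d" "j \<noteq> k"
              show "0 < c j - c k * a j / a k"
              proof (cases "a j = 0")
                case True then show ?thesis using h j by simp
              next
                case False
                then have "0 < a j * (z j - z k)" using h j by simp
                then show ?thesis unfolding 2[OF False] .
              qed
            qed
          qed
        qed
        finally show ?thesis .
      qed
      have "(\<Sum>k\<le>d. (-1) ^ k * chamber_fun d (omit k vs) x) = (\<Sum>k\<in>?S. sgn (a k) * of_bool (\<forall>p<d. 0 < dual d (omit k vs) ! p \<bullet> x))"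
        unfolding t by (rule sum.mono_neutral_right) auto
      also have "\<dots> = (\<Sum>k\<in>?S. of_bool ?Z * (sgn (a k) * of_bool (?G k)))"
        using eq by (intro sum.cong refl) (simp add: of_bool_conj)
      also have "\<dots> = of_bool ?Z * (\<Sum>k\<in>?S. sgn (a k) * of_bool (?G k))" by (simp only: sum_distrib_left)
      also have gs: "(\<Sum>k\<in>?S. sgn (a k) * of_bool (?G k)) = \<kappa>"
        unfolding \<kappa>_def by (rule good_sum) (use False inj in auto)
      also have "of_bool ?Z * \<kappa> = \<kappa> * ind (cone_gen d vs) x"
      proof (cases "\<kappa> = 0")
        case False
        have "rvec x \<in> cone_gen d vs \<longleftrightarrow> ?Z"
        proof
          assume Z: ?Z
          have "\<exists>k\<in>?S. ?G k"
          proof (rule ccontr)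
            assume "\<not> ?thesis"
            then have "(\<Sum>k\<in>?S. sgn (a k) * of_bool (?G k)) = 0" by (intro sum.neutral) auto
            then show False using gs False by simp
          qed
          then obtain k where k: "k \<in> ?S" "?G k" by blast
          then have kd: "k \<le> d" "Det d (omit k vs) \<noteq> 0" by (auto simp: a_def)
          have "\<forall>p<d. 0 < dual d (omit k vs) ! p \<bullet> x" using eq[OF k(1)] Z k(2) by blast
          then have "rvec x \<in> cone_gen d (omit k vs)"
            using simplicial_cone_iff[OF dual_lists_dual[OF circuit_vlist[OF kd(1)] kd(2)] x] by (simp add: less_imp_le)
          then show "rvec x \<in> cone_gen d vs" using cone_gen_mono[OF set_omit vc] by blast
        next
          assume mem: "rvec x \<in> cone_gen d vs"
          have kd: "Det d (omit k0 vs) \<noteq> 0" using k0 by (auto simp: a_def)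
          note dd = dual_lists_dual[OF circuit_vlist[OF k0(1)] kd]
          show ?Z
          proof (intro allI impI)
            fix j assume j: "j \<le> d" "a j = 0"
            then have jk: "j \<noteq> k0" using k0 by auto
            define p where "p = (if j < k0 then j else j - 1)"
            have p: "p < d" "(if p < k0 then p else Suc p) = j" using j jk k0 by (auto simp: p_def)
            have uc: "dual d (omit k0 vs) ! p \<in> carrier_vec d" using dd p by (simp add: dual_lists_def vlist_nth)
            \<comment> \<open>The dual form is 0 or 1 on the retained vectors. On the omitted one it
              equals \<open>- a j / a k0\<close>, which is zero. So it is nonnegative on the whole
              cone.\<close>
            have "0 \<le> dual d (omit k0 vs) ! p \<bullet> v" if vin: "v \<in> set vs" for v
            proof -
              obtain i where i: "i \<le> d" "v = vs ! i" using vin l by (auto simp: in_set_conv_nth less_Suc_eq_le)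
              show ?thesis
              proof (cases "i = k0")
                case True
                have vk: "v \<in> carrier_vec d" using vin vc by auto
                have "dual d (omit k0 vs) ! p \<bullet> v = - a (if p < k0 then p else Suc p) / a k0"
                proof (rule coords_eq[OF circuit_vlist[OF k0(1)] kd vk _ p(1)])
                  fix m assume m: "m < d"
                  have "(\<Sum>q<d. - a (if q < k0 then q else Suc q) / a k0 * omit k0 vs ! q $ m) =
                     (\<Sum>q<d. (\<lambda>i. - a i / a k0 * vs ! i $ m) (if q < k0 then q else Suc q))"
                    by (rule sum.cong[OF refl]) (simp only: circuit_nth[OF k0(1)] lessThan_iff)
                  also have "\<dots> = (\<Sum>i\<in>{..d} - {k0}. - a i / a k0 * vs ! i $ m)" by (rule sum_omit[OF k0(1)])
                  also have "\<dots> = v $ m - (\<Sum>i\<le>d. a i * vs ! i $ m) / a k0"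
                    using k0 i True by (subst (2) sum.remove[of _ k0]) (auto simp: sum_divide_distrib add_divide_distrib sum_negf)
                  finally show "v $ m = (\<Sum>q<d. - a (if q < k0 then q else Suc q) / a k0 * omit k0 vs ! q $ m)"
                    using circuit_relation[OF m] by simp
                qed
                then show ?thesis unfolding p(2) using j(2) by simp
              next
                case False
                define q where "q = (if i < k0 then i else i - 1)"
                have q: "q < d" "(if q < k0 then q else Suc q) = i" using i False k0 by (auto simp: q_def)
                have "omit k0 vs ! q = v" unfolding circuit_nth[OF k0(1) q(1)] q(2) using i by simp
                then have "dual d (omit k0 vs) ! p \<bullet> v = (if p = q then 1 else 0)"
                  using dd p(1) q(1) by (auto simp: dual_lists_def)
                then show ?thesis by simp
              qed
            qed
            then have "0 \<le> dual d (omit k0 vs) ! p \<bullet> x" by (rule cone_gen_nonneg[OF vc uc _ x mem])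
            moreover have "dual d (omit k0 vs) ! p \<bullet> x \<noteq> 0" using g k0 p(1) by blast
            ultimately show "0 < c j" using c[OF k0 p(1)] unfolding p(2) using j(2) by simp
          qed
        qed
        then show ?thesis by (simp add: ind_def)
      qed simp
      finally show "(\<Sum>k\<le>d. (-1) ^ k * chamber_fun d (omit k vs) x) = \<kappa> * ind (cone_gen d vs) x" .
    qed
    ultimately show ?thesis using vc by blast
  qed
qed

end

section \<open>Differential operators on products of linear forms\<close>

text \<open>With \<open>G ns\<close> standing for the product of the \<open>(us ! j)\<close> to the powers \<open>- (ns ! j)\<close>,
  this is the derivative in direction \<open>- x\<close>.\<close>
definition dop :: "nat \<Rightarrow> rat vec list \<Rightarrow> rat vec \<Rightarrow> (nat list \<Rightarrow> 'b :: field_char_0) \<Rightarrow> nat list \<Rightarrow> 'b" where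
  "dop d us x G ns = (\<Sum>j<d. of_rat ((us ! j \<bullet> x) * of_nat (ns ! j)) * G (ns[j := Suc (ns ! j)]))"

definition dops :: "nat \<Rightarrow> rat vec list \<Rightarrow> rat vec multiset \<Rightarrow> (nat list \<Rightarrow> 'b :: field_char_0) \<Rightarrow> nat list \<Rightarrow> 'b" where
  "dops d us X G = fold_mset (dop d us) G X"

text \<open>Symmetry of second derivatives, term by term after exchanging the two indices. It makes
  iteration over a multiset meaningful, which is how the symmetric power acts.\<close>

lemma dop_commute: "dop d us x (dop d us y G) ns = dop d us y (dop d us x G) ns"
proof -
  let ?t = "\<lambda>x y i j. of_rat ((us ! i \<bullet> x) * of_nat (ns ! i)) *
      (of_rat ((us ! j \<bullet> y) * of_nat (ns[i := Suc (ns ! i)] ! j)) * G (ns[i := Suc (ns ! i), j := Suc (ns[i := Suc (ns ! i)] ! j)]))"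
  have t: "?t x y i j = ?t y x j i" for i j
  proof (cases "i = j")
    case False
    then show ?thesis by (simp add: nth_list_update list_update_swap of_rat_mult mult_ac)
  qed (simp add: of_rat_mult mult_ac)
  have "dop d us x (dop d us y G) ns = (\<Sum>i<d. \<Sum>j<d. ?t x y i j)" by (simp add: dop_def sum_distrib_left)
  also have "\<dots> = (\<Sum>i<d. \<Sum>j<d. ?t y x j i)" unfolding t ..
  also have "\<dots> = (\<Sum>j<d. \<Sum>i<d. ?t y x j i)" by (rule sum.swap)
  also have "\<dots> = dop d us y (dop d us x G) ns" by (simp add: dop_def sum_distrib_left)
  finally show ?thesis .
qed

interpretation dop: comp_fun_commute "dop d us" for d us
  by standard (auto intro!: ext dop_commute)

lemma dops_empty [simp]: "dops d us {#} G = G"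
  by (simp add: dops_def)

lemma dops_add [simp]: "dops d us (add_mset x X) G = dop d us x (dops d us X G)"
  by (simp add: dops_def)

lemma dops_inner: "dops d us X (dop d us x G) = dops d us (add_mset x X) G"
  by (simp add: dops_def dop.fold_mset_fun_left_comm)

lemma dops_union: "dops d us (X + Y) G = dops d us X (dops d us Y G)"
  by (induction X) auto

lemma dops_hom:
  assumes "\<phi> 0 = 0" "\<And>x y. \<phi> (x + y) = \<phi> x + \<phi> y" "\<And>q y. \<phi> (of_rat q * y) = of_rat q * \<phi> y"
  shows "dops d us X (\<lambda>ns. \<phi> (G ns)) ns = \<phi> (dops d us X G ns)"
proof (induction X arbitrary: ns)
  case (add x X)
  have s: "\<phi> (sum f A) = (\<Sum>a\<in>A. \<phi> (f a))" for f and A :: "nat set"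
    by (induction A rule: infinite_finite_induct) (use assms in auto)
  show ?case by (simp add: dop_def add s assms(3))
qed simp

lemma dops_of_rat: "dops d us X (\<lambda>ns. of_rat (G ns)) ns = of_rat (dops d us X G ns)"
  by (rule dops_hom) (auto simp: of_rat_add of_rat_mult)

lemma dops_scale: "dops d us X (\<lambda>ns. c * G ns) ns = c * dops d us X G ns"
  by (rule dops_hom) (auto simp: algebra_simps)

lemma dop_linear:
  assumes us: "vlist d us" and "x \<in> carrier_vec d" "y \<in> carrier_vec d"
  shows "dop d us (x + y) G ns = dop d us x G ns + dop d us y G ns"
    "dop d us (c \<cdot>\<^sub>v x) G ns = of_rat c * dop d us x G ns"
  using assms vlist_nth[OF us]
  by (auto simp: dop_def scalar_prod_add_distrib[of _ d] of_rat_add of_rat_mult algebra_simps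
      sum.distrib sum_distrib_left intro!: sum.cong)

text \<open>Differentiating in the direction of a vector of the dual basis affects one linear form
  and so raises one exponent.\<close>

lemma dop_basis:
  assumes d: "dual_lists d us ws" and j: "j < d"
  shows "dop d us (ws ! j) G ns = of_nat (ns ! j) * G (ns[j := Suc (ns ! j)])"
proof -
  have "dop d us (ws ! j) G ns = (\<Sum>i<d. if i = j then of_nat (ns ! j) * G (ns[j := Suc (ns ! j)]) else 0)"
    unfolding dop_def using d j by (intro sum.cong) (auto simp: dual_lists_def)
  then show ?thesis using j by simp
qed

text \<open>Repetition multiplies by the rising factorial starting at \<open>ns ! j\<close>; it is
  stated as a quotient of factorials with the denominator cleared.\<close>

lemma dops_replicate:
  fixes G :: "nat list \<Rightarrow> 'b :: field_char_0"
  assumes d: "dual_lists d us ws" and j: "j < d" "length ns = d" and p: "1 \<le> ns ! j"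
  shows "dops d us (replicate_mset a (ws ! j)) G ns * fact (ns ! j - 1) = fact (ns ! j + a - 1) * G (ns[j := ns ! j + a])"
  using j p
proof (induction a arbitrary: ns)
  case 0
  then show ?case by (simp add: mult.commute)
next
  case (Suc a)
  let ?ns = "ns[j := Suc (ns ! j)]"
  have "dops d us (replicate_mset a (ws ! j)) G ?ns * fact (?ns ! j - 1) = fact (?ns ! j + a - 1) * G (?ns[j := ?ns ! j + a])"
    using Suc.prems by (intro Suc.IH) auto
  then have IH: "dops d us (replicate_mset a (ws ! j)) G ?ns * fact (ns ! j) = fact (ns ! j + a) * G (ns[j := ns ! j + Suc a])"
    using Suc.prems by simp
  have f: "fact (ns ! j) = (of_nat (ns ! j) * fact (ns ! j - 1) :: 'b)" using Suc.prems by (intro fact_reduce) simp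
  show ?case using IH unfolding f by (simp add: dop_basis[OF d Suc.prems(1)] mult_ac)
qed

text \<open>From exponents all equal to one, \<open>ns ! j - 1\<close> derivatives along
  \<open>ws ! j\<close> reach the exponent \<open>ns ! j\<close> and cost the factor
  \<open>fact (ns ! j - 1)\<close>; this accounts for the factorials in the theorem.\<close>

lemma dops_monomial:
  assumes d: "dual_lists d us ws" and ns: "length ns = d" "\<forall>j<d. 1 \<le> ns ! j"
  shows "dops d us (\<Sum>j<d. replicate_mset (ns ! j - 1) (ws ! j)) G (replicate d 1) = (\<Prod>j<d. fact (ns ! j - 1)) * G ns"
proof -
  have "m \<le> d \<Longrightarrow> dops d us (\<Sum>j<m. replicate_mset (ns ! j - 1) (ws ! j)) G (replicate d 1)
    = (\<Prod>j<m. fact (ns ! j - 1)) * G (take m ns @ replicate (d - m) 1)" for m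
  proof (induction m arbitrary: G)
    case 0
    then show ?case by simp
  next
    case (Suc m)
    let ?ns = "take m ns @ replicate (d - m) 1"
    have m: "m < d" using Suc.prems by simp
    have n1: "?ns ! m = 1" "length ?ns = d" using m ns by (auto simp: nth_append)
    have "?ns[m := ns ! m] = take (Suc m) ns @ replicate (d - Suc m) 1"
      using m ns by (intro nth_equalityI) (auto simp: nth_append nth_list_update less_Suc_eq)
    moreover have "Suc (ns ! m - Suc 0) = ns ! m" using ns(2) m by (simp add: Suc_le_eq)
    ultimately have "dops d us (replicate_mset (ns ! m - 1) (ws ! m)) G ?ns = fact (ns ! m - 1) * G (take (Suc m) ns @ replicate (d - Suc m) 1)"
      using dops_replicate[OF d m n1(2), of "ns ! m - 1" G] n1 ns(2) m by simp
    then show ?case using Suc.IH[of "dops d us (replicate_mset (ns ! m - 1) (ws ! m)) G"] Suc.prems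
      by (simp add: dops_union mult_ac)
  qed
  from this[of d] show ?thesis using ns by simp
qed

lemma dops_cong:
  assumes "\<And>ns. length ns = d \<Longrightarrow> G ns = H ns" "length ns = d"
  shows "dops d us X G ns = dops d us X H ns"
  using assms(2)
proof (induction X arbitrary: ns)
  case (add x X)
  then show ?case by (auto simp: dop_def intro!: sum.cong)
qed (simp add: assms(1))

text \<open>The coefficients of the operator do not involve the parameter, so it commutes with
  differentiation in the parameter.\<close>

lemma DERIV_dops:
  assumes "\<And>ns. length ns = d \<Longrightarrow> ((\<lambda>\<epsilon>. G \<epsilon> ns) has_field_derivative G' ns) (at (t :: real))" "length ns = d"
  shows "((\<lambda>\<epsilon>. dops d us X (G \<epsilon>) ns) has_field_derivative dops d us X G' ns) (at t)"
  using assms(2)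
proof (induction X arbitrary: ns)
  case (add x X)
  show ?case unfolding dops_add dop_def
    by (intro DERIV_sum DERIV_cmult add.IH) (use add.prems in auto)
qed (simp add: assms(1))

lemma DERIV_prod_log:
  fixes f :: "'i \<Rightarrow> real \<Rightarrow> real"
  assumes "finite A" "\<And>j. j \<in> A \<Longrightarrow> (f j has_field_derivative f' j) (at t)" "\<And>j. j \<in> A \<Longrightarrow> f j t \<noteq> 0"
  shows "((\<lambda>\<epsilon>. \<Prod>j\<in>A. f j \<epsilon>) has_field_derivative (\<Prod>j\<in>A. f j t) * (\<Sum>j\<in>A. f' j / f j t)) (at t)"
  using assms
proof (induction A rule: finite_induct)
  case (insert a A)
  have nz: "(\<Prod>j\<in>A. f j t) \<noteq> 0" "f a t \<noteq> 0" using insert by auto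
  have "((\<lambda>\<epsilon>. f a \<epsilon> * (\<Prod>j\<in>A. f j \<epsilon>)) has_field_derivative
      f' a * (\<Prod>j\<in>A. f j t) + (\<Prod>j\<in>A. f j t) * (\<Sum>j\<in>A. f' j / f j t) * f a t) (at t)"
    by (rule DERIV_mult) (use insert in auto)
  moreover have "f' a * (\<Prod>j\<in>A. f j t) + (\<Prod>j\<in>A. f j t) * (\<Sum>j\<in>A. f' j / f j t) * f a t
      = (\<Prod>j\<in>insert a A. f j t) * (\<Sum>j\<in>insert a A. f' j / f j t)"
    using insert(1,2) nz by (simp add: field_simps)
  moreover have "(\<lambda>\<epsilon>. \<Prod>j\<in>insert a A. f j \<epsilon>) = (\<lambda>\<epsilon>. f a \<epsilon> * (\<Prod>j\<in>A. f j \<epsilon>))"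
    using insert(1,2) by simp
  ultimately show ?case by (simp only:)
qed simp

text \<open>An identity between rational functions on the complement of finitely many hyperplanes
  can be differentiated; only its values along a sequence of rational points are used.\<close>
lemma generic_derivative:
  assumes I: "finite I" and us: "\<And>i. i \<in> I \<Longrightarrow> dual_lists d (us i) (ws i)" and v: "v \<in> carrier_vec d"
    and z: "gen_all d (\<lambda>x. (\<Sum>i\<in>I. \<kappa> i * dops d (us i) X (\<lambda>ns. rat_fun d (us i) ns x) (replicate d 1)) = 0)"
  shows "gen_all d (\<lambda>x. (\<Sum>i\<in>I. \<kappa> i * dops d (us i) (add_mset v X) (\<lambda>ns. rat_fun d (us i) ns x) (replicate d 1)) = 0)"
proof -
  let ?\<Phi> = "\<lambda>x. \<Sum>i\<in>I. \<kappa> i * dops d (us i) X (\<lambda>ns. rat_fun d (us i) ns x) (replicate d 1)"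
  from z obtain H where H: "finite H" "H \<subseteq> carrier_vec d - {0\<^sub>v d}"
    "\<forall>x\<in>carrier_vec d. (\<forall>h\<in>H. h \<bullet> x \<noteq> 0) \<longrightarrow> ?\<Phi> x = 0"
    unfolding gen_all_def by (elim exE conjE)
  have "gen_all d (\<lambda>x. (\<forall>i\<in>I. \<forall>j<d. us i ! j \<bullet> x \<noteq> 0) \<and> (\<forall>h\<in>H. h \<bullet> x \<noteq> 0))"
    by (intro gen_all_conj gen_all_ball I H(1)) (use us H(2) in \<open>auto intro: gen_all_dual gen_all_neq\<close>)
  then show ?thesis
  proof (rule gen_all_mono)
    fix x assume x: "x \<in> carrier_vec d" and g: "(\<forall>i\<in>I. \<forall>j<d. us i ! j \<bullet> x \<noteq> 0) \<and> (\<forall>h\<in>H. h \<bullet> x \<noteq> 0)"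
    define a where "a i j = real_of_rat (us i ! j \<bullet> x)" for i j
    define b where "b i j = real_of_rat (us i ! j \<bullet> v)" for i j
    \<comment> \<open>The rational function along the real line through \<open>x\<close> in
      direction \<open>- v\<close>; its derivative at 0 is the effect of \<open>dop\<close> in
      direction \<open>v\<close>.\<close>
    define R where "R i \<epsilon> ns = (\<Prod>j<d. 1 / (a i j - \<epsilon> * b i j) ^ (ns ! j))" for i \<epsilon> ns
    define \<phi> where "\<phi> \<epsilon> = (\<Sum>i\<in>I. real_of_rat (\<kappa> i) * dops d (us i) X (R i \<epsilon>) (replicate d 1))" for \<epsilon>
    let ?y = "\<lambda>q. x + (- q) \<cdot>\<^sub>v v"
    have R: "R i (real_of_rat q) ns = real_of_rat (rat_fun d (us i) ns (?y q))" if "i \<in> I" for i q ns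
    proof -
      have "us i ! j \<in> carrier_vec d" if "j < d" for j using us[OF \<open>i \<in> I\<close>] that by (simp add: dual_lists_def vlist_nth)
      then show ?thesis using x v unfolding R_def rat_fun_def a_def b_def
        by (auto simp: of_rat_prod of_rat_divide of_rat_power of_rat_diff of_rat_mult of_rat_add of_rat_minus scalar_prod_add_distrib[of _ d] intro!: prod.cong)
    qed
    have Rq: "R i (real_of_rat q) = (\<lambda>ns. real_of_rat (rat_fun d (us i) ns (?y q)))" if "i \<in> I" for i q
      by (rule ext) (rule R[OF that])
    have \<phi>q: "\<phi> (real_of_rat q) = real_of_rat (?\<Phi> (?y q))" for q
      unfolding \<phi>_def of_rat_sum of_rat_mult by (rule sum.cong) (auto simp: Rq dops_of_rat)
    have anz: "a i j \<noteq> 0" if "i \<in> I" "j < d" for i j using g that by (simp add: a_def)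
    have dR: "((\<lambda>\<epsilon>. R i \<epsilon> ns) has_field_derivative dop d (us i) v (R i 0) ns) (at 0)" if i: "i \<in> I" and n: "length ns = d" for i ns
    proof -
      have "((\<lambda>\<epsilon>. 1 / (a i j - \<epsilon> * b i j) ^ (ns ! j)) has_field_derivative
          of_nat (ns ! j) * b i j / a i j * (1 / a i j ^ (ns ! j))) (at 0)" if j: "j < d" for j
      proof (cases "ns ! j")
        case (Suc m)
        show ?thesis unfolding Suc
          by (rule derivative_eq_intros refl | use anz[OF i j] in \<open>simp add: field_simps power2_eq_square\<close>)+
      qed simp
      then have "((\<lambda>\<epsilon>. R i \<epsilon> ns) has_field_derivative
          (\<Prod>j<d. 1 / (a i j - 0 * b i j) ^ (ns ! j)) *
          (\<Sum>j<d. (of_nat (ns ! j) * b i j / a i j * (1 / a i j ^ (ns ! j))) / (1 / (a i j - 0 * b i j) ^ (ns ! j)))) (at 0)"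
        unfolding R_def using anz[OF i] by (intro DERIV_prod_log) auto
      moreover have "(\<Prod>j<d. 1 / (a i j - 0 * b i j) ^ (ns ! j)) *
          (\<Sum>j<d. (of_nat (ns ! j) * b i j / a i j * (1 / a i j ^ (ns ! j))) / (1 / (a i j - 0 * b i j) ^ (ns ! j)))
          = dop d (us i) v (R i 0) ns"
        unfolding dop_def sum_distrib_left
      proof (rule sum.cong[OF refl])
        fix j assume j: "j \<in> {..<d}"
        have "R i 0 (ns[j := Suc (ns ! j)]) = (\<Prod>k<d. 1 / a i k ^ (ns ! k)) / a i j"
          unfolding R_def using j n
          by (subst (1 2) prod.remove[of _ j]) (auto intro!: prod.cong)
        then show "(\<Prod>j<d. 1 / (a i j - 0 * b i j) ^ (ns ! j)) *
            ((of_nat (ns ! j) * b i j / a i j * (1 / a i j ^ (ns ! j))) / (1 / (a i j - 0 * b i j) ^ (ns ! j)))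
            = of_rat ((us i ! j \<bullet> v) * of_nat (ns ! j)) * R i 0 (ns[j := Suc (ns ! j)])"
          using anz[OF i, of j] j by (simp add: of_rat_mult b_def)
      qed
      ultimately show ?thesis by simp
    qed
    have d\<phi>: "(\<phi> has_field_derivative (\<Sum>i\<in>I. real_of_rat (\<kappa> i) * dops d (us i) X (dop d (us i) v (R i 0)) (replicate d 1))) (at 0)"
      unfolding \<phi>_def by (intro DERIV_sum DERIV_cmult DERIV_dops dR) auto
    let ?D = "\<Sum>i\<in>I. \<kappa> i * dops d (us i) (add_mset v X) (\<lambda>ns. rat_fun d (us i) ns x) (replicate d 1)"
    have "(\<Sum>i\<in>I. real_of_rat (\<kappa> i) * dops d (us i) X (dop d (us i) v (R i 0)) (replicate d 1)) = real_of_rat ?D"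
    proof -
      have x0: "?y 0 = x" using x v by (intro eq_vecI) auto
      have "R i 0 = (\<lambda>ns. real_of_rat (rat_fun d (us i) ns x))" if "i \<in> I" for i
        using R[OF that, of 0] x0 by auto
      then show ?thesis unfolding of_rat_sum of_rat_mult dops_inner
        by (intro sum.cong refl) (simp only: dops_of_rat)
    qed
    with d\<phi> have D: "((\<lambda>h. (\<phi> (0 + h) - \<phi> 0) / h) \<longlongrightarrow> real_of_rat ?D) (at 0)"
      by (simp only: DERIV_def)
    \<comment> \<open>The point \<open>x\<close> lies off the finitely many exceptional hyperplanes,
      hence so do the nearby rational points with parameter \<open>1 / (k + 1)\<close> for large
      \<open>k\<close>. There the identity holds, so the difference quotients vanish and the
      derivative is zero.\<close>
    have ev: "eventually (\<lambda>k. \<phi> (real_of_rat (1 / of_nat (Suc k))) = 0) sequentially"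
    proof -
      have "eventually (\<lambda>k. h \<bullet> ?y (1 / of_nat (Suc k)) \<noteq> 0) sequentially" if h: "h \<in> H" for h
      proof -
        have hc: "h \<in> carrier_vec d" using H(2) h by auto
        have "(\<lambda>k. real_of_rat (h \<bullet> x) - inverse (real (Suc k)) * real_of_rat (h \<bullet> v)) \<longlonglongrightarrow> real_of_rat (h \<bullet> x) - 0 * real_of_rat (h \<bullet> v)"
          by (intro tendsto_intros LIMSEQ_inverse_real_of_nat)
        then have "eventually (\<lambda>k. real_of_rat (h \<bullet> x) - inverse (real (Suc k)) * real_of_rat (h \<bullet> v) \<noteq> 0) sequentially"
          by (rule tendsto_imp_eventually_ne) (use g h in auto)
        then show ?thesis
        proof (rule eventually_mono)
          fix k assume "real_of_rat (h \<bullet> x) - inverse (real (Suc k)) * real_of_rat (h \<bullet> v) \<noteq> 0"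
          moreover have "real_of_rat (h \<bullet> ?y (1 / of_nat (Suc k))) = real_of_rat (h \<bullet> x) - inverse (real (Suc k)) * real_of_rat (h \<bullet> v)"
            using hc x v by (simp add: scalar_prod_add_distrib[of _ d] of_rat_diff of_rat_mult of_rat_divide of_rat_add inverse_eq_divide)
          ultimately show "h \<bullet> ?y (1 / of_nat (Suc k)) \<noteq> 0" by (metis of_rat_0)
        qed
      qed
      then have "eventually (\<lambda>k. \<forall>h\<in>H. h \<bullet> ?y (1 / of_nat (Suc k)) \<noteq> 0) sequentially"
        using H(1) by (simp add: eventually_ball_finite)
      then show ?thesis
        by (rule eventually_mono) (use H(3) x v in \<open>auto simp: \<phi>q\<close>)
    qed
    have y0: "?y 0 = x" using x v by (intro eq_vecI) auto
    have "?\<Phi> x = 0" using H(3) x g by blast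
    then have "\<phi> 0 = 0" using \<phi>q[of 0] unfolding y0 by simp
    have lim: "(\<lambda>k. (\<phi> (0 + inverse (real (Suc k))) - \<phi> 0) / inverse (real (Suc k))) \<longlonglongrightarrow> real_of_rat ?D"
      by (rule filterlim_compose[OF D])
        (use LIMSEQ_inverse_real_of_nat in \<open>auto simp: filterlim_at\<close>)
    have ev0: "eventually (\<lambda>k. (\<phi> (0 + inverse (real (Suc k))) - \<phi> 0) / inverse (real (Suc k)) = 0) sequentially"
      using ev by (rule eventually_mono) (simp add: \<open>\<phi> 0 = 0\<close> of_rat_divide inverse_eq_divide of_rat_add)
    have "real_of_rat ?D = 0"
      by (rule LIMSEQ_unique[OF lim tendsto_eventually[OF ev0]])
    then show "?D = 0" by simp
  qed
qed

lemma generic_derivatives: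
  assumes "finite I" "\<And>i. i \<in> I \<Longrightarrow> dual_lists d (us i) (ws i)" "set_mset X \<subseteq> carrier_vec d"
    and "gen_all d (\<lambda>x. (\<Sum>i\<in>I. \<kappa> i * (\<Prod>j<d. 1 / (us i ! j \<bullet> x))) = 0)"
  shows "gen_all d (\<lambda>x. (\<Sum>i\<in>I. \<kappa> i * dops d (us i) X (\<lambda>ns. rat_fun d (us i) ns x) (replicate d 1)) = 0)"
  using assms(3)
proof (induction X)
  case empty
  have "rat_fun d (us i) (replicate d 1) x = (\<Prod>j<d. 1 / (us i ! j \<bullet> x))" for i x
    by (simp add: rat_fun_def)
  then show ?case using assms(4) by simp
next
  case (add v X)
  then show ?case by (intro generic_derivative[OF assms(1,2)]) auto
qed

section \<open>The trilinear map on generators\<close>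

text \<open>The counterpart of \<open>free_ext\<close> for functions with values in a field; it
  evaluates a formal relation pointwise.\<close>

definition psum :: "('a \<Rightarrow> 'b :: field_char_0) \<Rightarrow> ('a \<Rightarrow>\<^sub>0 rat) \<Rightarrow> 'b" where
  "psum \<phi> r = (\<Sum>a\<in>keys r. of_rat (lookup r a) * \<phi> a)"

lemma psum_superset:
  "finite A \<Longrightarrow> keys r \<subseteq> A \<Longrightarrow> psum \<phi> r = (\<Sum>a\<in>A. of_rat (lookup r a) * \<phi> a)"
  unfolding psum_def by (rule sum.mono_neutral_left) (auto simp: in_keys_iff)

lemma psum_single [simp]: "psum \<phi> (single a c) = of_rat c * \<phi> a"
  by (subst psum_superset[of "{a}"]) auto

lemma psum_zero [simp]: "psum \<phi> 0 = 0"
  by (simp add: psum_def)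

lemma psum_add [simp]: "psum \<phi> (r + s) = psum \<phi> r + psum \<phi> s"
  using keys_add[of r s]
  by (subst (1 2 3) psum_superset[of "keys r \<union> keys s"])
    (auto simp: lookup_add of_rat_add algebra_simps sum.distrib)

lemma psum_diff [simp]: "psum \<phi> (r - s) = psum \<phi> r - psum \<phi> s"
  using psum_add[of \<phi> "r - s" s] by (simp add: algebra_simps)

lemma psum_sum [simp]: "psum \<phi> (\<Sum>i\<in>A. r i) = (\<Sum>i\<in>A. psum \<phi> (r i))"
  by (induction A rule: infinite_finite_induct) auto

lemma psum_mult: "psum (\<lambda>a. c * \<phi> a) r = c * psum \<phi> r"
  by (simp add: psum_def sum_distrib_left mult_ac)

lemma psum_of_rat: "psum (\<lambda>a. of_rat (\<phi> a)) r = of_rat (psum \<phi> r)"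
  by (simp add: psum_def of_rat_sum of_rat_mult)

lemma steinberg_gens_vlist: "vs \<in> steinberg_gens d \<Longrightarrow> vlist d vs"
  by (auto simp: steinberg_gens_def vlist_def)

lemma steinberg_gens_omit:
  assumes "length vs = Suc d" "set vs \<subseteq> carrier_vec d - {0\<^sub>v d}" "i \<le> d"
  shows "omit i vs \<in> steinberg_gens d"
  using assms set_omit[of i vs] length_omit[of i vs] by (auto simp: steinberg_gens_def)

lemma steinberg_gens_update:
  assumes "vs \<in> steinberg_gens d" "x \<in> carrier_vec d" "x \<noteq> 0\<^sub>v d"
  shows "vs[i := x] \<in> steinberg_gens d"
  using assms by (auto simp: steinberg_gens_def dest!: set_update_subset_insert[THEN subsetD])

lemma smult_vec_nonzero:
  fixes c :: "'a :: field"
  assumes "c \<noteq> 0" "x \<in> carrier_vec d" "x \<noteq> 0\<^sub>v d"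
  shows "c \<cdot>\<^sub>v x \<noteq> 0\<^sub>v d"
proof
  assume "c \<cdot>\<^sub>v x = 0\<^sub>v d"
  then have "(1 / c) \<cdot>\<^sub>v (c \<cdot>\<^sub>v x) = (1 / c) \<cdot>\<^sub>v 0\<^sub>v d" by (rule arg_cong)
  moreover have "(1 / c) \<cdot>\<^sub>v (c \<cdot>\<^sub>v x) = x" using assms(1) by (intro eq_vecI) auto
  moreover have "(1 / c) \<cdot>\<^sub>v 0\<^sub>v d = 0\<^sub>v d" by (rule eq_vecI) auto
  ultimately show False using assms by simp
qed

lemma steinberg_gens_nth:
  "vs \<in> steinberg_gens d \<Longrightarrow> i < d \<Longrightarrow> vs ! i \<in> carrier_vec d \<and> vs ! i \<noteq> 0\<^sub>v d"
proof -
  assume "vs \<in> steinberg_gens d" "i < d"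
  then have "length vs = d" "set vs \<subseteq> carrier_vec d - {0\<^sub>v d}" "i < length vs" by (auto simp: steinberg_gens_def)
  then have "vs ! i \<in> carrier_vec d - {0\<^sub>v d}" using nth_mem[of i vs] by blast
  then show ?thesis by simp
qed

lemma steinberg_rels_cases:
  assumes "r \<in> steinberg_rels d"
  obtains (dep) vs where "vs \<in> steinberg_gens d" "Det d vs = 0" "r = single vs 1"
  | (swap) vs i j where "vs \<in> steinberg_gens d" "i < d" "j < d" "i \<noteq> j"
      "r = single (vs[i := vs ! j, j := vs ! i]) 1 + single vs 1"
  | (scale) vs i c where "vs \<in> steinberg_gens d" "i < d" "c \<noteq> 0"
      "r = single (vs[i := c \<cdot>\<^sub>v vs ! i]) 1 - single vs 1"
  | (circuit) vs where "length vs = Suc d" "set vs \<subseteq> carrier_vec d - {0\<^sub>v d}"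
      "r = (\<Sum>i\<le>d. single (omit i vs) ((-1) ^ i))"
  using assms unfolding steinberg_rels_def omit_def[symmetric]
  by (elim UnE CollectE exE conjE) (auto simp: lin_dep_list_iff[OF steinberg_gens_vlist])

lemma steinberg_presentation: "presentation (steinberg_gens d) (steinberg_rels d)"
proof
  show "steinberg_rels d \<subseteq> carrier (free_mod (steinberg_gens d))"
  proof
    fix r assume "r \<in> steinberg_rels d"
    then show "r \<in> carrier (free_mod (steinberg_gens d))"
    proof (cases rule: steinberg_rels_cases)
      case (dep vs)
      then show ?thesis by (simp add: free_single)
    next
      case (swap vs i j)
      then have "vs[i := vs ! j, j := vs ! i] \<in> steinberg_gens d"
        using steinberg_gens_nth[OF swap(1)] by (intro steinberg_gens_update) auto
      then show ?thesis using swap qvs_add[OF free_qvs free_single free_single]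
        by (simp add: free_add)
    next
      case (scale vs i c)
      then have "vs[i := c \<cdot>\<^sub>v vs ! i] \<in> steinberg_gens d"
        using steinberg_gens_nth[OF scale(1,2)] by (intro steinberg_gens_update smult_vec_nonzero) auto
      then show ?thesis using scale
        by (auto simp: free_minus[of _ _ "steinberg_gens d"] intro!: qvs_add[OF free_qvs] qvs_smult[OF free_qvs] free_single)
    next
      case (circuit vs)
      have "(\<Sum>i\<in>A. single (omit i vs) ((-1 :: rat) ^ i)) \<in> carrier (free_mod (steinberg_gens d))"
        if "finite A" "A \<subseteq> {..d}" for A
        using that
      proof (induction A rule: finite_induct)
        case empty
        then show ?case using qvs_zero[OF free_qvs] by (simp add: free_zero)
      next
        case (insert i A)
        then have "omit i vs \<in> steinberg_gens d" using circuit by (intro steinberg_gens_omit) auto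
        then show ?case using insert qvs_add[OF free_qvs free_single[of "omit i vs"]] by (simp add: free_add)
      qed
      then show ?thesis using circuit by simp
    qed
  qed
qed

lemma sym_presentation:
  assumes V: "qvs V"
  shows "presentation (sym_gens m V) (sym_rels m V)"
proof
  show "sym_rels m V \<subseteq> carrier (free_mod (sym_gens m V))"
    unfolding sym_rels_def free_minus[of _ _ "sym_gens m V"]
    by (auto simp: sym_gens_def intro!: qvs_add[OF free_qvs] qvs_smult[OF free_qvs] free_single qvs_add[OF V] qvs_smult[OF V])
qed

lemma Qvec_qvs: "qvs (Qvec d)"
proof -
  interpret vec_space "TYPE(rat)" d .
  show ?thesis by (rule vec_vs)
qed

lemma Qvec_simps: "carrier (Qvec d) = carrier_vec d" "x \<oplus>\<^bsub>Qvec d\<^esub> y = x + y" "c \<odot>\<^bsub>Qvec d\<^esub> x = c \<cdot>\<^sub>v x"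
  "\<zero>\<^bsub>Qvec d\<^esub> = 0\<^sub>v d"
  by (simp_all add: module_vec_def)

section \<open>The image of a triple of generators\<close>

text \<open>The multiset \<open>X\<close> acts as a differential operator on the exponents, starting
  from all ones; for monomials in the \<open>ws\<close> this is the formula of the theorem without
  the normalising factorials (\<open>dops_monomial\<close>). Zero is prescribed for dependent lists,
  where \<open>dual\<close> is unspecified.\<close>

definition tri_fun :: "nat \<Rightarrow> rat vec list \<Rightarrow> rat vec list \<Rightarrow> rat vec multiset \<Rightarrow> int vec \<Rightarrow> complex" where
  "tri_fun d vs ws X \<nu> = (if Det d vs = 0 \<or> Det d ws = 0 then 0 else
     of_rat (sgn (Det d vs) / Det d ws) *
     dops d (dual d ws) X (\<lambda>ns. cone_distr d (cone_gen d vs) (dual d ws) ns \<nu>) (replicate d 1))"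

text \<open>The derivative of \<open>pole_fun\<close> by the operator that \<open>X\<close>
  represents.\<close>

definition pole_fun_deriv :: "nat \<Rightarrow> rat vec list \<Rightarrow> rat vec multiset \<Rightarrow> rat vec \<Rightarrow> rat" where
  "pole_fun_deriv d ws X x = (if Det d ws = 0 then 0 else
     1 / Det d ws * dops d (dual d ws) X (\<lambda>ns. rat_fun d (dual d ws) ns x) (replicate d 1))"

lemma qsub_hom_sum:
  assumes N: "qsub N (hom_distr_mod d n)" and "finite A" "\<And>a. a \<in> A \<Longrightarrow> f a \<in> N"
  shows "(\<lambda>\<nu>. \<Sum>a\<in>A. of_rat (c a) * f a \<nu>) \<in> N"
  using assms(2-)
proof (induction A rule: finite_induct)
  case empty
  then show ?case using qsub_zero[OF N] by (simp add: hom_zero)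
next
  case (insert a A)
  have "(\<lambda>\<nu>. of_rat (c a) * f a \<nu>) \<in> N" using qsub_smult[OF N insert.prems[of a], where c = "c a"] by (simp add: hom_smult)
  then have "(\<lambda>\<nu>. of_rat (c a) * f a \<nu> + (\<Sum>a\<in>A. of_rat (c a) * f a \<nu>)) \<in> N"
    using qsub_add[OF N, of "\<lambda>\<nu>. of_rat (c a) * f a \<nu>"] insert by (simp add: hom_add)
  then show ?case using insert(1,2) by simp
qed

lemma exponents_Suc:
  assumes "exponents d m ns" "j < d"
  shows "exponents d (Suc m) (ns[j := Suc (ns ! j)])"
proof -
  have "sum_list (ns[j := Suc (ns ! j)]) = Suc m"
    using assms member_le_sum_list[of "ns ! j" ns] by (simp add: exponents_def sum_list_update)
  then show ?thesis using assms by (auto simp: exponents_def nth_list_update)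
qed

text \<open>Every derivative adds one to the total exponent and leaves cone and linear forms alone,
  so a property \<open>P\<close> of the cone is preserved.\<close>

lemma dops_span:
  assumes C: "rational_cone d C" "P C" and us: "ordered_basis d us" and ns: "exponents d m ns"
  shows "(\<lambda>\<nu>. dops d us X (\<lambda>ns. cone_distr d C us ns \<nu>) ns) \<in>
    rat_span (hom_distr_mod d (m + size X)) (cone_distrs d (m + size X) P)"
  using ns
proof (induction X arbitrary: m ns)
  case empty
  then have "cone_distr d C us ns \<in> cone_distrs d m P" using C us by (auto simp: cone_distrs_def)
  then show ?case using qspan_superset[OF hom_qvs cone_distrs_carrier] by fastforce
next
  case (add x X)
  let ?N = "rat_span (hom_distr_mod d (m + size (add_mset x X))) (cone_distrs d (m + size (add_mset x X)) P)"
  have N: "qsub ?N (hom_distr_mod d (m + size (add_mset x X)))" by (rule qspan_sub[OF hom_qvs cone_distrs_carrier])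
  have "(\<lambda>\<nu>. \<Sum>j<d. of_rat ((us ! j \<bullet> x) * of_nat (ns ! j)) *
      dops d us X (\<lambda>ns. cone_distr d C us ns \<nu>) (ns[j := Suc (ns ! j)])) \<in> ?N"
  proof (rule qsub_hom_sum[OF N])
    fix j assume "j \<in> {..<d}"
    then show "(\<lambda>\<nu>. dops d us X (\<lambda>ns. cone_distr d C us ns \<nu>) (ns[j := Suc (ns ! j)])) \<in> ?N"
      using add.IH[OF exponents_Suc[OF add.prems, of j]] by simp
  qed simp
  then show ?case by (simp add: dop_def)
qed

lemma exponents_ones: "exponents d d (replicate d 1)"
  by (simp add: exponents_def sum_list_replicate)

lemma ordered_basis_dual: "vlist d ws \<Longrightarrow> Det d ws \<noteq> 0 \<Longrightarrow> ordered_basis d (dual d ws)"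
  using dual_lists_dual[of d ws] dual_lists_Det[of d "dual d ws" ws] by (auto simp: ordered_basis_iff dual_lists_def)

lemma tri_fun_SLc:
  assumes "vlist d vs" "vlist d ws" "d + size X = n"
  shows "tri_fun d vs ws X \<in> SLc d n"
proof (cases "Det d vs = 0 \<or> Det d ws = 0")
  case True
  then have "tri_fun d vs ws X = (\<lambda>\<nu>. 0)" by (auto simp: tri_fun_def)
  then show ?thesis using qsub_zero[OF SLc_sub, of d n] by (simp add: hom_zero)
next
  case False
  have "(\<lambda>\<nu>. dops d (dual d ws) X (\<lambda>ns. cone_distr d (cone_gen d vs) (dual d ws) ns \<nu>) (replicate d 1)) \<in> SLc d n"
    using dops_span[of d "cone_gen d vs" "\<lambda>_. True" "dual d ws" d "replicate d 1" X] assms False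
      ordered_basis_dual[of d ws] exponents_ones
    by (auto simp: SLc_def rational_cone_def vlist_def)
  from qsub_smult[OF SLc_sub this, where c = "sgn (Det d vs) / Det d ws"] show ?thesis
    using False by (simp add: hom_smult tri_fun_def[abs_def])
qed

text \<open>Off the walls of the cone and the polar hyperplanes the value splits into a factor from
  \<open>vs\<close> and a factor from \<open>ws\<close> and \<open>X\<close>. Relations in the two
  Steinberg variables can then be treated separately.\<close>

lemma tri_fun_generic:
  assumes vs: "vlist d vs" and ws: "vlist d ws"
  shows "gen_all d (\<lambda>x. \<forall>\<nu>\<in>carrier_vec d. ivec \<nu> = x \<longrightarrow>
    tri_fun d vs ws X \<nu> = of_rat (chamber_fun d vs x * pole_fun_deriv d ws X x))"
proof (cases "Det d vs = 0 \<or> Det d ws = 0")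
  case True
  then show ?thesis by (intro gen_allI) (auto simp: tri_fun_def chamber_fun_def pole_fun_deriv_def)
next
  case False
  then have dv: "dual_lists d (dual d vs) vs" and dw: "dual_lists d (dual d ws) ws"
    using vs ws by (auto intro: dual_lists_dual)
  show ?thesis
  proof (rule gen_all_mono[OF gen_all_conj[OF ind_simplicial[OF dv] gen_all_dual[OF dw]]], intro ballI impI)
    fix x \<nu> assume x: "x \<in> carrier_vec d" and g: "ind (cone_gen d vs) x = of_bool (\<forall>j<d. 0 < dual d vs ! j \<bullet> x) \<and>
         (\<forall>j<d. dual d ws ! j \<bullet> x \<noteq> 0)" and nu: "\<nu> \<in> carrier_vec d" "ivec \<nu> = x"
    have "cone_distr d (cone_gen d vs) (dual d ws) ns \<nu> = of_rat (ind (cone_gen d vs) x * rat_fun d (dual d ws) ns x)" for ns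
      using conjunct2[OF g] nu by (simp add: cone_distr_cone_fun cone_fun_def ind_def)
    then have "dops d (dual d ws) X (\<lambda>ns. cone_distr d (cone_gen d vs) (dual d ws) ns \<nu>) (replicate d 1)
      = of_rat (ind (cone_gen d vs) x * dops d (dual d ws) X (\<lambda>ns. rat_fun d (dual d ws) ns x) (replicate d 1))"
      by (simp only: dops_of_rat dops_scale)
    then show "tri_fun d vs ws X \<nu> = of_rat (chamber_fun d vs x * pole_fun_deriv d ws X x)"
      using False g by (simp add: tri_fun_def chamber_fun_def pole_fun_deriv_def of_rat_mult of_rat_divide)
  qed
qed

lemma gen_all_zero_low:
  assumes F: "F \<in> SLc d n" and g: "gen_all d (\<lambda>x. \<forall>\<nu>\<in>carrier_vec d. ivec \<nu> = x \<longrightarrow> F \<nu> = 0)"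
  shows "F \<in> low_dim_span d n"
proof -
  from g obtain H where H: "finite H" "H \<subseteq> carrier_vec d - {0\<^sub>v d}"
    "\<forall>x\<in>carrier_vec d. (\<forall>h\<in>H. h \<bullet> x \<noteq> 0) \<longrightarrow> (\<forall>\<nu>\<in>carrier_vec d. ivec \<nu> = x \<longrightarrow> F \<nu> = 0)"
    unfolding gen_all_def by (elim exE conjE)
  show ?thesis
  proof (rule generic_zero_low[OF F H(1,2)])
    fix \<nu> assume "\<nu> \<in> carrier_vec d" "\<And>h. h \<in> H \<Longrightarrow> h \<bullet> ivec \<nu> \<noteq> 0"
    moreover from this(1) have "ivec \<nu> \<in> carrier_vec d" by simp
    ultimately show "F \<nu> = 0" using bspec[OF H(3), of "ivec \<nu>"] by blast
  qed
qed

text \<open>Skew-symmetry and degeneracy hold exactly; scaling by negative numbers and the circuit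
  relation leave an error supported by a cone with a line. This error is the reason for passing to
  the top graded piece.\<close>

lemma steinberg_rel_chamber:
  assumes "r \<in> steinberg_rels d"
  shows "\<exists>gs \<kappa>. set gs \<subseteq> carrier_vec d \<and> (\<kappa> = 0 \<or> contains_subspace d 1 (cone_gen d gs)) \<and>
    gen_all d (\<lambda>x. psum (\<lambda>vs. chamber_fun d vs x) r = \<kappa> * ind (cone_gen d gs) x)"
  using assms
proof (cases rule: steinberg_rels_cases)
  case (dep vs)
  then have "psum (\<lambda>vs. chamber_fun d vs x) r = 0" for x by (simp add: chamber_fun_def)
  then show ?thesis by (intro exI[of _ "[]"] exI[of _ 0]) (auto intro: gen_allI)
next
  case (swap vs i j)
  then have "psum (\<lambda>vs. chamber_fun d vs x) r = 0" for x
    using chamber_fun_swap[OF steinberg_gens_vlist[OF swap(1)] swap(2-4)] by simp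
  then show ?thesis by (intro exI[of _ "[]"] exI[of _ 0]) (auto intro: gen_allI)
next
  case (scale vs i c)
  have "set vs \<subseteq> - {0\<^sub>v d}" using scale(1) by (auto simp: steinberg_gens_def)
  from chamber_fun_scale[OF steinberg_gens_vlist[OF scale(1)] scale(2,3) this] show ?thesis
    by (simp add: scale(4))
next
  case (circuit vs)
  have "set vs \<subseteq> - {0\<^sub>v d}" "set vs \<subseteq> carrier_vec d" using circuit(2) by auto
  from chamber_fun_circuit[OF circuit(1) this(2,1)] show ?thesis
    by (simp add: circuit(3) of_rat_power)
qed

lemma steinberg_rel_pole:
  assumes "r \<in> steinberg_rels d"
  shows "gen_all d (\<lambda>x. psum (\<lambda>ws. pole_fun d ws x) r = 0)"
  using assms
proof (cases rule: steinberg_rels_cases)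
  case (dep vs)
  then show ?thesis by (intro gen_allI) (simp add: pole_fun_def)
next
  case (swap vs i j)
  then show ?thesis
    using pole_fun_swap[OF steinberg_gens_vlist[OF swap(1)] swap(2-4)] by (intro gen_allI) simp
next
  case (scale vs i c)
  then show ?thesis
    using pole_fun_scale[OF steinberg_gens_vlist[OF scale(1)] scale(2,3)] by (intro gen_allI) simp
next
  case (circuit vs)
  have "set vs \<subseteq> - {0\<^sub>v d}" "set vs \<subseteq> carrier_vec d" using circuit(2) by auto
  from pole_fun_circuit[OF circuit(1) this(2,1)] show ?thesis
    by (simp add: circuit(3) of_rat_power)
qed

lemma steinberg_rel_keys: "r \<in> steinberg_rels d \<Longrightarrow> vs \<in> keys r \<Longrightarrow> vs \<in> steinberg_gens d"
  using presentation.R[OF steinberg_presentation] by (auto simp: free_carrier)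

text \<open>The identity for exponents one is a relation between rational functions at generic
  points, and such relations may be differentiated.\<close>

lemma steinberg_rel_pole_deriv:
  assumes r: "r \<in> steinberg_rels d" and X: "set_mset X \<subseteq> carrier_vec d"
  shows "gen_all d (\<lambda>x. psum (\<lambda>ws. pole_fun_deriv d ws X x) r = 0)"
proof -
  let ?I = "{ws \<in> keys r. Det d ws \<noteq> 0}"
  let ?\<kappa> = "\<lambda>ws. lookup r ws / Det d ws"
  have e: "psum \<phi> r = (\<Sum>ws\<in>?I. lookup r ws * \<phi> ws)" if "\<And>ws. Det d ws = 0 \<Longrightarrow> \<phi> ws = 0" for \<phi> :: "_ \<Rightarrow> rat"
    unfolding psum_def using that by (intro sum.mono_neutral_cong_right) auto
  have "gen_all d (\<lambda>x. (\<Sum>ws\<in>?I. ?\<kappa> ws * dops d (dual d ws) X (\<lambda>ns. rat_fun d (dual d ws) ns x) (replicate d 1)) = 0)"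
  proof (rule generic_derivatives[where ws = "\<lambda>ws. ws"])
    show "dual_lists d (dual d ws) ws" if "ws \<in> ?I" for ws
      using that steinberg_gens_vlist[OF steinberg_rel_keys[OF r]] by (intro dual_lists_dual) auto
    have "psum (\<lambda>ws. pole_fun d ws x) r = (\<Sum>ws\<in>?I. ?\<kappa> ws * (\<Prod>j<d. 1 / (dual d ws ! j \<bullet> x)))" for x
      by (subst e) (auto simp: pole_fun_def)
    then show "gen_all d (\<lambda>x. (\<Sum>ws\<in>?I. ?\<kappa> ws * (\<Prod>j<d. 1 / (dual d ws ! j \<bullet> x))) = 0)"
      using steinberg_rel_pole[OF r] by simp
  qed (use X in auto)
  moreover have "psum (\<lambda>ws. pole_fun_deriv d ws X x) r = (\<Sum>ws\<in>?I. ?\<kappa> ws * dops d (dual d ws) X (\<lambda>ns. rat_fun d (dual d ws) ns x) (replicate d 1))" for x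
    by (subst e) (auto simp: pole_fun_deriv_def)
  ultimately show ?thesis by simp
qed

lemma free_ext_SL:
  assumes f: "f \<in> G \<rightarrow> SLc d n" and r: "r \<in> carrier (free_mod G)"
  shows "free_ext (SL_span d n) f r = (\<lambda>\<nu>. psum (\<lambda>a. f a \<nu>) r)"
proof -
  let ?h = "\<lambda>r \<nu>. psum (\<lambda>a. f a \<nu>) r"
  have psm: "psum \<phi> (Poly_Mapping.map ((*) c) r) = of_rat c * psum \<phi> r" for \<phi> :: "_ \<Rightarrow> complex" and c r
    using keys_map_mult[of c r]
    by (subst (1 2) psum_superset[of "keys r"]) (auto simp: sum_distrib_left of_rat_mult mult_ac)
  have h: "qlin (free_mod G) (SL_span d n) ?h"
  proof (rule qlinI[OF free_qvs SLc_qvs])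
    fix r assume "r \<in> carrier (free_mod G)"
    then show "?h r \<in> carrier (SL_span d n)"
      unfolding psum_def SL_span_simps using f by (intro qsub_hom_sum[OF SLc_sub]) (auto simp: free_carrier)
  qed (auto simp: free_add free_smult SL_span_simps psm)
  have F: "qlin (free_mod G) (SL_span d n) (free_ext (SL_span d n) f)"
    by (rule free_ext_qlin[OF SLc_qvs]) (use f in \<open>auto simp: SL_span_simps\<close>)
  let ?d = "\<lambda>r. free_ext (SL_span d n) f r \<oplus>\<^bsub>SL_span d n\<^esub> (-1) \<odot>\<^bsub>SL_span d n\<^esub> ?h r"
  have "qlin (free_mod G) (SL_span d n) ?d" by (intro qlin_sum qlin_scale F h)
  then have "r \<in> {r \<in> carrier (free_mod G). ?d r = \<zero>\<^bsub>SL_span d n\<^esub>}"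
  proof (rule free_sub_eq[OF qlin_ker_sub _ r])
    fix g assume g: "g \<in> G"
    then have "free_ext (SL_span d n) f (single g 1) = f g"
      using free_ext_single[OF SLc_qvs, of f g d n 1] f qvs_one[OF SLc_qvs, of "f g" d n] by (auto simp: SL_span_simps)
    then show "single g 1 \<in> {r \<in> carrier (free_mod G). ?d r = \<zero>\<^bsub>SL_span d n\<^esub>}"
      using g by (simp add: free_single SL_span_simps of_rat_minus)
  qed
  then show ?thesis
    using qvs_eq_iff_diff[OF SLc_qvs qlin_closed[OF F r] qlin_closed[OF h r]] by simp
qed

lemma free_ext_gr_zero:
  assumes d: "1 \<le> d" and f: "f \<in> G \<rightarrow> SLc d n" and r: "r \<in> carrier (free_mod G)"
    and z: "(\<lambda>\<nu>. psum (\<lambda>a. f a \<nu>) r) \<in> low_or_line d n"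
  shows "free_ext (gr_top d n) (\<lambda>a. gr_top_class d n (f a)) r = \<zero>\<^bsub>gr_top d n\<^esub>"
proof -
  have "free_ext (gr_top d n) (\<lambda>a. gr_top_class d n (f a)) r = gr_top_class d n (free_ext (SL_span d n) f r)"
    using free_ext_comp[OF gr_top_class_qlin _ r, of f d n] f by (simp add: SL_span_simps)
  also have "\<dots> = \<zero>\<^bsub>gr_top d n\<^esub>"
    unfolding free_ext_SL[OF f r] using gr_top_class_zero_iff[OF d] z low_or_line_subset by blast
  finally show ?thesis .
qed

lemma psum_SLc:
  assumes f: "f \<in> G \<rightarrow> SLc d n" and r: "r \<in> carrier (free_mod G)"
  shows "(\<lambda>\<nu>. psum (\<lambda>a. f a \<nu>) r) \<in> SLc d n"
  unfolding psum_def using assms by (intro qsub_hom_sum[OF SLc_sub]) (auto simp: free_carrier)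

text \<open>The error cone of \<open>steinberg_rel_chamber\<close>, combined with the poles of
  \<open>ws\<close>, gives the distribution \<open>?G\<close> in \<open>low_or_line\<close>. Its
  difference from the relation vanishes generically and is therefore of lower dimension.\<close>

lemma tri_fun_rel1:
  assumes r: "r \<in> steinberg_rels d" and ws: "vlist d ws" and n: "d + size X = n"
  shows "(\<lambda>\<nu>. psum (\<lambda>vs. tri_fun d vs ws X \<nu>) r) \<in> low_or_line d n"
proof (cases "Det d ws = 0")
  case True
  then have "(\<lambda>\<nu>. psum (\<lambda>vs. tri_fun d vs ws X \<nu>) r) = (\<lambda>\<nu>. 0)" by (simp add: tri_fun_def psum_def)
  then show ?thesis using qsub_zero[OF low_or_line_sub, of d n] by (simp add: hom_zero)
next
  case False
  note dw = dual_lists_dual[OF ws False]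
  let ?us = "dual d ws"
  obtain gs \<kappa> where gs: "set gs \<subseteq> carrier_vec d" "\<kappa> = 0 \<or> contains_subspace d 1 (cone_gen d gs)"
    and g: "gen_all d (\<lambda>x. psum (\<lambda>vs. chamber_fun d vs x) r = \<kappa> * ind (cone_gen d gs) x)"
    using steinberg_rel_chamber[OF r] by blast
  let ?F = "\<lambda>\<nu>. psum (\<lambda>vs. tri_fun d vs ws X \<nu>) r"
  let ?G = "\<lambda>\<nu>. of_rat (\<kappa> / Det d ws) * dops d ?us X (\<lambda>ns. cone_distr d (cone_gen d gs) ?us ns \<nu>) (replicate d 1)"
  have G: "?G \<in> low_or_line d n"
  proof (cases "\<kappa> = 0")
    case True
    then show ?thesis using qsub_zero[OF low_or_line_sub, of d n] by (simp add: hom_zero)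
  next
    case \<kappa>: False
    have "(\<lambda>\<nu>. dops d ?us X (\<lambda>ns. cone_distr d (cone_gen d gs) ?us ns \<nu>) (replicate d 1)) \<in> low_or_line d n"
      unfolding low_or_line_def n[symmetric]
      by (rule dops_span) (use gs \<kappa> ordered_basis_dual[OF ws False] exponents_ones in \<open>auto simp: rational_cone_def\<close>)
    from qsub_smult[OF low_or_line_sub this, where c = "\<kappa> / Det d ws"] show ?thesis by (simp add: hom_smult)
  qed
  have F: "?F \<in> SLc d n"
    by (rule psum_SLc[of _ "steinberg_gens d"])
      (use presentation.R[OF steinberg_presentation] r ws n in \<open>auto intro!: tri_fun_SLc steinberg_gens_vlist\<close>)
  have "(\<lambda>\<nu>. ?F \<nu> + of_rat (-1) * ?G \<nu>) \<in> low_dim_span d n"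
  proof (rule gen_all_zero_low)
    have "(\<lambda>\<nu>. of_rat (-1) * ?G \<nu>) \<in> SLc d n"
      using qsub_smult[OF SLc_sub, of ?G d n "-1"] G low_or_line_subset by (auto simp: hom_smult)
    from qsub_add[OF SLc_sub F this] show "(\<lambda>\<nu>. ?F \<nu> + of_rat (-1) * ?G \<nu>) \<in> SLc d n" by (simp add: hom_add)
    have "gen_all d (\<lambda>x. \<forall>vs\<in>keys r. \<forall>\<nu>\<in>carrier_vec d. ivec \<nu> = x \<longrightarrow>
        tri_fun d vs ws X \<nu> = of_rat (chamber_fun d vs x * pole_fun_deriv d ws X x))"
      by (intro gen_all_ball tri_fun_generic ws steinberg_gens_vlist steinberg_rel_keys[OF r]) auto
    from gen_all_conj[OF this gen_all_conj[OF g gen_all_dual[OF dw]]]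
    show "gen_all d (\<lambda>x. \<forall>\<nu>\<in>carrier_vec d. ivec \<nu> = x \<longrightarrow> ?F \<nu> + of_rat (-1) * ?G \<nu> = 0)"
    proof (rule gen_all_mono, intro ballI impI, elim conjE)
      fix x \<nu> assume nu: "\<nu> \<in> carrier_vec d" "ivec \<nu> = x"
        and 1: "\<forall>vs\<in>keys r. \<forall>\<nu>\<in>carrier_vec d. ivec \<nu> = x \<longrightarrow>
          tri_fun d vs ws X \<nu> = of_rat (chamber_fun d vs x * pole_fun_deriv d ws X x)"
        and 2: "psum (\<lambda>vs. chamber_fun d vs x) r = \<kappa> * ind (cone_gen d gs) x"
        and 3: "\<forall>j<d. ?us ! j \<bullet> x \<noteq> 0"
      have "?F \<nu> = psum (\<lambda>vs. of_rat (pole_fun_deriv d ws X x * chamber_fun d vs x)) r"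
        unfolding psum_def using 1 nu by (intro sum.cong) (auto simp: mult.commute)
      also have "\<dots> = of_rat (pole_fun_deriv d ws X x * (\<kappa> * ind (cone_gen d gs) x))"
        unfolding psum_of_rat psum_mult 2 ..
      finally have Fe: "?F \<nu> = of_rat (pole_fun_deriv d ws X x * (\<kappa> * ind (cone_gen d gs) x))" .
      have "cone_distr d (cone_gen d gs) ?us ns \<nu> = of_rat (ind (cone_gen d gs) x * rat_fun d ?us ns x)" for ns
        using 3 nu by (simp add: cone_distr_cone_fun cone_fun_def ind_def)
      then have "dops d ?us X (\<lambda>ns. cone_distr d (cone_gen d gs) ?us ns \<nu>) (replicate d 1)
        = of_rat (ind (cone_gen d gs) x * dops d ?us X (\<lambda>ns. rat_fun d ?us ns x) (replicate d 1))"
        by (simp only: dops_of_rat dops_scale)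
      then show "?F \<nu> + of_rat (-1) * ?G \<nu> = 0"
        unfolding Fe using False by (simp add: pole_fun_deriv_def of_rat_mult of_rat_divide of_rat_minus)
    qed
  qed
  then have "(\<lambda>\<nu>. ?F \<nu> + of_rat (-1) * ?G \<nu>) \<in> low_or_line d n" using low_subset_low_or_line by blast
  from qsub_add[OF low_or_line_sub this G] show ?thesis by (simp add: hom_add of_rat_minus)
qed

text \<open>The relation holds exactly at generic points, so its failure is of lower
  dimension.\<close>

lemma tri_fun_rel2:
  assumes r: "r \<in> steinberg_rels d" and vs: "vlist d vs" and n: "d + size X = n" and X: "set_mset X \<subseteq> carrier_vec d"
  shows "(\<lambda>\<nu>. psum (\<lambda>ws. tri_fun d vs ws X \<nu>) r) \<in> low_or_line d n"
proof -
  let ?F = "\<lambda>\<nu>. psum (\<lambda>ws. tri_fun d vs ws X \<nu>) r"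
  have F: "?F \<in> SLc d n"
    by (rule psum_SLc[of _ "steinberg_gens d"])
      (use presentation.R[OF steinberg_presentation] r vs n in \<open>auto intro!: tri_fun_SLc steinberg_gens_vlist\<close>)
  have "gen_all d (\<lambda>x. \<forall>ws\<in>keys r. \<forall>\<nu>\<in>carrier_vec d. ivec \<nu> = x \<longrightarrow>
      tri_fun d vs ws X \<nu> = of_rat (chamber_fun d vs x * pole_fun_deriv d ws X x))"
    by (intro gen_all_ball tri_fun_generic vs steinberg_gens_vlist steinberg_rel_keys[OF r]) auto
  from gen_all_conj[OF this steinberg_rel_pole_deriv[OF r X]]
  have "gen_all d (\<lambda>x. \<forall>\<nu>\<in>carrier_vec d. ivec \<nu> = x \<longrightarrow> ?F \<nu> = 0)"
  proof (rule gen_all_mono, intro ballI impI, elim conjE)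
    fix x \<nu> assume nu: "\<nu> \<in> carrier_vec d" "ivec \<nu> = x"
      and 1: "\<forall>ws\<in>keys r. \<forall>\<nu>\<in>carrier_vec d. ivec \<nu> = x \<longrightarrow>
        tri_fun d vs ws X \<nu> = of_rat (chamber_fun d vs x * pole_fun_deriv d ws X x)"
      and 2: "psum (\<lambda>ws. pole_fun_deriv d ws X x) r = 0"
    have "?F \<nu> = psum (\<lambda>ws. of_rat (chamber_fun d vs x * pole_fun_deriv d ws X x)) r"
      unfolding psum_def using 1 nu by (intro sum.cong) auto
    then show "?F \<nu> = 0" unfolding psum_of_rat psum_mult 2 by simp
  qed
  then show ?thesis using gen_all_zero_low[OF F] low_subset_low_or_line by blast
qed

text \<open>The operator is linear in its direction, so multilinearity holds on the nose at every
  lattice point.\<close>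

lemma tri_fun_rel3:
  assumes r: "r \<in> sym_rels m (Qvec d)" and ws: "vlist d ws"
  shows "psum (\<lambda>X. tri_fun d vs ws X \<nu>) r = 0"
proof (cases "Det d vs = 0 \<or> Det d ws = 0")
  case True
  then show ?thesis by (auto simp: tri_fun_def psum_def)
next
  case False
  then have u: "vlist d (dual d ws)" using dual_lists_dual[OF ws] by (simp add: dual_lists_def)
  show ?thesis using r unfolding sym_rels_def
  proof (elim UnE CollectE exE conjE)
    fix x y X assume *: "r = single (add_mset (x \<oplus>\<^bsub>Qvec d\<^esub> y) X) 1 - single (add_mset x X) 1
        - single (add_mset y X) 1" "x \<in> carrier (Qvec d)" "y \<in> carrier (Qvec d)"
    then have xy: "x \<in> carrier_vec d" "y \<in> carrier_vec d" by (simp_all add: Qvec_simps)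
    show ?thesis using False unfolding *(1)
      by (simp add: Qvec_simps tri_fun_def dop_linear(1)[OF u xy] ring_distribs)
  next
    fix c x X assume *: "r = single (add_mset (c \<odot>\<^bsub>Qvec d\<^esub> x) X) 1 - single (add_mset x X) c"
      "x \<in> carrier (Qvec d)"
    then have x: "x \<in> carrier_vec d" by (simp add: Qvec_simps)
    show ?thesis using False unfolding *(1)
      by (simp add: Qvec_simps tri_fun_def dop_linear(2)[OF u x x])
  qed
qed

abbreviation pure_tensor where
  "pure_tensor d n vs ws X \<equiv> tensor_elt (StSt d) (sym_mod (n - d) (Qvec d))
    (tensor_elt (steinberg d) (steinberg d) (apartment d vs) (apartment d ws)) (sym_prod (n - d) (Qvec d) X)"

lemma trilinear_map_exists:
  assumes d: "1 \<le> d" and n: "d \<le> n"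
  obtains \<Phi> where "qlin (StStSym d n) (gr_top d n) \<Phi>"
    "\<And>vs ws X. vs \<in> steinberg_gens d \<Longrightarrow> ws \<in> steinberg_gens d \<Longrightarrow> X \<in> sym_gens (n - d) (Qvec d) \<Longrightarrow>
      \<Phi> (pure_tensor d n vs ws X)
        = gr_top_class d n (tri_fun d vs ws X)"
proof -
  note St = steinberg_presentation[of d] and Sy = sym_presentation[OF Qvec_qvs[of d], of "n - d"]
  have X: "d + size X = n" "set_mset X \<subseteq> carrier_vec d" if "X \<in> sym_gens (n - d) (Qvec d)" for X
    using that n by (auto simp: sym_gens_def Qvec_simps)
  have t: "tri_fun d vs ws X \<in> SLc d n" if "vs \<in> steinberg_gens d" "ws \<in> steinberg_gens d" "X \<in> sym_gens (n - d) (Qvec d)" for vs ws X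
    using that X by (intro tri_fun_SLc steinberg_gens_vlist) auto
  let ?t = "\<lambda>vs ws X. gr_top_class d n (tri_fun d vs ws X)"
  show thesis
  proof (rule trilinear_lift[OF St St Sy gr_top_qvs[of d n], of ?t])
    fix vs ws X assume *: "vs \<in> steinberg_gens d" "ws \<in> steinberg_gens d" "X \<in> sym_gens (n - d) (Qvec d)"
    show "?t vs ws X \<in> carrier (gr_top d n)" using t[OF *] by (simp add: gr_top_carrier)
  next
    fix r ws X assume *: "r \<in> steinberg_rels d" "ws \<in> steinberg_gens d" "X \<in> sym_gens (n - d) (Qvec d)"
    show "free_ext (gr_top d n) (\<lambda>vs. ?t vs ws X) r = \<zero>\<^bsub>gr_top d n\<^esub>"
      by (rule free_ext_gr_zero[OF d _ subsetD[OF presentation.R[OF St] *(1)]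
            tri_fun_rel1[OF *(1) steinberg_gens_vlist[OF *(2)] X(1)[OF *(3)]]]) (use t * in auto)
  next
    fix vs r X assume *: "vs \<in> steinberg_gens d" "r \<in> steinberg_rels d" "X \<in> sym_gens (n - d) (Qvec d)"
    show "free_ext (gr_top d n) (\<lambda>ws. ?t vs ws X) r = \<zero>\<^bsub>gr_top d n\<^esub>"
      by (rule free_ext_gr_zero[OF d _ subsetD[OF presentation.R[OF St] *(2)]
            tri_fun_rel2[OF *(2) steinberg_gens_vlist[OF *(1)] X[OF *(3)]]]) (use t * in auto)
  next
    fix vs ws r assume *: "vs \<in> steinberg_gens d" "ws \<in> steinberg_gens d" "r \<in> sym_rels (n - d) (Qvec d)"
    have z: "(\<lambda>\<nu>. psum (\<lambda>X. tri_fun d vs ws X \<nu>) r) \<in> low_or_line d n"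
      using qsub_zero[OF low_or_line_sub, of d n] tri_fun_rel3[OF *(3) steinberg_gens_vlist[OF *(2)]] by (simp add: hom_zero)
    show "free_ext (gr_top d n) (?t vs ws) r = \<zero>\<^bsub>gr_top d n\<^esub>"
      by (rule free_ext_gr_zero[OF d _ subsetD[OF presentation.R[OF Sy] *(3)] z]) (use t * in auto)
  qed (rule that; simp add: steinberg_def sym_mod_def apartment_def sym_prod_def)
qed

section \<open>Unitriangular apartments span the Steinberg module\<close>

text \<open>The first \<open>m\<close> columns of an elimination are done; for \<open>m = 0\<close>
  this is any generator, for \<open>m = d\<close> the vectors are the columns of a lower
  unitriangular matrix. The corresponding apartments are the classical basis of the Steinberg
  module, an orbit of the unipotent group.\<close>

definition unitri_list :: "nat \<Rightarrow> nat \<Rightarrow> rat vec list \<Rightarrow> bool" where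
  "unitri_list d m vs \<longleftrightarrow> vs \<in> steinberg_gens d \<and>
    (\<forall>i<d. \<forall>k<min i m. vs ! i $ k = 0) \<and> (\<forall>i<m. vs ! i $ i = 1)"

lemma dual_lists_sym:
  fixes us :: "'a :: field vec list"
  shows "dual_lists d us vs \<Longrightarrow> dual_lists d vs us"
  unfolding dual_lists_def by (auto simp: comm_scalar_prod[OF vlist_nth vlist_nth])

lemma Det_zero_orth:
  fixes vs :: "'a :: field vec list"
  assumes vs: "vlist d vs" and h: "h \<in> carrier_vec d" "h \<noteq> 0\<^sub>v d" "\<And>i. i < d \<Longrightarrow> vs ! i \<bullet> h = 0"
  shows "Det d vs = 0"
proof (rule ccontr)
  assume "Det d vs \<noteq> 0"
  then obtain us where "dual_lists d us vs" using dual_lists_exists[OF vs] by blast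
  from dual_lists_zero[OF dual_lists_sym[OF this] h(1)] h show False by blast
qed

text \<open>The \<open>m\<close> vectors before position \<open>m\<close>, cut to the first
  \<open>m + 1\<close> coordinates, have a common orthogonal vector. Extended by zero, it is
  orthogonal to the remaining vectors as well.\<close>

lemma Det_zero_low:
  fixes vs :: "'a :: field vec list"
  assumes vs: "vlist d vs" and m: "m < d" and z: "\<And>i k. m \<le> i \<Longrightarrow> i < d \<Longrightarrow> k \<le> m \<Longrightarrow> vs ! i $ k = 0"
  shows "Det d vs = 0"
proof -
  let ?g = "\<lambda>i. vec (Suc m) (\<lambda>k. vs ! i $ k)"
  obtain h where h: "h \<in> carrier_vec (Suc m)" "h \<noteq> 0\<^sub>v (Suc m)" "\<And>i. i < m \<Longrightarrow> h \<bullet> ?g i = 0"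
    using orth_exists[of "map ?g [0..<m]" "Suc m"] by (auto simp: image_subset_iff)
  let ?h = "vec d (\<lambda>k. if k \<le> m then h $ k else 0)"
  have s: "vs ! i \<bullet> ?h = (\<Sum>k<Suc m. vs ! i $ k * h $ k)" if "i < d" for i
  proof -
    have "vs ! i \<bullet> ?h = (\<Sum>k<d. vs ! i $ k * (if k \<le> m then h $ k else 0))"
      using vlist_nth[OF vs that] by (subst sprod) auto
    also have "\<dots> = (\<Sum>k<Suc m. vs ! i $ k * h $ k)"
      using m by (intro sum.mono_neutral_cong_right) auto
    finally show ?thesis .
  qed
  show ?thesis
  proof (rule Det_zero_orth[OF vs, of ?h])
    obtain k where "k < Suc m" "h $ k \<noteq> 0" using h(1,2) by (metis eq_vecI carrier_vecD index_zero_vec)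
    then have "?h $ k \<noteq> 0\<^sub>v d $ k" using m by auto
    then show "?h \<noteq> 0\<^sub>v d" by metis
    fix i assume i: "i < d"
    show "vs ! i \<bullet> ?h = 0"
    proof (cases "i < m")
      case True
      have "h \<bullet> ?g i = (\<Sum>k<Suc m. h $ k * vs ! i $ k)" using h(1) by (subst sprod) auto
      then show ?thesis using h(3)[OF True] by (simp add: s[OF i] mult.commute)
    next
      case False
      then show ?thesis using z[of i] i by (simp add: s[OF i])
    qed
  qed simp
qed

text \<open>The elimination is phrased for a predicate \<open>P\<close> that respects the four kinds
  of Steinberg relations. It is applied with \<open>P\<close> the membership of an apartment in a
  given subspace.\<close>

context
  fixes d :: nat and P :: "rat vec list \<Rightarrow> bool"
  assumes dep: "\<And>vs. vs \<in> steinberg_gens d \<Longrightarrow> Det d vs = 0 \<Longrightarrow> P vs"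
    and swap: "\<And>vs i j. vs \<in> steinberg_gens d \<Longrightarrow> i < d \<Longrightarrow> j < d \<Longrightarrow> i \<noteq> j \<Longrightarrow> P vs \<Longrightarrow> P (vs[i := vs ! j, j := vs ! i])"
    and scale: "\<And>vs i c. vs \<in> steinberg_gens d \<Longrightarrow> i < d \<Longrightarrow> c \<noteq> 0 \<Longrightarrow> P (vs[i := c \<cdot>\<^sub>v vs ! i]) \<Longrightarrow> P vs"
    and circuit: "\<And>x vs. vs \<in> steinberg_gens d \<Longrightarrow> x \<in> carrier_vec d - {0\<^sub>v d} \<Longrightarrow>
      (\<And>k. k < d \<Longrightarrow> P (x # omit k vs)) \<Longrightarrow> P vs"
begin

lemma steinberg_rotate:
  "ps @ ys @ x # zs \<in> steinberg_gens d \<Longrightarrow> P (ps @ ys @ x # zs) \<Longrightarrow> P (ps @ x # ys @ zs)"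
proof (induction ys arbitrary: zs rule: rev_induct)
  case (snoc y ys)
  let ?vs = "ps @ ys @ y # x # zs"
  let ?i = "length ps + length ys"
  have g: "?vs \<in> steinberg_gens d" and "P ?vs" using snoc by auto
  from swap[OF g, of ?i "Suc ?i"] this
  have s: "P (?vs[?i := ?vs ! Suc ?i, Suc ?i := ?vs ! ?i])" by (auto simp: steinberg_gens_def)
  have "?vs[?i := ?vs ! Suc ?i, Suc ?i := ?vs ! ?i] = ps @ ys @ x # y # zs"
    by (simp add: list_update_append nth_append)
  with s have "P (ps @ ys @ x # y # zs)" by simp
  moreover have "ps @ ys @ x # y # zs \<in> steinberg_gens d" using g by (auto simp: steinberg_gens_def)
  ultimately show ?case using snoc.IH[of "y # zs"] by simp
qed simp

text \<open>The circuit relation for \<open>x\<close> followed by \<open>vs\<close> writes the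
  apartment of \<open>vs\<close> through those in which \<open>x\<close> replaces one entry;
  neighbouring swaps bring \<open>x\<close> to its place.\<close>

lemma steinberg_exchange:
  assumes vs: "vs \<in> steinberg_gens d" and x: "x \<in> carrier_vec d" "x \<noteq> 0\<^sub>v d"
    and p: "\<And>k. k < d \<Longrightarrow> P (vs[k := x])"
  shows "P vs"
proof (rule circuit[OF vs])
  show "x \<in> carrier_vec d - {0\<^sub>v d}" using x by simp
  fix k assume k: "k < d"
  have l: "length vs = d" using vs by (simp add: steinberg_gens_def)
  have e: "vs[k := x] = take k vs @ x # drop (Suc k) vs" using k l by (simp add: upd_conv_take_nth_drop)
  have "vs[k := x] \<in> steinberg_gens d" by (rule steinberg_gens_update[OF vs x])
  then show "P (x # omit k vs)"
    using steinberg_rotate[of "[]" "take k vs" x "drop (Suc k) vs"] p[OF k] unfolding e omit_def by simp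
qed

text \<open>Gaussian elimination in coordinate \<open>m\<close>, by induction on the number of
  vectors from position \<open>m\<close> onward with nonzero entry there. Two such vectors are
  combined by an exchange. A single one is moved to position \<open>m\<close> and scaled. If there
  is none, the list is dependent.\<close>

lemma unitri_step:
  assumes m: "m < d" and IH: "\<And>vs. unitri_list d (Suc m) vs \<Longrightarrow> P vs" and u: "unitri_list d m vs"
  shows "P vs"
  using u
proof (induction "card {i. m \<le> i \<and> i < d \<and> vs ! i $ m \<noteq> 0}" arbitrary: vs rule: less_induct)
  case less
  let ?I = "\<lambda>vs :: rat vec list. {i. m \<le> i \<and> i < d \<and> vs ! i $ m \<noteq> 0}"
  have g: "vs \<in> steinberg_gens d" and z: "\<And>i k. i < d \<Longrightarrow> k < i \<Longrightarrow> k < m \<Longrightarrow> vs ! i $ k = 0"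
    and o: "\<And>i. i < m \<Longrightarrow> vs ! i $ i = 1" using less.prems by (auto simp: unitri_list_def)
  have l: "length vs = d" using g by (simp add: steinberg_gens_def)
  note vl = steinberg_gens_vlist[OF g]
  have vc: "vs ! i \<in> carrier_vec d" if "i < d" for i using vlist_nth[OF vl that] .
  show ?case
  proof (cases "\<exists>i\<in>?I vs. \<exists>j\<in>?I vs. i \<noteq> j")
    case True
    then obtain i j where ij: "m \<le> i" "i < d" "vs ! i $ m \<noteq> 0" "m \<le> j" "j < d" "vs ! j $ m \<noteq> 0" "i \<noteq> j" by blast
    let ?a = "vs ! i $ m" and ?b = "vs ! j $ m"
    \<comment> \<open>The combination of the two vectors that cancels coordinate \<open>m\<close>;
      it inherits the zeros in the earlier coordinates.\<close>
    define x where "x = ?b \<cdot>\<^sub>v vs ! i - ?a \<cdot>\<^sub>v vs ! j"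
    have xc: "x \<in> carrier_vec d" using vc ij by (simp add: x_def)
    have xk: "x $ k = ?b * vs ! i $ k - ?a * vs ! j $ k" if "k < d" for k
      using that vc[of i] vc[of j] ij by (simp add: x_def)
    show ?thesis
    proof (cases "x = 0\<^sub>v d")
      case True
      have "\<exists>c. (\<exists>i<d. c i \<noteq> 0) \<and> (\<forall>k<d. (\<Sum>i<d. c i * vs ! i $ k) = 0)"
      proof (intro exI[of _ "\<lambda>p. (if p = i then ?b else 0) + (if p = j then - ?a else 0)"] conjI allI impI)
        fix k assume "k < d"
        then show "(\<Sum>p<d. ((if p = i then ?b else 0) + (if p = j then - ?a else 0)) * vs ! p $ k) = 0"
          using xk[of k] ij unfolding True
          by (simp add: distrib_right sum.distrib if_distrib[where f = "\<lambda>c. c * _"] cong: if_cong)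
      qed (use ij in auto)
      then show ?thesis using Det_zero_iff[OF vl] dep[OF g] by blast
    next
      case nz: False
      show ?thesis
      proof (rule steinberg_exchange[OF g xc nz])
        fix k assume k: "k < d"
        have gk: "vs[k := x] \<in> steinberg_gens d" by (rule steinberg_gens_update[OF g xc nz])
        show "P (vs[k := x])"
        proof (cases "k = i \<or> k = j")
          case True
          have xm: "x $ m = 0" using xk[OF m] by simp
          have n: "vs[k := x] ! p = (if p = k then x else vs ! p)" for p using k l by (cases "p = k") auto
          have kI: "k \<in> ?I vs" using True ij by blast
          have "?I (vs[k := x]) \<subseteq> ?I vs - {k}" unfolding n using xm by (intro subsetI) (simp split: if_splits)
          then have "?I (vs[k := x]) \<subset> ?I vs" using kI by blast
          then have c: "card (?I (vs[k := x])) < card (?I vs)" by (intro psubset_card_mono) auto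
          have "unitri_list d m (vs[k := x])"
            unfolding unitri_list_def
          proof (intro conjI allI impI gk)
            fix p q assume "p < d" "q < min p m"
            then show "vs[k := x] ! p $ q = 0"
              using z[of p q] z[of i q] z[of j q] xk[of q] ij m by (cases "p = k") (simp_all add: n)
          next
            fix p assume "p < m"
            then show "vs[k := x] ! p $ p = 1" using o[of p] True ij by auto
          qed
          then show ?thesis using less.hyps[OF c] by simp
        next
          case False
          \<comment> \<open>Here \<open>x\<close> replaced a third vector, while the two vectors it
            is a combination of are still in the list.\<close>
          have "\<exists>c. (\<exists>i<d. c i \<noteq> 0) \<and> (\<forall>q<d. (\<Sum>p<d. c p * vs[k := x] ! p $ q) = 0)"
          proof (intro exI[of _ "\<lambda>p. (if p = k then -1 else 0) + ((if p = i then ?b else 0) + (if p = j then - ?a else 0))"] conjI allI impI)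
            fix q assume q: "q < d"
            show "(\<Sum>p<d. ((if p = k then -1 else 0) + ((if p = i then ?b else 0) + (if p = j then - ?a else 0))) * vs[k := x] ! p $ q) = 0"
              using xk[OF q] ij k l False
              by (simp add: distrib_right sum.distrib if_distrib[where f = "\<lambda>c. c * _"] cong: if_cong)
          qed (use ij k False in \<open>auto intro!: exI[of _ k]\<close>)
          then show ?thesis using Det_zero_iff[OF steinberg_gens_vlist[OF gk]] dep[OF gk] by blast
        qed
      qed
    qed
  next
    case uniq: False
    show ?thesis
    proof (cases "?I vs = {}")
      case True
      have "Det d vs = 0"
      proof (rule Det_zero_low[OF vl m])
        fix i k assume *: "m \<le> i" "i < d" "k \<le> m"
        then show "vs ! i $ k = 0" using z[of i k] True by (cases "k = m") auto
      qed
      then show ?thesis by (rule dep[OF g])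
    next
      case False
      then obtain i where i: "m \<le> i" "i < d" "vs ! i $ m \<noteq> 0" by blast
      have oth: "vs ! p $ m = 0" if "m \<le> p" "p < d" "p \<noteq> i" for p using that i uniq by blast
      \<comment> \<open>The pivot moves to position \<open>m\<close>; \<open>us\<close> is the same
        list with the pivot entry scaled to one.\<close>
      define ws where "ws = vs[i := vs ! m, m := vs ! i]"
      have wsg: "ws \<in> steinberg_gens d"
        unfolding ws_def using steinberg_gens_nth[OF g] i m by (intro steinberg_gens_update g) auto
      have lw: "length ws = d" using l by (simp add: ws_def)
      have wn: "ws ! p = vs ! (if p = m then i else if p = i then m else p)" if "p < d" for p
        using that l m by (auto simp: ws_def nth_list_update)
      define us where "us = ws[m := (1 / ws ! m $ m) \<cdot>\<^sub>v ws ! m]"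
      have wm: "ws ! m $ m \<noteq> 0" using i m by (simp add: wn)
      have un: "us ! p $ q = (if p = m then ws ! m $ q / ws ! m $ m else ws ! p $ q)" if "p < d" "q < d" for p q
        using that lw vc[of i] m i by (auto simp: us_def nth_list_update wn)
      have usg: "us \<in> steinberg_gens d"
        unfolding us_def using steinberg_gens_nth[OF wsg m] wm by (intro steinberg_gens_update wsg smult_vec_nonzero) auto
      have "unitri_list d (Suc m) us"
        unfolding unitri_list_def
      proof (intro conjI allI impI usg)
        fix p q assume *: "p < d" "q < min p (Suc m)"
        show "us ! p $ q = 0"
        proof (cases "q = m")
          case True
          then have "ws ! p $ m = 0" using * oth i by (auto simp: wn)
          then show ?thesis using * True un[of p q] by auto
        next
          case False
          then have "q < m" "q < p" using * by auto
          then have "ws ! p $ q = 0" using * z[of p q] z[of i q] z[of m q] i m by (auto simp: wn)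
          then show ?thesis using * un[of p q] by auto
        qed
      next
        fix p assume p: "p < Suc m"
        show "us ! p $ p = 1"
        proof (cases "p = m")
          case True
          then show ?thesis using un[OF m m] wm by simp
        next
          case False
          then have "p < m" using p by simp
          then have "ws ! p $ p = 1" using o[of p] i m by (auto simp: wn)
          then show ?thesis using un[of p p] \<open>p < m\<close> m by auto
        qed
      qed
      then have "P us" by (rule IH)
      then have Pw: "P ws" using scale[OF wsg m, of "1 / ws ! m $ m"] wm by (simp add: us_def)
      show ?thesis
      proof (cases "i = m")
        case True
        then show ?thesis using Pw l by (simp add: ws_def)
      next
        case False
        have "ws[i := ws ! m, m := ws ! i] = vs"
          using l lw i m False by (intro nth_equalityI) (auto simp: nth_list_update wn)
        then show ?thesis using swap[OF wsg i(2) m False Pw] by simp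
      qed
    qed
  qed
qed

lemma unitri_induct:
  assumes base: "\<And>vs. unitri_list d d vs \<Longrightarrow> P vs" and g: "vs \<in> steinberg_gens d"
  shows "P vs"
proof -
  have "\<And>vs. unitri_list d m vs \<Longrightarrow> P vs" if "m \<le> d" for m
    using that
  proof (induction rule: inc_induct)
    case (step m)
    show ?case by (rule unitri_step[OF step(2) step(3) step(4)])
  qed (rule base)
  from this[of 0] show ?thesis using g by (simp add: unitri_list_def)
qed

end

text \<open>Membership in a subspace is compatible with the Steinberg relations, so
  \<open>unitri_induct\<close> reduces all apartments to unitriangular ones.\<close>

lemma steinberg_sub_eq:
  assumes S: "qsub S (steinberg d)" and B: "\<And>vs. unitri_list d d vs \<Longrightarrow> apartment d vs \<in> S"
    and x: "x \<in> carrier (steinberg d)"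
  shows "x \<in> S"
proof -
  interpret presentation "steinberg_gens d" "steinberg_rels d" by (rule steinberg_presentation)
  note q = PM_qvs
  note S' = S[unfolded steinberg_def]
  have F: "qlin (free_mod (steinberg_gens d)) PM (free_ext PM gen)"
    by (rule free_ext_qlin[OF q]) (auto intro: gen_carrier)
  let ?e = "free_ext PM gen"
  note c = gen_carrier
  have s: "?e (single vs k) = k \<odot>\<^bsub>PM\<^esub> gen vs" if "vs \<in> steinberg_gens d" for vs k
    using free_ext_single[OF q, of gen vs] c[OF that] by simp
  have canc: "a \<in> S" if a: "a \<in> carrier PM" and b: "b \<in> S" and e: "a \<oplus>\<^bsub>PM\<^esub> b = \<zero>\<^bsub>PM\<^esub>" for a b
  proof -
    have "b \<in> carrier PM" using qsub_subset[OF S'] b by blast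
    then have nb: "(-1) \<odot>\<^bsub>PM\<^esub> b \<in> carrier PM" "b = (-1) \<odot>\<^bsub>PM\<^esub> ((-1) \<odot>\<^bsub>PM\<^esub> b)"
      by (simp_all add: qvs_smult[OF q] qvs_smult_smult[OF q] qvs_one[OF q])
    have "a = (-1) \<odot>\<^bsub>PM\<^esub> b" using qvs_eq_iff_diff[OF q a nb(1)] nb(2) e by simp
    then show ?thesis using qsub_smult[OF S' b] by simp
  qed
  have "gen vs \<in> S" if "vs \<in> steinberg_gens d" for vs
  proof (rule unitri_induct[OF _ _ _ _ _ that, where P = "\<lambda>vs. gen vs \<in> S"])
    fix vs assume *: "vs \<in> steinberg_gens d" "Det d vs = 0"
    then have "single vs 1 \<in> steinberg_rels d"
      using lin_dep_list_iff[OF steinberg_gens_vlist[OF *(1)]] by (auto simp: steinberg_rels_def)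
    from rel_zero[OF this] show "gen vs \<in> S"
      using s[OF *(1), of 1] c[OF *(1)] qsub_zero[OF S'] by (simp add: qvs_one[OF q])
  next
    fix vs i j assume *: "vs \<in> steinberg_gens d" "i < d" "j < d" "i \<noteq> j" "gen vs \<in> S"
    let ?w = "vs[i := vs ! j, j := vs ! i]"
    have w: "?w \<in> steinberg_gens d"
      using steinberg_gens_nth[OF *(1)] * by (intro steinberg_gens_update *) auto
    have "single ?w 1 + single vs 1 \<in> steinberg_rels d"
      unfolding steinberg_rels_def using * by blast
    from rel_zero[OF this] have "gen ?w \<oplus>\<^bsub>PM\<^esub> gen vs = \<zero>\<^bsub>PM\<^esub>"
      using qlin_add[OF F free_single[OF w, of 1] free_single[OF *(1), of 1]] c[OF w] c[OF *(1)]
      by (simp add: free_add s w * qvs_one[OF q])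
    then show "gen ?w \<in> S" by (rule canc[OF c[OF w] *(5)])
  next
    fix vs i and k :: rat assume *: "vs \<in> steinberg_gens d" "i < d" "k \<noteq> 0"
    let ?w = "vs[i := k \<cdot>\<^sub>v vs ! i]"
    assume wS: "gen ?w \<in> S"
    have w: "?w \<in> steinberg_gens d"
      using steinberg_gens_nth[OF *(1)] * by (intro steinberg_gens_update smult_vec_nonzero *) auto
    have "single ?w 1 - single vs 1 \<in> steinberg_rels d"
      unfolding steinberg_rels_def using * by blast
    from rel_zero[OF this] have "gen ?w \<oplus>\<^bsub>PM\<^esub> (-1) \<odot>\<^bsub>PM\<^esub> gen vs = \<zero>\<^bsub>PM\<^esub>"
      using qlin_add[OF F free_single[OF w, of 1] qvs_smult[OF free_qvs free_single[OF *(1), of 1], of "-1"]]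
        qlin_smult[OF F free_single[OF *(1), of 1], of "-1"] c[OF w] c[OF *(1)]
      by (simp add: free_minus[of _ _ "steinberg_gens d"] s w * qvs_one[OF q])
    then have "gen ?w = gen vs" using qvs_eq_iff_diff[OF q c[OF w] c[OF *(1)]] by simp
    then show "gen vs \<in> S" using wS by simp
  next
    fix x vs assume vs: "vs \<in> steinberg_gens d" and x: "x \<in> carrier_vec d - {0\<^sub>v d}"
      and P: "\<And>k. k < d \<Longrightarrow> gen (x # omit k vs) \<in> S"
    let ?g = "\<lambda>k. single (x # omit k vs) ((-1 :: rat) ^ Suc k)"
    have l: "length (x # vs) = Suc d" "set (x # vs) \<subseteq> carrier_vec d - {0\<^sub>v d}" using vs x by (auto simp: steinberg_gens_def)
    have o: "x # omit k vs \<in> steinberg_gens d" if "k < d" for k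
      using steinberg_gens_omit[OF l, of "Suc k"] that by (simp add: omit_def)
    have oS: "(\<Sum>k\<in>A. ?g k) \<in> carrier (free_mod (steinberg_gens d)) \<and> ?e (\<Sum>k\<in>A. ?g k) \<in> S" if "finite A" "A \<subseteq> {..<d}" for A
      using that
    proof (induction A rule: finite_induct)
      case empty
      then show ?case using qlin_zero[OF F] qvs_zero[OF free_qvs] qsub_zero[OF S'] by (simp add: free_zero)
    next
      case (insert k A)
      then have k: "k < d" by simp
      have "?e (?g k) \<in> S" using s[OF o[OF k]] qsub_smult[OF S' P[OF k]] by simp
      then show ?case
        using insert qlin_add[OF F free_single[OF o[OF k]]] qvs_add[OF free_qvs free_single[OF o[OF k]]] qsub_add[OF S']
        by (simp add: free_add)
    qed
    have "(\<Sum>i\<le>d. single (take i (x # vs) @ drop (Suc i) (x # vs)) ((-1) ^ i)) \<in> steinberg_rels d"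
      unfolding steinberg_rels_def using l by blast
    \<comment> \<open>The term that omits \<open>x\<close> is \<open>vs\<close> itself; all others
      contain \<open>x\<close> in front.\<close>
    also have "(\<Sum>i\<le>d. single (take i (x # vs) @ drop (Suc i) (x # vs)) ((-1 :: rat) ^ i))
       = single vs 1 + (\<Sum>k<d. ?g k)"
      by (simp add: sum.atMost_shift omit_def)
    finally have e: "gen vs \<oplus>\<^bsub>PM\<^esub> ?e (\<Sum>k<d. ?g k) = \<zero>\<^bsub>PM\<^esub>"
      using rel_zero qlin_add[OF F free_single[OF vs, of 1], of "\<Sum>k<d. ?g k"] oS[of "{..<d}"] c[OF vs]
      by (simp add: free_add s vs qvs_one[OF q])
    show "gen vs \<in> S" by (rule canc[OF c[OF vs] conjunct2[OF oS] e]) auto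
  next
    fix vs assume "unitri_list d d vs"
    from B[OF this] show "gen vs \<in> S" by (simp add: apartment_def)
  qed
  then show ?thesis using sub_eq[OF S'] x by (simp add: steinberg_def)
qed

section \<open>Spanning the tensor product\<close>

lemma unitri_vlist: "unitri_list d m vs \<Longrightarrow> vlist d vs"
  by (auto simp: unitri_list_def intro: steinberg_gens_vlist)

lemma unitri_Det: 
  assumes "unitri_list d d vs"
  shows "Det d vs \<noteq> 0"
proof
  have z: "\<And>i k. i < d \<Longrightarrow> k < i \<Longrightarrow> vs ! i $ k = 0"
    and o: "\<And>i. i < d \<Longrightarrow> vs ! i $ i = 1" using assms by (auto simp: unitri_list_def)
  assume "Det d vs = 0"
  then obtain c where c: "\<exists>i<d. c i \<noteq> 0" "\<And>k. k < d \<Longrightarrow> (\<Sum>i<d. c i * vs ! i $ k) = 0"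
    using Det_zero_iff[OF unitri_vlist[OF assms]] by blast
  have "c i = 0" if "i < d" for i
    using that
  proof (induction i rule: less_induct)
    case (less i)
    have "(\<Sum>p<d. c p * vs ! p $ i) = (\<Sum>p<d. if p = i then c i else 0)"
    proof (rule sum.cong)
      fix p assume "p \<in> {..<d}"
      then show "c p * vs ! p $ i = (if p = i then c i else 0)"
        using less z[of p i] o[of i] by (cases "p < i"; cases "p = i") auto
    qed simp
    then show ?case using c(2)[OF less.prems] less.prems by simp
  qed
  then show False using c(1) by blast
qed

lemma qsub_Qvec_basis:
  assumes b: "ordered_basis d ws" and T: "qsub T (Qvec d)" and "set ws \<subseteq> T"
  shows "carrier_vec d \<subseteq> T"
proof -
  interpret vec_space "TYPE(rat)" d .
  have "rat_span (Qvec d) (set ws) = carrier (Qvec d)"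
    using b basis_def by (auto simp: ordered_basis_def)
  then show ?thesis using qspan_least[OF Qvec_qvs assms(3) T] by (simp add: Qvec_simps)
qed

lemma sym_prod_qlin:
  assumes V: "qvs V" and X: "set_mset X \<subseteq> carrier V" "Suc (size X) = m"
  shows "qlin V (sym_mod m V) (\<lambda>x. sym_prod m V (add_mset x X))"
proof -
  interpret presentation "sym_gens m V" "sym_rels m V" by (rule sym_presentation[OF V])
  note q = PM_qvs
  have F: "qlin (free_mod (sym_gens m V)) PM (free_ext PM gen)"
    by (rule free_ext_qlin[OF q]) (auto intro: gen_carrier)
  have g: "add_mset x X \<in> sym_gens m V" if "x \<in> carrier V" for x using that X by (auto simp: sym_gens_def)
  note c = gen_carrier[OF g] and fs = free_single[OF g]
  have s: "free_ext PM gen (single (add_mset x X) k) = k \<odot>\<^bsub>PM\<^esub> gen (add_mset x X)" if "x \<in> carrier V" for x k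
    using free_ext_single[OF q, of gen "add_mset x X"] c[OF that] by simp
  note fsm = qvs_smult[OF free_qvs fs]
  show ?thesis unfolding sym_mod_def sym_prod_def
  proof (rule qlinI[OF V q])
    fix x y assume xy: "x \<in> carrier V" "y \<in> carrier V"
    note xyc = qvs_add[OF V xy]
    have "single (add_mset (x \<oplus>\<^bsub>V\<^esub> y) X) 1 - single (add_mset x X) 1
        - single (add_mset y X) 1 \<in> sym_rels m V"
      unfolding sym_rels_def using xy X by blast
    from rel_zero[OF this]
    have "gen (add_mset (x \<oplus>\<^bsub>V\<^esub> y) X) \<oplus>\<^bsub>PM\<^esub> (-1) \<odot>\<^bsub>PM\<^esub> gen (add_mset x X) \<oplus>\<^bsub>PM\<^esub> (-1) \<odot>\<^bsub>PM\<^esub> gen (add_mset y X) = \<zero>\<^bsub>PM\<^esub>"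
      using xy xyc by (simp add: free_minus[of _ _ "sym_gens m V"] qlin_add[OF F] qlin_smult[OF F] fs fsm qvs_add[OF free_qvs] s c qvs_one[OF q])
    then have "gen (add_mset (x \<oplus>\<^bsub>V\<^esub> y) X) \<oplus>\<^bsub>PM\<^esub> (-1) \<odot>\<^bsub>PM\<^esub> (gen (add_mset x X) \<oplus>\<^bsub>PM\<^esub> gen (add_mset y X)) = \<zero>\<^bsub>PM\<^esub>"
      using xy xyc by (simp add: qvs_assoc[OF q] qvs_smult_r[OF q] c qvs_smult[OF q])
    then show "gen (add_mset (x \<oplus>\<^bsub>V\<^esub> y) X) = gen (add_mset x X) \<oplus>\<^bsub>PM\<^esub> gen (add_mset y X)"
      using qvs_eq_iff_diff[OF q c[OF xyc] qvs_add[OF q c[OF xy(1)] c[OF xy(2)]]] by simp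
  next
    fix k x assume x: "x \<in> carrier V"
    note kx = qvs_smult[OF V x, of k]
    have "single (add_mset (k \<odot>\<^bsub>V\<^esub> x) X) 1 - single (add_mset x X) k \<in> sym_rels m V"
      unfolding sym_rels_def using x X by blast
    from rel_zero[OF this]
    have "gen (add_mset (k \<odot>\<^bsub>V\<^esub> x) X) \<oplus>\<^bsub>PM\<^esub> (-1) \<odot>\<^bsub>PM\<^esub> (k \<odot>\<^bsub>PM\<^esub> gen (add_mset x X)) = \<zero>\<^bsub>PM\<^esub>"
      using x kx by (simp add: free_minus[of _ _ "sym_gens m V"] qlin_add[OF F] qlin_smult[OF F] fs fsm s c qvs_one[OF q])
    then show "gen (add_mset (k \<odot>\<^bsub>V\<^esub> x) X) = k \<odot>\<^bsub>PM\<^esub> gen (add_mset x X)"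
      using qvs_eq_iff_diff[OF q c[OF kx] qvs_smult[OF q c[OF x]]] by simp
  qed (rule c)
qed

text \<open>By multilinearity the factors of a product are moved one at a time from arbitrary
  vectors to members of the basis.\<close>

lemma sym_sub_eq:
  assumes b: "ordered_basis d ws" and S: "qsub S (sym_mod m (Qvec d))"
    and base: "\<And>X. set_mset X \<subseteq> set ws \<Longrightarrow> size X = m \<Longrightarrow> sym_prod m (Qvec d) X \<in> S"
    and y: "y \<in> carrier (sym_mod m (Qvec d))"
  shows "y \<in> S"
proof -
  have ws: "set ws \<subseteq> carrier_vec d" using b by (simp add: ordered_basis_iff vlist_def)
  have "sym_prod m (Qvec d) (X + Y) \<in> S"
    if "set_mset X \<subseteq> carrier_vec d" "set_mset Y \<subseteq> set ws" "size X + size Y = m" for X Y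
    using that
  proof (induction X arbitrary: Y)
    case empty
    then show ?case using base by simp
  next
    case (add x X)
    let ?T = "{x \<in> carrier (Qvec d). sym_prod m (Qvec d) (add_mset x (X + Y)) \<in> S}"
    have "qlin (Qvec d) (sym_mod m (Qvec d)) (\<lambda>x. sym_prod m (Qvec d) (add_mset x (X + Y)))"
      by (rule sym_prod_qlin[OF Qvec_qvs]) (use add.prems ws in \<open>auto simp: Qvec_simps\<close>)
    from qlin_vimage_sub[OF this S] have T: "qsub ?T (Qvec d)" .
    have "set ws \<subseteq> ?T"
    proof
      fix w assume w: "w \<in> set ws"
      then have "sym_prod m (Qvec d) (X + add_mset w Y) \<in> S" using add.prems by (intro add.IH) auto
      then show "w \<in> ?T" using w ws by (auto simp: Qvec_simps)
    qed
    from qsub_Qvec_basis[OF b T this] add.prems show ?case by auto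
  qed
  from this[of _ "{#}"] have "sym_prod m (Qvec d) X \<in> S" if "X \<in> sym_gens m (Qvec d)" for X
    using that by (auto simp: sym_gens_def Qvec_simps)
  then show ?thesis
    using presentation.sub_eq[OF sym_presentation[OF Qvec_qvs], of S m d y] S y
    by (auto simp: sym_mod_def sym_prod_def)
qed

lemma mset_monomial:
  assumes "distinct ws" "set_mset X \<subseteq> set ws"
  shows "X = (\<Sum>j<length ws. replicate_mset (count X (ws ! j)) (ws ! j))"
proof (rule multiset_eqI)
  fix w
  have "count (\<Sum>j<length ws. replicate_mset (count X (ws ! j)) (ws ! j)) w
     = (\<Sum>j<length ws. if ws ! j = w then count X w else 0)"
    by (auto simp: count_sum intro!: sum.cong)
  also have "\<dots> = count X w"
  proof (cases "w \<in> set ws")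
    case True
    then obtain i where i: "i < length ws" "w = ws ! i" by (auto simp: in_set_conv_nth)
    have "(\<Sum>j<length ws. if ws ! j = w then count X w else 0) = (\<Sum>j<length ws. if j = i then count X w else 0)"
      using i assms(1) by (intro sum.cong) (auto simp: nth_eq_iff_index_eq)
    then show ?thesis using i by simp
  next
    case False
    then have "count X w = 0" using assms(2) by (meson count_eq_zero_iff subsetD)
    then show ?thesis by simp
  qed
  finally show "count X w = count (\<Sum>j<length ws. replicate_mset (count X (ws ! j)) (ws ! j)) w" ..
qed

text \<open>The exponent of a basis vector is its multiplicity plus one; the \<open>d\<close>
  additional units turn the degree \<open>n - d\<close> into \<open>n\<close>.\<close>

lemma monomial_exponents:
  assumes b: "ordered_basis d ws" and X: "set_mset X \<subseteq> set ws" "size X = n - d" and n: "d \<le> n"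
  obtains ns where "exponents d n ns" "X = (\<Sum>j<d. replicate_mset (ns ! j - 1) (ws ! j))"
proof
  have ws: "length ws = d" "distinct ws" using b by (auto simp: ordered_basis_iff[of d ws] vlist_def)
      (use b in \<open>simp add: ordered_basis_def\<close>)
  let ?ns = "map (\<lambda>w. Suc (count X w)) ws"
  have e: "X = (\<Sum>j<d. replicate_mset (count X (ws ! j)) (ws ! j))" using mset_monomial[OF ws(2) X(1)] ws(1) by simp
  then show "X = (\<Sum>j<d. replicate_mset (?ns ! j - 1) (ws ! j))" using ws by simp
  have "size X = (\<Sum>j<d. count X (ws ! j))" by (subst e) (simp add: size_multiset_sum)
  then have "sum_list ?ns = n" using X n ws by (simp add: sum_list_sum_nth sum_Suc atLeast0LessThan)
  then show "exponents d n ?ns" using ws by (simp add: exponents_def)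
qed

text \<open>The three factors are reduced separately, the others being fixed: the symmetric factor
  to monomials in the unitriangular \<open>ws\<close> (the factorials are invertible), then each
  Steinberg factor to unitriangular apartments.\<close>

lemma StStSym_sub_eq:
  assumes n: "d \<le> n" and S: "qsub S (StStSym d n)"
    and base: "\<And>vs ws ns. unitri_list d d vs \<Longrightarrow> unitri_list d d ws \<Longrightarrow> exponents d n ns \<Longrightarrow>
      StStSym_elt d n vs ws ns \<in> S"
    and z: "z \<in> carrier (StStSym d n)"
  shows "z \<in> S"
proof -
  let ?Sy = "sym_mod (n - d) (Qvec d)" and ?St = "steinberg d"
  have St: "qvs ?St" unfolding steinberg_def by (rule presentation.PM_qvs[OF steinberg_presentation])
  have Sy: "qvs ?Sy" unfolding sym_mod_def by (rule presentation.PM_qvs[OF sym_presentation[OF Qvec_qvs]])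
  note TT = tensor_qvs[OF St St]
  note b1 = tensor_elt_bilin[OF St St] and b2 = tensor_elt_bilin[OF TT Sy]
  have ap: "apartment d vs \<in> carrier ?St" if "vs \<in> steinberg_gens d" for vs
    unfolding steinberg_def apartment_def by (rule presentation.gen_carrier[OF steinberg_presentation that])
  let ?E = "tensor_elt (StSt d) ?Sy" and ?e = "tensor_elt ?St ?St"
  have 1: "?E (?e (apartment d vs) (apartment d ws)) y \<in> S"
    if vs: "unitri_list d d vs" and ws: "unitri_list d d ws" and y: "y \<in> carrier ?Sy" for vs ws y
  proof -
    let ?t = "?e (apartment d vs) (apartment d ws)"
    have t: "?t \<in> carrier (StSt d)"
      by (rule qbilin_closed[OF b1]) (use vs ws in \<open>auto intro!: ap simp: unitri_list_def\<close>)
    note l = qbilin_qlin2[OF b2 t]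
    have b: "ordered_basis d ws" using ws unitri_Det unitri_vlist by (auto simp: ordered_basis_iff)
    have "y \<in> {y \<in> carrier ?Sy. ?E ?t y \<in> S}"
    proof (rule sym_sub_eq[OF b qlin_vimage_sub[OF l S] _ y])
      fix X assume X: "set_mset X \<subseteq> set ws" "size X = n - d"
      obtain ns where ns: "exponents d n ns" "X = (\<Sum>j<d. replicate_mset (ns ! j - 1) (ws ! j))"
        using monomial_exponents[OF b X n] .
      have Xg: "X \<in> sym_gens (n - d) (Qvec d)"
        using X b by (auto simp: sym_gens_def Qvec_simps ordered_basis_iff vlist_def)
      have c: "sym_prod (n - d) (Qvec d) X \<in> carrier ?Sy"
        unfolding sym_mod_def sym_prod_def by (rule presentation.gen_carrier[OF sym_presentation[OF Qvec_qvs] Xg])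
      let ?f = "(\<Prod>j<d. fact (ns ! j - 1)) :: rat"
      have "?E ?t ((1 / ?f) \<odot>\<^bsub>?Sy\<^esub> sym_prod (n - d) (Qvec d) X) \<in> S"
        using base[OF vs ws ns(1)] unfolding StStSym_elt_def ns(2) .
      then have "(1 / ?f) \<odot>\<^bsub>?Sy\<^esub> sym_prod (n - d) (Qvec d) X \<in> {y \<in> carrier ?Sy. ?E ?t y \<in> S}"
        using qvs_smult[OF Sy c] by simp
      from qsub_smult[OF qlin_vimage_sub[OF l S] this, of ?f]
      show "sym_prod (n - d) (Qvec d) X \<in> {y \<in> carrier ?Sy. ?E ?t y \<in> S}"
        by (simp add: qvs_smult_smult[OF Sy c] qvs_one[OF Sy c])
    qed
    then show ?thesis by simp
  qed
  have 2: "?E (?e (apartment d vs) b) y \<in> S"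
    if vs: "unitri_list d d vs" and b: "b \<in> carrier ?St" and y: "y \<in> carrier ?Sy" for vs b y
  proof -
    have a: "apartment d vs \<in> carrier ?St" using vs by (intro ap) (simp add: unitri_list_def)
    note l = qlin_comp[OF qbilin_qlin2[OF b1 a] qbilin_qlin1[OF b2 y]]
    have "b \<in> {b \<in> carrier ?St. ?E (?e (apartment d vs) b) y \<in> S}"
      by (rule steinberg_sub_eq[OF qlin_vimage_sub[OF l S] _ b])
        (use 1[OF vs _ y] ap in \<open>auto simp: unitri_list_def\<close>)
    then show ?thesis by simp
  qed
  have 3: "?E (?e a b) y \<in> S"
    if a: "a \<in> carrier ?St" and b: "b \<in> carrier ?St" and y: "y \<in> carrier ?Sy" for a b y
  proof -
    note l = qlin_comp[OF qbilin_qlin1[OF b1 b] qbilin_qlin1[OF b2 y]]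
    have "a \<in> {a \<in> carrier ?St. ?E (?e a b) y \<in> S}"
      by (rule steinberg_sub_eq[OF qlin_vimage_sub[OF l S] _ a])
        (use 2[OF _ b y] ap in \<open>auto simp: unitri_list_def\<close>)
    then show ?thesis by simp
  qed
  have 4: "?E t y \<in> S" if t: "t \<in> carrier (StSt d)" and y: "y \<in> carrier ?Sy" for t y
  proof -
    have "t \<in> {t \<in> carrier (StSt d). ?E t y \<in> S}"
      by (rule tensor_sub_eq[OF St St qlin_vimage_sub[OF qbilin_qlin1[OF b2 y] S] _ t])
        (use 3[OF _ _ y] qbilin_closed[OF b1] in auto)
    then show ?thesis by simp
  qed
  show ?thesis by (rule tensor_sub_eq[OF TT Sy S 4 z])
qed

section \<open>Germs of cones at infinity\<close>

definition flip :: "nat set \<Rightarrow> nat \<Rightarrow> 'a :: ring_1" where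
  "flip S i = (if i \<in> S then -1 else 1)"

text \<open>With \<open>e\<close> the coordinates of a basis \<open>b\<close>, such a curve is asymptotic to the sum of the
  \<open>\<plusminus> t ^ (d - i)\<close> multiples of \<open>b ! i\<close>; the set \<open>S\<close> collects the indices with the negative sign.\<close>
definition germ_curve :: "nat \<Rightarrow> rat vec list \<Rightarrow> nat set \<Rightarrow> (nat \<Rightarrow> rat vec) \<Rightarrow> bool" where
  "germ_curve d e S z \<longleftrightarrow> (\<forall>t. z t \<in> carrier_vec d) \<and>
    (\<forall>i<d. (\<lambda>t. real_of_rat (e ! i \<bullet> z t) / real t ^ (d - i)) \<longlonglongrightarrow> flip S i)"

text \<open>Quantified over all curves with the given leading terms; by \<open>in_germ_iff\<close>
  any single such curve decides.\<close>

definition in_germ :: "nat \<Rightarrow> rat vec list \<Rightarrow> nat set \<Rightarrow> real vec set \<Rightarrow> bool" where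
  "in_germ d e S C \<longleftrightarrow> (\<forall>z. germ_curve d e S z \<longrightarrow> (\<forall>\<^sub>F t in sequentially. rvec (z t) \<in> C))"

text \<open>The separating functional for the first Steinberg factor: an alternating sum over all
  sign choices along the flag of \<open>b\<close>. Cones of lower dimension and cones with a line
  give zero, and on unitriangular bases it is the coordinate functional of the apartment of
  \<open>b\<close>.\<close>

definition germ_sum :: "nat \<Rightarrow> rat vec list \<Rightarrow> real vec set \<Rightarrow> rat" where
  "germ_sum d e C = (\<Sum>S\<in>Pow {..<d}. (-1) ^ card S * of_bool (in_germ d e S C))"

text \<open>The sets without \<open>k\<close> are paired with those obtained by adding
  \<open>k\<close>; the signs in a pair are opposite.\<close>

lemma sum_Pow_cancel:
  fixes f :: "nat set \<Rightarrow> 'a :: field_char_0"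
  assumes k: "k \<in> A" and A: "finite A" and f: "\<And>S. S \<subseteq> A - {k} \<Longrightarrow> f (insert k S) = f S"
  shows "(\<Sum>S\<in>Pow A. (-1) ^ card S * f S) = 0"
proof -
  have "Pow A = Pow (A - {k}) \<union> insert k ` Pow (A - {k})"
    using Pow_insert[of k "A - {k}"] k by (simp add: insert_absorb)
  then have "(\<Sum>S\<in>Pow A. (-1) ^ card S * f S) = (\<Sum>S\<in>Pow (A - {k}). (-1) ^ card S * f S)
      + (\<Sum>S\<in>insert k ` Pow (A - {k}). (-1) ^ card S * f S)"
    using A by (simp only:) (intro sum.union_disjoint, auto)
  also have "(\<Sum>S\<in>insert k ` Pow (A - {k}). (-1) ^ card S * f S)
      = (\<Sum>S\<in>Pow (A - {k}). (-1) ^ card (insert k S) * f (insert k S))"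
    by (subst sum.reindex) (auto intro!: inj_onI)
  also have "\<dots> = (\<Sum>S\<in>Pow (A - {k}). - ((-1) ^ card S * f S))"
  proof (rule sum.cong)
    fix S assume S: "S \<in> Pow (A - {k})"
    then have "finite S" "k \<notin> S" using A finite_subset by auto
    then show "(-1) ^ card (insert k S) * f (insert k S) = - ((-1) ^ card S * f S)"
      using f[of S] S by simp
  qed simp
  finally show ?thesis by (simp add: sum_negf)
qed

lemma leading_index:
  assumes B: "dual_lists d e b" and h: "h \<in> carrier_vec d" "h \<noteq> 0\<^sub>v d"
  obtains k where "k < d" "h \<bullet> b ! k \<noteq> 0" "\<And>i. i < k \<Longrightarrow> h \<bullet> b ! i = 0"
proof -
  have "\<exists>k. k < d \<and> h \<bullet> b ! k \<noteq> 0"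
  proof (rule ccontr)
    assume "\<not> (\<exists>k. k < d \<and> h \<bullet> b ! k \<noteq> 0)"
    then have "b ! i \<bullet> h = 0" if "i < d" for i
      using that h comm_scalar_prod[of h d "b ! i"] B by (simp add: dual_lists_def vlist_nth)
    then show False using dual_lists_zero[OF dual_lists_sym[OF B] h(1)] h(2) by blast
  qed
  then obtain k where k: "k < d" "h \<bullet> b ! k \<noteq> 0" "\<forall>m<k. \<not> (m < d \<and> h \<bullet> b ! m \<noteq> 0)"
    unfolding exists_least_iff[of "\<lambda>k. k < d \<and> h \<bullet> b ! k \<noteq> 0"] by (elim exE conjE)
  then have "h \<bullet> b ! i = 0" if "i < k" for i using that by (meson less_trans)
  then show thesis using that k by blast
qed

lemma dual_lists_sprod:
  assumes B: "dual_lists d e b" and h: "h \<in> carrier_vec d" and x: "x \<in> carrier_vec d"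
  shows "h \<bullet> x = (\<Sum>i<d. (e ! i \<bullet> x) * (h \<bullet> b ! i))"
proof -
  have b: "b ! i \<in> carrier_vec d" if "i < d" for i using B that by (simp add: dual_lists_def vlist_nth)
  have "h \<bullet> x = (\<Sum>k<d. h $ k * (\<Sum>i<d. (e ! i \<bullet> x) * b ! i $ k))"
    unfolding sprod[OF h x] by (intro sum.cong) (auto simp: dual_lists_expand[OF B x])
  also have "\<dots> = (\<Sum>i<d. (e ! i \<bullet> x) * (\<Sum>k<d. h $ k * b ! i $ k))"
    unfolding sum_distrib_left by (subst sum.swap) (simp add: mult_ac)
  finally show ?thesis using b by (simp add: sprod[OF h])
qed

text \<open>The coordinate along \<open>b ! i\<close> grows like \<open>t ^ (d - i)\<close>, so
  earlier basis vectors dominate and the first one on which \<open>h\<close> does not vanish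
  determines growth and sign.\<close>

lemma curve_limit:
  assumes B: "dual_lists d e b" and z: "germ_curve d e S z" and h: "h \<in> carrier_vec d"
    and k: "k < d" "\<And>i. i < k \<Longrightarrow> h \<bullet> b ! i = 0"
  shows "(\<lambda>t. real_of_rat (h \<bullet> z t) / real t ^ (d - k)) \<longlonglongrightarrow> flip S k * real_of_rat (h \<bullet> b ! k)"
proof -
  have zc: "z t \<in> carrier_vec d" for t using z by (simp add: germ_curve_def)
  have l: "(\<lambda>t. real_of_rat (e ! i \<bullet> z t) / real t ^ (d - i)) \<longlonglongrightarrow> flip S i" if "i < d" for i
    using z that by (simp add: germ_curve_def)
  have "(\<lambda>t. \<Sum>i<d. real_of_rat (h \<bullet> b ! i) * (real_of_rat (e ! i \<bullet> z t) / real t ^ (d - k)))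
      \<longlonglongrightarrow> (\<Sum>i<d. if i = k then flip S k * real_of_rat (h \<bullet> b ! k) else 0)"
  proof (rule tendsto_sum)
    fix i assume i: "i \<in> {..<d}"
    consider "i < k" | "i = k" | "k < i" by linarith
    then show "(\<lambda>t. real_of_rat (h \<bullet> b ! i) * (real_of_rat (e ! i \<bullet> z t) / real t ^ (d - k)))
      \<longlonglongrightarrow> (if i = k then flip S k * real_of_rat (h \<bullet> b ! k) else 0)"
    proof cases
      case 1
      then show ?thesis using k(2) by simp
    next
      case 2
      then show ?thesis using tendsto_mult[OF tendsto_const l[OF k(1)], of "real_of_rat (h \<bullet> b ! k)"]
        by (simp add: mult.commute)
    next
      case 3
      have "(\<lambda>t. inverse (real t ^ (i - k))) \<longlonglongrightarrow> 0"
        using 3 by (intro tendsto_inverse_0_at_top filterlim_pow_at_top filterlim_real_sequentially) auto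
      from tendsto_mult[OF tendsto_const tendsto_mult[OF l this]] i
      have "(\<lambda>t. real_of_rat (h \<bullet> b ! i) * (real_of_rat (e ! i \<bullet> z t) / real t ^ (d - i) * inverse (real t ^ (i - k)))) \<longlonglongrightarrow> 0"
        by fastforce
      moreover have "real t ^ (d - k) = real t ^ (d - i) * real t ^ (i - k)" for t
        using 3 i by (simp add: power_add[symmetric])
      ultimately show ?thesis using 3 by (simp add: field_simps)
    qed
  qed
  moreover have "(\<Sum>i<d. real_of_rat (h \<bullet> b ! i) * (real_of_rat (e ! i \<bullet> z t) / real t ^ (d - k)))
     = real_of_rat (h \<bullet> z t) / real t ^ (d - k)" for t
    by (simp add: dual_lists_sprod[OF B h zc] of_rat_sum of_rat_mult sum_divide_distrib mult.commute)
  ultimately show ?thesis using k(1) by simp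
qed

lemma curve_sign:
  assumes B: "dual_lists d e b" and z: "germ_curve d e S z" and h: "h \<in> carrier_vec d"
    and k: "k < d" "\<And>i. i < k \<Longrightarrow> h \<bullet> b ! i = 0" "h \<bullet> b ! k \<noteq> 0"
  shows "\<forall>\<^sub>F t in sequentially. h \<bullet> z t \<noteq> 0 \<and> (0 < h \<bullet> z t \<longleftrightarrow> 0 < flip S k * (h \<bullet> b ! k))"
proof -
  let ?L = "flip S k * real_of_rat (h \<bullet> b ! k)"
  note l = curve_limit[OF B z h k(1,2)]
  show ?thesis
  proof (cases "0 < flip S k * (h \<bullet> b ! k)")
    case True
    then have "0 < ?L" by (auto simp: flip_def split: if_splits)
    from order_tendstoD(1)[OF l this] show ?thesis
    proof (rule eventually_mono)
      fix t assume "0 < real_of_rat (h \<bullet> z t) / real t ^ (d - k)"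
      then have "0 < h \<bullet> z t" by (auto simp: zero_less_divide_iff)
      then show "h \<bullet> z t \<noteq> 0 \<and> (0 < h \<bullet> z t \<longleftrightarrow> 0 < flip S k * (h \<bullet> b ! k))" using True by simp
    qed
  next
    case False
    then have "?L < 0" using k(3) by (auto simp: flip_def split: if_splits)
    from order_tendstoD(2)[OF l this] show ?thesis
    proof (rule eventually_mono)
      fix t assume "real_of_rat (h \<bullet> z t) / real t ^ (d - k) < 0"
      then have "h \<bullet> z t < 0" by (auto simp: divide_less_0_iff)
      then show "h \<bullet> z t \<noteq> 0 \<and> (0 < h \<bullet> z t \<longleftrightarrow> 0 < flip S k * (h \<bullet> b ! k))" using False by simp
    qed
  qed
qed

text \<open>Every nonzero form has a leading index and is therefore eventually nonzero along the
  curve.\<close>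

lemma curve_generic:
  assumes B: "dual_lists d e b" and z: "germ_curve d e S z" and g: "gen_all d P"
  shows "\<forall>\<^sub>F t in sequentially. P (z t)"
proof -
  from g obtain H where H: "finite H" "H \<subseteq> carrier_vec d - {0\<^sub>v d}"
    "\<forall>x\<in>carrier_vec d. (\<forall>h\<in>H. h \<bullet> x \<noteq> 0) \<longrightarrow> P x"
    unfolding gen_all_def by (elim exE conjE)
  have "\<forall>\<^sub>F t in sequentially. h \<bullet> z t \<noteq> 0" if "h \<in> H" for h
  proof -
    have h: "h \<in> carrier_vec d" "h \<noteq> 0\<^sub>v d" using that H by auto
    obtain k where k: "k < d" "h \<bullet> b ! k \<noteq> 0" "\<And>i. i < k \<Longrightarrow> h \<bullet> b ! i = 0"
      using leading_index[OF B h] by blast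
    have "\<forall>\<^sub>F t in sequentially. h \<bullet> z t \<noteq> 0 \<and> (0 < h \<bullet> z t \<longleftrightarrow> 0 < flip S k * (h \<bullet> b ! k))"
      by (rule curve_sign[OF B z h(1) k(1)]) (use k in auto)
    then show ?thesis by (rule eventually_mono) (rule conjunct1)
  qed
  then have "\<forall>\<^sub>F t in sequentially. \<forall>h\<in>H. h \<bullet> z t \<noteq> 0" by (intro eventually_ball_finite H(1)) auto
  then show ?thesis
  proof (rule eventually_mono)
    fix t assume "\<forall>h\<in>H. h \<bullet> z t \<noteq> 0"
    moreover have "z t \<in> carrier_vec d" using z by (simp add: germ_curve_def)
    ultimately show "P (z t)" using H(3) by blast
  qed
qed

text \<open>A polynomial curve with the prescribed leading terms. It passes through \<open>x\<close>
  at \<open>t = 0\<close>, all exponents \<open>d - i\<close> being positive; this base point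
  carries the rational functions in the later evaluation.\<close>

definition std_curve :: "nat \<Rightarrow> rat vec list \<Rightarrow> nat set \<Rightarrow> rat vec \<Rightarrow> nat \<Rightarrow> rat vec" where
  "std_curve d b S x t = vec d (\<lambda>k. x $ k + (\<Sum>i<d. flip S i * of_nat t ^ (d - i) * b ! i $ k))"

lemma std_curve_sprod:
  assumes b: "vlist d b" and h: "h \<in> carrier_vec d" and x: "x \<in> carrier_vec d"
  shows "h \<bullet> std_curve d b S x t = h \<bullet> x + (\<Sum>i<d. flip S i * of_nat t ^ (d - i) * (h \<bullet> b ! i))"
proof -
  have "(\<Sum>k<d. h $ k * (\<Sum>i<d. flip S i * of_nat t ^ (d - i) * b ! i $ k))
    = (\<Sum>i<d. flip S i * of_nat t ^ (d - i) * (\<Sum>k<d. h $ k * b ! i $ k))"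
    unfolding sum_distrib_left by (subst sum.swap) (simp add: mult_ac)
  also have "\<dots> = (\<Sum>i<d. flip S i * of_nat t ^ (d - i) * (h \<bullet> b ! i))"
    by (intro sum.cong) (auto simp: sprod[OF h vlist_nth[OF b]])
  finally show ?thesis
    by (subst sprod[OF h]) (auto simp: std_curve_def sprod[OF h x] algebra_simps sum.distrib)
qed

lemma germ_curve_std:
  assumes B: "dual_lists d e b" and x: "x \<in> carrier_vec d"
  shows "germ_curve d e S (std_curve d b S x)"
  unfolding germ_curve_def
proof (intro conjI allI impI)
  fix i assume i: "i < d"
  have ei: "e ! i \<in> carrier_vec d" and b: "vlist d b" using B i by (auto simp: dual_lists_def vlist_nth)
  have "(\<Sum>p<d. flip S p * of_nat t ^ (d - p) * (e ! i \<bullet> b ! p)) = (\<Sum>p<d. if p = i then flip S i * of_nat t ^ (d - i) else (0 :: rat))" for t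
    using B i by (intro sum.cong) (auto simp: dual_lists_def)
  then have c: "e ! i \<bullet> std_curve d b S x t = e ! i \<bullet> x + flip S i * of_nat t ^ (d - i)" for t
    using i by (simp add: std_curve_sprod[OF b ei x])
  have "(\<lambda>t. inverse (real t ^ (d - i))) \<longlonglongrightarrow> 0"
    using i by (intro tendsto_inverse_0_at_top filterlim_pow_at_top filterlim_real_sequentially) auto
  from tendsto_add[OF tendsto_mult[OF tendsto_const this, of "real_of_rat (e ! i \<bullet> x)"] tendsto_const[of "flip S i"]]
  have "(\<lambda>t. real_of_rat (e ! i \<bullet> x) * inverse (real t ^ (d - i)) + flip S i) \<longlonglongrightarrow> flip S i" by simp
  then show "(\<lambda>t. real_of_rat (e ! i \<bullet> std_curve d b S x t) / real t ^ (d - i)) \<longlonglongrightarrow> flip S i"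
  proof (rule Lim_transform_eventually)
    show "\<forall>\<^sub>F t in sequentially. real_of_rat (e ! i \<bullet> x) * inverse (real t ^ (d - i)) + flip S i
        = real_of_rat (e ! i \<bullet> std_curve d b S x t) / real t ^ (d - i)"
      using eventually_gt_at_top[of 0]
      by (rule eventually_mono) (auto simp: c of_rat_add of_rat_mult of_rat_power flip_def field_simps of_rat_minus)
  qed
qed (simp add: std_curve_def)

text \<open>By Caratheodory, membership of generic points is a Boolean combination of signs of
  finitely many linear forms. Along the curve each sign is eventually constant, with a value that
  depends on the leading terms alone.\<close>

lemma in_germ_eventually:
  assumes B: "dual_lists d e b" and gs: "set gs \<subseteq> carrier_vec d" and z: "germ_curve d e S z"
  shows "\<forall>\<^sub>F t in sequentially. rvec (z t) \<in> cone_gen d gs \<longleftrightarrow> in_germ d e S (cone_gen d gs)"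
proof -
  let ?V = "{vs. set vs \<subseteq> set gs \<and> length vs = d \<and> Det d vs \<noteq> 0}"
  have fV: "finite ?V" by (rule finite_subset[OF _ finite_lists_length_eq[OF finite_set[of gs], of d]]) auto
  have dv: "dual_lists d (dual d vs) vs" if "vs \<in> ?V" for vs
    using that gs by (intro dual_lists_dual) (auto simp: vlist_def)
  have "gen_all d (\<lambda>x. rvec x \<in> cone_gen d gs \<longleftrightarrow> (\<exists>vs\<in>?V. \<forall>j<d. 0 < dual d vs ! j \<bullet> x))"
  proof (rule gen_all_mono[OF cone_gen_caratheodory[OF gs]])
    fix x assume e: "rvec x \<in> cone_gen d gs \<longleftrightarrow> (\<exists>vs us. set vs \<subseteq> set gs \<and> dual_lists d us vs \<and> (\<forall>j<d. 0 < us ! j \<bullet> x))"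
    have "vs \<in> ?V" "dual d vs = us" if "set vs \<subseteq> set gs" "dual_lists d us vs" for vs us
      using that dual_eq[OF that(2)] dual_lists_Det_nz[OF that(2)] by (auto simp: dual_lists_def vlist_def)
    then show "rvec x \<in> cone_gen d gs \<longleftrightarrow> (\<exists>vs\<in>?V. \<forall>j<d. 0 < dual d vs ! j \<bullet> x)"
      unfolding e using dv by blast
  qed
  note ev = curve_generic[OF B _ this]
  have "\<exists>G. \<forall>z. germ_curve d e S z \<longrightarrow> (\<forall>\<^sub>F t in sequentially. 0 < dual d vs ! j \<bullet> z t \<longleftrightarrow> G)" if vs: "vs \<in> ?V" and j: "j < d" for vs j
  proof -
    have h: "dual d vs ! j \<in> carrier_vec d" "dual d vs ! j \<noteq> 0\<^sub>v d"
      using dv[OF vs] j dual_lists_nonzero by (auto simp: dual_lists_def vlist_nth)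
    obtain k where k: "k < d" "dual d vs ! j \<bullet> b ! k \<noteq> 0" "\<And>i. i < k \<Longrightarrow> dual d vs ! j \<bullet> b ! i = 0"
      using leading_index[OF B h] by blast
    show ?thesis
      by (intro exI[of _ "0 < flip S k * (dual d vs ! j \<bullet> b ! k)"] allI impI)
        (rule eventually_mono[OF curve_sign[OF B _ h(1) k(1,3,2)]], auto)
  qed
  then have "\<forall>p. \<exists>G. fst p \<in> ?V \<and> snd p < d \<longrightarrow> (\<forall>z. germ_curve d e S z \<longrightarrow>
      (\<forall>\<^sub>F t in sequentially. 0 < dual d (fst p) ! snd p \<bullet> z t \<longleftrightarrow> G))" by blast
  from choice[OF this] obtain G' where G': "\<forall>p. fst p \<in> ?V \<and> snd p < d \<longrightarrow> (\<forall>z. germ_curve d e S z \<longrightarrow>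
      (\<forall>\<^sub>F t in sequentially. 0 < dual d (fst p) ! snd p \<bullet> z t \<longleftrightarrow> G' p))" ..
  define G where "G vs j = G' (vs, j)" for vs j
  have G: "\<forall>\<^sub>F t in sequentially. 0 < dual d vs ! j \<bullet> z t \<longleftrightarrow> G vs j"
    if "vs \<in> ?V" "j < d" "germ_curve d e S z" for vs j z
    using G'[rule_format, of "(vs, j)" z] that unfolding G_def fst_conv snd_conv by blast
  let ?G = "\<exists>vs\<in>?V. \<forall>j<d. G vs j"
  have main: "\<forall>\<^sub>F t in sequentially. rvec (z t) \<in> cone_gen d gs \<longleftrightarrow> ?G" if z: "germ_curve d e S z" for z
  proof -
    have "\<forall>\<^sub>F t in sequentially. \<forall>vs\<in>?V. \<forall>j\<in>{..<d}. 0 < dual d vs ! j \<bullet> z t \<longleftrightarrow> G vs j"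
      using G z by (intro eventually_ball_finite fV ballI) auto
    with ev[OF z] show ?thesis by eventually_elim auto
  qed
  have "in_germ d e S (cone_gen d gs) \<longleftrightarrow> ?G"
  proof
    assume ?G
    then show "in_germ d e S (cone_gen d gs)"
      unfolding in_germ_def by (intro allI impI) (use main in \<open>auto elim: eventually_mono\<close>)
  next
    assume "in_germ d e S (cone_gen d gs)"
    then have "\<forall>\<^sub>F t in sequentially. rvec (z t) \<in> cone_gen d gs" using z by (simp add: in_germ_def)
    with main[OF z] have "\<forall>\<^sub>F t::nat in sequentially. ?G" by eventually_elim auto
    then show ?G by simp
  qed
  then show ?thesis using main[OF z] by simp
qed

lemma in_germ_iff:
  assumes B: "dual_lists d e b" and gs: "set gs \<subseteq> carrier_vec d" and z: "germ_curve d e S z"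
  shows "in_germ d e S (cone_gen d gs) \<longleftrightarrow> (\<forall>\<^sub>F t in sequentially. rvec (z t) \<in> cone_gen d gs)"
proof
  assume "\<forall>\<^sub>F t in sequentially. rvec (z t) \<in> cone_gen d gs"
  with in_germ_eventually[OF assms] have "\<forall>\<^sub>F t::nat in sequentially. in_germ d e S (cone_gen d gs)"
    by eventually_elim auto
  then show "in_germ d e S (cone_gen d gs)" by simp
qed (use z in \<open>simp add: in_germ_def\<close>)

text \<open>The cone lies in a hyperplane, which the curves eventually avoid, so no germ is
  contained in it.\<close>

lemma germ_sum_low:
  assumes B: "dual_lists d e b" and gs: "set gs \<subseteq> carrier_vec d" and l: "cone_dim d (cone_gen d gs) < d"
  shows "germ_sum d e (cone_gen d gs) = 0"
proof -
  obtain h where h: "h \<in> carrier_vec d" "h \<noteq> 0\<^sub>v d" "\<And>g. g \<in> set gs \<Longrightarrow> h \<bullet> g = 0"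
    using l unfolding cone_dim_less_iff[OF gs] by blast
  have "\<not> in_germ d e S (cone_gen d gs)" for S
  proof
    assume a: "in_germ d e S (cone_gen d gs)"
    let ?z = "std_curve d b S (0\<^sub>v d)"
    have z: "germ_curve d e S ?z" by (rule germ_curve_std[OF B]) simp
    have "\<forall>\<^sub>F t in sequentially. rvec (?z t) \<in> cone_gen d gs" using a z by (simp add: in_germ_def)
    with curve_generic[OF B z gen_all_neq[OF h(1,2)]] have "\<forall>\<^sub>F t::nat in sequentially. False"
    proof eventually_elim
      case (elim t)
      have c: "?z t \<in> carrier_vec d" by (simp add: std_curve_def)
      have "0 \<le> h \<bullet> ?z t" by (rule cone_gen_nonneg[OF gs h(1) _ c elim(2)]) (simp add: h)
      moreover have "0 \<le> (- h) \<bullet> ?z t"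
        by (rule cone_gen_nonneg[OF gs _ _ c elim(2)]) (use h gs in \<open>auto simp: subset_iff\<close>)
      ultimately show ?case using elim(1) h(1) c by simp
    qed
    then show False by simp
  qed
  then show ?thesis by (simp add: germ_sum_def)
qed

text \<open>If the cone is invariant under translation by \<open>g\<close>, a multiple of \<open>g\<close> flips the sign of the
  last basis vector occurring in \<open>g\<close> and only changes the earlier coordinates to lower order.\<close>
lemma germ_sum_line:
  assumes B: "dual_lists d e b" and gs: "set gs \<subseteq> carrier_vec d" and l: "contains_subspace d 1 (cone_gen d gs)"
  shows "germ_sum d e (cone_gen d gs) = 0"
proof -
  obtain g where g: "g \<in> set gs" "g \<noteq> 0\<^sub>v d" "rvec (- g) \<in> cone_gen d gs"
    using l unfolding contains_line_iff[OF gs] by blast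
  have gc: "g \<in> carrier_vec d" using g gs by auto
  have ec: "e ! i \<in> carrier_vec d" if "i < d" for i using B that by (simp add: dual_lists_def vlist_nth)
  have shift: "rvec (x + t \<cdot>\<^sub>v g) \<in> cone_gen d gs" if x: "x \<in> carrier_vec d" "rvec x \<in> cone_gen d gs" for x t
  proof -
    have "real_of_rat \<bar>t\<bar> \<cdot>\<^sub>v (if 0 \<le> t then rvec g else rvec (- g)) \<in> cone_gen d gs"
      using g cone_gen_member[OF gs g(1)] by (intro cone_gen_smult[OF gs]) auto
    from cone_gen_add[OF gs x(2) this]
    have "rvec x + real_of_rat \<bar>t\<bar> \<cdot>\<^sub>v (if 0 \<le> t then rvec g else rvec (- g)) \<in> cone_gen d gs" .
    also have "rvec x + real_of_rat \<bar>t\<bar> \<cdot>\<^sub>v (if 0 \<le> t then rvec g else rvec (- g)) = rvec (x + t \<cdot>\<^sub>v g)"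
        using x gc by (intro eq_vecI) (auto simp: of_rat_add of_rat_mult of_rat_minus)
    finally show ?thesis .
  qed
  have "\<exists>k. k < d \<and> e ! k \<bullet> g \<noteq> 0" using dual_lists_zero[OF B gc] g(2) by blast
  define k where "k = Max {k. k < d \<and> e ! k \<bullet> g \<noteq> 0}"
  have "k \<in> {k. k < d \<and> e ! k \<bullet> g \<noteq> 0}"
    unfolding k_def by (rule Max_in) (use \<open>\<exists>k. k < d \<and> e ! k \<bullet> g \<noteq> 0\<close> in auto)
  then have k: "k < d" "e ! k \<bullet> g \<noteq> 0" by auto
  have kl: "e ! i \<bullet> g = 0" if "k < i" "i < d" for i
  proof (rule ccontr)
    assume "e ! i \<bullet> g \<noteq> 0"
    then have "i \<le> k" unfolding k_def using that by (intro Max_ge) auto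
    then show False using that by simp
  qed
  have "in_germ d e (insert k S) (cone_gen d gs) = in_germ d e S (cone_gen d gs)" if S: "k \<notin> S" for S
  proof -
    let ?z = "std_curve d b S (0\<^sub>v d)"
    have z: "germ_curve d e S ?z" by (rule germ_curve_std[OF B]) simp
    have zc: "?z t \<in> carrier_vec d" for t by (simp add: std_curve_def)
    \<comment> \<open>Chosen so that coordinate \<open>k\<close> changes from
      \<open>t ^ (d - k)\<close> to its negative. Coordinates before \<open>k\<close> are of higher
      order, and \<open>g\<close> has no component in those after \<open>k\<close>.\<close>
    define a where "a t = (- 2 * of_nat t ^ (d - k) / (e ! k \<bullet> g) :: rat)" for t :: nat
    let ?z' = "\<lambda>t. ?z t + a t \<cdot>\<^sub>v g"
    have z': "germ_curve d e (insert k S) ?z'"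
      unfolding germ_curve_def
    proof (intro conjI allI impI)
      show "?z' t \<in> carrier_vec d" for t using zc gc by simp
      fix i assume i: "i < d"
      let ?r = "real_of_rat (- 2 * (e ! i \<bullet> g) / (e ! k \<bullet> g))"
      have c: "e ! i \<bullet> ?z' t = e ! i \<bullet> ?z t + a t * (e ! i \<bullet> g)" for t
        using ec[OF i] zc gc by (simp add: scalar_prod_add_distrib[of _ d])
      have l: "(\<lambda>t. real_of_rat (e ! i \<bullet> ?z t) / real t ^ (d - i)) \<longlonglongrightarrow> flip S i"
        using z i by (simp add: germ_curve_def)
      have lim: "(\<lambda>t. real t ^ (d - k) / real t ^ (d - i)) \<longlonglongrightarrow> of_bool (i = k)" if "i \<le> k"
      proof (cases "i = k")
        case True
        have "\<forall>\<^sub>F t in sequentially. 1 = real t ^ (d - k) / real t ^ (d - k)"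
          using eventually_gt_at_top[of 0] by (rule eventually_mono) simp
        from Lim_transform_eventually[OF tendsto_const this] show ?thesis using True by simp
      next
        case False
        have "(\<lambda>t. inverse (real t ^ (k - i))) \<longlonglongrightarrow> 0"
          using that False by (intro tendsto_inverse_0_at_top filterlim_pow_at_top filterlim_real_sequentially) auto
        then have "(\<lambda>t. real t ^ (d - k) / real t ^ (d - i)) \<longlonglongrightarrow> 0"
        proof (rule Lim_transform_eventually)
          have "real t ^ (d - i) = real t ^ (d - k) * real t ^ (k - i)" for t
            using that k by (simp add: power_add[symmetric])
          then show "\<forall>\<^sub>F t in sequentially. inverse (real t ^ (k - i)) = real t ^ (d - k) / real t ^ (d - i)"
            by (intro eventually_mono[OF eventually_gt_at_top[of 0]]) (simp add: divide_simps)
        qed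
        then show ?thesis using False by simp
      qed
      have m: "(\<lambda>t. real_of_rat (e ! i \<bullet> ?z t) / real t ^ (d - i) + ?r * (real t ^ (d - k) / real t ^ (d - i)))
          \<longlonglongrightarrow> flip S i + ?r * of_bool (i = k)" if "i \<le> k"
        by (intro tendsto_add tendsto_mult tendsto_const l lim that)
      show "(\<lambda>t. real_of_rat (e ! i \<bullet> ?z' t) / real t ^ (d - i)) \<longlonglongrightarrow> flip (insert k S) i"
      proof (cases "i \<le> k")
        case True
        have "real_of_rat (e ! i \<bullet> ?z' t) / real t ^ (d - i) =
            real_of_rat (e ! i \<bullet> ?z t) / real t ^ (d - i) + ?r * (real t ^ (d - k) / real t ^ (d - i))" for t
          unfolding c unfolding a_def by (simp add: of_rat_add of_rat_mult of_rat_divide of_rat_power of_rat_minus of_rat_diff add_divide_distrib diff_divide_distrib)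
        moreover have "flip S i + ?r * of_bool (i = k) = flip (insert k S) i"
          using k S by (auto simp: flip_def of_rat_minus)
        ultimately show ?thesis using m[OF True] by simp
      next
        case False
        then show ?thesis using l kl[of i] i by (simp add: c flip_def)
      qed
    qed
    have "rvec (?z' t) \<in> cone_gen d gs \<longleftrightarrow> rvec (?z t) \<in> cone_gen d gs" for t
    proof
      assume "rvec (?z' t) \<in> cone_gen d gs"
      from shift[OF _ this, of "- a t"] zc gc have "rvec (?z' t + (- a t) \<cdot>\<^sub>v g) \<in> cone_gen d gs" by simp
      moreover have "?z' t + (- a t) \<cdot>\<^sub>v g = ?z t" using zc[of t] gc by (intro eq_vecI) auto
      ultimately show "rvec (?z t) \<in> cone_gen d gs" by simp
    qed (rule shift[OF zc])
    then show ?thesis unfolding in_germ_iff[OF B gs z] in_germ_iff[OF B gs z'] by simp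
  qed
  then show ?thesis unfolding germ_sum_def using k(1) by (intro sum_Pow_cancel[of k]) auto
qed

text \<open>The inverse of a lower unitriangular matrix is lower triangular; the entries are cleared
  from the last coordinate downward.\<close>

lemma unitri_dual_lower:
  assumes u: "unitri_list d d b" and B: "dual_lists d e b" and j: "j < d" and k: "j < k" "k < d"
  shows "e ! j $ k = 0"
proof -
  have "\<forall>k. d - m \<le> k \<longrightarrow> j < k \<longrightarrow> k < d \<longrightarrow> e ! j $ k = 0" if "m \<le> d" for m
    using that
  proof (induction m)
    case (Suc m)
    show ?case
    proof (intro allI impI)
      fix k assume k: "d - Suc m \<le> k" "j < k" "k < d"
      have bk: "b ! k \<in> carrier_vec d" and ej: "e ! j \<in> carrier_vec d" and z: "e ! j \<bullet> b ! k = 0"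
        using B k j by (auto simp: dual_lists_def vlist_nth)
      have "e ! j \<bullet> b ! k = (\<Sum>p<d. if p = k then e ! j $ k else 0)"
        unfolding sprod[OF ej bk]
      proof (rule sum.cong)
        fix p assume "p \<in> {..<d}"
        moreover have "b ! k $ k = 1" "p < k \<Longrightarrow> b ! k $ p = 0" using u k by (auto simp: unitri_list_def)
        moreover have "e ! j $ p = 0" if "k < p" "p < d"
          using Suc.IH Suc.prems that k by auto
        ultimately show "e ! j $ p * b ! k $ p = (if p = k then e ! j $ k else 0)"
          by (cases "p < k"; cases "p = k") auto
      qed simp
      then show "e ! j $ k = 0" using z k by simp
    qed
  qed simp
  from this[of d] k show ?thesis by simp
qed

text \<open>The scalar products form the product of two lower unitriangular matrices.\<close>

lemma unitri_dual_diag: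
  assumes u: "unitri_list d d b" and v: "unitri_list d d v" and V: "dual_lists d f v" and j: "j < d"
  shows "f ! j \<bullet> b ! j = 1" "\<And>i. j < i \<Longrightarrow> i < d \<Longrightarrow> f ! j \<bullet> b ! i = 0"
proof -
  have fj: "f ! j \<in> carrier_vec d" using V j by (simp add: dual_lists_def vlist_nth)
  have bc: "b ! i \<in> carrier_vec d" if "i < d" for i using unitri_vlist[OF u] that by (rule vlist_nth)
  have vc: "v ! i \<in> carrier_vec d" if "i < d" for i using unitri_vlist[OF v] that by (rule vlist_nth)
  note lo = unitri_dual_lower[OF v V j]
  have s: "f ! j \<bullet> w = f ! j $ j" if w: "w \<in> carrier_vec d" "w $ j = 1" "\<And>p. p < j \<Longrightarrow> w $ p = 0" for w
  proof -
    have "f ! j \<bullet> w = (\<Sum>p<d. if p = j then f ! j $ j else 0)"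
      unfolding sprod[OF fj w(1)]
    proof (rule sum.cong)
      fix p assume "p \<in> {..<d}"
      then show "f ! j $ p * w $ p = (if p = j then f ! j $ j else 0)"
        using lo[of p] w by (cases "p < j"; cases "p = j") auto
    qed simp
    then show ?thesis using j by simp
  qed
  have "f ! j \<bullet> v ! j = f ! j $ j" by (rule s) (use vc v j in \<open>auto simp: unitri_list_def\<close>)
  then have one: "f ! j $ j = 1" using V j by (simp add: dual_lists_def)
  show "f ! j \<bullet> b ! j = 1" unfolding one[symmetric] by (rule s) (use bc u j in \<open>auto simp: unitri_list_def\<close>)
  fix i assume i: "j < i" "i < d"
  have "f ! j $ p * b ! i $ p = 0" if "p < d" for p
    using lo[of p] u i that by (cases "p \<le> j") (auto simp: unitri_list_def)
  then show "f ! j \<bullet> b ! i = 0" using i bc by (simp add: sprod[OF fj] del: mult_eq_0_iff)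
qed

text \<open>Whether the germ with signs \<open>S\<close> lies in the cone of \<open>v\<close>
  depends on the signs at the leading indices \<open>k j\<close> of the dual forms of
  \<open>v\<close> with respect to \<open>b\<close>, and \<open>k j \<le> j\<close>. If some index
  is not of this form, flipping its sign cancels the sum. Otherwise \<open>k\<close> is a bijection,
  hence the identity; then the dual basis of \<open>v\<close> is also dual to \<open>b\<close>, so
  \<open>b = v\<close>, and only the empty \<open>S\<close> contributes.\<close>

lemma germ_sum_unitri:
  assumes u: "unitri_list d d b" and v: "unitri_list d d v" and B: "dual_lists d e b"
  shows "germ_sum d e (cone_gen d v) = of_bool (b = v)"
proof -
  let ?f = "dual d v"
  have V: "dual_lists d ?f v" by (rule dual_lists_dual[OF unitri_vlist[OF v] unitri_Det[OF v]])
  have vs: "set v \<subseteq> carrier_vec d" using unitri_vlist[OF v] by (simp add: vlist_def)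
  have "\<exists>k. k < d \<and> ?f ! j \<bullet> b ! k \<noteq> 0 \<and> (\<forall>i<k. ?f ! j \<bullet> b ! i = 0)" if j: "j < d" for j
  proof -
    have h: "?f ! j \<in> carrier_vec d" "?f ! j \<noteq> 0\<^sub>v d"
      using V j dual_lists_nonzero by (auto simp: dual_lists_def vlist_nth)
    from leading_index[OF B h] show ?thesis by blast
  qed
  then obtain k where k: "\<And>j. j < d \<Longrightarrow> k j < d" "\<And>j. j < d \<Longrightarrow> ?f ! j \<bullet> b ! k j \<noteq> 0"
      "\<And>j i. j < d \<Longrightarrow> i < k j \<Longrightarrow> ?f ! j \<bullet> b ! i = 0" by metis
  have fc: "?f ! j \<in> carrier_vec d" if "j < d" for j using V that by (simp add: dual_lists_def vlist_nth)
  have germ: "in_germ d e S (cone_gen d v) \<longleftrightarrow> (\<forall>j<d. 0 < flip S (k j) * (?f ! j \<bullet> b ! k j))" for S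
  proof -
    let ?z = "std_curve d b S (0\<^sub>v d)"
    have z: "germ_curve d e S ?z" by (rule germ_curve_std[OF B]) simp
    have "\<forall>\<^sub>F t in sequentially. \<forall>j\<in>{..<d}. ?f ! j \<bullet> ?z t \<noteq> 0 \<and> (0 < ?f ! j \<bullet> ?z t \<longleftrightarrow> 0 < flip S (k j) * (?f ! j \<bullet> b ! k j))"
      by (intro eventually_ball_finite ballI curve_sign[OF B z] fc k) auto
    then have "\<forall>\<^sub>F t in sequentially. rvec (?z t) \<in> cone_gen d v \<longleftrightarrow> (\<forall>j<d. 0 < flip S (k j) * (?f ! j \<bullet> b ! k j))"
    proof (rule eventually_mono)
      fix t assume a: "\<forall>j\<in>{..<d}. ?f ! j \<bullet> ?z t \<noteq> 0 \<and> (0 < ?f ! j \<bullet> ?z t \<longleftrightarrow> 0 < flip S (k j) * (?f ! j \<bullet> b ! k j))"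
      have "?z t \<in> carrier_vec d" by (simp add: std_curve_def)
      from simplicial_cone_iff[OF V this] a
      show "rvec (?z t) \<in> cone_gen d v \<longleftrightarrow> (\<forall>j<d. 0 < flip S (k j) * (?f ! j \<bullet> b ! k j))"
        by (metis lessThan_iff less_le)
    qed
    with in_germ_eventually[OF B vs z]
    have "\<forall>\<^sub>F t::nat in sequentially. in_germ d e S (cone_gen d v) \<longleftrightarrow> (\<forall>j<d. 0 < flip S (k j) * (?f ! j \<bullet> b ! k j))"
      by eventually_elim auto
    then show ?thesis by simp
  qed
  have kj: "k j \<le> j" if "j < d" for j
    using k(3)[OF that, of j] unitri_dual_diag(1)[OF u v V that] by (cases "k j \<le> j") auto
  show ?thesis
  proof (cases "\<exists>p<d. p \<notin> k ` {..<d}")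
    case True
    then obtain p where p: "p < d" "\<And>j. j < d \<Longrightarrow> k j \<noteq> p" by blast
    have "b \<noteq> v"
    proof
      assume bv: "b = v"
      have "k p = p" using k(2)[OF p(1)] k(1)[OF p(1)] V p(1) unfolding bv by (auto simp: dual_lists_def split: if_splits)
      then show False using p by blast
    qed
    moreover have "germ_sum d e (cone_gen d v) = 0"
      unfolding germ_sum_def
    proof (rule sum_Pow_cancel[of p])
      fix S
      have "flip (insert p S) (k j) = (flip S (k j) :: rat)" if "j < d" for j using p(2)[OF that] by (simp add: flip_def)
      then show "of_bool (in_germ d e (insert p S) (cone_gen d v)) = (of_bool (in_germ d e S (cone_gen d v)) :: rat)"
        by (simp add: germ cong: conj_cong imp_cong)
    qed (use p in auto)
    ultimately show ?thesis by simp
  next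
    case False
    then have "{..<d} = k ` {..<d}" using k(1) by auto
    then have inj: "inj_on k {..<d}" by (intro eq_card_imp_inj_on) auto
    \<comment> \<open>An injective map with \<open>k j \<le> j\<close> on an initial segment is the
      identity: a smaller value would already be taken by a fixed point.\<close>
    have kid: "k j = j" if "j < d" for j
      using that
    proof (induction j rule: less_induct)
      case (less j)
      show ?case
      proof (rule ccontr)
        assume "k j \<noteq> j"
        then have lt: "k j < j" using kj[OF less.prems] by simp
        then have "k (k j) = k j" using less by simp
        then show False using inj lt less.prems by (auto dest!: inj_onD)
      qed
    qed
    have "dual_lists d ?f b"
      unfolding dual_lists_def
    proof (intro conjI allI impI)
      fix i j assume ij: "i < d" "j < d"
      consider "i = j" | "i < j" | "j < i" by linarith
      then show "?f ! i \<bullet> b ! j = (if i = j then 1 else 0)"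
      proof cases
        case 3
        then show ?thesis using k(3)[OF ij(1), of j] kid[OF ij(1)] by simp
      qed (use unitri_dual_diag[OF u v V ij(1)] ij in auto)
    qed (use V unitri_vlist[OF u] in \<open>auto simp: dual_lists_def\<close>)
    from dual_lists_unique[OF dual_lists_sym[OF this] dual_lists_sym[OF V]] have bv: "b = v" .
    have "in_germ d e S (cone_gen d v) \<longleftrightarrow> S = {}" if S: "S \<subseteq> {..<d}" for S
    proof -
      have "in_germ d e S (cone_gen d v) \<longleftrightarrow> (\<forall>j<d. 0 < (flip S j :: rat))"
        unfolding germ using kid unitri_dual_diag(1)[OF u v V] by simp
      also have "\<dots> \<longleftrightarrow> S = {}" using S by (auto simp: flip_def)
      finally show ?thesis .
    qed
    then have "germ_sum d e (cone_gen d v) = (\<Sum>S\<in>Pow {..<d}. if S = {} then 1 else 0)"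
      unfolding germ_sum_def by (intro sum.cong) auto
    then show ?thesis using bv by (simp add: sum.delta)
  qed
qed

section \<open>Values of distributions along germs\<close>

text \<open>At the point of parameter \<open>t\<close> of the curve, the distribution, extended to rational points by
  homogeneity, takes the value \<open>p t / q t\<close>.\<close>
definition frac_at :: "nat \<Rightarrow> nat \<Rightarrow> rat vec list \<Rightarrow> nat set \<Rightarrow> (int vec \<Rightarrow> complex) \<Rightarrow> rat vec \<Rightarrow> rat poly \<Rightarrow> rat poly \<Rightarrow> nat \<Rightarrow> bool" where
  "frac_at d n b S F x p q t \<longleftrightarrow>
    (\<forall>N \<nu>. 0 < N \<longrightarrow> \<nu> \<in> carrier_vec d \<longrightarrow> ivec \<nu> = of_nat N \<cdot>\<^sub>v std_curve d b S x t \<longrightarrow>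
      of_rat (poly q (of_nat t)) * of_nat N ^ n * F \<nu> = of_rat (poly p (of_nat t)))"

text \<open>The number \<open>r\<close> is the value of the rational function \<open>p / q\<close>
  at \<open>t = 0\<close>, although \<open>p / q\<close> describes the distribution for large
  \<open>t\<close>: continuation back to the base point \<open>x\<close>. Denominators are cleared,
  with \<open>poly q 0\<close> required to be nonzero.\<close>

definition germ_val :: "nat \<Rightarrow> nat \<Rightarrow> rat vec list \<Rightarrow> nat set \<Rightarrow> (int vec \<Rightarrow> complex) \<Rightarrow> rat vec \<Rightarrow> rat \<Rightarrow> bool" where
  "germ_val d n b S F x r \<longleftrightarrow> (\<exists>p q. poly q 0 \<noteq> 0 \<and> poly p 0 = poly q 0 * r \<and>
    (\<forall>\<^sub>F t in sequentially. frac_at d n b S F x p q t))"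

lemma germ_valI:
  "poly q 0 \<noteq> 0 \<Longrightarrow> poly p 0 = poly q 0 * r \<Longrightarrow> \<forall>\<^sub>F t in sequentially. frac_at d n b S F x p q t \<Longrightarrow>
    germ_val d n b S F x r"
  unfolding germ_val_def by blast

lemma germ_valE:
  assumes "germ_val d n b S F x r"
  obtains p q where "poly q 0 \<noteq> 0" "poly p 0 = poly q 0 * r" "\<forall>\<^sub>F t in sequentially. frac_at d n b S F x p q t"
  using assms unfolding germ_val_def by blast

lemma frac_atD:
  "frac_at d n b S F x p q t \<Longrightarrow> 0 < N \<Longrightarrow> \<nu> \<in> carrier_vec d \<Longrightarrow> ivec \<nu> = of_nat N \<cdot>\<^sub>v std_curve d b S x t \<Longrightarrow>
    of_rat (poly p (of_nat t)) = of_rat (poly q (of_nat t)) * of_nat N ^ n * F \<nu>"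
  unfolding frac_at_def by simp

lemma germ_val_zero: "germ_val d n b S (\<lambda>\<nu>. 0) x 0"
  by (rule germ_valI[of 1 0]) (auto simp: frac_at_def)

lemma germ_val_add:
  assumes "germ_val d n b S F x r" "germ_val d n b S G x s"
  shows "germ_val d n b S (\<lambda>\<nu>. F \<nu> + G \<nu>) x (r + s)"
proof -
  obtain p q where p: "poly q 0 \<noteq> 0" "poly p 0 = poly q 0 * r" "\<forall>\<^sub>F t in sequentially. frac_at d n b S F x p q t"
    by (rule germ_valE[OF assms(1)])
  obtain p' q' where p': "poly q' 0 \<noteq> 0" "poly p' 0 = poly q' 0 * s" "\<forall>\<^sub>F t in sequentially. frac_at d n b S G x p' q' t"
    by (rule germ_valE[OF assms(2)])
  show ?thesis
  proof (rule germ_valI[of "q * q'" "p * q' + q * p'"])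
    from p(3) p'(3) show "\<forall>\<^sub>F t in sequentially. frac_at d n b S (\<lambda>\<nu>. F \<nu> + G \<nu>) x (p * q' + q * p') (q * q') t"
    proof eventually_elim
      case (elim t)
      show ?case unfolding frac_at_def
      proof (intro allI impI)
        fix N \<nu> assume *: "0 < N" "\<nu> \<in> carrier_vec d" "ivec \<nu> = of_nat N \<cdot>\<^sub>v std_curve d b S x t"
        show "of_rat (poly (q * q') (of_nat t)) * of_nat N ^ n * (F \<nu> + G \<nu>) = of_rat (poly (p * q' + q * p') (of_nat t))"
          by (simp add: of_rat_add of_rat_mult frac_atD[OF elim(1) *] frac_atD[OF elim(2) *] algebra_simps)
      qed
    qed
  qed (use p p' in \<open>auto simp: algebra_simps\<close>)
qed

lemma germ_val_smult:
  assumes "germ_val d n b S F x r"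
  shows "germ_val d n b S (\<lambda>\<nu>. of_rat c * F \<nu>) x (c * r)"
proof -
  obtain p q where p: "poly q 0 \<noteq> 0" "poly p 0 = poly q 0 * r" "\<forall>\<^sub>F t in sequentially. frac_at d n b S F x p q t"
    by (rule germ_valE[OF assms])
  show ?thesis
  proof (rule germ_valI[of q "Polynomial.smult c p"])
    from p(3) show "\<forall>\<^sub>F t in sequentially. frac_at d n b S (\<lambda>\<nu>. of_rat c * F \<nu>) x (Polynomial.smult c p) q t"
    proof eventually_elim
      case (elim t)
      show ?case unfolding frac_at_def
      proof (intro allI impI)
        fix N \<nu> assume *: "0 < N" "\<nu> \<in> carrier_vec d" "ivec \<nu> = of_nat N \<cdot>\<^sub>v std_curve d b S x t"
        show "of_rat (poly q (of_nat t)) * of_nat N ^ n * (of_rat c * F \<nu>) = of_rat (poly (Polynomial.smult c p) (of_nat t))"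
          by (simp add: of_rat_mult frac_atD[OF elim *] algebra_simps)
      qed
    qed
  qed (use p in auto)
qed

text \<open>At every large \<open>t\<close> some integer multiple of the curve point is a lattice
  point, so both fractions give the same value there. Their cross difference is a polynomial with
  infinitely many zeros.\<close>

lemma germ_val_unique:
  assumes "germ_val d n b S F x r" "germ_val d n b S F x s"
  shows "r = s"
proof -
  obtain p q where p: "poly q 0 \<noteq> 0" "poly p 0 = poly q 0 * r" "\<forall>\<^sub>F t in sequentially. frac_at d n b S F x p q t"
    by (rule germ_valE[OF assms(1)])
  obtain p' q' where p': "poly q' 0 \<noteq> 0" "poly p' 0 = poly q' 0 * s" "\<forall>\<^sub>F t in sequentially. frac_at d n b S F x p' q' t"
    by (rule germ_valE[OF assms(2)])
  let ?D = "p * q' - p' * q"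
  have "\<forall>\<^sub>F t in sequentially. poly ?D (of_nat t) = 0" using p(3) p'(3)
  proof eventually_elim
    case (elim t)
    have "std_curve d b S x t \<in> carrier_vec d" by (simp add: std_curve_def)
    then obtain N \<nu> where N: "0 < (N::nat)" "\<nu> \<in> carrier_vec d" "of_nat N \<cdot>\<^sub>v std_curve d b S x t = ivec \<nu>"
      by (rule vec_common_denominator)
    have "(of_rat (poly ?D (of_nat t)) :: complex) = 0"
      by (simp add: of_rat_diff of_rat_mult frac_atD[OF elim(1) N(1,2) N(3)[symmetric]]
        frac_atD[OF elim(2) N(1,2) N(3)[symmetric]] algebra_simps)
    then show ?case by simp
  qed
  then obtain t0 where t0: "\<And>t. t0 \<le> t \<Longrightarrow> poly ?D (of_nat t) = 0" by (auto simp: eventually_sequentially)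
  have "infinite ((of_nat :: nat \<Rightarrow> rat) ` {t0..})"
    by (subst finite_image_iff) (auto intro: inj_onI simp: infinite_Ici)
  moreover have "(of_nat :: nat \<Rightarrow> rat) ` {t0..} \<subseteq> {y. poly ?D y = 0}" using t0 by auto
  ultimately have "?D = 0" using poly_roots_finite[of ?D] finite_subset by blast
  then have "poly ?D 0 = 0" by simp
  then show ?thesis using p p' by (simp add: algebra_simps)
qed

text \<open>If the germ lies in the cone, the coefficients are eventually the reciprocal of a
  product of powers of polynomials \<open>l j\<close>, and \<open>l j\<close> takes the value
  \<open>us ! j \<bullet> x\<close> at 0. Otherwise they are eventually zero.\<close>

lemma germ_val_cone_distr:
  assumes B: "dual_lists d e b" and gs: "set gs \<subseteq> carrier_vec d"
    and us: "ordered_basis d us" and ns: "exponents d n ns"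
    and x: "x \<in> carrier_vec d" "\<And>j. j < d \<Longrightarrow> us ! j \<bullet> x \<noteq> 0"
  shows "germ_val d n b S (cone_distr d (cone_gen d gs) us ns) x
    (of_bool (in_germ d e S (cone_gen d gs)) * rat_fun d us ns x)"
proof -
  let ?C = "cone_gen d gs" and ?z = "std_curve d b S x"
  have z: "germ_curve d e S ?z" by (rule germ_curve_std[OF B x(1)])
  have zc: "?z t \<in> carrier_vec d" for t by (simp add: std_curve_def)
  have b: "vlist d b" using B by (simp add: dual_lists_def)
  have uv: "vlist d us" "Det d us \<noteq> 0" using us by (auto simp: ordered_basis_iff)
  have uc: "us ! j \<in> carrier_vec d" if "j < d" for j using uv(1) that by (rule vlist_nth)
  have F: "of_nat N ^ n * cone_distr d ?C us ns \<nu> = of_rat (cone_fun d ?C us ns (?z t))"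
    if "0 < N" "\<nu> \<in> carrier_vec d" "ivec \<nu> = of_nat N \<cdot>\<^sub>v ?z t" for N \<nu> t
  proof -
    have "rational_cone d ?C" using gs by (auto simp: rational_cone_def)
    from cone_fun_smult[OF this uv(1) ns _ zc, of "of_nat N" t] show ?thesis
      using that by (simp add: cone_distr_cone_fun of_rat_divide of_rat_power)
  qed
  note ev = in_germ_eventually[OF B gs z]
  show ?thesis
  proof (cases "in_germ d e S ?C")
    case False
    show ?thesis
    proof (rule germ_valI[of 1 0])
      from ev show "\<forall>\<^sub>F t in sequentially. frac_at d n b S (cone_distr d ?C us ns) x 0 1 t"
      proof eventually_elim
        case (elim t)
        have "cone_fun d ?C us ns (?z t) = 0" using elim False by (simp add: cone_fun_def)
        then show ?case using F[of _ _ t] by (simp add: frac_at_def)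
      qed
    qed (use False in auto)
  next
    case True
    define l where "l j = [:us ! j \<bullet> x:] + (\<Sum>i<d. Polynomial.monom (flip S i * (us ! j \<bullet> b ! i)) (d - i))" for j
    have l: "poly (l j) (of_nat t) = us ! j \<bullet> ?z t" if "j < d" for j t
      by (simp add: l_def poly_sum poly_monom std_curve_sprod[OF b uc[OF that] x(1)] mult_ac)
    have l0: "poly (l j) 0 = us ! j \<bullet> x" for j
      unfolding l_def by (auto simp: poly_sum poly_monom intro!: sum.neutral)
    show ?thesis
    proof (rule germ_valI[of "\<Prod>j<d. l j ^ (ns ! j)" 1])
      show "poly (\<Prod>j<d. l j ^ (ns ! j)) 0 \<noteq> 0" using x(2) by (simp add: poly_prod l0)
      show "poly 1 0 = poly (\<Prod>j<d. l j ^ (ns ! j)) 0 * (of_bool (in_germ d e S ?C) * rat_fun d us ns x)"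
        using True x(2) by (simp add: poly_prod l0 rat_fun_def prod.distrib[symmetric])
      have D: "dual_lists d us (dual d us)" by (rule dual_lists_sym[OF dual_lists_dual[OF uv]])
      from ev curve_generic[OF B z gen_all_dual[OF D]]
      show "\<forall>\<^sub>F t in sequentially. frac_at d n b S (cone_distr d ?C us ns) x 1 (\<Prod>j<d. l j ^ (ns ! j)) t"
      proof eventually_elim
        case (elim t)
        have "cone_fun d ?C us ns (?z t) = rat_fun d us ns (?z t)" using elim True by (simp add: cone_fun_def)
        then have "poly (\<Prod>j<d. l j ^ (ns ! j)) (of_nat t) * cone_fun d ?C us ns (?z t) = 1"
          using elim(2) by (simp add: poly_prod l rat_fun_def prod.distrib[symmetric])
        from arg_cong[OF this, of "of_rat :: rat \<Rightarrow> complex"] show ?case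
          using F[of _ _ t] by (simp add: frac_at_def of_rat_mult mult.assoc)
      qed
    qed
  qed
qed

definition germs :: "nat \<Rightarrow> nat \<Rightarrow> rat vec list \<Rightarrow> (int vec \<Rightarrow> complex) \<Rightarrow> (nat set \<Rightarrow> rat vec \<Rightarrow> rat) \<Rightarrow> bool" where
  "germs d n b F r \<longleftrightarrow> gen_all d (\<lambda>x. \<forall>S\<in>Pow {..<d}. germ_val d n b S F x (r S x))"

lemma germs_cone_distr:
  assumes B: "dual_lists d e b" and gs: "set gs \<subseteq> carrier_vec d"
    and us: "ordered_basis d us" and ns: "exponents d n ns"
  shows "germs d n b (cone_distr d (cone_gen d gs) us ns)
    (\<lambda>S x. of_bool (in_germ d e S (cone_gen d gs)) * rat_fun d us ns x)"
proof -
  have "dual_lists d us (dual d us)" using us by (intro dual_lists_sym[OF dual_lists_dual]) (auto simp: ordered_basis_iff)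
  from gen_all_dual[OF this] show ?thesis
    unfolding germs_def by (rule gen_all_mono) (use germ_val_cone_distr[OF assms] in auto)
qed

lemma germs_zero: "germs d n b (\<lambda>\<nu>. 0) (\<lambda>S x. 0)"
  unfolding germs_def by (intro gen_allI) (auto intro: germ_val_zero)

lemma germs_add: "germs d n b F r \<Longrightarrow> germs d n b G s \<Longrightarrow> germs d n b (\<lambda>\<nu>. F \<nu> + G \<nu>) (\<lambda>S x. r S x + s S x)"
  unfolding germs_def by (drule (1) gen_all_conj, erule gen_all_mono) (auto intro: germ_val_add)

lemma germs_smult: "germs d n b F r \<Longrightarrow> germs d n b (\<lambda>\<nu>. of_rat c * F \<nu>) (\<lambda>S x. c * r S x)"
  unfolding germs_def by (erule gen_all_mono) (auto intro: germ_val_smult)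

lemma germs_sum:
  assumes "finite A" "\<And>a. a \<in> A \<Longrightarrow> germs d n b (F a) (r a)"
  shows "germs d n b (\<lambda>\<nu>. \<Sum>a\<in>A. of_rat (c a) * F a \<nu>) (\<lambda>S x. \<Sum>a\<in>A. c a * r a S x)"
  using assms by (induction A rule: finite_induct) (auto intro!: germs_zero germs_add germs_smult)

text \<open>On the spanning distributions the alternating sum is \<open>germ_sum\<close> times a
  rational function, and \<open>germ_sum\<close> vanishes for both kinds of cones; linearity does
  the rest.\<close>

lemma germs_low_or_line:
  assumes B: "dual_lists d e b" and F: "F \<in> low_or_line d n"
  shows "\<exists>r. germs d n b F r \<and> (\<forall>x. (\<Sum>S\<in>Pow {..<d}. (-1) ^ card S * r S x) = 0)"
  using F[unfolded low_or_line_def] cone_distrs_carrier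
proof (induction rule: qspan_induct[OF hom_qvs, consumes 2, case_names zero base add smult])
  case zero
  then show ?case unfolding hom_zero by (intro exI[of _ "\<lambda>S x. 0"]) (auto intro: germs_zero)
next
  case (base F)
  then obtain gs us ns where F: "F = cone_distr d (cone_gen d gs) us ns" and gs: "set gs \<subseteq> carrier_vec d"
    and l: "cone_dim d (cone_gen d gs) < d \<or> contains_subspace d 1 (cone_gen d gs)"
    and u: "ordered_basis d us" "exponents d n ns"
    by (auto simp: cone_distrs_def rational_cone_def)
  have "germ_sum d e (cone_gen d gs) = 0" using l germ_sum_low[OF B gs] germ_sum_line[OF B gs] by blast
  then have "(\<Sum>S\<in>Pow {..<d}. (-1) ^ card S * (of_bool (in_germ d e S (cone_gen d gs)) * rat_fun d us ns x)) = 0" for x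
    unfolding germ_sum_def mult.assoc[symmetric] sum_distrib_right[symmetric] by simp
  then show ?case using germs_cone_distr[OF B gs u] unfolding F by blast
next
  case (add F G)
  then obtain r s where "germs d n b F r" "\<forall>x. (\<Sum>S\<in>Pow {..<d}. (-1) ^ card S * r S x) = 0"
    "germs d n b G s" "\<forall>x. (\<Sum>S\<in>Pow {..<d}. (-1) ^ card S * s S x) = 0" by blast
  then show ?case unfolding hom_add
    by (intro exI[of _ "\<lambda>S x. r S x + s S x"]) (auto intro: germs_add simp: distrib_left sum.distrib)
next
  case (smult c F)
  then obtain r where "germs d n b F r" "\<forall>x. (\<Sum>S\<in>Pow {..<d}. (-1) ^ card S * r S x) = 0" by blast
  then show ?case unfolding hom_smult
    by (intro exI[of _ "\<lambda>S x. c * r S x"]) (auto intro: germs_smult simp: mult.left_commute[of _ c] sum_distrib_left[symmetric])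
qed

text \<open>The germ values of the combination are computed from its terms and from its membership
  in \<open>low_or_line\<close>; uniqueness equates the results. The alternating sum over signs
  turns each cone into a number and leaves a relation between rational functions of the base
  point.\<close>

lemma germ_relation:
  assumes B: "dual_lists d e b" and A: "finite A" and gs: "\<And>a. a \<in> A \<Longrightarrow> set (gs a) \<subseteq> carrier_vec d"
    and us: "\<And>a. a \<in> A \<Longrightarrow> ordered_basis d (us a)" and ns: "\<And>a. a \<in> A \<Longrightarrow> exponents d n (ns a)"
    and l: "(\<lambda>\<nu>. \<Sum>a\<in>A. of_rat (c a) * cone_distr d (cone_gen d (gs a)) (us a) (ns a) \<nu>) \<in> low_or_line d n"
  shows "gen_all d (\<lambda>x. (\<Sum>a\<in>A. c a * germ_sum d e (cone_gen d (gs a)) * rat_fun d (us a) (ns a) x) = 0)"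
proof -
  let ?r = "\<lambda>S x. \<Sum>a\<in>A. c a * (of_bool (in_germ d e S (cone_gen d (gs a))) * rat_fun d (us a) (ns a) x)"
  have g: "germs d n b (\<lambda>\<nu>. \<Sum>a\<in>A. of_rat (c a) * cone_distr d (cone_gen d (gs a)) (us a) (ns a) \<nu>) ?r"
    by (rule germs_sum[OF A germs_cone_distr[OF B gs us ns]])
  obtain r where r: "germs d n b (\<lambda>\<nu>. \<Sum>a\<in>A. of_rat (c a) * cone_distr d (cone_gen d (gs a)) (us a) (ns a) \<nu>) r"
    "\<forall>x. (\<Sum>S\<in>Pow {..<d}. (-1) ^ card S * r S x) = 0" using germs_low_or_line[OF B l] by blast
  from gen_all_conj[OF g[unfolded germs_def] r(1)[unfolded germs_def]] show ?thesis
  proof (rule gen_all_mono)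
    fix x assume *: "(\<forall>S\<in>Pow {..<d}. germ_val d n b S (\<lambda>\<nu>. \<Sum>a\<in>A. of_rat (c a) * cone_distr d (cone_gen d (gs a)) (us a) (ns a) \<nu>) x (?r S x)) \<and>
      (\<forall>S\<in>Pow {..<d}. germ_val d n b S (\<lambda>\<nu>. \<Sum>a\<in>A. of_rat (c a) * cone_distr d (cone_gen d (gs a)) (us a) (ns a) \<nu>) x (r S x))"
    have "?r S x = r S x" if "S \<in> Pow {..<d}" for S using * that germ_val_unique by blast
    then have "(\<Sum>S\<in>Pow {..<d}. (-1) ^ card S * ?r S x) = 0" using r(2) by simp
    also have "(\<Sum>S\<in>Pow {..<d}. (-1) ^ card S * ?r S x)
      = (\<Sum>a\<in>A. c a * germ_sum d e (cone_gen d (gs a)) * rat_fun d (us a) (ns a) x)"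
      unfolding germ_sum_def sum_distrib_left sum_distrib_right
      by (subst sum.swap) (simp add: mult_ac)
    finally show "(\<Sum>a\<in>A. c a * germ_sum d e (cone_gen d (gs a)) * rat_fun d (us a) (ns a) x) = 0" .
  qed
qed

section \<open>Partial fractions\<close>

text \<open>The behaviour of one partial fraction at \<open>T = \<epsilon> - a\<close> after
  multiplication by \<open>\<epsilon> ^ k\<close>: only a pole at this very place and of order
  exactly \<open>k\<close> survives.\<close>

lemma pole_term_limit:
  fixes a b c :: real and \<epsilon> :: "nat \<Rightarrow> real"
  assumes e: "\<epsilon> \<longlonglongrightarrow> 0" "\<And>i. \<epsilon> i \<noteq> 0" and k: "1 \<le> k" and c: "b = a \<Longrightarrow> k < m \<Longrightarrow> c = 0"
  shows "(\<lambda>i. \<epsilon> i ^ k * (c / (b + (\<epsilon> i - a)) ^ m)) \<longlonglongrightarrow> (if b = a \<and> m = k then c else 0)"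
proof (cases "b = a")
  case True
  consider "k < m" | "m = k" | "m < k" by linarith
  then show ?thesis
  proof cases
    case 1
    then show ?thesis using c True by simp
  next
    case 2
    then show ?thesis using True e(2) by simp
  next
    case 3
    have "(\<lambda>i. \<epsilon> i ^ (k - m) * c) \<longlonglongrightarrow> 0 ^ (k - m) * c" by (intro tendsto_intros e(1))
    moreover have "\<epsilon> i ^ k = \<epsilon> i ^ (k - m) * \<epsilon> i ^ m" for i using 3 by (simp add: power_add[symmetric])
    ultimately show ?thesis using 3 True e(2) by (simp add: power_0_left)
  qed
next
  case False
  have "(\<lambda>i. \<epsilon> i ^ k * (c / (b + (\<epsilon> i - a)) ^ m)) \<longlonglongrightarrow> 0 ^ k * (c / (b + (0 - a)) ^ m)"
    by (intro tendsto_intros e(1)) (use False in auto)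
  then show ?thesis using False k by (simp add: power_0_left)
qed

text \<open>At a pole with a nonzero coefficient take the largest order \<open>k\<close> that occurs
  with nonzero coefficient, multiply by the power \<open>k\<close> of the distance to the pole, and
  approach the pole.\<close>

lemma poles_independent:
  fixes C :: "rat \<times> nat \<Rightarrow> rat"
  assumes K: "finite K" "\<And>a k. (a, k) \<in> K \<Longrightarrow> 1 \<le> k" and B: "finite B"
    and z: "\<And>T. T \<notin> B \<Longrightarrow> (\<Sum>p\<in>K. C p / (fst p + T) ^ snd p) = 0"
    and p: "p \<in> K"
  shows "C p = 0"
proof (rule ccontr)
  assume nz: "C p \<noteq> 0"
  define a where "a = fst p"
  let ?M = "{k. (a, k) \<in> K \<and> C (a, k) \<noteq> 0}"
  have fM: "finite ?M" by (rule finite_subset[OF _ finite_imageI[OF K(1), of snd]]) force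
  have neM: "snd p \<in> ?M" using p nz by (simp add: a_def)
  define k where "k = Max ?M"
  have "k \<in> ?M" unfolding k_def using fM neM by (intro Max_in) auto
  then have k: "(a, k) \<in> K" "C (a, k) \<noteq> 0" "1 \<le> k" using K(2) by auto
  have mx: "C (a, m) = 0" if "(a, m) \<in> K" "k < m" for m
    using Max_ge[OF fM, of m] that unfolding k_def[symmetric] by force
  \<comment> \<open>Approaching along an injective sequence of rational numbers avoids the finite
    exceptional set \<open>B\<close> from some index on.\<close>
  define \<epsilon> where "\<epsilon> i = inverse (of_nat (Suc i) :: rat)" for i
  have inj: "inj \<epsilon>" by (rule injI) (simp add: \<epsilon>_def del: of_nat_Suc)
  have "finite {i. \<epsilon> i - a \<in> B}"
    using finite_vimageI[OF B, of "\<lambda>i. \<epsilon> i - a"] inj by (simp add: vimage_def inj_def)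
  then have "\<forall>\<^sub>F i in sequentially. \<epsilon> i - a \<notin> B" by (simp add: cofinite_eq_sequentially[symmetric] eventually_cofinite)
  let ?r = "real_of_rat"
  let ?f = "\<lambda>p i. ?r (\<epsilon> i) ^ k * (?r (C p) / (?r (fst p) + (?r (\<epsilon> i) - ?r a)) ^ snd p)"
  have e: "(\<lambda>i. ?r (\<epsilon> i)) \<longlonglongrightarrow> 0"
    using LIMSEQ_inverse_real_of_nat by (simp add: \<epsilon>_def of_rat_inverse del: of_nat_Suc)
  have "(\<lambda>i. \<Sum>p\<in>K. ?f p i) \<longlonglongrightarrow> (\<Sum>p\<in>K. if ?r (fst p) = ?r a \<and> snd p = k then ?r (C p) else 0)"
  proof (intro tendsto_sum pole_term_limit e k(3))
    show "?r (\<epsilon> i) \<noteq> 0" for i by (simp add: \<epsilon>_def del: of_nat_Suc)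
    fix p assume p: "p \<in> K" "?r (fst p) = ?r a" "k < snd p"
    then have "p = (a, snd p)" by (cases p) simp
    then show "?r (C p) = 0" using mx[of "snd p"] p by simp
  qed
  moreover have "\<forall>\<^sub>F i in sequentially. (\<Sum>p\<in>K. ?f p i) = 0"
    using \<open>\<forall>\<^sub>F i in sequentially. \<epsilon> i - a \<notin> B\<close>
  proof (rule eventually_mono)
    fix i assume "\<epsilon> i - a \<notin> B"
    from arg_cong[OF z[OF this], of "\<lambda>q. ?r (\<epsilon> i ^ k * q)"]
    show "(\<Sum>p\<in>K. ?f p i) = 0"
      by (simp add: of_rat_mult of_rat_sum of_rat_divide of_rat_power of_rat_add of_rat_diff sum_distrib_left)
  qed
  ultimately have "(\<lambda>i::nat. 0) \<longlonglongrightarrow> (\<Sum>p\<in>K. if ?r (fst p) = ?r a \<and> snd p = k then ?r (C p) else 0)"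
    by (rule Lim_transform_eventually)
  then have "(\<Sum>p\<in>K. if ?r (fst p) = ?r a \<and> snd p = k then ?r (C p) else 0) = 0"
    using LIMSEQ_unique tendsto_const by blast
  moreover have "(\<Sum>p\<in>K. if ?r (fst p) = ?r a \<and> snd p = k then ?r (C p) else 0) = (\<Sum>p\<in>K. if p = (a, k) then ?r (C (a, k)) else 0)"
    by (intro sum.cong) auto
  ultimately show False using k K(1) by simp
qed

text \<open>Generic points exist, since a curve with distinct orders of growth eventually leaves
  every given hyperplane.\<close>

lemma gen_all_ex:
  assumes "gen_all d P"
  shows "\<exists>x\<in>carrier_vec d. P x"
proof -
  let ?e = "map (unit_vec d) [0..<d]"
  have B: "dual_lists d ?e ?e" by (auto simp: dual_lists_def vlist_def)
  have z: "germ_curve d ?e {} (std_curve d ?e {} (0\<^sub>v d))" by (rule germ_curve_std[OF B]) simp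
  have "\<exists>t. P (std_curve d ?e {} (0\<^sub>v d) t)"
    using curve_generic[OF B z assms] by (auto simp: eventually_sequentially)
  then show ?thesis by (auto simp: std_curve_def)
qed

definition lower_list :: "nat \<Rightarrow> nat \<Rightarrow> (rat vec \<times> nat) list \<Rightarrow> bool" where
  "lower_list d m ps \<longleftrightarrow> length ps = m \<and> (\<forall>j<m. fst (ps ! j) \<in> carrier_vec d \<and> fst (ps ! j) $ j = 1 \<and>
    (\<forall>k. j < k \<longrightarrow> k < d \<longrightarrow> fst (ps ! j) $ k = 0) \<and> 1 \<le> snd (ps ! j))"

text \<open>Moving \<open>x\<close> along the last unit vector changes only the last factor, so the poles in that
  direction can be separated, and the remaining factors are treated by induction.\<close>
lemma lower_independent:
  assumes "m \<le> d" "finite A" "\<And>ps. ps \<in> A \<Longrightarrow> lower_list d m ps"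
    and "gen_all d (\<lambda>x. (\<Sum>ps\<in>A. c ps * (\<Prod>j<m. 1 / (fst (ps ! j) \<bullet> x) ^ snd (ps ! j))) = 0)"
    and "ps \<in> A"
  shows "c ps = 0"
  using assms
proof (induction m arbitrary: A c ps)
  case 0
  have "A = {[]}" using 0(3,5) by (fastforce simp: lower_list_def)
  moreover obtain x where "(\<Sum>ps\<in>A. c ps * (\<Prod>j<0::nat. 1 / (fst (ps ! j) \<bullet> x) ^ snd (ps ! j))) = 0"
    using gen_all_ex[OF 0(4)] by blast
  ultimately show ?case using 0(5) by auto
next
  case (Suc m)
  then have m: "m < d" by simp
  let ?t = "\<lambda>ps x. (\<Prod>j<m. 1 / (fst (ps ! j) \<bullet> x) ^ snd (ps ! j)) :: rat"
  obtain H where H: "finite H" "H \<subseteq> carrier_vec d - {0\<^sub>v d}"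
    "\<forall>x\<in>carrier_vec d. (\<forall>h\<in>H. h \<bullet> x \<noteq> 0) \<longrightarrow>
      (\<Sum>ps\<in>A. c ps * (\<Prod>j<Suc m. 1 / (fst (ps ! j) \<bullet> x) ^ snd (ps ! j))) = 0"
    using Suc(5) unfolding gen_all_def by (elim exE conjE)
  let ?K = "(\<lambda>ps. ps ! m) ` A"
  have hc: "h \<in> carrier_vec d" and hm: "h $ m = 1" and k1: "1 \<le> k" if "(h, k) \<in> ?K" for h k
  proof -
    obtain ps where ps: "ps \<in> A" "ps ! m = (h, k)" using \<open>(h, k) \<in> ?K\<close> by (metis (no_types, lifting) imageE)
    from Suc(4)[OF ps(1)] ps(2) show "h \<in> carrier_vec d" "h $ m = 1" "1 \<le> k"
      by (auto simp: lower_list_def dest: spec[of _ m])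
  qed
  have hcK: "h \<in> carrier_vec d" if "h \<in> fst ` ?K" for h
  proof -
    obtain p where "p \<in> ?K" "h = fst p" using \<open>h \<in> fst ` ?K\<close> by blast
    then show ?thesis using hc[of "fst p" "snd p"] by simp
  qed
  \<comment> \<open>Off the hyperplanes normal to these differences, distinct last forms take
    distinct values at \<open>x\<close> and so give distinct poles.\<close>
  define D where "D = {h - h' | h h'. h \<in> fst ` ?K \<and> h' \<in> fst ` ?K \<and> h \<noteq> h'}"
  have fD: "finite D"
    by (rule finite_subset[of _ "(\<lambda>(h, h'). h - h') ` (fst ` ?K \<times> fst ` ?K)"]) (use Suc(3) in \<open>auto simp: D_def\<close>)
  have Dc: "g \<in> carrier_vec d \<and> g \<noteq> 0\<^sub>v d" if "g \<in> D" for g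
  proof -
    obtain h h' where h: "g = h - h'" "h \<in> fst ` ?K" "h' \<in> fst ` ?K" "h \<noteq> h'" using \<open>g \<in> D\<close> by (auto simp: D_def)
    then have "h \<in> carrier_vec d" "h' \<in> carrier_vec d" using hcK by blast+
    moreover have "h = h'" if "h - h' = 0\<^sub>v d"
    proof (rule eq_vecI)
      fix i assume "i < dim_vec h'"
      then show "h $ i = h' $ i" using arg_cong[OF that, of "\<lambda>v. v $ i"] calculation by simp
    qed (use calculation in simp)
    ultimately show ?thesis using h(1,4) by auto
  qed
  have main: "gen_all d (\<lambda>x. \<forall>p\<in>?K. (\<Sum>ps\<in>{ps \<in> A. ps ! m = p}. c ps * ?t ps x) = 0)"
  proof (rule gen_all_mono[OF gen_all_conj])
    show "gen_all d (\<lambda>x. \<forall>h\<in>H. h \<bullet> x \<noteq> 0)" using H by (intro gen_all_ball gen_all_neq) auto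
    show "gen_all d (\<lambda>x. \<forall>g\<in>D. g \<bullet> x \<noteq> 0)" using Dc by (intro gen_all_ball gen_all_neq fD) auto
    fix x assume x: "x \<in> carrier_vec d" and g: "(\<forall>h\<in>H. h \<bullet> x \<noteq> 0) \<and> (\<forall>g\<in>D. g \<bullet> x \<noteq> 0)"
    let ?x = "\<lambda>T. x + T \<cdot>\<^sub>v unit_vec d m"
    have sx: "h \<bullet> ?x T = h \<bullet> x + T * h $ m" if "h \<in> carrier_vec d" for h T
      using that x m by (simp add: scalar_prod_add_distrib[of _ d])
    have inj: "h = h'" if "h \<in> fst ` ?K" "h' \<in> fst ` ?K" "h \<bullet> x = h' \<bullet> x" for h h'
    proof (rule ccontr)
      assume "h \<noteq> h'"
      then have "h - h' \<in> D" unfolding D_def using that(1,2) by blast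
      then have "(h - h') \<bullet> x \<noteq> 0" using g by blast
      moreover have "h \<in> carrier_vec d" "h' \<in> carrier_vec d" using that hcK by blast+
      ultimately show False using that x by (simp add: minus_scalar_prod_distrib[of _ d])
    qed
    \<comment> \<open>Position (up to sign) and order of the pole that the last factor has in the
      parameter \<open>T\<close>.\<close>
    let ?q = "\<lambda>p. (fst p \<bullet> x, snd p :: nat)"
    have injK: "inj_on ?q ?K"
    proof (rule inj_onI)
      fix p p' assume "p \<in> ?K" "p' \<in> ?K" "?q p = ?q p'"
      then show "p = p'" using inj[of "fst p" "fst p'"] by (simp add: prod_eq_iff)
    qed
    let ?C = "\<lambda>p. \<Sum>ps\<in>{ps \<in> A. ps ! m = p}. c ps * ?t ps x"
    let ?B = "(\<lambda>h. - (h \<bullet> x) / h $ m) ` H"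
    have z: "(\<Sum>p\<in>?q ` ?K. ?C (the_inv_into ?K ?q p) / (fst p + T) ^ snd p) = 0" if T: "T \<notin> ?B" for T
    proof -
      have "h \<bullet> ?x T \<noteq> 0" if h: "h \<in> H" for h
      proof (cases "h $ m = 0")
        case True
        then show ?thesis using g h H sx[of h T] by auto
      next
        case False
        then have "T \<noteq> - (h \<bullet> x) / h $ m" using T h by blast
        then show ?thesis using False h H sx[of h T] by (auto simp: field_simps add_eq_0_iff)
      qed
      moreover have "?x T \<in> carrier_vec d" using x by simp
      ultimately have "(\<Sum>ps\<in>A. c ps * (\<Prod>j<Suc m. 1 / (fst (ps ! j) \<bullet> ?x T) ^ snd (ps ! j))) = 0"
        using H(3) by blast
      also have "(\<Sum>ps\<in>A. c ps * (\<Prod>j<Suc m. 1 / (fst (ps ! j) \<bullet> ?x T) ^ snd (ps ! j)))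
         = (\<Sum>ps\<in>A. c ps * ?t ps x / (fst (ps ! m) \<bullet> x + T) ^ snd (ps ! m))"
      proof (rule sum.cong)
        fix ps assume ps: "ps \<in> A"
        have l: "fst (ps ! j) \<in> carrier_vec d" "fst (ps ! j) $ j = 1" "j < m \<Longrightarrow> fst (ps ! j) $ m = 0" if "j < Suc m" for j
          using Suc(4)[OF ps] that m by (auto simp: lower_list_def)
        have "fst (ps ! j) \<bullet> ?x T = fst (ps ! j) \<bullet> x" if "j < m" for j
          using that l[of j] by (simp add: sx)
        moreover have "fst (ps ! m) \<bullet> ?x T = fst (ps ! m) \<bullet> x + T" using l[of m] by (simp add: sx)
        ultimately show "c ps * (\<Prod>j<Suc m. 1 / (fst (ps ! j) \<bullet> ?x T) ^ snd (ps ! j))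
            = c ps * ?t ps x / (fst (ps ! m) \<bullet> x + T) ^ snd (ps ! m)" by simp
      qed simp
      also have "\<dots> = (\<Sum>p\<in>?K. \<Sum>ps\<in>{ps \<in> A. ps ! m = p}. c ps * ?t ps x / (fst (ps ! m) \<bullet> x + T) ^ snd (ps ! m))"
        using Suc(3) by (rule sum.image_gen)
      also have "\<dots> = (\<Sum>p\<in>?K. ?C p / (fst p \<bullet> x + T) ^ snd p)"
        by (intro sum.cong refl) (simp add: sum_divide_distrib)
      also have "\<dots> = (\<Sum>p\<in>?q ` ?K. ?C (the_inv_into ?K ?q p) / (fst p + T) ^ snd p)"
        by (subst sum.reindex[OF injK]) (auto simp: the_inv_into_f_f[OF injK] intro!: sum.cong)
      finally show ?thesis .
    qed
    show "\<forall>p\<in>?K. ?C p = 0"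
    proof
      fix p assume p: "p \<in> ?K"
      have "?C (the_inv_into ?K ?q (?q p)) = 0"
      proof (rule poles_independent[where K = "?q ` ?K" and B = ?B and C = "\<lambda>p. ?C (the_inv_into ?K ?q p)"])
        show "1 \<le> k" if "(a, k) \<in> ?q ` ?K" for a k
        proof -
          obtain p' where "p' \<in> ?K" "k = snd p'" using \<open>(a, k) \<in> ?q ` ?K\<close> by blast
          then show ?thesis using k1[of "fst p'" "snd p'"] by simp
        qed
      qed (use Suc(3) H(1) z p in auto)
      then show "?C p = 0" using the_inv_into_f_f[OF injK p] by simp
    qed
  qed
  let ?A = "{qs \<in> A. qs ! m = ps ! m}"
  have l: "length qs = Suc m" if "qs \<in> A" for qs using Suc(4)[OF that] by (simp add: lower_list_def)
  \<comment> \<open>With the last factor fixed, the remaining factors determine the list, so the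
    induction hypothesis applies to the shortened lists.\<close>
  have inj: "inj_on butlast ?A"
  proof (rule inj_onI)
    fix qs rs assume *: "qs \<in> ?A" "rs \<in> ?A" "butlast qs = butlast rs"
    have lq: "length qs = Suc m" "length rs = Suc m" using *(1,2) l by auto
    then have ne: "qs \<noteq> []" "rs \<noteq> []" by auto
    have "last qs = last rs" using * lq by (simp add: last_conv_nth[OF ne(1)] last_conv_nth[OF ne(2)])
    then show "qs = rs" using *(3) append_butlast_last_id[OF ne(1)] append_butlast_last_id[OF ne(2)] by metis
  qed
  have "c (the_inv_into ?A butlast (butlast ps)) = 0"
  proof (rule Suc.IH[where A = "butlast ` ?A" and c = "\<lambda>qs. c (the_inv_into ?A butlast qs)"])
    show "lower_list d m qs" if "qs \<in> butlast ` ?A" for qs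
      using that Suc(4) l by (auto simp: lower_list_def nth_butlast)
    have "(\<Sum>qs\<in>butlast ` ?A. c (the_inv_into ?A butlast qs) * ?t qs x) = (\<Sum>qs\<in>?A. c qs * ?t qs x)" for x
    proof -
      have "(\<Sum>qs\<in>butlast ` ?A. c (the_inv_into ?A butlast qs) * ?t qs x) = (\<Sum>qs\<in>?A. c (the_inv_into ?A butlast (butlast qs)) * ?t (butlast qs) x)"
        by (subst sum.reindex[OF inj]) simp
      also have "\<dots> = (\<Sum>qs\<in>?A. c qs * ?t qs x)"
      proof (rule sum.cong)
        fix qs assume qs: "qs \<in> ?A"
        then have "?t (butlast qs) x = ?t qs x" using l by (intro prod.cong) (auto simp: nth_butlast)
        then show "c (the_inv_into ?A butlast (butlast qs)) * ?t (butlast qs) x = c qs * ?t qs x"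
          using the_inv_into_f_f[OF inj qs] by simp
      qed simp
      finally show ?thesis .
    qed
    then show "gen_all d (\<lambda>x. (\<Sum>qs\<in>butlast ` ?A. c (the_inv_into ?A butlast qs) * ?t qs x) = 0)"
      using main Suc(6) by (auto elim: gen_all_mono)
  qed (use Suc m in auto)
  then show ?case using the_inv_into_f_f[OF inj, of ps] Suc(6) by simp
qed

text \<open>The dual basis of a unitriangular basis is triangular with ones on the diagonal, as
  \<open>lower_independent\<close> requires; forms and exponents are zipped into one list, and this
  encoding is injective because a basis is determined by its dual.\<close>

lemma rat_fun_independent:
  assumes A: "finite A" and u: "\<And>ws ns. (ws, ns) \<in> A \<Longrightarrow> unitri_list d d ws \<and> exponents d n ns"
    and z: "gen_all d (\<lambda>x. (\<Sum>p\<in>A. c p * rat_fun d (dual d (fst p)) (snd p) x) = 0)" and p: "p \<in> A"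
  shows "c p = 0"
proof -
  let ?f = "\<lambda>p. zip (dual d (fst p)) (snd p)"
  have D: "dual_lists d (dual d (fst p)) (fst p)" and ns: "exponents d n (snd p)" and U: "unitri_list d d (fst p)" if "p \<in> A" for p
    using u[of "fst p" "snd p"] that dual_lists_dual[OF unitri_vlist unitri_Det] by auto
  have len: "length (dual d (fst p)) = d" "length (snd p) = d" if "p \<in> A" for p
    using D[OF that] ns[OF that] by (auto simp: dual_lists_def vlist_def exponents_def)
  have inj: "inj_on ?f A"
  proof (rule inj_onI)
    fix p q assume *: "p \<in> A" "q \<in> A" "?f p = ?f q"
    have "dual d (fst p) = dual d (fst q)" "snd p = snd q"
      using arg_cong[OF *(3), of "map fst"] arg_cong[OF *(3), of "map snd"] len[OF *(1)] len[OF *(2)] by simp_all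
    moreover from this have "fst p = fst q"
      using dual_lists_unique[OF dual_lists_sym[OF D[OF *(1)]]] dual_lists_sym[OF D[OF *(2)]] by simp
    ultimately show "p = q" by (simp add: prod_eq_iff)
  qed
  have "c (the_inv_into A ?f (?f p)) = 0"
  proof (rule lower_independent[where m = d and d = d and A = "?f ` A" and c = "\<lambda>ps. c (the_inv_into A ?f ps)"])
    show "lower_list d d ps" if "ps \<in> ?f ` A" for ps
    proof -
      obtain p where p: "p \<in> A" "ps = ?f p" using \<open>ps \<in> ?f ` A\<close> by blast
      have dg: "dual d (fst p) ! j $ j = 1" if j: "j < d" for j
      proof -
        have dc: "dual d (fst p) ! j \<in> carrier_vec d" and bc: "fst p ! j \<in> carrier_vec d"
          using D[OF p(1)] j by (auto simp: dual_lists_def vlist_nth)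
        have "dual d (fst p) ! j \<bullet> fst p ! j = (\<Sum>k<d. if k = j then dual d (fst p) ! j $ j else 0)"
          unfolding sprod[OF dc bc]
        proof (rule sum.cong)
          fix k assume "k \<in> {..<d}"
          then show "dual d (fst p) ! j $ k * fst p ! j $ k = (if k = j then dual d (fst p) ! j $ j else 0)"
            using unitri_dual_lower[OF U[OF p(1)] D[OF p(1)] j, of k] U[OF p(1)] j
            by (cases "k < j"; cases "k = j") (auto simp: unitri_list_def)
        qed simp
        then show ?thesis using D[OF p(1)] j by (simp add: dual_lists_def)
      qed
      show ?thesis
        using len[OF p(1)] D[OF p(1)] ns[OF p(1)] dg unitri_dual_lower[OF U[OF p(1)] D[OF p(1)]]
        by (auto simp: lower_list_def p(2) exponents_def dual_lists_def vlist_nth)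
    qed
    have "(\<Sum>ps\<in>?f ` A. c (the_inv_into A ?f ps) * (\<Prod>j<d. 1 / (fst (ps ! j) \<bullet> x) ^ snd (ps ! j)))
        = (\<Sum>p\<in>A. c p * rat_fun d (dual d (fst p)) (snd p) x)" for x
      by (subst sum.reindex[OF inj]) (auto simp: the_inv_into_f_f[OF inj] rat_fun_def len intro!: sum.cong prod.cong)
    then show "gen_all d (\<lambda>x. (\<Sum>ps\<in>?f ` A. c (the_inv_into A ?f ps) * (\<Prod>j<d. 1 / (fst (ps ! j) \<bullet> x) ^ snd (ps ! j))) = 0)"
      using z by simp
  qed (use A p in auto)
  then show ?thesis using the_inv_into_f_f[OF inj p] by simp
qed

section \<open>Triangulation of cones\<close>

text \<open>Steinitz exchange: a dependence after replacing entry \<open>p\<close> would force the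
  coefficient of \<open>g\<close> to vanish, and with it all others.\<close>

lemma list_exchange:
  assumes D: "dual_lists d us vs" and g: "g \<in> carrier_vec d" and p: "p < d" "us ! p \<bullet> g \<noteq> 0"
  shows "Det d (vs[p := g]) \<noteq> 0"
proof
  have v: "vlist d vs" using D by (simp add: dual_lists_def)
  have w: "vlist d (vs[p := g])" by (rule vlist_update[OF v g])
  assume "Det d (vs[p := g]) = 0"
  then obtain c where c: "\<exists>i<d. c i \<noteq> 0" "\<And>k. k < d \<Longrightarrow> (\<Sum>i<d. c i * vs[p := g] ! i $ k) = 0"
    using Det_zero_iff[OF w] by blast
  let ?e = "\<lambda>i. (if i = p then 0 else c i) + c p * (us ! i \<bullet> g)"
  have "us ! i \<bullet> 0\<^sub>v d = ?e i" if i: "i < d" for i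
  proof (rule dual_lists_coord[OF D _ i])
    fix k assume k: "k < d"
    have "(\<Sum>i<d. ?e i * vs ! i $ k) = (\<Sum>i<d. (if i = p then 0 else c i * vs ! i $ k)) + c p * g $ k"
      unfolding dual_lists_expand[OF D g k] sum_distrib_left sum.distrib[symmetric]
      by (intro sum.cong) (auto simp: algebra_simps)
    also have "\<dots> = (\<Sum>i<d. c i * vs[p := g] ! i $ k)"
      using p v by (subst (1 2) sum.remove[of _ p]) (auto simp: vlist_def intro!: sum.cong)
    finally show "0\<^sub>v d $ k = (\<Sum>i<d. ?e i * vs ! i $ k)" using c(2)[OF k] k by simp
  qed simp
  moreover have "us ! i \<bullet> 0\<^sub>v d = 0" if "i < d" for i using D that by (simp add: dual_lists_def vlist_nth)
  ultimately have e: "?e i = 0" if "i < d" for i using that by simp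
  have "c p = 0" using e[OF p(1)] p(2) by simp
  then have "c i = 0" if "i < d" for i using e[OF that] by (auto split: if_splits)
  then show False using c(1) by blast
qed

lemma finite_min_ex:
  fixes f :: "'a \<Rightarrow> 'b :: linorder"
  assumes "finite A" "A \<noteq> {}"
  obtains a where "a \<in> A" "\<And>b. b \<in> A \<Longrightarrow> f a \<le> f b"
proof -
  have "Min (f ` A) \<in> f ` A" using assms by (intro Min_in) auto
  then obtain a where "a \<in> A" "f a = Min (f ` A)" by force
  then show thesis using that assms by simp
qed

context
  fixes d :: nat and gs :: "rat vec list"
  assumes gs: "set gs \<subseteq> carrier_vec d"
begin

definition bases :: "rat vec list set" where
  "bases = {vs. set vs \<subseteq> set gs \<and> length vs = d \<and> Det d vs \<noteq> 0}"

lemma bases_finite: "finite bases"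
  unfolding bases_def by (rule finite_subset[OF _ finite_lists_length_eq[OF finite_set[of gs], of d]]) auto

lemma bases_vlist: "vs \<in> bases \<Longrightarrow> vlist d vs"
  using gs by (auto simp: bases_def vlist_def)

lemma bases_dual: "vs \<in> bases \<Longrightarrow> dual_lists d (dual d vs) vs"
  using bases_vlist by (intro dual_lists_dual) (auto simp: bases_def)

text \<open>The value at \<open>x\<close> of the linear form agreeing with the heights \<open>\<theta>\<close> on \<open>vs\<close>.\<close>
definition cost :: "(rat vec \<Rightarrow> rat) \<Rightarrow> rat vec list \<Rightarrow> rat vec \<Rightarrow> rat" where
  "cost \<theta> vs x = (\<Sum>j<d. \<theta> (vs ! j) * (dual d vs ! j \<bullet> x))"

text \<open>Heights are powers of a natural number \<open>K\<close>, with exponents numbering the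
  generators. Equality of a height with its interpolated value is a polynomial equation in
  \<open>K\<close>, nontrivial because \<open>g\<close> is not in \<open>vs\<close>, so finitely
  many values of \<open>K\<close> are excluded.\<close>

lemma generic_heights:
  obtains \<theta> where "\<And>g. 0 < \<theta> g" "\<And>vs g. vs \<in> bases \<Longrightarrow> g \<in> set gs \<Longrightarrow> g \<notin> set vs \<Longrightarrow> cost \<theta> vs g \<noteq> \<theta> g"
proof -
  obtain ix :: "rat vec \<Rightarrow> nat" where ix: "inj_on ix (set gs)" using finite_imp_inj_to_nat_seg[OF finite_set[of gs]] by blast
  define P where "P = (\<lambda>(vs, g). Polynomial.monom 1 (ix g) - (\<Sum>j<d. Polynomial.monom (dual d vs ! j \<bullet> g) (ix (vs ! j))))"
  let ?I = "{(vs, g). vs \<in> bases \<and> g \<in> set gs \<and> g \<notin> set vs}"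
  have fI: "finite ?I" by (rule finite_subset[of _ "bases \<times> set gs"]) (auto simp: bases_finite)
  have P: "P (vs, g) \<noteq> 0" if "(vs, g) \<in> ?I" for vs g
  proof -
    have "ix (vs ! j) \<noteq> ix g" if j: "j < d" for j
    proof
      assume a: "ix (vs ! j) = ix g"
      have "vs ! j \<in> set vs" using j \<open>(vs, g) \<in> ?I\<close> by (auto simp: bases_def)
      moreover from this have "vs ! j \<in> set gs" using \<open>(vs, g) \<in> ?I\<close> by (auto simp: bases_def)
      ultimately show False using inj_onD[OF ix a] \<open>(vs, g) \<in> ?I\<close> by auto
    qed
    then have "coeff (P (vs, g)) (ix g) = 1" by (simp add: P_def coeff_sum coeff_monom)
    then show ?thesis by auto
  qed
  have "finite (\<Union>i\<in>?I. {k. poly (P i) k = 0})"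
    using fI P by (intro finite_UN_I poly_roots_finite) auto
  moreover have "infinite ((of_nat :: nat \<Rightarrow> rat) ` {1..})"
    by (subst finite_image_iff) (auto intro: inj_onI simp: infinite_Ici)
  ultimately have "\<not> (of_nat :: nat \<Rightarrow> rat) ` {1..} \<subseteq> (\<Union>i\<in>?I. {k. poly (P i) k = 0})" using finite_subset by blast
  then obtain K :: nat where K: "1 \<le> K" "\<And>i. i \<in> ?I \<Longrightarrow> poly (P i) (of_nat K) \<noteq> 0" by auto
  show thesis
  proof (rule that[of "\<lambda>g. of_nat K ^ ix g"])
    fix vs g assume "vs \<in> bases" "g \<in> set gs" "g \<notin> set vs"
    then show "cost (\<lambda>g. of_nat K ^ ix g) vs g \<noteq> of_nat K ^ ix g"
      using K(2)[of "(vs, g)"] by (auto simp: P_def cost_def poly_sum poly_monom mult.commute)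
  qed (use K in auto)
qed

text \<open>A pivot of the simplex method: \<open>g\<close> enters, and the minimal ratio of
  coordinates decides which vector leaves, so that the coordinates of \<open>x\<close> stay
  nonnegative. Genericity makes them positive.\<close>

lemma cost_pivot:
  assumes \<theta>: "\<And>g. 0 < \<theta> g" and vs: "vs \<in> bases" and x: "x \<in> carrier_vec d"
    and nz: "\<And>vs j. vs \<in> bases \<Longrightarrow> j < d \<Longrightarrow> dual d vs ! j \<bullet> x \<noteq> 0"
    and pos: "\<And>j. j < d \<Longrightarrow> 0 < dual d vs ! j \<bullet> x"
    and g: "g \<in> set gs" "\<theta> g < cost \<theta> vs g"
  obtains ws where "ws \<in> bases" "\<And>j. j < d \<Longrightarrow> 0 < dual d ws ! j \<bullet> x" "cost \<theta> ws x < cost \<theta> vs x"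
proof -
  let ?us = "dual d vs"
  note D = bases_dual[OF vs]
  have gc: "g \<in> carrier_vec d" using g gs by auto
  have l: "length vs = d" using vs by (simp add: bases_def)
  define \<alpha> where "\<alpha> j = ?us ! j \<bullet> g" for j
  define c where "c j = ?us ! j \<bullet> x" for j
  \<comment> \<open>Otherwise the interpolated height of \<open>g\<close> would be at most zero,
    below the positive height of \<open>g\<close>.\<close>
  have "\<exists>j<d. 0 < \<alpha> j"
  proof (rule ccontr)
    assume n: "\<not> (\<exists>j<d. 0 < \<alpha> j)"
    have "\<theta> (vs ! j) * (?us ! j \<bullet> g) \<le> 0" if "j < d" for j
    proof (rule mult_nonneg_nonpos)
      have "\<not> 0 < \<alpha> j" using n that by blast
      then show "?us ! j \<bullet> g \<le> 0" by (simp add: \<alpha>_def)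
    qed (use \<theta>[of "vs ! j"] in simp)
    then have "cost \<theta> vs g \<le> 0" unfolding cost_def by (intro sum_nonpos) auto
    then show False using g(2) \<theta>[of g] by simp
  qed
  then obtain p where p: "p \<in> {j. j < d \<and> 0 < \<alpha> j}" "\<And>j. j \<in> {j. j < d \<and> 0 < \<alpha> j} \<Longrightarrow> c p / \<alpha> p \<le> c j / \<alpha> j"
    using finite_min_ex[of "{j. j < d \<and> 0 < \<alpha> j}" "\<lambda>j. c j / \<alpha> j"] by (auto simp del: mem_Collect_eq simp: Collect_empty_eq)
  then have pd: "p < d" "0 < \<alpha> p" by auto
  define t where "t = c p / \<alpha> p"
  have t: "0 < t" "t * \<alpha> p = c p" using pos[OF pd(1)] pd by (auto simp: t_def c_def)
  let ?ws = "vs[p := g]"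
  let ?e = "\<lambda>i. if i = p then t else c i - t * \<alpha> i"
  have ws: "?ws \<in> bases"
    using vs g(1) list_exchange[OF D gc pd(1)] pd(2)
    by (auto simp: bases_def \<alpha>_def dest!: set_update_subset_insert[THEN subsetD])
  have e: "dual d ?ws ! i \<bullet> x = ?e i" if i: "i < d" for i
  proof (rule dual_lists_coord[OF bases_dual[OF ws] x i])
    fix k assume k: "k < d"
    have "(\<Sum>i<d. ?e i * ?ws ! i $ k) = t * g $ k + (\<Sum>i\<in>{..<d} - {p}. (c i - t * \<alpha> i) * vs ! i $ k)"
      using pd l by (subst sum.remove[of _ p]) (auto intro!: sum.cong)
    also have "(\<Sum>i\<in>{..<d} - {p}. (c i - t * \<alpha> i) * vs ! i $ k) = (\<Sum>i<d. (c i - t * \<alpha> i) * vs ! i $ k)"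
      using pd t by (subst (2) sum.remove[of _ p]) auto
    also have "t * g $ k + \<dots> = (\<Sum>i<d. c i * vs ! i $ k)"
      unfolding dual_lists_expand[OF D gc k] \<alpha>_def sum_distrib_left sum.distrib[symmetric]
      by (intro sum.cong) (auto simp: algebra_simps)
    also have "\<dots> = x $ k" unfolding dual_lists_expand[OF D x k] c_def ..
    finally show "x $ k = (\<Sum>i<d. ?e i * ?ws ! i $ k)" ..
  qed
  show thesis
  proof (rule that[OF ws])
    fix j assume j: "j < d"
    show "0 < dual d ?ws ! j \<bullet> x"
    proof (cases "j = p")
      case False
      have "0 \<le> c j - t * \<alpha> j"
      proof (cases "0 < \<alpha> j")
        case True
        then have "t \<le> c j / \<alpha> j" using p(2) j by (simp add: t_def)
        then show ?thesis using True by (simp add: field_simps)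
      next
        case False
        then have "t * \<alpha> j \<le> 0" using t by (simp add: mult_nonneg_nonpos)
        then show ?thesis using pos[OF j] by (simp add: c_def)
      qed
      then show ?thesis using e[OF j] nz[OF ws j] False by simp
    qed (use e[OF j] t in simp)
  next
    have "cost \<theta> ?ws x = (\<Sum>i<d. \<theta> (?ws ! i) * ?e i)" by (simp add: cost_def e)
    also have "\<dots> = \<theta> g * t + (\<Sum>i\<in>{..<d} - {p}. \<theta> (vs ! i) * (c i - t * \<alpha> i))"
      using pd l by (subst sum.remove[of _ p]) (auto intro!: sum.cong)
    also have "(\<Sum>i\<in>{..<d} - {p}. \<theta> (vs ! i) * (c i - t * \<alpha> i)) = (\<Sum>i<d. \<theta> (vs ! i) * (c i - t * \<alpha> i))"
      using pd t by (subst (2) sum.remove[of _ p]) auto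
    also have "\<dots> = cost \<theta> vs x - t * cost \<theta> vs g"
      by (simp add: cost_def c_def \<alpha>_def right_diff_distrib sum_subtractf sum_distrib_left mult_ac)
    finally have "cost \<theta> ?ws x = cost \<theta> vs x + t * (\<theta> g - cost \<theta> vs g)" by (simp add: algebra_simps)
    moreover have "t * (\<theta> g - cost \<theta> vs g) < 0" using t g(2) by (simp add: mult_pos_neg)
    ultimately show "cost \<theta> ?ws x < cost \<theta> vs x" by simp
  qed
qed

text \<open>Strict dual feasibility: the linear form interpolating the heights on \<open>vs\<close>
  lies strictly below the heights at all other generators. Such bases span the lower faces of the
  lifted configuration, the cells of a regular triangulation.\<close>

definition feasible :: "(rat vec \<Rightarrow> rat) \<Rightarrow> rat vec list set" where
  "feasible \<theta> = {vs \<in> bases. \<forall>g\<in>set gs - set vs. cost \<theta> vs g < \<theta> g}"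

text \<open>Expand \<open>x\<close> in \<open>ws\<close> with positive coefficients: the form of
  \<open>vs\<close> stays below the heights on \<open>ws\<close>, strictly at a vector of
  \<open>ws\<close> not in \<open>vs\<close>.\<close>

lemma cost_less:
  assumes vs: "vs \<in> feasible \<theta>" and ws: "ws \<in> bases" and x: "x \<in> carrier_vec d"
    and pos: "\<And>j. j < d \<Longrightarrow> 0 < dual d ws ! j \<bullet> x" and ne: "\<not> set ws \<subseteq> set vs"
  shows "cost \<theta> vs x < cost \<theta> ws x"
proof -
  have vb: "vs \<in> bases" using vs by (simp add: feasible_def)
  note D = bases_dual[OF vb] and E = bases_dual[OF ws]
  have lw: "length ws = d" "set ws \<subseteq> set gs" using ws by (auto simp: bases_def)
  have uc: "dual d vs ! j \<in> carrier_vec d" if "j < d" for j using D that by (simp add: dual_lists_def vlist_nth)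
  have eq: "cost \<theta> vs (ws ! i) = \<theta> (ws ! i)" if i: "i < d" "ws ! i \<in> set vs" for i
  proof -
    obtain q where q: "q < d" "ws ! i = vs ! q" using i(2) vb by (auto simp: in_set_conv_nth bases_def)
    have "cost \<theta> vs (vs ! q) = (\<Sum>j<d. if j = q then \<theta> (vs ! q) else 0)"
      unfolding cost_def using D q(1) by (intro sum.cong) (auto simp: dual_lists_def)
    then show ?thesis using q by simp
  qed
  have lt: "cost \<theta> vs (ws ! i) < \<theta> (ws ! i)" if "i < d" "ws ! i \<notin> set vs" for i
  proof -
    have "ws ! i \<in> set gs - set vs" using that lw nth_mem[of i ws] by blast
    then show ?thesis using vs by (simp add: feasible_def)
  qed
  have "cost \<theta> vs x = (\<Sum>j<d. \<theta> (vs ! j) * (\<Sum>i<d. (dual d ws ! i \<bullet> x) * (dual d vs ! j \<bullet> ws ! i)))"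
    unfolding cost_def by (intro sum.cong) (auto simp: dual_lists_sprod[OF E uc x])
  also have "\<dots> = (\<Sum>i<d. (dual d ws ! i \<bullet> x) * cost \<theta> vs (ws ! i))"
    unfolding cost_def sum_distrib_left by (subst sum.swap) (simp add: mult_ac)
  also have "\<dots> < (\<Sum>i<d. (dual d ws ! i \<bullet> x) * \<theta> (ws ! i))"
  proof (rule sum_strict_mono_ex1)
    show "\<forall>i\<in>{..<d}. (dual d ws ! i \<bullet> x) * cost \<theta> vs (ws ! i) \<le> (dual d ws ! i \<bullet> x) * \<theta> (ws ! i)"
    proof
      fix i assume "i \<in> {..<d}"
      then show "(dual d ws ! i \<bullet> x) * cost \<theta> vs (ws ! i) \<le> (dual d ws ! i \<bullet> x) * \<theta> (ws ! i)"
        using eq[of i] lt[of i] pos[of i] by (cases "ws ! i \<in> set vs") (auto intro!: mult_left_mono)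
    qed
    obtain w where w: "w \<in> set ws" "w \<notin> set vs" using ne by blast
    then obtain i where i: "i < d" "w = ws ! i" using lw by (auto simp: in_set_conv_nth)
    then show "\<exists>i\<in>{..<d}. (dual d ws ! i \<bullet> x) * cost \<theta> vs (ws ! i) < (dual d ws ! i \<bullet> x) * \<theta> (ws ! i)"
      using lt[of i] pos[of i] w by (intro bexI[of _ i]) auto
  qed simp
  also have "\<dots> = cost \<theta> ws x" by (simp add: cost_def mult.commute)
  finally show ?thesis .
qed

text \<open>For generic \<open>x\<close> in the cone, linear programming finds the unique basis of minimal cost
  whose cone contains \<open>x\<close>; strict feasibility of that basis does not depend on \<open>x\<close>.\<close>
lemma cone_triangulation:
  obtains J where "finite J" "J \<subseteq> bases"
    "gen_all d (\<lambda>x. ind (cone_gen d gs) x = (\<Sum>vs\<in>J. ind (cone_gen d vs) x))"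
proof -
  obtain \<theta> where \<theta>: "\<And>g. 0 < \<theta> g" "\<And>vs g. vs \<in> bases \<Longrightarrow> g \<in> set gs \<Longrightarrow> g \<notin> set vs \<Longrightarrow> cost \<theta> vs g \<noteq> \<theta> g"
    using generic_heights by blast
  \<comment> \<open>One ordering is selected for each set of vectors, so that every cone of the
    triangulation is counted once.\<close>
  define enum where "enum S = (SOME vs. vs \<in> feasible \<theta> \<and> set vs = S)" for S
  have en: "enum (set vs) \<in> feasible \<theta> \<and> set (enum (set vs)) = set vs" if "vs \<in> feasible \<theta>" for vs
    unfolding enum_def by (rule someI[of _ vs]) (use that in simp)
  let ?J = "(\<lambda>vs. enum (set vs)) ` feasible \<theta>"
  have fb: "feasible \<theta> \<subseteq> bases" by (auto simp: feasible_def)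
  have Jf: "?J \<subseteq> feasible \<theta>" using en by auto
  have J: "finite ?J" "?J \<subseteq> bases" using finite_subset[OF fb bases_finite] Jf fb by auto
  have card: "set vs = set ws" if "vs \<in> bases" "ws \<in> bases" "set ws \<subseteq> set vs" for vs ws
  proof -
    have "ordered_basis d vs" "ordered_basis d ws" using that bases_vlist by (auto simp: ordered_basis_iff bases_def)
    then have "card (set vs) = d" "card (set ws) = d"
      using that by (auto simp: ordered_basis_def bases_def distinct_card)
    then show ?thesis using card_subset_eq[OF finite_set that(3)] by simp
  qed
  have "gen_all d (\<lambda>x. \<forall>vs\<in>bases. \<forall>j<d. dual d vs ! j \<bullet> x \<noteq> 0)"
    by (intro gen_all_ball gen_all_dual[OF bases_dual] bases_finite)
  from gen_all_conj[OF this cone_gen_caratheodory[OF gs]]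
  have "gen_all d (\<lambda>x. ind (cone_gen d gs) x = (\<Sum>vs\<in>?J. ind (cone_gen d vs) x))"
  proof (rule gen_all_mono, elim conjE)
    fix x assume x: "x \<in> carrier_vec d" and nz: "\<forall>vs\<in>bases. \<forall>j<d. dual d vs ! j \<bullet> x \<noteq> 0"
      and car: "rvec x \<in> cone_gen d gs \<longleftrightarrow> (\<exists>vs us. set vs \<subseteq> set gs \<and> dual_lists d us vs \<and> (\<forall>j<d. 0 < us ! j \<bullet> x))"
    have mem: "rvec x \<in> cone_gen d vs \<longleftrightarrow> (\<forall>j<d. 0 < dual d vs ! j \<bullet> x)" if "vs \<in> bases" for vs
      using simplicial_cone_iff[OF bases_dual[OF that] x] nz that by (auto simp: le_less)
    have sub: "cone_gen d vs \<subseteq> cone_gen d gs" if "vs \<in> bases" for vs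
      using that gs by (intro cone_gen_mono) (auto simp: bases_def)
    show "ind (cone_gen d gs) x = (\<Sum>vs\<in>?J. ind (cone_gen d vs) x)"
    proof (cases "rvec x \<in> cone_gen d gs")
      case False
      then have "ind (cone_gen d vs) x = 0" if "vs \<in> ?J" for vs
        using sub J that by (auto simp: ind_def)
      then show ?thesis using False by (simp add: ind_def)
    next
      case True
      let ?A = "{vs \<in> bases. rvec x \<in> cone_gen d vs}"
      obtain us vs where "set vs \<subseteq> set gs" "dual_lists d us vs" "\<forall>j<d. 0 < us ! j \<bullet> x" using True car by blast
      then have "vs \<in> ?A" using mem[of vs] dual_eq[of d us vs] dual_lists_Det_nz[of d us vs]
        by (auto simp: bases_def dual_lists_def vlist_def)
      then have "?A \<noteq> {}" by blast
      then obtain vs where vs: "vs \<in> ?A" "\<And>ws. ws \<in> ?A \<Longrightarrow> cost \<theta> vs x \<le> cost \<theta> ws x"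
        using finite_min_ex[of ?A "\<lambda>vs. cost \<theta> vs x"] bases_finite by auto
      \<comment> \<open>A basis of minimal cost is feasible: a generator violating feasibility could
        enter by a pivot and lower the cost.\<close>
      have "vs \<in> feasible \<theta>"
      proof (rule ccontr)
        assume "vs \<notin> feasible \<theta>"
        then obtain g where g: "g \<in> set gs" "g \<notin> set vs" "\<not> cost \<theta> vs g < \<theta> g" using vs(1) by (auto simp: feasible_def)
        then have "\<theta> g < cost \<theta> vs g" using \<theta>(2)[of vs g] vs(1) by auto
        then obtain ws where "ws \<in> bases" "\<And>j. j < d \<Longrightarrow> 0 < dual d ws ! j \<bullet> x" "cost \<theta> ws x < cost \<theta> vs x"
          using cost_pivot[where \<theta> = \<theta> and g = g and vs = vs, OF \<theta>(1) _ x _ _ g(1)] vs(1) nz mem[of vs] by blast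
        then show False using vs(2)[of ws] mem[of ws] by auto
      qed
      define ws where "ws = enum (set vs)"
      have ws: "ws \<in> ?J" "set ws = set vs" "ws \<in> feasible \<theta>"
        using en[OF \<open>vs \<in> feasible \<theta>\<close>] \<open>vs \<in> feasible \<theta>\<close> by (auto simp: ws_def)
      have "cone_gen d ws = cone_gen d vs" by (rule cone_gen_cong) (use ws vs(1) gs in \<open>auto simp: bases_def\<close>)
      then have wx: "rvec x \<in> cone_gen d ws" using vs(1) by simp
      \<comment> \<open>Two feasible bases with different sets whose cones contain \<open>x\<close>
        would each be strictly cheaper than the other.\<close>
      have uniq: "ws' = ws" if w': "ws' \<in> ?J" "rvec x \<in> cone_gen d ws'" for ws'
      proof -
        have f: "ws' \<in> feasible \<theta>" "ws' \<in> bases" "ws \<in> bases" using w' Jf fb ws by auto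
        have "set ws' = set ws"
        proof (rule ccontr)
          assume ne: "set ws' \<noteq> set ws"
          have "cost \<theta> ws' x < cost \<theta> ws x"
            by (rule cost_less[OF f(1,3) x]) (use mem[OF f(3)] wx card[OF f(2,3)] ne in auto)
          moreover have "cost \<theta> ws x < cost \<theta> ws' x"
            by (rule cost_less[OF ws(3) f(2) x]) (use mem[OF f(2)] w' card[OF f(3,2)] ne in auto)
          ultimately show False by simp
        qed
        moreover obtain vs' where "vs' \<in> feasible \<theta>" "ws' = enum (set vs')" using w'(1) by blast
        moreover from this have "set ws' = set vs'" using en by simp
        ultimately show ?thesis using ws(2) by (simp add: ws_def)
      qed
      have "(\<Sum>vs\<in>?J. ind (cone_gen d vs) x) = (\<Sum>vs\<in>?J. if vs = ws then 1 else 0)"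
      proof (rule sum.cong)
        fix vs assume "vs \<in> ?J"
        then have "rvec x \<in> cone_gen d vs \<longleftrightarrow> vs = ws" using uniq[of vs] wx by blast
        then show "ind (cone_gen d vs) x = (if vs = ws then 1 else 0)" by (simp add: ind_def)
      qed (rule refl)
      also have "\<dots> = 1" using ws(1) by (simp only: sum.delta[OF J(1)] if_True)
      finally show ?thesis using True by (simp only: ind_def of_bool_eq)
    qed
  qed
  then show thesis using that J by blast
qed

end

lemma cone_distr_SLc:
  assumes "set gs \<subseteq> carrier_vec d" "ordered_basis d us" "exponents d n ns"
  shows "cone_distr d (cone_gen d gs) us ns \<in> SLc d n"
  by (rule subsetD[OF cone_distrs_SLc[of d n "\<lambda>_. True"]])
    (use assms in \<open>auto simp: cone_distrs_def rational_cone_def\<close>)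

text \<open>A triangulation reproduces the indicator of the cone at generic points; the discrepancy
  vanishes generically and thus belongs to \<open>low_dim_span\<close>.\<close>

lemma simplicial_span:
  assumes N: "qsub N (hom_distr_mod d n)" and low: "low_dim_span d n \<subseteq> N"
    and simp: "\<And>vs us ns. ordered_basis d vs \<Longrightarrow> ordered_basis d us \<Longrightarrow> exponents d n ns \<Longrightarrow>
      cone_distr d (cone_gen d vs) us ns \<in> N"
  shows "SLc d n \<subseteq> N"
  unfolding SLc_def
proof (rule qspan_least[OF hom_qvs _ N], rule subsetI)
  fix F assume "F \<in> cone_distrs d n (\<lambda>C. True)"
  then obtain gs us ns where F: "F = cone_distr d (cone_gen d gs) us ns" and gs: "set gs \<subseteq> carrier_vec d"
    and us: "ordered_basis d us" and ns: "exponents d n ns"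
    by (auto simp: cone_distrs_def rational_cone_def)
  obtain J where J: "finite J" "J \<subseteq> bases d gs"
    and g: "gen_all d (\<lambda>x. ind (cone_gen d gs) x = (\<Sum>vs\<in>J. ind (cone_gen d vs) x))"
    by (rule cone_triangulation[OF gs])
  have b: "ordered_basis d vs" if "vs \<in> J" for vs
    using that J(2) bases_vlist[OF gs] by (auto simp: ordered_basis_iff bases_def[OF gs])
  have vc: "set vs \<subseteq> carrier_vec d" if "vs \<in> J" for vs using b[OF that] by (simp add: ordered_basis_iff vlist_def)
  let ?f = "\<lambda>vs. cone_distr d (cone_gen d vs) us ns"
  let ?G = "\<lambda>\<nu>. \<Sum>vs\<in>J. of_rat 1 * ?f vs \<nu>"
  note fS = cone_distr_SLc[OF _ us ns]
  have GN: "?G \<in> N" by (rule qsub_hom_sum[OF N J(1)]) (use simp b us ns in auto)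
  have GS: "?G \<in> SLc d n" by (rule qsub_hom_sum[OF SLc_sub J(1)]) (use fS vc in auto)
  let ?H = "\<lambda>\<nu>. F \<nu> + of_rat (-1) * ?G \<nu>"
  have "?H \<in> low_dim_span d n"
  proof (rule gen_all_zero_low)
    show "?H \<in> SLc d n"
      using qsub_add[OF SLc_sub fS[OF gs] qsub_smult[OF SLc_sub GS, where c = "-1"]] by (simp add: F hom_add hom_smult)
    have D: "dual_lists d us (dual d us)" using us by (intro dual_lists_sym[OF dual_lists_dual]) (auto simp: ordered_basis_iff)
    have cf: "cone_distr d C us ns \<nu> = of_rat (ind C x * rat_fun d us ns x)"
      if "\<forall>j<d. us ! j \<bullet> x \<noteq> 0" "\<nu> \<in> carrier_vec d" "ivec \<nu> = x" for C \<nu> x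
      using that by (simp add: cone_distr_cone_fun cone_fun_def ind_def)
    from gen_all_conj[OF g gen_all_dual[OF D]]
    show "gen_all d (\<lambda>x. \<forall>\<nu>\<in>carrier_vec d. ivec \<nu> = x \<longrightarrow> ?H \<nu> = 0)"
    proof (rule gen_all_mono, intro ballI impI, elim conjE)
      fix x \<nu> assume nu: "\<nu> \<in> carrier_vec d" "ivec \<nu> = x" and 1: "ind (cone_gen d gs) x = (\<Sum>vs\<in>J. ind (cone_gen d vs) x)"
        and 2: "\<forall>j<d. us ! j \<bullet> x \<noteq> 0"
      show "?H \<nu> = 0"
        unfolding F cf[OF 2 nu] 1 by (simp add: of_rat_mult of_rat_sum sum_distrib_right of_rat_minus)
    qed
  qed
  then have HN: "?H \<in> N" using low by blast
  from qsub_add[OF N this GN] show "F \<in> N" by (simp add: hom_add of_rat_minus)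
qed

section \<open>The isomorphism\<close>

lemma ordered_basis_gens:
  assumes "ordered_basis d vs"
  shows "vs \<in> steinberg_gens d"
proof -
  have v: "vlist d vs" "Det d vs \<noteq> 0" using assms by (auto simp: ordered_basis_iff)
  have "vs ! i \<noteq> 0\<^sub>v d" if "i < d" for i
    by (rule dual_lists_nonzero[OF dual_lists_sym[OF dual_lists_dual[OF v]] that])
  then show ?thesis using v(1) by (auto simp: steinberg_gens_def vlist_def in_set_conv_nth)
qed

lemma steinberg_qvs: "qvs (steinberg d)"
  unfolding steinberg_def by (rule presentation.PM_qvs[OF steinberg_presentation])

lemma sym_qvs: "qvs V \<Longrightarrow> qvs (sym_mod m V)"
  unfolding sym_mod_def by (rule presentation.PM_qvs[OF sym_presentation])

lemma StStSym_qvs: "qvs (StStSym d n)"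
  by (intro tensor_qvs steinberg_qvs sym_qvs Qvec_qvs)

lemma StStSym_elt_carrier:
  assumes n: "d \<le> n" and vs: "ordered_basis d vs" and ws: "ordered_basis d ws" and ns: "exponents d n ns"
  defines "X \<equiv> \<Sum>j<d. replicate_mset (ns ! j - 1) (ws ! j)"
  shows "StStSym_elt d n vs ws ns \<in> carrier (StStSym d n)"
    and "X \<in> sym_gens (n - d) (Qvec d)"
    and "\<And>\<Phi> W. qlin (StStSym d n) W \<Phi> \<Longrightarrow> \<Phi> (StStSym_elt d n vs ws ns) =
      (1 / (\<Prod>j<d. fact (ns ! j - 1))) \<odot>\<^bsub>W\<^esub>
      \<Phi> (pure_tensor d n vs ws X)"
proof -
  let ?Sy = "sym_mod (n - d) (Qvec d)" and ?St = "steinberg d"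
  note Sy = sym_qvs[OF Qvec_qvs[of d], of "n - d"]
  note TT = tensor_qvs[OF steinberg_qvs[of d] steinberg_qvs[of d]]
  note b1 = tensor_elt_bilin[OF steinberg_qvs[of d] steinberg_qvs[of d]] and b2 = tensor_elt_bilin[OF TT Sy]
  have ap: "apartment d vs \<in> carrier ?St" if "ordered_basis d vs" for vs
    unfolding steinberg_def apartment_def
    by (rule presentation.gen_carrier[OF steinberg_presentation ordered_basis_gens[OF that]])
  let ?t = "tensor_elt ?St ?St (apartment d vs) (apartment d ws)"
  have t: "?t \<in> carrier (StSt d)" by (rule qbilin_closed[OF b1 ap[OF vs] ap[OF ws]])
  have l: "length ns = d" "sum_list ns = n" "\<And>j. j < d \<Longrightarrow> 1 \<le> ns ! j" using ns by (auto simp: exponents_def)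
  have "(\<Sum>j<d. ns ! j - 1) + d = (\<Sum>j<d. (ns ! j - 1) + 1)" unfolding sum.distrib by simp
  also have "\<dots> = (\<Sum>j<d. ns ! j)"
  proof (rule sum.cong)
    fix j assume "j \<in> {..<d}"
    then show "ns ! j - 1 + 1 = ns ! j" using l(3)[of j] by simp
  qed simp
  also have "\<dots> = n" using l(1,2) by (simp add: sum_list_sum_nth atLeast0LessThan)
  finally have "size X = n - d" by (simp add: X_def size_multiset_sum)
  moreover have "set_mset X \<subseteq> carrier_vec d"
    using ws by (auto simp: X_def set_mset_sum ordered_basis_iff vlist_nth split: if_splits)
  ultimately show X: "X \<in> sym_gens (n - d) (Qvec d)" by (simp add: sym_gens_def Qvec_simps)
  have sp: "sym_prod (n - d) (Qvec d) X \<in> carrier ?Sy"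
    unfolding sym_mod_def sym_prod_def by (rule presentation.gen_carrier[OF sym_presentation[OF Qvec_qvs] X])
  note lin = qbilin_qlin2[OF b2 t]
  show "StStSym_elt d n vs ws ns \<in> carrier (StStSym d n)"
    unfolding StStSym_elt_def X_def[symmetric] by (rule qlin_closed[OF lin qvs_smult[OF Sy sp]])
  show "\<Phi> (StStSym_elt d n vs ws ns) = (1 / (\<Prod>j<d. fact (ns ! j - 1))) \<odot>\<^bsub>W\<^esub>
      \<Phi> (pure_tensor d n vs ws X)" if "qlin (StStSym d n) W \<Phi>" for \<Phi> W
    unfolding StStSym_elt_def X_def[symmetric] qlin_smult[OF lin sp]
    by (rule qlin_smult[OF that qlin_closed[OF lin sp]])
qed

abbreviation sgn_det :: "nat \<Rightarrow> rat vec list \<Rightarrow> rat vec list \<Rightarrow> rat" where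
  "sgn_det d vs ws \<equiv> sgn (Det d vs) / Det d ws"

text \<open>The factorials produced by the derivatives cancel against the normalisation in
  \<open>StStSym_elt\<close>.\<close>

lemma tri_fun_value:
  assumes n: "d \<le> n" and vs: "ordered_basis d vs" and D: "dual_lists d us ws" and ns: "exponents d n ns"
    and \<Phi>: "qlin (StStSym d n) (gr_top d n) \<Phi>"
    and t: "\<And>vs ws X. vs \<in> steinberg_gens d \<Longrightarrow> ws \<in> steinberg_gens d \<Longrightarrow> X \<in> sym_gens (n - d) (Qvec d) \<Longrightarrow>
      \<Phi> (pure_tensor d n vs ws X)
        = gr_top_class d n (tri_fun d vs ws X)"
  shows "\<Phi> (StStSym_elt d n vs ws ns) =
    sgn_det d vs ws \<odot>\<^bsub>gr_top d n\<^esub> gr_top_class d n (cone_distr d (cone_gen d vs) us ns)"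
proof -
  have us: "ordered_basis d us" and ws: "ordered_basis d ws"
    using D dual_bases_iff[of d us ws] by (auto simp: dual_bases_def)
  let ?X = "\<Sum>j<d. replicate_mset (ns ! j - 1) (ws ! j)"
  note X = StStSym_elt_carrier(2)[OF n vs ws ns]
  let ?f = "(\<Prod>j<d. fact (ns ! j - 1)) :: rat"
  have v: "vlist d vs" "Det d vs \<noteq> 0" "vlist d ws" "Det d ws \<noteq> 0" using vs ws by (auto simp: ordered_basis_iff)
  have sz: "d + size ?X = n" using X n by (simp add: sym_gens_def)
  have f: "of_rat ?f = (\<Prod>j<d. fact (ns ! j - 1) :: complex)"
  proof -
    have "of_rat (fact m) = (fact m :: complex)" for m :: nat
      using of_rat_of_nat_eq[of "fact m", where 'a = complex] by simp
    then show ?thesis by (simp add: of_rat_prod)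
  qed
  have "tri_fun d vs ws ?X \<nu> = of_rat (sgn_det d vs ws) * (of_rat ?f * cone_distr d (cone_gen d vs) us ns \<nu>)" for \<nu>
  proof -
    have "dops d us ?X (\<lambda>ns. cone_distr d (cone_gen d vs) us ns \<nu>) (replicate d 1)
        = of_rat ?f * cone_distr d (cone_gen d vs) us ns \<nu>"
      unfolding f by (rule dops_monomial[OF D]) (use ns in \<open>auto simp: exponents_def\<close>)
    then show ?thesis using v(2,4) by (simp only: tri_fun_def dual_eq[OF D] if_False simp_thms)
  qed
  from this have tf: "tri_fun d vs ws ?X = (?f * sgn_det d vs ws) \<odot>\<^bsub>SL_span d n\<^esub> cone_distr d (cone_gen d vs) us ns"
    unfolding SL_span_simps of_rat_mult by (intro ext) (simp only: mult_ac)
  have c: "cone_distr d (cone_gen d vs) us ns \<in> carrier (SL_span d n)"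
    using cone_distr_SLc[OF _ us ns] v(1) by (simp add: SL_span_simps vlist_def)
  note cc = qlin_closed[OF gr_top_class_qlin c]
  have "\<Phi> (StStSym_elt d n vs ws ns) = (1 / ?f) \<odot>\<^bsub>gr_top d n\<^esub> gr_top_class d n (tri_fun d vs ws ?X)"
    using StStSym_elt_carrier(3)[OF n vs ws ns \<Phi>] t[OF ordered_basis_gens[OF vs] ordered_basis_gens[OF ws] X] by simp
  also have "\<dots> = (1 / ?f) \<odot>\<^bsub>gr_top d n\<^esub> ((?f * sgn_det d vs ws) \<odot>\<^bsub>gr_top d n\<^esub> gr_top_class d n (cone_distr d (cone_gen d vs) us ns))"
    unfolding tf qlin_smult[OF gr_top_class_qlin c] ..
  also have "\<dots> = sgn_det d vs ws \<odot>\<^bsub>gr_top d n\<^esub> gr_top_class d n (cone_distr d (cone_gen d vs) us ns)"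
    by (simp add: qvs_smult_smult[OF gr_top_qvs cc])
  finally show ?thesis .
qed

lemma unitri_ordered_basis: "unitri_list d d vs \<Longrightarrow> ordered_basis d vs"
  using unitri_Det unitri_vlist by (auto simp: ordered_basis_iff)

definition unitri_index :: "nat \<Rightarrow> nat \<Rightarrow> (rat vec list \<times> rat vec list \<times> nat list) set" where
  "unitri_index d n = {(vs, ws, ns). unitri_list d d vs \<and> unitri_list d d ws \<and> exponents d n ns}"

lemma StStSym_combination:
  assumes n: "d \<le> n" and z: "z \<in> carrier (StStSym d n)"
  obtains p where "p \<in> carrier (free_mod (unitri_index d n))"
    "z = free_ext (StStSym d n) (\<lambda>(vs, ws, ns). StStSym_elt d n vs ws ns) p"
proof -
  let ?e = "\<lambda>(vs, ws, ns). StStSym_elt d n vs ws ns"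
  let ?F = "free_mod (unitri_index d n)"
  have e: "?e \<in> unitri_index d n \<rightarrow> carrier (StStSym d n)"
    using StStSym_elt_carrier(1)[OF n] by (auto simp: unitri_index_def unitri_ordered_basis)
  note E = free_ext_qlin[OF StStSym_qvs e]
  let ?S = "free_ext (StStSym d n) ?e ` carrier ?F"
  note S = qlin_image_sub[OF E]
  have "z \<in> ?S"
  proof (rule StStSym_sub_eq[OF n S _ z])
    fix vs ws ns assume u: "unitri_list d d vs" "unitri_list d d ws" "exponents d n ns"
    have i: "(vs, ws, ns) \<in> unitri_index d n" using u by (simp add: unitri_index_def)
    have c: "StStSym_elt d n vs ws ns \<in> carrier (StStSym d n)" using funcset_mem[OF e i] by simp
    have "free_ext (StStSym d n) ?e (single (vs, ws, ns) 1) = StStSym_elt d n vs ws ns"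
      using free_ext_single[OF StStSym_qvs, of ?e "(vs, ws, ns)" d n 1] c by (simp add: qvs_one[OF StStSym_qvs])
    then show "StStSym_elt d n vs ws ns \<in> ?S"
      using imageI[OF free_single[OF i, of 1], of "free_ext (StStSym d n) ?e"] by simp
  qed
  then show thesis using that by blast
qed

text \<open>For each \<open>b\<close>, applying \<open>germ_sum\<close> along \<open>b\<close>
  isolates the triples whose first component is \<open>b\<close>; the remaining relation between
  rational functions has zero coefficients by partial fractions.\<close>

lemma unitri_distr_independent:
  assumes p: "p \<in> carrier (free_mod (unitri_index d n))"
    and c: "\<And>i. i \<in> unitri_index d n \<Longrightarrow> c i \<noteq> 0"
    and l: "(\<lambda>\<nu>. psum (\<lambda>i. of_rat (c i) *
      cone_distr d (cone_gen d (fst i)) (dual d (fst (snd i))) (snd (snd i)) \<nu>) p) \<in> low_or_line d n"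
  shows "p = 0"
proof -
  let ?K = "keys p"
  have K: "?K \<subseteq> unitri_index d n" using p by (simp add: free_carrier)
  have KU: "unitri_list d d (fst i)" "unitri_list d d (fst (snd i))" "exponents d n (snd (snd i))" if "i \<in> ?K" for i
    using K that by (auto simp: unitri_index_def)
  let ?c = "\<lambda>i. lookup p i * c i"
  have l': "(\<lambda>\<nu>. \<Sum>i\<in>?K. of_rat (?c i) *
      cone_distr d (cone_gen d (fst i)) (dual d (fst (snd i))) (snd (snd i)) \<nu>) \<in> low_or_line d n"
    using l by (simp add: psum_def of_rat_mult mult.assoc)
  have "?K = {}"
  proof (rule equals0I)
    fix i assume i: "i \<in> ?K"
    define b where "b = fst i"
    have bU: "unitri_list d d b" using KU(1)[OF i] by (simp add: b_def)
    have B: "dual_lists d (dual d b) b" by (rule dual_lists_dual[OF unitri_vlist[OF bU] unitri_Det[OF bU]])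
    have "gen_all d (\<lambda>x. (\<Sum>i\<in>?K. ?c i * germ_sum d (dual d b) (cone_gen d (fst i)) *
        rat_fun d (dual d (fst (snd i))) (snd (snd i)) x) = 0)"
    proof (rule germ_relation[OF B _ _ _ _ l'])
      show "set (fst i) \<subseteq> carrier_vec d" if "i \<in> ?K" for i
        using unitri_vlist[OF KU(1)[OF that]] by (simp add: vlist_def)
      show "ordered_basis d (dual d (fst (snd i)))" if "i \<in> ?K" for i
        using KU(2)[OF that] by (intro ordered_basis_dual unitri_vlist unitri_Det)
      show "exponents d n (snd (snd i))" if "i \<in> ?K" for i by (rule KU(3)[OF that])
    qed simp
    moreover have "(\<Sum>i\<in>?K. ?c i * germ_sum d (dual d b) (cone_gen d (fst i)) *
        rat_fun d (dual d (fst (snd i))) (snd (snd i)) x)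
      = (\<Sum>q\<in>snd ` {i \<in> ?K. fst i = b}. ?c (b, q) * rat_fun d (dual d (fst q)) (snd q) x)" for x
    proof -
      have "(\<Sum>i\<in>?K. ?c i * germ_sum d (dual d b) (cone_gen d (fst i)) *
          rat_fun d (dual d (fst (snd i))) (snd (snd i)) x)
        = (\<Sum>i\<in>{i \<in> ?K. fst i = b}. ?c i * rat_fun d (dual d (fst (snd i))) (snd (snd i)) x)"
        using germ_sum_unitri[OF bU KU(1) B] by (intro sum.mono_neutral_cong_right) auto
      also have "\<dots> = (\<Sum>q\<in>snd ` {i \<in> ?K. fst i = b}. ?c (b, q) * rat_fun d (dual d (fst q)) (snd q) x)"
        by (subst sum.reindex) (auto intro!: inj_onI sum.cong simp: prod_eq_iff)
      finally show ?thesis .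
    qed
    ultimately have "gen_all d (\<lambda>x. (\<Sum>q\<in>snd ` {i \<in> ?K. fst i = b}. ?c (b, q) * rat_fun d (dual d (fst q)) (snd q) x) = 0)"
      by simp
    then have "?c (b, snd i) = 0"
      by (rule rat_fun_independent[rotated 2]) (use i KU in \<open>auto simp: b_def\<close>)
    then have "lookup p i = 0" using c[of i] i K by (auto simp: b_def)
    then show False using i by (simp add: in_keys_iff)
  qed
  then show ?thesis by simp
qed

text \<open>Well-definedness is rendered as existence and uniqueness of a linear map with the
  prescribed values; uniqueness is meant on the carrier of the source.\<close>

theorem corollary96:
  fixes d n :: nat
  assumes "1 \<le> d" and "d \<le> n"
  shows "\<exists>\<Phi>.
    (let is_map = (\<lambda>\<Psi>. linear_map class_ring (StStSym d n) (gr_top d n) \<Psi> \<and>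
           (\<forall>vs ws us ns.
              ordered_basis d vs \<and> ordered_basis d ws \<and> dual_bases d us ws \<and> exponents d n ns \<longrightarrow>
              \<Psi> (StStSym_elt d n vs ws ns) =
                (sgn (det (mat_of_cols d vs)) / det (mat_of_cols d ws)) \<odot>\<^bsub>gr_top d n\<^esub>
                  gr_top_class d n (cone_distr d (cone_gen d vs) us ns)))
     in is_map \<Phi> \<and>
        bij_betw \<Phi> (carrier (StStSym d n)) (carrier (gr_top d n)) \<and>
        (\<forall>\<Psi>. is_map \<Psi> \<longrightarrow> (\<forall>x\<in>carrier (StStSym d n). \<Psi> x = \<Phi> x)))"
proof -
  note d = assms(1) and n = assms(2)
  let ?W = "gr_top d n" and ?T = "StStSym d n"
  let ?e = "\<lambda>(vs, ws, ns). StStSym_elt d n vs ws ns"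
  obtain \<Phi> where \<Phi>: "qlin ?T ?W \<Phi>"
    and t: "\<And>vs ws X. vs \<in> steinberg_gens d \<Longrightarrow> ws \<in> steinberg_gens d \<Longrightarrow> X \<in> sym_gens (n - d) (Qvec d) \<Longrightarrow>
      \<Phi> (pure_tensor d n vs ws X)
        = gr_top_class d n (tri_fun d vs ws X)"
    using trilinear_map_exists[OF d n] by blast
  have val: "\<Phi> (StStSym_elt d n vs ws ns) =
      sgn_det d vs ws \<odot>\<^bsub>?W\<^esub> gr_top_class d n (cone_distr d (cone_gen d vs) us ns)"
    if "ordered_basis d vs" "dual_lists d us ws" "exponents d n ns" for vs us ws ns
    by (rule tri_fun_value[OF n that \<Phi> t])
  note cl = gr_top_class_qlin[of d n]
  have inj: "inj_on \<Phi> (carrier ?T)"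
  proof (rule qlin_inj_onI[OF \<Phi>])
    fix z assume z: "z \<in> carrier ?T" and z0: "\<Phi> z = \<zero>\<^bsub>?W\<^esub>"
    let ?I = "unitri_index d n"
    obtain p where p: "p \<in> carrier (free_mod ?I)" "z = free_ext ?T ?e p" by (rule StStSym_combination[OF n z])
    have e: "?e \<in> ?I \<rightarrow> carrier ?T"
      using StStSym_elt_carrier(1)[OF n] by (auto simp: unitri_index_def unitri_ordered_basis)
    let ?c = "\<lambda>i. sgn_det d (fst i) (fst (snd i))"
    let ?f = "\<lambda>i \<nu>. of_rat (?c i) * cone_distr d (cone_gen d (fst i)) (dual d (fst (snd i))) (snd (snd i)) \<nu>"
    have cd: "cone_distr d (cone_gen d (fst i)) (dual d (fst (snd i))) (snd (snd i)) \<in> SLc d n" if "i \<in> ?I" for i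
    proof -
      have u: "unitri_list d d (fst i)" "unitri_list d d (fst (snd i))" "exponents d n (snd (snd i))"
        using that by (auto simp: unitri_index_def)
      have "set (fst i) \<subseteq> carrier_vec d" using unitri_vlist[OF u(1)] by (simp add: vlist_def)
      then show ?thesis by (intro cone_distr_SLc ordered_basis_dual unitri_vlist[OF u(2)] unitri_Det u)
    qed
    have f: "?f \<in> ?I \<rightarrow> SLc d n" using qsub_smult[OF SLc_sub cd] by (auto simp: hom_smult)
    have "\<Phi> z = free_ext ?W (\<lambda>i. \<Phi> (?e i)) p" unfolding p(2) by (rule free_ext_comp[OF \<Phi> e p(1)])
    also have "\<dots> = free_ext ?W (\<lambda>i. gr_top_class d n (?f i)) p"
    proof (rule free_ext_cong[OF gr_top_qvs p(1)])
      show "(\<lambda>i. gr_top_class d n (?f i)) \<in> ?I \<rightarrow> carrier ?W" using f by (auto simp: gr_top_carrier)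
      fix i assume i: "i \<in> ?I"
      then have u: "unitri_list d d (fst i)" "unitri_list d d (fst (snd i))" "exponents d n (snd (snd i))"
        by (auto simp: unitri_index_def)
      have "dual_lists d (dual d (fst (snd i))) (fst (snd i))" using u by (intro dual_lists_dual unitri_vlist unitri_Det)
      from val[OF unitri_ordered_basis[OF u(1)] this u(3)] qlin_smult[OF cl, of _ "?c i"] cd[OF i]
      show "\<Phi> (?e i) = gr_top_class d n (?f i)" by (simp add: SL_span_simps case_prod_beta)
    qed
    also have "\<dots> = gr_top_class d n (free_ext (SL_span d n) ?f p)"
      using free_ext_comp[OF cl _ p(1), of ?f] f by (simp add: SL_span_simps)
    also have "free_ext (SL_span d n) ?f p = (\<lambda>\<nu>. psum (\<lambda>i. ?f i \<nu>) p)" by (rule free_ext_SL[OF f p(1)])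
    \<comment> \<open>The kernel condition, pulled back to honest functions: the combination belongs
      to \<open>low_or_line\<close>, and independence forces all coefficients to vanish.\<close>
    finally have "(\<lambda>\<nu>. psum (\<lambda>i. ?f i \<nu>) p) \<in> low_or_line d n"
      using z0 gr_top_class_zero_iff[OF d psum_SLc[OF f p(1)]] by simp
    then have "p = 0"
    proof (rule unitri_distr_independent[OF p(1), rotated])
      fix i assume "i \<in> ?I"
      then have "Det d (fst i) \<noteq> 0" "Det d (fst (snd i)) \<noteq> 0" using unitri_Det by (auto simp: unitri_index_def)
      then show "?c i \<noteq> 0" by (simp add: sgn_0_0)
    qed
    then show "z = \<zero>\<^bsub>?T\<^esub>" using p(2) qlin_zero[OF free_ext_qlin[OF StStSym_qvs e]] by (simp add: free_zero)
  qed
  note im = qlin_image_sub[OF \<Phi>]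
  \<comment> \<open>Surjectivity: the distributions whose class is in the image form a subspace
    containing those of lower dimension, so simplicial cones remain to be checked.\<close>
  have "SLc d n \<subseteq> {F \<in> SLc d n. gr_top_class d n F \<in> \<Phi> ` carrier ?T}" (is "_ \<subseteq> ?N")
  proof (rule simplicial_span)
    have cadd: "gr_top_class d n (\<lambda>\<nu>. F \<nu> + G \<nu>) = gr_top_class d n F \<oplus>\<^bsub>?W\<^esub> gr_top_class d n G"
      if "F \<in> SLc d n" "G \<in> SLc d n" for F G using qlin_add[OF cl, of F G] that by (simp add: SL_span_simps)
    have csm: "gr_top_class d n (\<lambda>\<nu>. of_rat c * F \<nu>) = c \<odot>\<^bsub>?W\<^esub> gr_top_class d n F"
      if "F \<in> SLc d n" for c F using qlin_smult[OF cl, of F c] that by (simp add: SL_span_simps)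
    have zN: "F \<in> ?N" if F: "F \<in> low_or_line d n" for F
    proof -
      have "F \<in> SLc d n" using F low_or_line_subset by blast
      then have "gr_top_class d n F = \<zero>\<^bsub>?W\<^esub>" using gr_top_class_zero_iff[OF d] F by simp
      then show ?thesis using \<open>F \<in> SLc d n\<close> qsub_zero[OF im] by simp
    qed
    show "qsub ?N (hom_distr_mod d n)"
    proof (rule qsubI[OF hom_qvs])
      show "?N \<subseteq> carrier (hom_distr_mod d n)" using qsub_subset[OF SLc_sub] by blast
      show "\<zero>\<^bsub>hom_distr_mod d n\<^esub> \<in> ?N" by (rule zN[OF qsub_zero[OF low_or_line_sub]])
    next
      fix F G assume *: "F \<in> ?N" "G \<in> ?N"
      have "gr_top_class d n (\<lambda>\<nu>. F \<nu> + G \<nu>) \<in> \<Phi> ` carrier ?T"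
        using * qsub_add[OF im] by (simp add: cadd)
      then show "F \<oplus>\<^bsub>hom_distr_mod d n\<^esub> G \<in> ?N"
        using * qsub_add[OF SLc_sub, of F d n G] by (simp add: hom_add)
    next
      fix c F assume *: "F \<in> ?N"
      have "gr_top_class d n (\<lambda>\<nu>. of_rat c * F \<nu>) \<in> \<Phi> ` carrier ?T"
        using * qsub_smult[OF im] by (simp add: csm)
      then show "c \<odot>\<^bsub>hom_distr_mod d n\<^esub> F \<in> ?N"
        using * qsub_smult[OF SLc_sub, of F d n c] by (simp add: hom_smult)
    qed
    show "low_dim_span d n \<subseteq> ?N" using zN low_subset_low_or_line by blast
    fix vs us ns assume vs: "ordered_basis d vs" and us: "ordered_basis d us" and ns: "exponents d n ns"
    let ?F = "cone_distr d (cone_gen d vs) us ns" and ?ws = "dual d us"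
    have v: "vlist d vs" "Det d vs \<noteq> 0" "vlist d us" "Det d us \<noteq> 0" using vs us by (auto simp: ordered_basis_iff)
    have D: "dual_lists d us ?ws" by (rule dual_lists_sym[OF dual_lists_dual[OF v(3,4)]])
    have wb: "ordered_basis d ?ws" by (rule ordered_basis_dual[OF v(3,4)])
    have F: "?F \<in> SLc d n" using v(1) by (intro cone_distr_SLc us ns) (simp add: vlist_def)
    have Fc: "gr_top_class d n ?F \<in> carrier ?W" using F by (simp add: gr_top_carrier)
    \<comment> \<open>The scalar in the prescribed value is invertible, so dividing by it gives a
      preimage of the class.\<close>
    have nz: "sgn_det d vs ?ws \<noteq> 0" using v(2) wb by (simp add: ordered_basis_iff sgn_0_0)
    note ec = StStSym_elt_carrier(1)[OF n vs wb ns]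
    have inv: "1 / c * c = 1" if "c \<noteq> 0" for c :: rat using that by simp
    have "\<Phi> ((1 / sgn_det d vs ?ws) \<odot>\<^bsub>?T\<^esub> StStSym_elt d n vs ?ws ns) = gr_top_class d n ?F"
      unfolding qlin_smult[OF \<Phi> ec] val[OF vs D ns] qvs_smult_smult[OF gr_top_qvs Fc]
        inv[OF nz] by (rule qvs_one[OF gr_top_qvs Fc])
    then have "gr_top_class d n ?F \<in> \<Phi> ` carrier ?T"
      using imageI[OF qvs_smult[OF StStSym_qvs ec, of "1 / sgn_det d vs ?ws"], of \<Phi>] by simp
    then show "?F \<in> ?N" using F by simp
  qed
  then have "carrier ?W \<subseteq> \<Phi> ` carrier ?T" unfolding gr_top_carrier by blast
  then have bij: "bij_betw \<Phi> (carrier ?T) (carrier ?W)"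
    unfolding bij_betw_def using inj qlin_closed[OF \<Phi>] by blast
  have uniq: "\<Psi> x = \<Phi> x" if \<Psi>: "qlin ?T ?W \<Psi>"
    and v: "\<And>vs ws us ns. ordered_basis d vs \<Longrightarrow> ordered_basis d ws \<Longrightarrow> dual_bases d us ws \<Longrightarrow> exponents d n ns \<Longrightarrow>
      \<Psi> (StStSym_elt d n vs ws ns) = sgn_det d vs ws \<odot>\<^bsub>?W\<^esub> gr_top_class d n (cone_distr d (cone_gen d vs) us ns)"
    and x: "x \<in> carrier ?T" for \<Psi> x
  proof -
    \<comment> \<open>The kernel of the difference of the two maps contains the unitriangular
      elements, which span.\<close>
    have l: "qlin ?T ?W (\<lambda>x. \<Psi> x \<oplus>\<^bsub>?W\<^esub> (-1) \<odot>\<^bsub>?W\<^esub> \<Phi> x)" by (intro qlin_sum qlin_scale \<Psi> \<Phi>)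
    have "x \<in> {x \<in> carrier ?T. \<Psi> x \<oplus>\<^bsub>?W\<^esub> (-1) \<odot>\<^bsub>?W\<^esub> \<Phi> x = \<zero>\<^bsub>?W\<^esub>}"
    proof (rule StStSym_sub_eq[OF n qlin_ker_sub[OF l] _ x])
      fix vs ws ns assume u: "unitri_list d d vs" "unitri_list d d ws" and ns: "exponents d n ns"
      note b = unitri_ordered_basis[OF u(1)] unitri_ordered_basis[OF u(2)]
      have D: "dual_lists d (dual d ws) ws" by (rule dual_lists_dual[OF unitri_vlist[OF u(2)] unitri_Det[OF u(2)]])
      note ec = StStSym_elt_carrier(1)[OF n b ns]
      have "\<Psi> (StStSym_elt d n vs ws ns) = \<Phi> (StStSym_elt d n vs ws ns)"
        using v[OF b _ ns, of "dual d ws"] val[OF b(1) D ns] D by (simp add: dual_bases_iff)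
      then show "StStSym_elt d n vs ws ns \<in> {x \<in> carrier ?T. \<Psi> x \<oplus>\<^bsub>?W\<^esub> (-1) \<odot>\<^bsub>?W\<^esub> \<Phi> x = \<zero>\<^bsub>?W\<^esub>}"
        using ec qvs_neg[OF gr_top_qvs qlin_closed[OF \<Phi> ec]] by simp
    qed
    then show ?thesis using qvs_eq_iff_diff[OF gr_top_qvs qlin_closed[OF \<Psi> x] qlin_closed[OF \<Phi> x]] by simp
  qed
  show ?thesis
    unfolding Let_def
  proof (intro exI[of _ \<Phi>] conjI allI impI ballI)
    show "\<Phi> (StStSym_elt d n vs ws ns) =
        sgn_det d vs ws \<odot>\<^bsub>?W\<^esub> gr_top_class d n (cone_distr d (cone_gen d vs) us ns)"
      if "ordered_basis d vs \<and> ordered_basis d ws \<and> dual_bases d us ws \<and> exponents d n ns" for vs ws us ns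
      using that by (intro val) (simp_all add: dual_bases_iff)
  next
    fix \<Psi> x assume a: "qlin ?T ?W \<Psi> \<and> (\<forall>vs ws us ns.
        ordered_basis d vs \<and> ordered_basis d ws \<and> dual_bases d us ws \<and> exponents d n ns \<longrightarrow>
        \<Psi> (StStSym_elt d n vs ws ns) =
          sgn_det d vs ws \<odot>\<^bsub>?W\<^esub> gr_top_class d n (cone_distr d (cone_gen d vs) us ns))"
      and x: "x \<in> carrier ?T"
    show "\<Psi> x = \<Phi> x" by (rule uniq[OF conjunct1[OF a] _ x]) (use conjunct2[OF a] in blast)
  qed (rule \<Phi> bij)+
qed

end
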